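(* Let $\mathbb{F}$ be an algebraically closed field of characteristic $2$ and $n\ge0$. For any $(\mu;\nu)\in\mathcal{Q}_n^{B,2}$ and any $q=2^s$, $$|\mathcal{O}_{\mu;\nu}^{B,2}(\mathbb{F}_q)|=|\mathbb{T}_{\mu;\nu}^{B,2}(\mathbb{F}_q)|=\sum_{(\rho;\sigma)\in\mathcal{Q}_n,\ (\rho;\sigma)^\sim=(\mu;\nu)}P_{\rho;\sigma}(q).$$
   Context: **Combinatorics.** A partition is a weakly decreasing sequence of nonnegative integers, almost all zero; $|\pi|=\sum_i\pi_i$; $\ell(\pi)$ is the number of nonzero parts; sums of partitions are termwise; $\lambda\cup\lambda=(\lambda_1,\lambda_1,\lambda_2,\lambda_2,\dots)$. $\mathcal{Q}_n$ is the set of bipartitions $(\rho;\sigma)$ of $n$ (ordered pairs of partitions with $|\rho|+|\sigma|=n$), and $\mathcal{Q}_n^{B,2}=\{(\mu;\nu)\in\mathcal{Q}_n:\mu_i\ge\nu_i-2\ \forall i\}$. For $(\rho;\sigma)\in\mathcal{Q}_n$, $(\rho;\sigma)^\sim\in\mathcal{Q}_n^{B,2}$ is obtained by replacing $\rho_i,\sigma_i$ with $\lceil\frac{\rho_i+\sigma_i}{2}\rceil-1,\lfloor\frac{\rho_i+\sigma_i}{2}\rfloor+1$ whenever $\rho_i<\sigma_i-2$. $\Phi^{B,2}(\mu;\nu)$ is the partition of $2n+1$ obtained from $(\mu+\nu)\cup(\mu+\nu)$ by adding $1$ to its $(2\ell(\nu)+1)$th part. The function $\tilde\chi_{\mu;\nu}$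 on the set of parts of $\Phi^{B,2}(\mu;\nu)$ is defined by the (consistent) rules $\tilde\chi_{\mu;\nu}(\mu_{\ell(\nu)+1}+1)=\mu_{\ell(\nu)+1}+1$, and $\tilde\chi_{\mu;\nu}(\mu_i+\nu_i)=\mu_i+1$ if $i\le\ell(\nu)$, $=\mu_i$ if $i>\ell(\nu)$. **Geometry.** $V$ has basis $e_1,\dots,e_{2n}$ and quadratic form $Q(\sum a_ie_i)=a_1a_{2n}+a_2a_{2n-1}+\cdots+a_na_{n+1}$, with associated nondegenerate alternating form $\langle v,w\rangle=Q(v+w)-Q(v)-Q(w)$. $\tilde V=\mathbb{F}e_0\oplus V$ with quadratic form $\tilde Q(ae_0+v)=a^2+Q(v)$; $O(\tilde V)$ is its stabilizer in $GL(\tilde V)$. Rational structures are given by these bases. The Lie algebra of $O(\tilde V)$ is $\mathfrak{o}(\tilde V)=\{y\in\mathrm{End}(\tilde V): ye_0=0,\ \langle yv,v\rangle=0\ \forall v\in V\}$ (with $\langle\cdot,\cdot\rangle$ extended to $\tilde V$ as the form associated to $\tilde Q$, having radical $\mathbb{F}e_0$), and $\mathcal{N}(\mathfrak{o}(\tilde V))$ is its variety of nilpotent elements. For $(\mu;\nu)\in\mathcal{Q}_n^{B,2}$, $\mathcal{O}^{B,2}_{\mu;\nu}$ is the $O(\tilde V)$-orbit (by the Hesselink–Spaltenstein classification) of those $y\in\mathcal{N}(\mathfrak{o}(\tilde V))$ whose Jordan type is $\Phi^{B,2}(\mu;\nu)$ and which satisfy $\min\{j\ge0:\tilde Q(y^jw)=0\text{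 for all }w\in\ker(y^m)\}=\tilde\chi_{\mu;\nu}(m)$ for all parts $m$ of $\Phi^{B,2}(\mu;\nu)$. For a $2n$-dimensional symplectic vector space $V$ over an algebraically closed field (any characteristic), the exotic nilpotent cone is $\mathfrak{N}=\{(v,x)\in V\times\mathrm{End}(V):x\text{ nilpotent},\langle xw,w\rangle=0\ \forall w\in V\}$. Its $Sp(V)$-orbits are $\mathbb{O}_{\mu;\nu}$, $(\mu;\nu)\in\mathcal{Q}_n$: $\mathbb{O}_{\mu;\nu}$ consists of the $(v,x)\in\mathfrak{N}$ such that $x$ has Jordan type $(\mu+\nu)\cup(\mu+\nu)$ and $v$ lies in the open $GL(V)^x$-orbit in $\sum_{i\ge1}x^{\nu_i}(\ker(x^{\mu_i+\nu_i}))$, where $GL(V)^x$ is the stabilizer of $x$ in $GL(V)$. For $(\mu;\nu)\in\mathcal{Q}_n^{B,2}$, $\mathbb{T}^{B,2}_{\mu;\nu}=\bigcup_{(\rho;\sigma)\in\mathcal{Q}_n,\,(\rho;\sigma)^\sim=(\mu;\nu)}\mathbb{O}_{\rho;\sigma}$. $P_{\rho;\sigma}(t)\in\mathbb{Z}[t]$ is the (known to exist) polynomial such that, over any algebraically closed field of characteristic $\neq 2$ and any finite subfield $\mathbb{F}_q$ of it (with $V$ and its form defined over the prime field), $|\mathbb{O}_{\rho;\sigma}(\mathbb{F}_q)|=P_{\rho;\sigma}(q)$. *)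

theory Defs
  imports
    "HOL-Computational_Algebra.Computational_Algebra"
    "Jordan_Normal_Form.Matrix_Kernel"
    "Jordan_Normal_Form.Jordan_Normal_Form"
begin

section \<open>Partitions and bipartitions\<close>

text \<open>
  Indices start at 0: the value \<open>\<pi> i\<close> is the part written $\pi_{i+1}$ in the usual
  1-based notation. In particular a 1-based condition $i \le \ell(\nu)$ becomes
  \<open>i < plen \<nu>\<close>.
\<close>

type_synonym part = "nat \<Rightarrow> nat"

definition is_partition :: "part \<Rightarrow> bool" where
  "is_partition \<pi> \<longleftrightarrow> antimono \<pi> \<and> finite {i. \<pi> i \<noteq> 0}"

definition psize :: "part \<Rightarrow> nat" where
  "psize \<pi> = (\<Sum>i | \<pi> i \<noteq> 0. \<pi> i)"

definition plen :: "part \<Rightarrow> nat" where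
  "plen \<pi> = card {i. \<pi> i \<noteq> 0}"

definition padd :: "part \<Rightarrow> part \<Rightarrow> part" where
  "padd \<rho> \<sigma> = (\<lambda>i. \<rho> i + \<sigma> i)"

text \<open>The partition $\pi \cup \pi = (\pi_1,\pi_1,\pi_2,\pi_2,\dots)$.\<close>

definition pdouble :: "part \<Rightarrow> part" where
  "pdouble \<pi> = (\<lambda>i. \<pi> (i div 2))"

definition bipartitions :: "nat \<Rightarrow> (part \<times> part) set" where
  "bipartitions n =
     {(\<rho>, \<sigma>). is_partition \<rho> \<and> is_partition \<sigma> \<and> psize \<rho> + psize \<sigma> = n}"

definition bipartitions_B2 :: "nat \<Rightarrow> (part \<times> part) set" where
  "bipartitions_B2 n = {(\<mu>, \<nu>) \<in> bipartitions n. \<forall>i. \<nu> i \<le> \<mu> i + 2}"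

text \<open>
  The map $(\rho;\sigma) \mapsto (\rho;\sigma)^\sim$. The condition $\rho_i < \sigma_i - 2$ is
  written without subtraction; where it holds, $\rho_i + \sigma_i \ge 3$, so the natural
  subtraction below is a genuine one. The ceiling of $m/2$ is \<open>(m + 1) div 2\<close>.
\<close>

definition tilde_B2 :: "part \<times> part \<Rightarrow> part \<times> part" where
  "tilde_B2 = (\<lambda>(\<rho>, \<sigma>).
     (\<lambda>i. if \<rho> i + 2 < \<sigma> i then (\<rho> i + \<sigma> i + 1) div 2 - 1 else \<rho> i,
      \<lambda>i. if \<rho> i + 2 < \<sigma> i then (\<rho> i + \<sigma> i) div 2 + 1 else \<sigma> i))"

definition Phi_B2 :: "part \<Rightarrow> part \<Rightarrow> part" where
  "Phi_B2 \<mu> \<nu> = (let \<pi> = pdouble (padd \<mu> \<nu>); k = 2 * plen \<nu> in \<pi>(k := \<pi> k + 1))"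

text \<open>The function $\tilde\chi_{\mu;\nu}$; only its values on the parts of \<open>Phi_B2 \<mu> \<nu>\<close> matter.\<close>

definition chi_B2 :: "part \<Rightarrow> part \<Rightarrow> nat \<Rightarrow> nat" where
  "chi_B2 \<mu> \<nu> m = (THE c.
      (m = \<mu> (plen \<nu>) + 1 \<and> c = \<mu> (plen \<nu>) + 1) \<or>
      (\<exists>i. m = \<mu> i + \<nu> i \<and> c = (if i < plen \<nu> then \<mu> i + 1 else \<mu> i)))"


section \<open>Fields and rational points\<close>

definition is_subfield :: "'a::field set \<Rightarrow> bool" where
  "is_subfield K \<longleftrightarrow> 0 \<in> K \<and> 1 \<in> K \<and>
     (\<forall>a\<in>K. \<forall>b\<in>K. a + b \<in> K \<and> a * b \<in> K) \<and>
     (\<forall>a\<in>K. - a \<in> K \<and> inverse a \<in> K)"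

definition prime_subfield :: "'a::field set" where
  "prime_subfield = \<Inter> {K. is_subfield K}"

definition rational_mats :: "'a set \<Rightarrow> 'a mat set" where
  "rational_mats K = {y. elements_mat y \<subseteq> K}"

definition rational_pairs :: "'a set \<Rightarrow> ('a vec \<times> 'a mat) set" where
  "rational_pairs K = {(v, x). vec_set v \<subseteq> K \<and> elements_mat x \<subseteq> K}"


section \<open>Zariski topology on affine space\<close>

text \<open>The polynomial functions in the \<open>m\<close> coordinates of a vector.\<close>

inductive_set poly_fun :: "nat \<Rightarrow> ('a::comm_ring_1 vec \<Rightarrow> 'a) set" for m :: nat where
  const: "(\<lambda>v. c) \<in> poly_fun m"
| coord: "i < m \<Longrightarrow> (\<lambda>v. v $ i) \<in> poly_fun m"
| add: "f \<in> poly_fun m \<Longrightarrow> g \<in> poly_fun m \<Longrightarrow> (\<lambda>v. f v + g v) \<in> poly_fun m"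
| mult: "f \<in> poly_fun m \<Longrightarrow> g \<in> poly_fun m \<Longrightarrow> (\<lambda>v. f v * g v) \<in> poly_fun m"

text \<open>Open and closed sets of the subspace topology on a set \<open>W\<close> of vectors of length \<open>m\<close>.\<close>

definition zariski_closed_in :: "nat \<Rightarrow> 'a::comm_ring_1 vec set \<Rightarrow> 'a vec set \<Rightarrow> bool" where
  "zariski_closed_in m W Z \<longleftrightarrow> (\<exists>S \<subseteq> poly_fun m. Z = {w \<in> W. \<forall>f\<in>S. f w = 0})"

definition zariski_open_in :: "nat \<Rightarrow> 'a::comm_ring_1 vec set \<Rightarrow> 'a vec set \<Rightarrow> bool" where
  "zariski_open_in m W U \<longleftrightarrow> U \<subseteq> W \<and> zariski_closed_in m W (W - U)"


section \<open>Nilpotent endomorphisms\<close>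

definition nilpotent_mats :: "nat \<Rightarrow> 'a::field mat set" where
  "nilpotent_mats m = {y \<in> carrier_mat m m. \<exists>k. y ^\<^sub>m k = 0\<^sub>m m m}"

text \<open>Jordan type of a nilpotent endomorphism: the block sizes are the nonzero parts.\<close>

definition has_jordan_type :: "'a::field mat \<Rightarrow> part \<Rightarrow> bool" where
  "has_jordan_type y \<pi> \<longleftrightarrow> jordan_nf y (map (\<lambda>i. (\<pi> i, 0)) [0..<plen \<pi>])"


section \<open>The exotic nilpotent cone\<close>

definition symplectic_form :: "nat \<Rightarrow> ('a::field vec \<Rightarrow> 'a vec \<Rightarrow> 'a) \<Rightarrow> bool" where
  "symplectic_form m B \<longleftrightarrow>
     (\<forall>u\<in>carrier_vec m. \<forall>v\<in>carrier_vec m. \<forall>w\<in>carrier_vec m.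
        B (u + v) w = B u w + B v w \<and> B w (u + v) = B w u + B w v) \<and>
     (\<forall>a. \<forall>v\<in>carrier_vec m. \<forall>w\<in>carrier_vec m.
        B (a \<cdot>\<^sub>v v) w = a * B v w \<and> B v (a \<cdot>\<^sub>v w) = a * B v w) \<and>
     (\<forall>v\<in>carrier_vec m. B v v = 0) \<and>
     (\<forall>v\<in>carrier_vec m. (\<forall>w\<in>carrier_vec m. B v w = 0) \<longrightarrow> v = 0\<^sub>v m)"

definition form_over :: "nat \<Rightarrow> 'a::field set \<Rightarrow> ('a vec \<Rightarrow> 'a vec \<Rightarrow> 'a) \<Rightarrow> bool" where
  "form_over m K B \<longleftrightarrow> (\<forall>i<m. \<forall>j<m. B (unit_vec m i) (unit_vec m j) \<in> K)"

definition exotic_cone ::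
  "nat \<Rightarrow> ('a::field vec \<Rightarrow> 'a vec \<Rightarrow> 'a) \<Rightarrow> ('a vec \<times> 'a mat) set" where
  "exotic_cone n B = {(v, x). v \<in> carrier_vec (2 * n) \<and> x \<in> nilpotent_mats (2 * n) \<and>
     (\<forall>w\<in>carrier_vec (2 * n). B (x *\<^sub>v w) w = 0)}"

text \<open>The orbit of \<open>v\<close> under the stabilizer (centralizer) of \<open>x\<close> in \<open>GL\<^sub>m\<close>.\<close>

definition centralizer_orbit :: "nat \<Rightarrow> 'a::field mat \<Rightarrow> 'a vec \<Rightarrow> 'a vec set" where
  "centralizer_orbit m x v =
     {g *\<^sub>v v | g. g \<in> carrier_mat m m \<and> invertible_mat g \<and> g * x = x * g}"

text \<open>
  The subspace $\sum_i x^{\alpha_i}(\ker x^{\beta_i})$ of an \<open>m\<close>-dimensional space;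
  the summands with $\beta_i = 0$ vanish and are omitted.
\<close>

definition ker_sum :: "nat \<Rightarrow> 'a::field mat \<Rightarrow> part \<Rightarrow> part \<Rightarrow> 'a vec set" where
  "ker_sum m x \<alpha> \<beta> =
     {finsum_vec TYPE('a) m u {..<plen \<beta>} | u.
        \<forall>i<plen \<beta>. u i \<in> (\<lambda>w. (x ^\<^sub>m \<alpha> i) *\<^sub>v w) ` mat_kernel (x ^\<^sub>m \<beta> i)}"

definition exotic_orbit ::
  "nat \<Rightarrow> ('a::field vec \<Rightarrow> 'a vec \<Rightarrow> 'a) \<Rightarrow> part \<Rightarrow> part \<Rightarrow> ('a vec \<times> 'a mat) set" where
  "exotic_orbit n B \<mu> \<nu> = {(v, x) \<in> exotic_cone n B.
     has_jordan_type x (pdouble (padd \<mu> \<nu>)) \<and>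
     v \<in> ker_sum (2 * n) x \<nu> (padd \<mu> \<nu>) \<and>
     zariski_open_in (2 * n) (ker_sum (2 * n) x \<nu> (padd \<mu> \<nu>)) (centralizer_orbit (2 * n) x v)}"

definition exotic_piece_B2 ::
  "nat \<Rightarrow> ('a::field vec \<Rightarrow> 'a vec \<Rightarrow> 'a) \<Rightarrow> part \<Rightarrow> part \<Rightarrow> ('a vec \<times> 'a mat) set" where
  "exotic_piece_B2 n B \<mu> \<nu> =
     (\<Union>(\<rho>, \<sigma>) \<in> {b \<in> bipartitions n. tilde_B2 b = (\<mu>, \<nu>)}. exotic_orbit n B \<rho> \<sigma>)"

text \<open>
  The family \<open>P\<close> counts the rational points of the exotic orbits for all finite subfields of the
  algebraically closed field \<open>'k\<close> and all symplectic forms defined over its prime field. If \<open>'k\<close>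
  has positive characteristic, it has arbitrarily large finite subfields, so each
  \<open>P \<rho> \<sigma>\<close> is uniquely determined; in characteristic 0 the condition is void.
\<close>

definition exotic_count_polys ::
  "'k::alg_closed_field itself \<Rightarrow> nat \<Rightarrow> (part \<Rightarrow> part \<Rightarrow> int poly) \<Rightarrow> bool" where
  "exotic_count_polys T n P \<longleftrightarrow>
     (\<forall>(\<rho>, \<sigma>) \<in> bipartitions n. \<forall>(K :: 'k set) B.
        is_subfield K \<and> finite K \<and> symplectic_form (2 * n) B \<and> form_over (2 * n) prime_subfield B \<longrightarrow>
        int (card (exotic_orbit n B \<rho> \<sigma> \<inter> rational_pairs K)) = poly (P \<rho> \<sigma>) (int (card K)))"


section \<open>The odd orthogonal Lie algebra in characteristic 2\<close>

definition polar :: "('a::field vec \<Rightarrow> 'a) \<Rightarrow> 'a vec \<Rightarrow> 'a vec \<Rightarrow> 'a" where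
  "polar q v w = q (v + w) - q v - q w"

text \<open>The form $Q$ on $V$, with $e_1,\dots,e_{2n}$ at the positions \<open>0, ..., 2 * n - 1\<close>.\<close>

definition quad :: "nat \<Rightarrow> 'a::field vec \<Rightarrow> 'a" where
  "quad n v = (\<Sum>i<n. v $ i * v $ (2 * n - 1 - i))"

text \<open>
  The form on $\tilde V = \mathbb{F}e_0 \oplus V$; the element $a e_0 + v$ is \<open>vCons a v\<close>.
\<close>

definition quad_ext :: "nat \<Rightarrow> 'a::field vec \<Rightarrow> 'a" where
  "quad_ext n w = (w $ 0)\<^sup>2 + quad n (vec_last w (2 * n))"

definition orthogonal_lie :: "nat \<Rightarrow> 'a::field mat set" where
  "orthogonal_lie n = {y \<in> carrier_mat (2 * n + 1) (2 * n + 1).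
     y *\<^sub>v unit_vec (2 * n + 1) 0 = 0\<^sub>v (2 * n + 1) \<and>
     (\<forall>v\<in>carrier_vec (2 * n). polar (quad_ext n) (y *\<^sub>v vCons 0 v) (vCons 0 v) = 0)}"

text \<open>The orbit $\mathcal{O}^{B,2}_{\mu;\nu}$, as described by the Hesselink--Spaltenstein invariants.\<close>

definition orbit_B2 :: "nat \<Rightarrow> part \<Rightarrow> part \<Rightarrow> 'a::field mat set" where
  "orbit_B2 n \<mu> \<nu> = {y \<in> orthogonal_lie n \<inter> nilpotent_mats (2 * n + 1).
     has_jordan_type y (Phi_B2 \<mu> \<nu>) \<and>
     (\<forall>m \<in> range (Phi_B2 \<mu> \<nu>).
        (LEAST j. \<forall>w \<in> mat_kernel (y ^\<^sub>m m). quad_ext n ((y ^\<^sub>m j) *\<^sub>v w) = 0) = chi_B2 \<mu> \<nu> m)}"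

end

theory Submission
  imports
    Defs
    "HOL-Library.Function_Algebras"
    "Jordan_Normal_Form.Jordan_Normal_Form_Uniqueness"
    "Jordan_Normal_Form.Determinant"
begin

text \<open>Both sides count pairs of a vector and a nilpotent operator over a field with \<open>q\<close> elements.
Let \<open>B\<close> be the symplectic form on the space \<open>V\<close> of dimension \<open>2 * n\<close>.

An element of the orthogonal Lie algebra kills the radical vector \<open>e0\<close>, so it has the form
\<open>y w = B(v, w) e0 + x w\<close> with a vector \<open>v\<close> and a nilpotent \<open>x\<close> such that \<open>B(x w, w) = 0\<close>
(\<open>ymat_bij\<close>). The rank of a power of \<open>y\<close> exceeds the rank of the power of \<open>x\<close> by one as long as the
chain of \<open>v\<close> jumps (\<open>ymat_rank\<close>). Since the ranks of the powers of \<open>x\<close> are even, the Jordan type of \<open>y\<close>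
fixes the type of \<open>x\<close> and the jumps of \<open>v\<close> (\<open>type_iff\<close>). The second invariant of the orbit asks when
\<open>B(v, x^k w)^2 + Q(x^(k+1) w)\<close> vanishes on the kernel of a power of \<open>y\<close>. The sum of the intersections of
the image and the kernel of \<open>x^j\<close> is totally isotropic for \<open>B\<close>, so \<open>Q\<close> is there the square of a functional
\<open>B(c, -)\<close> (\<open>isotropic_root\<close>). After replacing \<open>v\<close> by \<open>v + x c\<close>, a bijection on pairs, the invariant is
expressed by the depths of \<open>v\<close>, the least \<open>j\<close> with \<open>x^j v\<close> in the image of \<open>x^m\<close>, for the block sizes \<open>m\<close>
(\<open>least_nojump\<close>), and the conditions on \<open>y\<close> say precisely that the bipartition of these depths lies
over \<open>(\<mu>, \<nu>)\<close> (\<open>orbit_iff\<close>).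

On the exotic side, \<open>v\<close> lies in the open orbit of the centralizer if and only if its depths are the
entries of \<open>\<rho>\<close> (\<open>open_orbit_iff\<close>): vectors with these depths generate the subspace under the centralizer
algebra, and all others lie in proper invariant subspaces. Therefore the exotic piece has the same
description, and the two numbers are equal.

For the polynomials, the rational points of an exotic orbit are counted directly over every finite
field. The number of operators \<open>x\<close> of a given type is found by double counting pairs of an operator and
a kernel vector, which reduces the space by a hyperbolic plane (\<open>card_ranked\<close>); the number of vectors
with given depths follows by Moebius inversion (\<open>card_depth\<close>). The resulting formula is the same
for all fields and symplectic forms. A family \<open>P\<close> that counts correctly over the arbitrarily large
finite subfields of \<open>'k\<close> satisfies it identically, and so it can be evaluated at \<open>2 ^ s\<close>.\<close>

section \<open>Linear algebra over a finite subfield\<close>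

locale finite_subfield =
  fixes K :: "'a::field set"
  assumes subfield: "is_subfield K" and finite_K: "finite K"
begin

lemma K_closed [simp]:
  "0 \<in> K" "1 \<in> K"
  "a \<in> K \<Longrightarrow> b \<in> K \<Longrightarrow> a + b \<in> K"
  "a \<in> K \<Longrightarrow> b \<in> K \<Longrightarrow> a * b \<in> K"
  "a \<in> K \<Longrightarrow> - a \<in> K"
  "a \<in> K \<Longrightarrow> inverse a \<in> K"
  using subfield unfolding is_subfield_def by auto

lemma K_diff [simp]: "a \<in> K \<Longrightarrow> b \<in> K \<Longrightarrow> a - b \<in> K"
  using K_closed(3)[of a "-b"] by simp

lemma K_divide [simp]: "a \<in> K \<Longrightarrow> b \<in> K \<Longrightarrow> a / b \<in> K"
  by (simp add: divide_inverse)

lemma K_sum [simp]: "(\<And>i. i \<in> A \<Longrightarrow> f i \<in> K) \<Longrightarrow> sum f A \<in> K"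
  by (induction A rule: infinite_finite_induct) auto

lemma card_K_ge_2: "card K \<ge> 2"
proof -
  have "card {0, 1::'a} \<le> card K"
    by (rule card_mono) (use finite_K in auto)
  then show ?thesis by simp
qed

end

lemma card_additive_image_kernel:
  fixes f :: "'b::ab_group_add \<Rightarrow> 'c::ab_group_add"
  assumes fin: "finite U" and z: "0 \<in> U" and m: "\<And>u v. u \<in> U \<Longrightarrow> v \<in> U \<Longrightarrow> u - v \<in> U"
    and f: "\<And>u v. u \<in> U \<Longrightarrow> v \<in> U \<Longrightarrow> f (u - v) = f u - f v"
  shows "card U = card (f ` U) * card {u \<in> U. f u = 0}"
proof -
  have p: "u + v \<in> U" if "u \<in> U" "v \<in> U" for u v
    using m[OF that(1) m[OF z that(2)]] by simp
  have fp: "f (u + v) = f u + f v" if "u \<in> U" "v \<in> U" for u v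
    using f[OF p[OF that] that(2)] by (simp add: algebra_simps)
  have fib: "card {u \<in> U. f u = y} = card {u \<in> U. f u = 0}" if "y \<in> f ` U" for y
  proof -
    obtain u0 where u0: "u0 \<in> U" "f u0 = y" using \<open>y \<in> f ` U\<close> by auto
    have "bij_betw (\<lambda>u. u + u0) {u \<in> U. f u = 0} {u \<in> U. f u = y}"
      by (rule bij_betw_byWitness[where f' = "\<lambda>u. u - u0"]) (use u0 p m f fp in auto)
    then show ?thesis by (simp add: bij_betw_same_card)
  qed
  have "U = (\<Union>y\<in>f ` U. {u \<in> U. f u = y})" by auto
  then have "card U = card (\<Union>y\<in>f ` U. {u \<in> U. f u = y})" by simp
  also have "\<dots> = (\<Sum>y\<in>f ` U. card {u \<in> U. f u = y})"
    by (rule card_UN_disjoint) (use fin in auto)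
  also have "\<dots> = (\<Sum>y\<in>f ` U. card {u \<in> U. f u = 0})" by (rule sum.cong) (use fib in auto)
  finally show ?thesis by simp
qed

locale kspace = vector_space scale + finite_subfield K
  for scale :: "'a::field \<Rightarrow> 'b::ab_group_add \<Rightarrow> 'b" (infixr "*s" 75) and K :: "'a set"
begin

definition ksub :: "'b set \<Rightarrow> bool" where
  "ksub U \<longleftrightarrow> finite U \<and> 0 \<in> U \<and> (\<forall>u\<in>U. \<forall>v\<in>U. u + v \<in> U) \<and> (\<forall>c\<in>K. \<forall>u\<in>U. c *s u \<in> U)"

definition klin :: "'b set \<Rightarrow> ('b \<Rightarrow> 'b) \<Rightarrow> bool" where
  "klin U f \<longleftrightarrow> (\<forall>u\<in>U. f u \<in> U) \<and> (\<forall>u\<in>U. \<forall>v\<in>U. f (u + v) = f u + f v) \<and>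
     (\<forall>c\<in>K. \<forall>u\<in>U. f (c *s u) = c *s f u)"

definition kfunctional :: "'b set \<Rightarrow> ('b \<Rightarrow> 'a) \<Rightarrow> bool" where
  "kfunctional U f \<longleftrightarrow> (\<forall>u\<in>U. f u \<in> K) \<and> (\<forall>u\<in>U. \<forall>v\<in>U. f (u + v) = f u + f v) \<and>
     (\<forall>c\<in>K. \<forall>u\<in>U. f (c *s u) = c * f u)"

definition altform :: "'b set \<Rightarrow> ('b \<Rightarrow> 'b \<Rightarrow> 'a) \<Rightarrow> bool" where
  "altform V B \<longleftrightarrow> (\<forall>u\<in>V. kfunctional V (B u) \<and> kfunctional V (\<lambda>v. B v u) \<and> B u u = 0)"

definition nondegenerate :: "'b set \<Rightarrow> ('b \<Rightarrow> 'b \<Rightarrow> 'a) \<Rightarrow> bool" where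
  "nondegenerate V B \<longleftrightarrow> (\<forall>v\<in>V. (\<forall>w\<in>V. B v w = 0) \<longrightarrow> v = 0)"

definition perp :: "'b set \<Rightarrow> ('b \<Rightarrow> 'b \<Rightarrow> 'a) \<Rightarrow> 'b set \<Rightarrow> 'b set" where
  "perp V B U = {v \<in> V. \<forall>u\<in>U. B v u = 0}"

lemma ksubD:
  assumes "ksub U"
  shows "finite U" "0 \<in> U" "u \<in> U \<Longrightarrow> v \<in> U \<Longrightarrow> u + v \<in> U" "c \<in> K \<Longrightarrow> u \<in> U \<Longrightarrow> c *s u \<in> U"
    "u \<in> U \<Longrightarrow> - u \<in> U" "u \<in> U \<Longrightarrow> v \<in> U \<Longrightarrow> u - v \<in> U"
proof -
  show *: "finite U" "0 \<in> U" "u \<in> U \<Longrightarrow> v \<in> U \<Longrightarrow> u + v \<in> U" "c \<in> K \<Longrightarrow> u \<in> U \<Longrightarrow> c *s u \<in> U"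
    for u v c using assms unfolding ksub_def by auto
  show m: "u \<in> U \<Longrightarrow> - u \<in> U" for u using *(4)[of "-1" u] by simp
  show "u \<in> U \<Longrightarrow> v \<in> U \<Longrightarrow> u - v \<in> U" using *(3)[OF _ m, of u v] by simp
qed

lemma klinD:
  assumes "klin U f"
  shows "u \<in> U \<Longrightarrow> f u \<in> U" "u \<in> U \<Longrightarrow> v \<in> U \<Longrightarrow> f (u + v) = f u + f v"
    "c \<in> K \<Longrightarrow> u \<in> U \<Longrightarrow> f (c *s u) = c *s f u"
  using assms unfolding klin_def by auto

lemma klinD':
  assumes "klin U f" "ksub U"
  shows "f 0 = 0" "u \<in> U \<Longrightarrow> f (- u) = - f u" "u \<in> U \<Longrightarrow> v \<in> U \<Longrightarrow> f (u - v) = f u - f v"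
proof -
  show "f 0 = 0" using klinD(3)[OF assms(1), of 0 0] ksubD(2)[OF assms(2)] by simp
  show m: "u \<in> U \<Longrightarrow> f (- u) = - f u" for u
    using klinD(3)[OF assms(1), of "-1" u] by simp
  show "u \<in> U \<Longrightarrow> v \<in> U \<Longrightarrow> f (u - v) = f u - f v"
    using klinD(2)[OF assms(1), of u "-v"] m ksubD(5)[OF assms(2)] by simp
qed

lemma kfunctionalD:
  assumes "kfunctional U f"
  shows "u \<in> U \<Longrightarrow> f u \<in> K" "u \<in> U \<Longrightarrow> v \<in> U \<Longrightarrow> f (u + v) = f u + f v"
    "c \<in> K \<Longrightarrow> u \<in> U \<Longrightarrow> f (c *s u) = c * f u"
  using assms unfolding kfunctional_def by auto

lemma kfunctionalD':
  assumes "kfunctional U f" "ksub U"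
  shows "f 0 = 0" "u \<in> U \<Longrightarrow> f (- u) = - f u" "u \<in> U \<Longrightarrow> v \<in> U \<Longrightarrow> f (u - v) = f u - f v"
proof -
  show "f 0 = 0" using kfunctionalD(3)[OF assms(1), of 0 0] ksubD(2)[OF assms(2)] by simp
  show m: "u \<in> U \<Longrightarrow> f (- u) = - f u" for u
    using kfunctionalD(3)[OF assms(1), of "-1" u] by simp
  show "u \<in> U \<Longrightarrow> v \<in> U \<Longrightarrow> f (u - v) = f u - f v"
    using kfunctionalD(2)[OF assms(1), of u "-v"] m ksubD(5)[OF assms(2)] by simp
qed

lemma altformD:
  assumes "altform V B" "u \<in> V"
  shows "v \<in> V \<Longrightarrow> B u v \<in> K" "v \<in> V \<Longrightarrow> w \<in> V \<Longrightarrow> B u (v + w) = B u v + B u w"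
    "v \<in> V \<Longrightarrow> w \<in> V \<Longrightarrow> B (v + w) u = B v u + B w u"
    "v \<in> V \<Longrightarrow> c \<in> K \<Longrightarrow> B u (c *s v) = c * B u v"
    "v \<in> V \<Longrightarrow> c \<in> K \<Longrightarrow> B (c *s v) u = c * B v u"
    "B u u = 0"
  using assms unfolding altform_def kfunctional_def by auto

lemma altformD':
  assumes "altform V B" "ksub V" "u \<in> V"
  shows "B u 0 = 0" "B 0 u = 0" "v \<in> V \<Longrightarrow> B u (- v) = - B u v"  "v \<in> V \<Longrightarrow> B (- v) u = - B v u"
    "v \<in> V \<Longrightarrow> w \<in> V \<Longrightarrow> B u (v - w) = B u v - B u w"
    "v \<in> V \<Longrightarrow> w \<in> V \<Longrightarrow> B (v - w) u = B v u - B w u"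
    "v \<in> V \<Longrightarrow> B v u = - B u v"
proof -
  have k: "kfunctional V (B u)" "kfunctional V (\<lambda>v. B v u)"
    using assms unfolding altform_def by auto
  show "B u 0 = 0" "B 0 u = 0" "v \<in> V \<Longrightarrow> B u (- v) = - B u v"  "v \<in> V \<Longrightarrow> B (- v) u = - B v u"
    "v \<in> V \<Longrightarrow> w \<in> V \<Longrightarrow> B u (v - w) = B u v - B u w"
    "v \<in> V \<Longrightarrow> w \<in> V \<Longrightarrow> B (v - w) u = B v u - B w u"
    using kfunctionalD'[OF k(1) assms(2)] kfunctionalD'[OF k(2) assms(2)] by auto
  show "B v u = - B u v" if "v \<in> V"
  proof -
    have uv: "u + v \<in> V" using ksubD(3)[OF assms(2,3) that] .
    have "0 = B (u + v) (u + v)" using altformD(6)[OF assms(1) uv] by simp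
    also have "\<dots> = B u (u + v) + B v (u + v)" by (rule altformD(3)[OF assms(1) uv assms(3) that])
    also have "\<dots> = B u v + B v u"
      using altformD(2)[OF assms(1) assms(3) assms(3) that] altformD(2)[OF assms(1) that assms(3) that]
        altformD(6)[OF assms(1)] assms(3) that by simp
    finally show ?thesis by (simp add: eq_neg_iff_add_eq_0 add.commute)
  qed
qed

lemma card_klin:
  assumes "klin U f" "ksub U"
  shows "card U = card (f ` U) * card {u \<in> U. f u = 0}"
  by (rule card_additive_image_kernel) (use assms ksubD klinD' in auto)

lemma card_kfunctional:
  assumes "kfunctional U f" "ksub U"
  shows "card U = card (f ` U) * card {u \<in> U. f u = 0}"
  by (rule card_additive_image_kernel) (use assms ksubD kfunctionalD' in auto)

lemma kfunctional_surj:
  assumes "kfunctional U f" "ksub U" "u \<in> U" "f u \<noteq> 0"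
  shows "f ` U = K"
proof
  show "f ` U \<subseteq> K" using kfunctionalD[OF assms(1)] by auto
  show "K \<subseteq> f ` U"
  proof
    fix c assume c: "c \<in> K"
    have "f ((c / f u) *s u) = c"
      using kfunctionalD(3)[OF assms(1), of "c / f u" u] kfunctionalD(1)[OF assms(1), of u] assms(3,4) c by simp
    moreover have "(c / f u) *s u \<in> U"
      using ksubD(4)[OF assms(2)] kfunctionalD(1)[OF assms(1)] assms(3) c by simp
    ultimately show "c \<in> f ` U" by (metis imageI)
  qed
qed

lemma ksub_image: "klin V f \<Longrightarrow> ksub V \<Longrightarrow> U \<subseteq> V \<Longrightarrow> ksub U \<Longrightarrow> ksub (f ` U)"
proof -
  assume a: "klin V f" "ksub V" "U \<subseteq> V" "ksub U"
  show "ksub (f ` U)"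
    unfolding ksub_def
  proof (intro conjI ballI)
    show "finite (f ` U)" using ksubD(1)[OF a(4)] by simp
    show "0 \<in> f ` U" using klinD'(1)[OF a(1,2)] ksubD(2)[OF a(4)] by (metis imageI)
    fix y assume "y \<in> f ` U"
    then obtain u where u: "u \<in> U" "y = f u" by auto
    show "y + z \<in> f ` U" if zz: "z \<in> f ` U" for z
    proof -
      obtain v where v: "v \<in> U" "z = f v" using zz by auto
      have "f (u + v) = y + z" using klinD(2)[OF a(1)] u v a(3) by auto
      then show ?thesis using ksubD(3)[OF a(4) u(1) v(1)] by (metis imageI)
    qed
    show "c *s y \<in> f ` U" if "c \<in> K" for c
    proof -
      have "f (c *s u) = c *s y" using klinD(3)[OF a(1)] u a(3) that by auto
      then show ?thesis using ksubD(4)[OF a(4) that u(1)] by (metis imageI)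
    qed
  qed
qed

lemma ksub_kernel: "klin U f \<Longrightarrow> ksub U \<Longrightarrow> ksub {u \<in> U. f u = 0}"
  using klinD[of U f] klinD'[of U f] unfolding ksub_def by auto

lemma ksub_perp: "altform V B \<Longrightarrow> ksub V \<Longrightarrow> U \<subseteq> V \<Longrightarrow> ksub (perp V B U)"
  unfolding ksub_def perp_def
  by (auto simp: altformD(3,5) altformD'(2)[unfolded ksub_def] subset_iff)

lemma klin_pow: "klin U f \<Longrightarrow> klin U (f ^^ j)"
  by (induction j) (auto simp: klin_def)

lemma ksub_adjoin:
  assumes "ksub U" "b \<notin> U"
  shows "ksub {u + c *s b | u c. u \<in> U \<and> c \<in> K}"
  unfolding ksub_def
proof (intro conjI ballI)
  let ?W = "{u + c *s b | u c. u \<in> U \<and> c \<in> K}"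
  have "?W = (\<lambda>(u,c). u + c *s b) ` (U \<times> K)" by auto
  then show "finite ?W" using ksubD(1)[OF assms(1)] finite_K by simp
  show "0 \<in> ?W" using ksubD(2)[OF assms(1)] by force
  fix y assume "y \<in> ?W"
  then obtain u c where y: "y = u + c *s b" "u \<in> U" "c \<in> K" by auto
  show "y + z \<in> ?W" if zz: "z \<in> ?W" for z
  proof -
    obtain u' c' where z: "z = u' + c' *s b" "u' \<in> U" "c' \<in> K" using zz by auto
    have "y + z = (u + u') + (c + c') *s b" using y z by (simp add: algebra_simps)
    then show ?thesis using K_closed(3)[OF y(3) z(3)] ksubD(3)[OF assms(1) y(2) z(2)] by blast
  qed
  show "d *s y \<in> ?W" if "d \<in> K" for d
  proof -
    have "d *s y = d *s u + (d * c) *s b" using y by (simp add: algebra_simps)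
    then show ?thesis using K_closed(4)[OF that y(3)] ksubD(4)[OF assms(1) that y(2)] by blast
  qed
qed

text \<open>Subspaces over \<open>K\<close> are finite sets without a chosen basis, so dimension arguments become inductions that adjoin one vector at a time and cardinality counts.\<close>

lemma ksub_induct [consumes 1, case_names zero adjoin]:
  assumes "ksub W" and "P {0}"
    and step: "\<And>U b. ksub U \<Longrightarrow> U \<subseteq> W \<Longrightarrow> b \<in> W \<Longrightarrow> b \<notin> U \<Longrightarrow> P U \<Longrightarrow> P {u + c *s b | u c. u \<in> U \<and> c \<in> K}"
  shows "P W"
proof -
  have "\<And>U. ksub U \<Longrightarrow> U \<subseteq> W \<Longrightarrow> P U \<Longrightarrow> P W"
  proof -
    fix U assume "ksub U" "U \<subseteq> W" "P U"
    then show "P W"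
    proof (induction "card W - card U" arbitrary: U rule: less_induct)
      case less
      show ?case
      proof (cases "U = W")
        case True then show ?thesis using less by simp
      next
        case False
        then obtain b where b: "b \<in> W" "b \<notin> U" using less by auto
        let ?U = "{u + c *s b | u c. u \<in> U \<and> c \<in> K}"
        have k: "ksub ?U" by (rule ksub_adjoin[OF less(2) b(2)])
        have sub: "?U \<subseteq> W" using less b(1) ksubD(3,4)[OF assms(1)] by auto
        have "U \<subset> ?U"
        proof
          show "U \<subseteq> ?U"
          proof
            fix u assume "u \<in> U"
            then show "u \<in> ?U" by (intro CollectI exI[of _ u] exI[of _ 0]) auto
          qed
          have "b \<in> ?U" using ksubD(2)[OF less(2)]
            by (intro CollectI exI[of _ 0] exI[of _ 1]) auto
          then show "U \<noteq> ?U" using b by blast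
        qed
        then have "card U < card ?U" "card ?U \<le> card W"
          using psubset_card_mono[OF ksubD(1)[OF k]] card_mono[OF ksubD(1)[OF assms(1)] sub] by auto
        then show ?thesis
          by (intro less(1)[OF _ k sub]) (use step[OF less(2) less(3) b less(4)] in auto)
      qed
    qed
  qed
  from this[of "{0}"] show ?thesis using assms(2) ksubD(2)[OF assms(1)] by (simp add: ksub_def)
qed

end

section \<open>Orthogonality for alternating forms\<close>

context kspace
begin

lemma card_adjoin:
  assumes "ksub U" "b \<notin> U"
  shows "card {u + c *s b | u c. u \<in> U \<and> c \<in> K} = card K * card U"
proof -
  have inj: "inj_on (\<lambda>(u, c). u + c *s b) (U \<times> K)"
  proof (rule inj_onI, clarify)
    fix u c u' c' assume a: "u \<in> U" "c \<in> K" "u' \<in> U" "c' \<in> K" "u + c *s b = u' + c' *s b"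
    have e: "(c - c') *s b = u' - u" using a(5) by (simp add: algebra_simps)
    have "c = c'"
    proof (rule ccontr)
      assume "c \<noteq> c'"
      then have "b = inverse (c - c') *s (u' - u)" by (simp flip: e)
      then have "b \<in> U" using ksubD(4,6)[OF assms(1)] a by simp
      then show False using assms by simp
    qed
    then show "u = u' \<and> c = c'" using a(5) by simp
  qed
  have "{u + c *s b | u c. u \<in> U \<and> c \<in> K} = (\<lambda>(u, c). u + c *s b) ` (U \<times> K)" by auto
  then show ?thesis using card_image[OF inj] by (simp add: card_cartesian_product)
qed

lemma kfunctional_subset: "kfunctional W g \<Longrightarrow> U \<subseteq> W \<Longrightarrow> kfunctional U g"
  unfolding kfunctional_def by (meson subsetD)

lemma perp_facts:
  assumes V: "ksub V" and B: "altform V B" and nd: "nondegenerate V B" and U: "ksub U" "U \<subseteq> V"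
  shows card_perp: "card U * card (perp V B U) = card V"
    and perp_perp: "\<And>v. v \<in> V \<Longrightarrow> (\<And>w. w \<in> perp V B U \<Longrightarrow> B w v = 0) \<Longrightarrow> v \<in> U"
    and extend_functional: "\<And>g. kfunctional U g \<Longrightarrow> \<exists>c\<in>V. \<forall>u\<in>U. g u = B c u"
proof -
  note A = altformD[OF B] note A' = altformD'[OF B V] note S = ksubD[OF V]
  have "U \<subseteq> V \<longrightarrow> card U * card (perp V B U) = card V \<and>
     (\<forall>v\<in>V. (\<forall>w\<in>perp V B U. B w v = 0) \<longrightarrow> v \<in> U) \<and>
     (\<forall>g. kfunctional U g \<longrightarrow> (\<exists>c\<in>V. \<forall>u\<in>U. g u = B c u))"
    using U(1)
  proof (induction rule: ksub_induct)
    case zero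
    have p: "perp V B {0} = V" unfolding perp_def using A'(1) by auto
    have "v = 0" if v: "v \<in> V" "\<forall>w\<in>V. B w v = 0" for v
    proof -
      have "B v w = 0" if "w \<in> V" for w using A'(7)[OF that v(1)] v that by simp
      then show ?thesis using nd v unfolding nondegenerate_def by blast
    qed
    moreover have "\<exists>c\<in>V. \<forall>u\<in>{0}. g u = B c u" if "kfunctional {0} g" for g
      using kfunctionalD'(1)[OF that] A'(1) S(2) by (auto simp: ksub_def)
    ultimately show ?case unfolding p by auto
  next
    case (adjoin T b)
    let ?T' = "{u + c *s b | u c. u \<in> T \<and> c \<in> K}"
    show ?case
    proof
      assume T'V: "?T' \<subseteq> V"
      have TT': "T \<subseteq> ?T'" 
      proof
        fix u assume "u \<in> T"
        then show "u \<in> ?T'" by (intro CollectI exI[of _ u] exI[of _ 0]) auto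
      qed
      then have TV: "T \<subseteq> V" using T'V by blast
      have bT': "b \<in> ?T'" using ksubD(2)[OF adjoin(1)] by (intro CollectI exI[of _ 0] exI[of _ 1]) auto
      then have bV: "b \<in> V" using T'V by blast
      have IH: "card T * card (perp V B T) = card V"
        "\<And>v. v \<in> V \<Longrightarrow> (\<forall>w\<in>perp V B T. B w v = 0) \<Longrightarrow> v \<in> T"
        "\<And>g. kfunctional T g \<Longrightarrow> \<exists>c\<in>V. \<forall>u\<in>T. g u = B c u"
        using adjoin(5) TV by blast+
      obtain t where t: "t \<in> perp V B T" "B t b \<noteq> 0" using IH(2)[OF bV] adjoin(4) by blast
      have tV: "t \<in> V" using t unfolding perp_def by auto
      have pk: "ksub (perp V B T)" by (rule ksub_perp[OF B V TV])
      have fb: "kfunctional (perp V B T) (\<lambda>w. B w b)"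
        using A bV unfolding kfunctional_def perp_def by auto
      have pp: "perp V B ?T' = {w \<in> perp V B T. B w b = 0}"
      proof (intro equalityI subsetI)
        fix w assume "w \<in> perp V B ?T'"
        then show "w \<in> {w \<in> perp V B T. B w b = 0}" using TT' bT' unfolding perp_def by blast
      next
        fix w assume w: "w \<in> {w \<in> perp V B T. B w b = 0}"
        then have wV: "w \<in> V" unfolding perp_def by auto
        have "B w (u + c *s b) = 0" if "u \<in> T" "c \<in> K" for u c
          using that w wV TV bV A(2)[of w u "c *s b"] A(4)[of w b c] S(4) unfolding perp_def by auto
        then show "w \<in> perp V B ?T'" using wV unfolding perp_def by auto
      qed
      have im: "(\<lambda>w. B w b) ` perp V B T = K" by (rule kfunctional_surj[OF fb pk t])
      have c1: "card (perp V B T) = card K * card (perp V B ?T')"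
        using card_kfunctional[OF fb pk] unfolding im pp .
      have "card ?T' * card (perp V B ?T') = card V"
        using card_adjoin[OF adjoin(1,4)] c1 IH(1) by (simp add: ac_simps)
      moreover have "v \<in> ?T'" if v: "v \<in> V" "\<forall>w\<in>perp V B ?T'. B w v = 0" for v
      proof -
        define d where "d = B t v / B t b"
        have dK: "d \<in> K" unfolding d_def using A(1) tV v bV by simp
        have "v - d *s b \<in> T"
        proof (rule IH(2))
          show "v - d *s b \<in> V" using S(4,6) v bV dK by simp
          show "\<forall>w\<in>perp V B T. B w (v - d *s b) = 0"
          proof
            fix w assume w: "w \<in> perp V B T"
            then have wV: "w \<in> V" unfolding perp_def by auto
            define r where "r = B w b / B t b"
            have rK: "r \<in> K" unfolding r_def using A(1) wV tV bV by simp
            have rt: "r *s t \<in> perp V B T" using ksubD(4)[OF pk rK t(1)] .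
            have "B (w - r *s t) b = 0"
              using A'(6)[OF bV wV, of "r *s t"] A(5)[OF bV tV rK] S(4)[OF rK tV] t(2) unfolding r_def by simp
            then have "w - r *s t \<in> perp V B ?T'" unfolding pp using ksubD(6)[OF pk w rt] by simp
            then have "B (w - r *s t) v = 0" using v by blast
            then have "B w v = r * B t v"
              using A'(6)[OF v(1) wV, of "r *s t"] A(5)[OF v(1) tV rK] S(4)[OF rK tV] by simp
            then show "B w (v - d *s b) = 0"
              using A'(5)[OF wV v(1) S(4)[OF dK bV]] A(4)[OF wV bV dK] t(2) unfolding d_def r_def by simp
          qed
        qed
        then show ?thesis using dK by (intro CollectI exI[of _ "v - d *s b"] exI[of _ d]) simp
      qed
      moreover have "\<exists>c\<in>V. \<forall>u\<in>?T'. g u = B c u" if g: "kfunctional ?T' g" for g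
      proof -
        have "kfunctional T g" by (rule kfunctional_subset[OF g TT'])
        then obtain c where c: "c \<in> V" "\<forall>u\<in>T. g u = B c u" using IH(3) by blast
        define d where "d = (g b - B c b) / B t b"
        have dK: "d \<in> K" unfolding d_def using A(1) tV c(1) bV kfunctionalD(1)[OF g bT'] by simp
        have dt: "d *s t \<in> V" using S(4)[OF dK tV] .
        have "g (u + a *s b) = B (c + d *s t) (u + a *s b)" if u: "u \<in> T" "a \<in> K" for u a
        proof -
          have uV: "u \<in> V" using u TV by blast
          have ab: "a *s b \<in> V" "a *s b \<in> ?T'" "u \<in> ?T'"
            using S(4)[OF u(2) bV] ksubD(4)[OF ksub_adjoin[OF adjoin(1,4)] u(2) bT'] u TT' by auto
          have "g (u + a *s b) = g u + a * g b"
            using kfunctionalD(2)[OF g ab(3,2)] kfunctionalD(3)[OF g u(2) bT'] by simp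
          moreover have "B (c + d *s t) u = B c u"
            using A(3)[OF uV c(1) dt] A(5)[OF uV tV dK] t(1) u(1) unfolding perp_def by simp
          moreover have "B (c + d *s t) b = g b"
            using A(3)[OF bV c(1) dt] A(5)[OF bV tV dK] t(2) unfolding d_def by simp
          moreover have "B (c + d *s t) (u + a *s b) = B (c + d *s t) u + a * B (c + d *s t) b"
            using A(2)[OF S(3)[OF c(1) dt] uV ab(1)] A(4)[OF S(3)[OF c(1) dt] bV u(2)] by simp
          ultimately show ?thesis using c(2) u(1) by simp
        qed
        then show ?thesis using S(3)[OF c(1) dt] by blast
      qed
      ultimately show "card ?T' * card (perp V B ?T') = card V \<and>
        (\<forall>v\<in>V. (\<forall>w\<in>perp V B ?T'. B w v = 0) \<longrightarrow> v \<in> ?T') \<and>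
        (\<forall>g. kfunctional ?T' g \<longrightarrow> (\<exists>c\<in>V. \<forall>u\<in>?T'. g u = B c u))" by blast
    qed
  qed
  then show "card U * card (perp V B U) = card V"
    "\<And>v. v \<in> V \<Longrightarrow> (\<And>w. w \<in> perp V B U \<Longrightarrow> B w v = 0) \<Longrightarrow> v \<in> U"
    "\<And>g. kfunctional U g \<Longrightarrow> \<exists>c\<in>V. \<forall>u\<in>U. g u = B c u"
    using U(2) by blast+
qed

text \<open>A pair with \<open>B e f = 1\<close> spans a nondegenerate plane, and subtracting the two components of a vector projects it to the orthogonal complement.\<close>

lemma hyperbolic_split:
  assumes V: "ksub V" and B: "altform V B" and e: "e \<in> V" "f \<in> V" "B e f = 1"
  defines "W \<equiv> perp V B {e, f}"
  shows "ksub W"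
    and "\<And>v. v \<in> V \<Longrightarrow> v - B v f *s e + B v e *s f \<in> W"
    and "\<And>a c w. a \<in> K \<Longrightarrow> c \<in> K \<Longrightarrow> w \<in> W \<Longrightarrow> a *s e + w + c *s f \<in> V \<and>
           B (a *s e + w + c *s f) e = - c \<and> B (a *s e + w + c *s f) f = a"
    and "card V = (card K)\<^sup>2 * card W"
proof -
  note A = altformD[OF B] note A' = altformD'[OF B V] note S = ksubD[OF V]
  have fe: "B f e = - 1" using A'(7)[OF e(1,2)] e(3) by simp
  have ee: "B e e = 0" "B f f = 0" using A(6) e by auto
  have WV: "W \<subseteq> V" unfolding W_def perp_def by auto
  show kW: "ksub W" unfolding W_def by (rule ksub_perp[OF B V]) (use e in auto)
  show pr: "v - B v f *s e + B v e *s f \<in> W" if v: "v \<in> V" for v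
  proof -
    have c: "B v f \<in> K" "B v e \<in> K" using A(1) v e by auto
    have m: "B v f *s e \<in> V" "B v e *s f \<in> V" "v - B v f *s e \<in> V" using S(4,6) c e v by auto
    have "B (v - B v f *s e + B v e *s f) e = 0"
      using A(3)[OF e(1) m(3,2)] A'(6)[OF e(1) v m(1)] A(5)[OF e(1) e(2) c(2)] A(5)[OF e(1) e(1) c(1)] fe ee by simp
    moreover have "B (v - B v f *s e + B v e *s f) f = 0"
      using A(3)[OF e(2) m(3,2)] A'(6)[OF e(2) v m(1)] A(5)[OF e(2) e(2) c(2)] A(5)[OF e(2) e(1) c(1)] e(3) ee by simp
    ultimately show ?thesis unfolding W_def perp_def using S(3)[OF m(3,2)] by simp
  qed
  show comb: "a *s e + w + c *s f \<in> V \<and>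
           B (a *s e + w + c *s f) e = - c \<and> B (a *s e + w + c *s f) f = a"
    if a: "a \<in> K" "c \<in> K" "w \<in> W" for a c w
  proof -
    have m: "a *s e \<in> V" "c *s f \<in> V" "w \<in> V" "a *s e + w \<in> V"
      using S(3,4) a e WV by auto
    have w: "B w e = 0" "B w f = 0" using a(3) unfolding W_def perp_def by auto
    have "B (a *s e + w + c *s f) e = - c"
      using A(3)[OF e(1) m(4,2)] A(3)[OF e(1) m(1,3)] A(5)[OF e(1) e(1) a(1)] A(5)[OF e(1) e(2) a(2)] ee fe w by simp
    moreover have "B (a *s e + w + c *s f) f = a"
      using A(3)[OF e(2) m(4,2)] A(3)[OF e(2) m(1,3)] A(5)[OF e(2) e(1) a(1)] A(5)[OF e(2) e(2) a(2)] ee e(3) w by simp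
    ultimately show ?thesis using S(3)[OF m(4,2)] by simp
  qed
  have "bij_betw (\<lambda>((a, c), w). a *s e + w + c *s f) ((K \<times> K) \<times> W) V"
  proof (rule bij_betw_byWitness[where f' = "\<lambda>v. ((B v f, - B v e), v - B v f *s e + B v e *s f)"])
    show "\<forall>p\<in>(K \<times> K) \<times> W. (\<lambda>v. ((B v f, - B v e), v - B v f *s e + B v e *s f))
         ((\<lambda>((a, c), w). a *s e + w + c *s f) p) = p"
      using comb by auto
    show "(\<lambda>v. ((B v f, - B v e), v - B v f *s e + B v e *s f)) ` V \<subseteq> (K \<times> K) \<times> W"
      using pr A(1) e by auto
  qed (use comb in auto)
  then have "card V = card ((K \<times> K) \<times> W)" by (simp add: bij_betw_same_card)
  then show "card V = (card K)\<^sup>2 * card W" by (simp add: card_cartesian_product power2_eq_square)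
qed

lemma hyperbolic_pair_exists:
  assumes V: "ksub V" and B: "altform V B" and v: "v \<in> V" "w \<in> V" "B v w \<noteq> 0"
  shows "\<exists>f\<in>V. B v f = 1"
proof
  have k: "inverse (B v w) \<in> K" using altformD(1)[OF B v(1,2)] by simp
  show "inverse (B v w) *s w \<in> V" by (rule ksubD(4)[OF V k v(2)])
  show "B v (inverse (B v w) *s w) = 1" using altformD(4)[OF B v(1,2) k] v(3) by simp
qed

lemma altform_subset: "altform V B \<Longrightarrow> U \<subseteq> V \<Longrightarrow> altform U B"
  unfolding altform_def kfunctional_def by blast

text \<open>As long as the form is not identically zero, a hyperbolic plane splits off and the size of the space drops by the square of the size of the field while the radical stays the same.\<close>

lemma altform_rank_even:
  assumes "ksub V" "altform V B"
  shows "\<exists>k. card V = card K ^ (2 * k) * card {v \<in> V. \<forall>w\<in>V. B v w = 0}"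
  using assms
proof (induction "card V" arbitrary: V rule: less_induct)
  case (less V)
  note V = less(2) note B = less(3)
  note A = altformD[OF B] note A' = altformD'[OF B V] note S = ksubD[OF V]
  show ?case
  proof (cases "\<forall>v\<in>V. \<forall>w\<in>V. B v w = 0")
    case True
    then have "{v \<in> V. \<forall>w\<in>V. B v w = 0} = V" by auto
    then show ?thesis by (intro exI[of _ 0]) simp
  next
    case False
    then obtain e f where e: "e \<in> V" "f \<in> V" "B e f = 1" using hyperbolic_pair_exists[OF V B] by blast
    define W where "W = perp V B {e, f}"
    note H = hyperbolic_split[OF V B e, folded W_def]
    have WV: "W \<subseteq> V" unfolding W_def perp_def by auto
    have "card W > 0" using ksubD(1,2)[OF H(1)] card_gt_0_iff by blast
    moreover have "1 < (card K)\<^sup>2" using card_K_ge_2 by (intro one_less_power) auto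
    ultimately have "card W < card V" unfolding H(4) by simp
    then obtain k where k: "card W = card K ^ (2 * k) * card {v \<in> W. \<forall>w\<in>W. B v w = 0}"
      using less(1)[OF _ H(1) altform_subset[OF B WV]] by blast
    have "{v \<in> W. \<forall>w\<in>W. B v w = 0} = {v \<in> V. \<forall>w\<in>V. B v w = 0}"
    proof (intro equalityI subsetI)
      fix v assume v: "v \<in> {v \<in> W. \<forall>w\<in>W. B v w = 0}"
      then have vV: "v \<in> V" using WV by auto
      have "B v w = 0" if w: "w \<in> V" for w
      proof -
        let ?w = "w - B w f *s e + B w e *s f"
        have c: "B w f \<in> K" "B w e \<in> K" using A(1) w e by auto
        have m: "B w f *s e \<in> V" "B w e *s f \<in> V" "w - B w f *s e \<in> V" using S(4,6) c e w by auto
        have "B v ?w = 0" using v H(2)[OF w] by blast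
        moreover have "B v ?w = B v w - B w f * B v e + B w e * B v f"
          using A(2)[OF vV m(3,2)] A'(5)[OF vV w m(1)] A(4)[OF vV e(1) c(1)] A(4)[OF vV e(2) c(2)] by simp
        ultimately show ?thesis using v unfolding W_def perp_def by simp
      qed
      then show "v \<in> {v \<in> V. \<forall>w\<in>V. B v w = 0}" using vV by blast
    next
      fix v assume "v \<in> {v \<in> V. \<forall>w\<in>V. B v w = 0}"
      then show "v \<in> {v \<in> W. \<forall>w\<in>W. B v w = 0}" using e unfolding W_def perp_def by auto
    qed
    then have "card V = card K ^ (2 * Suc k) * card {v \<in> V. \<forall>w\<in>V. B v w = 0}"
      using k H(4) by (simp add: power2_eq_square)
    then show ?thesis by blast
  qed
qed

end

section \<open>Reduction of an operator along a kernel vector\<close>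

context kspace
begin

definition alt_endos :: "'b set \<Rightarrow> ('b \<Rightarrow> 'b \<Rightarrow> 'a) \<Rightarrow> ('b \<Rightarrow> 'b) set" where
  "alt_endos V B = {x. klin V x \<and> (\<forall>v. v \<notin> V \<longrightarrow> x v = 0) \<and> (\<forall>v\<in>V. B (x v) v = 0)}"

definition ranked :: "'b set \<Rightarrow> ('b \<Rightarrow> 'b \<Rightarrow> 'a) \<Rightarrow> (nat \<Rightarrow> nat) \<Rightarrow> ('b \<Rightarrow> 'b) set" where
  "ranked V B r = {x \<in> alt_endos V B. \<forall>j. card ((x ^^ j) ` V) = card K ^ r j}"

lemma alt_selfadjoint:
  assumes V: "ksub V" and B: "altform V B" and x: "klin V x" "\<forall>v\<in>V. B (x v) v = 0"
    and v: "v \<in> V" "w \<in> V"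
  shows "B (x v) w = B v (x w)"
proof -
  note A = altformD[OF B] note A' = altformD'[OF B V]
  have m: "x v \<in> V" "x w \<in> V" "v + w \<in> V" using klinD(1)[OF x(1)] v ksubD(3)[OF V] by auto
  have "0 = B (x (v + w)) (v + w)" using x(2) m(3) by simp
  also have "\<dots> = B (x v) (v + w) + B (x w) (v + w)"
    using klinD(2)[OF x(1) v] A(3)[OF m(3,1,2)] by simp
  also have "\<dots> = B (x v) w + B (x w) v"
    using A(2)[OF m(1) v] A(2)[OF m(2) v] x(2) v by simp
  also have "B (x w) v = - B v (x w)" using A'(7)[OF v(1) m(2)] .
  finally show ?thesis by simp
qed

text \<open>From \<open>B (x v) v = 0\<close> it follows that \<open>x\<close> is self-adjoint, so an even power can be split evenly between the two arguments and an odd power leaves one alternating factor \<open>x\<close>. No division by two enters, and the argument works in characteristic two.\<close>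

lemma alt_pow:
  assumes V: "ksub V" and B: "altform V B" and x: "klin V x" "\<forall>v\<in>V. B (x v) v = 0"
    and v: "v \<in> V"
  shows "w \<in> V \<Longrightarrow> B ((x ^^ j) v) w = B v ((x ^^ j) w)"
    and "B ((x ^^ j) v) v = 0"
proof -
  have sa: "B ((x ^^ j) v) w = B v ((x ^^ j) w)" if "v \<in> V" "w \<in> V" for v w j
    using that
  proof (induction j arbitrary: w)
    case (Suc j)
    have "B ((x ^^ Suc j) v) w = B ((x ^^ j) v) (x w)"
      using alt_selfadjoint[OF V B x klinD(1)[OF klin_pow[OF x(1)] Suc(2)] Suc(3)] by simp
    also have "\<dots> = B v ((x ^^ j) (x w))" using Suc klinD(1)[OF x(1)] by blast
    finally show ?case by (simp only: funpow_Suc_right o_apply)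
  qed simp
  show "w \<in> V \<Longrightarrow> B ((x ^^ j) v) w = B v ((x ^^ j) w)" using sa v by blast
  show "B ((x ^^ j) v) v = 0"
  proof (cases "even j")
    case True
    then obtain i where i: "j = i + i" by (metis evenE mult_2)
    have iv: "(x ^^ i) v \<in> V" using klinD(1)[OF klin_pow[OF x(1)] v] .
    have "(x ^^ j) v = (x ^^ i) ((x ^^ i) v)" unfolding i funpow_add by simp
    then show ?thesis using sa[OF iv v] altformD(6)[OF B iv] by simp
  next
    case False
    then obtain i where i: "j = Suc (i + i)" by (metis oddE mult_2 Suc_eq_plus1)
    have iv: "(x ^^ i) v \<in> V" using klinD(1)[OF klin_pow[OF x(1)] v] .
    have "(x ^^ j) v = (x ^^ i) (x ((x ^^ i) v))" unfolding i funpow_add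
      by (simp add: funpow_add funpow_swap1)
    then show ?thesis using sa[OF klinD(1)[OF x(1) iv] v] x(2) iv by simp
  qed
qed

text \<open>For a self-adjoint \<open>x\<close>, the image of a power is the orthogonal complement of its kernel. This turns membership in an image, the condition behind all the invariants below, into the vanishing of a form on a kernel.\<close>

lemma image_pow_eq:
  assumes V: "ksub V" and B: "altform V B" and nd: "nondegenerate V B"
    and x: "klin V x" "\<forall>v\<in>V. B (x v) v = 0" and t: "t \<in> V"
    and k: "\<And>w. w \<in> V \<Longrightarrow> (x ^^ j) w = 0 \<Longrightarrow> B w t = 0"
  shows "t \<in> (x ^^ j) ` V"
proof (rule perp_perp[OF V B nd _ _ t])
  have kp: "klin V (x ^^ j)" by (rule klin_pow[OF x(1)])
  show "ksub ((x ^^ j) ` V)" by (rule ksub_image[OF kp V order_refl V])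
  show "(x ^^ j) ` V \<subseteq> V" using klinD(1)[OF kp] by blast
  fix w assume w: "w \<in> perp V B ((x ^^ j) ` V)"
  then have wV: "w \<in> V" unfolding perp_def by auto
  have "B ((x ^^ j) w) u = 0" if u: "u \<in> V" for u
    using w u alt_pow(1)[OF V B x wV u] unfolding perp_def by auto
  then have "(x ^^ j) w = 0" using nd klinD(1)[OF kp wV] unfolding nondegenerate_def by blast
  then show "B w t = 0" using k wV by blast
qed

lemma finite_alt_endos: "ksub V \<Longrightarrow> finite (alt_endos V B)"
  by (rule finite_subset[OF _ finite_set_of_finite_funs[of V V 0]])
    (auto simp: alt_endos_def klin_def ksub_def)

lemma image_pow_mono: "klin V x \<Longrightarrow> i \<le> j \<Longrightarrow> (x ^^ j) ` V \<subseteq> (x ^^ i) ` V"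
proof
  fix v assume a: "klin V x" "i \<le> j" "v \<in> (x ^^ j) ` V"
  then obtain w where w: "w \<in> V" "v = (x ^^ j) w" by auto
  have "v = (x ^^ i) ((x ^^ (j - i)) w)" using w a(2) by (metis comp_apply funpow_add le_add_diff_inverse)
  then show "v \<in> (x ^^ i) ` V" using klinD(1)[OF klin_pow[OF a(1)] w(1)] by blast
qed

end

text \<open>An operator killing an isotropic vector \<open>e\<close> preserves its orthogonal complement and acts on the quotient by \<open>e\<close>, which is modelled by the complement \<open>W\<close> of a hyperbolic plane. Conversely such an operator is determined by its reduction \<open>y\<close> on \<open>W\<close> and by one vector \<open>u\<close>, which encodes the image of the partner \<open>f\<close> of \<open>e\<close>.\<close>

locale hyperbolic_plane = kspace scale K
  for scale :: "'a::field \<Rightarrow> 'b::ab_group_add \<Rightarrow> 'b" (infixr "*s" 75) and K :: "'a set" +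
  fixes V :: "'b set" and B :: "'b \<Rightarrow> 'b \<Rightarrow> 'a" and e f :: 'b
  assumes V: "ksub V" and B: "altform V B" and nd: "nondegenerate V B"
    and e: "e \<in> V" "f \<in> V" "B e f = 1"
begin

definition "W = perp V B {e, f}"

definition "pr v = v - B v f *s e + B v e *s f"

definition lift :: "'b \<Rightarrow> ('b \<Rightarrow> 'b) \<Rightarrow> 'b \<Rightarrow> 'b" where
  "lift u y = (\<lambda>v. if v \<in> V then y (pr v) + B v u *s e - B v e *s u else 0)"

definition red :: "('b \<Rightarrow> 'b) \<Rightarrow> 'b \<Rightarrow> 'b" where
  "red x = (\<lambda>w. if w \<in> W then x w - B (x w) f *s e else 0)"

lemmas A = altformD[OF B] and A' = altformD'[OF B V] and S = ksubD[OF V]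

lemmas H = hyperbolic_split[OF V B e, folded W_def]

lemma WV: "W \<subseteq> V" "w \<in> W \<Longrightarrow> w \<in> V" unfolding W_def perp_def by auto

lemma W_perp: "w \<in> W \<Longrightarrow> B w e = 0" "w \<in> W \<Longrightarrow> B w f = 0" "w \<in> W \<Longrightarrow> B e w = 0" "w \<in> W \<Longrightarrow> B f w = 0"
  unfolding W_def perp_def using A'(7)[OF e(1)] A'(7)[OF e(2)] by auto

lemma fe: "B f e = - 1" "B e e = 0" "B f f = 0"
  using A'(7)[OF e(1,2)] e A(6) by auto

lemma BW: "altform W B" by (rule altform_subset[OF B WV(1)])

lemma pr_in: "v \<in> V \<Longrightarrow> pr v \<in> W"
  unfolding pr_def by (rule H(2))

lemma decomp: "v = B v f *s e + pr v - B v e *s f"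
  unfolding pr_def by (simp add: algebra_simps)

lemma coeffs: "v \<in> V \<Longrightarrow> B v f \<in> K" "v \<in> V \<Longrightarrow> B v e \<in> K"
  using A(1) e by auto

lemma pr_W: "w \<in> W \<Longrightarrow> pr w = w"
  unfolding pr_def by (simp add: W_perp)

lemma pr_klin: "u \<in> V \<Longrightarrow> v \<in> V \<Longrightarrow> pr (u + v) = pr u + pr v"
  "c \<in> K \<Longrightarrow> u \<in> V \<Longrightarrow> pr (c *s u) = c *s pr u"
  unfolding pr_def using e by (simp_all add: A(3,5) algebra_simps)

lemma pr_ef: "pr e = 0" "pr f = 0"
  unfolding pr_def using e fe by simp_all

lemma B_pr: "v \<in> V \<Longrightarrow> t \<in> W \<Longrightarrow> B (pr v) t = B v t" "v \<in> V \<Longrightarrow> t \<in> W \<Longrightarrow> B t (pr v) = B t v"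
proof -
  assume a: "v \<in> V" "t \<in> W"
  have m: "B v f *s e \<in> V" "B v e *s f \<in> V" "v - B v f *s e \<in> V" "t \<in> V" using S(4,6) coeffs e a WV by auto
  show *: "B (pr v) t = B v t" unfolding pr_def
    using A(3)[OF m(4,3,2)] A'(6)[OF m(4) a(1) m(1)] A(5)[OF m(4) e(1) coeffs(1)[OF a(1)]]
      A(5)[OF m(4) e(2) coeffs(2)[OF a(1)]] W_perp[OF a(2)] by simp
  show "B t (pr v) = B t v" using * A'(7)[OF m(4) a(1)] A'(7)[OF m(4) WV(2)[OF pr_in[OF a(1)]]] by simp
qed

lemma ndW: "nondegenerate W B"
  unfolding nondegenerate_def
proof (intro ballI impI)
  fix v assume v: "v \<in> W" "\<forall>w\<in>W. B v w = 0"
  have "B v w = 0" if "w \<in> V" for w using B_pr(2)[OF that v(1)] v(2) pr_in[OF that] by simp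
  then show "v = 0" using nd v WV unfolding nondegenerate_def by blast
qed

lemma W_Ke: "w \<in> W \<Longrightarrow> a \<in> K \<Longrightarrow> w' \<in> W \<Longrightarrow> b \<in> K \<Longrightarrow> w + a *s e = w' + b *s e \<Longrightarrow> w = w' \<and> a = b"
proof -
  assume a: "w \<in> W" "a \<in> K" "w' \<in> W" "b \<in> K" "w + a *s e = w' + b *s e"
  have F: "B (w + a *s e) f = a" if "w \<in> W" "a \<in> K" for w a
    using A(3)[OF e(2) WV(2)[OF that(1)] S(4)[OF that(2) e(1)]] A(5)[OF e(2,1) that(2)] W_perp(2)[OF that(1)] e(3)
    by simp
  have "a = b" using F[OF a(1,2)] F[OF a(3,4)] a(5) by simp
  then show ?thesis using a(5) by simp
qed

lemma lift_alt:
  assumes u: "u \<in> W" and y: "y \<in> alt_endos W B"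
  shows "lift u y \<in> alt_endos V B" "lift u y e = 0" "lift u y f = u" "red (lift u y) = y"
proof -
  have yl: "klin W y" "\<And>w. w \<notin> W \<Longrightarrow> y w = 0" "\<forall>w\<in>W. B (y w) w = 0"
    using y unfolding alt_endos_def by auto
  have y0: "y 0 = 0" by (rule klinD'(1)[OF yl(1) H(1)])
  have uV: "u \<in> V" using u WV by auto
  have yW: "y (pr v) \<in> W" "y (pr v) \<in> V" if "v \<in> V" for v
    using klinD(1)[OF yl(1) pr_in[OF that]] WV by auto
  have BK: "B v u \<in> K" if "v \<in> V" for v using A(1)[OF that uV] .
  have cl: "lift u y v \<in> V" if "v \<in> V" for v
    unfolding lift_def using that yW[OF that] S(3,4,6) BK coeffs e uV by simp
  show "lift u y e = 0" unfolding lift_def using e pr_ef y0 fe W_perp[OF u] by simp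
  show "lift u y f = u" unfolding lift_def using e pr_ef y0 fe W_perp[OF u] by simp
  show "lift u y \<in> alt_endos V B" unfolding alt_endos_def
  proof (intro CollectI conjI ballI allI impI)
    show "klin V (lift u y)" unfolding klin_def
    proof (intro conjI ballI)
      show "lift u y v \<in> V" if "v \<in> V" for v using cl that .
      show "lift u y (v + w) = lift u y v + lift u y w" if "v \<in> V" "w \<in> V" for v w
        unfolding lift_def using that S(3)
        by (simp add: pr_klin klinD(2)[OF yl(1) pr_in pr_in] A(3)[OF uV] A(3)[OF e(1)] algebra_simps)
      show "lift u y (c *s v) = c *s lift u y v" if "c \<in> K" "v \<in> V" for c v
        unfolding lift_def using that S(4)
        by (simp add: pr_klin klinD(3)[OF yl(1) _ pr_in] A(5)[OF uV] A(5)[OF e(1)] algebra_simps)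
    qed
    show "lift u y v = 0" if "v \<notin> V" for v unfolding lift_def using that by simp
    fix v assume v: "v \<in> V"
    have m: "y (pr v) \<in> V" "B v u *s e \<in> V" "B v e *s u \<in> V" "y (pr v) + B v u *s e \<in> V"
      using yW v S(3,4) BK coeffs e uV by auto
    have "B (y (pr v)) v = 0" using B_pr(2)[OF v yW(1)[OF v]] yl(3) pr_in[OF v] by simp
    moreover have "B e v = - B v e" using A'(7)[OF v e(1)] .
    moreover have "B u v = - B v u" using A'(7)[OF v uV] .
    ultimately have "B (y (pr v) + B v u *s e - B v e *s u) v = 0"
      using A'(6)[OF v m(4,3)] A(3)[OF v m(1,2)] A(5)[OF v e(1) BK[OF v]] A(5)[OF v uV coeffs(2)[OF v]] by simp
    then show "B (lift u y v) v = 0" unfolding lift_def using v by simp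
  qed
  show "red (lift u y) = y"
  proof
    fix w
    show "red (lift u y) w = y w"
    proof (cases "w \<in> W")
      case True
      then have wV: "w \<in> V" using WV by auto
      have l: "lift u y w = y w + B w u *s e" unfolding lift_def using wV pr_W[OF True] W_perp[OF True] by simp
      have "B (y w + B w u *s e) f = B w u"
        using A(3)[OF e(2) WV(2)[OF klinD(1)[OF yl(1) True]] S(4)[OF BK[OF wV] e(1)]]
          A(5)[OF e(2) e(1) BK[OF wV]] W_perp[OF klinD(1)[OF yl(1) True]] e by simp
      then show ?thesis unfolding red_def l using True by simp
    qed (simp add: red_def yl)
  qed
qed

lemma lift_red:
  assumes x: "x \<in> alt_endos V B" and xe: "x e = 0"
  shows "x f \<in> W" "red x \<in> alt_endos W B" "lift (x f) (red x) = x"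
proof -
  have xl: "klin V x" "\<And>w. w \<notin> V \<Longrightarrow> x w = 0" "\<forall>w\<in>V. B (x w) w = 0"
    using x unfolding alt_endos_def by auto
  note sa = alt_selfadjoint[OF V B xl(1,3)]
  have xV: "v \<in> V \<Longrightarrow> x v \<in> V" for v using klinD(1)[OF xl(1)] .
  have Bxe: "B (x v) e = 0" if "v \<in> V" for v using sa[OF that e(1)] xe A'(1)[OF that] by simp
  show xf: "x f \<in> W" unfolding W_def perp_def using xV e Bxe xl(3) by auto
  have r: "red x w \<in> W" if w: "w \<in> W" for w
  proof -
    have wV: "x w \<in> V" using WV(2)[OF w] xV by auto
    have "red x w = pr (x w)" unfolding red_def pr_def using w Bxe[OF WV(2)[OF w]] by simp
    then show ?thesis using pr_in[OF wV] by simp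
  qed
  show "red x \<in> alt_endos W B" unfolding alt_endos_def
  proof (intro CollectI conjI ballI allI impI)
    show "klin W (red x)" unfolding klin_def
    proof (intro conjI ballI)
      show "red x w \<in> W" if "w \<in> W" for w using r that .
      show "red x (v + w) = red x v + red x w" if "v \<in> W" "w \<in> W" for v w
        unfolding red_def using that ksubD(3)[OF H(1)] WV xV e
        by (simp add: klinD(2)[OF xl(1)] A(3) algebra_simps)
      show "red x (c *s w) = c *s red x w" if "c \<in> K" "w \<in> W" for c w
        unfolding red_def using that ksubD(4)[OF H(1)] WV xV e
        by (simp add: klinD(3)[OF xl(1)] A(5) algebra_simps)
    qed
    show "red x w = 0" if "w \<notin> W" for w unfolding red_def using that by simp
    fix w assume w: "w \<in> W"
    have wV: "w \<in> V" using WV w by auto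
    have c: "B (x w) f \<in> K" using coeffs xV wV by auto
    show "B (red x w) w = 0" unfolding red_def
      using w A'(6)[OF wV xV[OF wV] S(4)[OF c e(1)]] A(5)[OF wV e(1) c] W_perp[OF w] xl(3) wV by simp
  qed
  show "lift (x f) (red x) = x"
  proof
    fix v
    show "lift (x f) (red x) v = x v"
    proof (cases "v \<in> V")
      case True
      have p: "pr v \<in> W" "pr v \<in> V" using pr_in[OF True] WV by auto
      have m: "B v f *s e \<in> V" "B v e *s f \<in> V" "B v f *s e + pr v \<in> V" using S(3,4) coeffs e True p by auto
      have "x v = x (B v f *s e + pr v - B v e *s f)" using decomp[of v] by simp
      also have "\<dots> = x (pr v) - B v e *s x f"
        using klinD'(3)[OF xl(1) V m(3,2)] klinD(2)[OF xl(1) m(1) p(2)] klinD(3)[OF xl(1) coeffs(1)[OF True] e(1)]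
          klinD(3)[OF xl(1) coeffs(2)[OF True] e(2)] xe by simp
      finally have xv: "x v = x (pr v) - B v e *s x f" .
      have "B v (x f) = B (x v) f" using sa[OF True e(2)] by simp
      also have "\<dots> = B (x (pr v)) f"
        unfolding xv using A'(6)[OF e(2) xV[OF p(2)] S(4)[OF coeffs(2)[OF True] xV[OF e(2)]]]
          A(5)[OF e(2) xV[OF e(2)] coeffs(2)[OF True]] xl(3) e(2) by simp
      finally show ?thesis unfolding lift_def red_def using True p xv by simp
    qed (simp add: lift_def xl)
  qed
qed

lemma lift_pow:
  assumes u: "u \<in> W" and y: "y \<in> alt_endos W B" and v: "v \<in> V"
  shows "(lift u y ^^ Suc j) v = (y ^^ Suc j) (pr v) + B (pr v) ((y ^^ j) u) *s e - B v e *s (y ^^ j) u"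
proof (induction j)
  case 0
  show ?case unfolding lift_def using v B_pr[OF v u] by simp
next
  case (Suc j)
  have yl: "klin W y" "\<forall>w\<in>W. B (y w) w = 0" using y unfolding alt_endos_def by auto
  have L: "klin V (lift u y)" "lift u y e = 0" using lift_alt[OF u y] unfolding alt_endos_def by auto
  define t where "t = (y ^^ j) u"
  define z where "z = (y ^^ Suc j) (pr v)"
  have p: "pr v \<in> W" "t \<in> W" "z \<in> W" "pr v \<in> V" "t \<in> V" "z \<in> V"
    unfolding t_def z_def using pr_in[OF v] klinD(1)[OF klin_pow[OF yl(1)]] u WV by blast+
  have c: "B (pr v) t \<in> K" "B v e \<in> K" using A(1) p coeffs v by auto
  have m: "B (pr v) t *s e \<in> V" "B v e *s t \<in> V" "z + B (pr v) t *s e \<in> V"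
    using S(3,4) c p e by auto
  have lw: "lift u y w = y w + B w u *s e" if "w \<in> W" for w
    unfolding lift_def using that WV W_perp pr_W by simp
  have "(lift u y ^^ Suc (Suc j)) v = lift u y (z + B (pr v) t *s e - B v e *s t)"
    using Suc by (simp only: funpow.simps(2)[of "Suc j" "lift u y"] o_apply t_def z_def)
  also have "\<dots> = lift u y z - B v e *s lift u y t"
    using klinD'(3)[OF L(1) V m(3,2)] klinD(2)[OF L(1) p(6) m(1)] klinD(3)[OF L(1) c(1) e(1)]
      klinD(3)[OF L(1) c(2) p(5)] L(2) by simp
  also have "\<dots> = y z + B z u *s e - B v e *s (y t + B t u *s e)" using lw p by simp
  also have "B t u = 0" unfolding t_def by (rule alt_pow(2)[OF H(1) BW yl u])
  also have "B z u = B (pr v) ((y ^^ Suc j) u)" unfolding z_def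
    by (rule alt_pow(1)[OF H(1) BW yl p(1) u])
  finally show ?case unfolding z_def t_def by simp
qed

lemma lift_pow_image:
  assumes u: "u \<in> W" and y: "y \<in> alt_endos W B"
  shows "(lift u y ^^ Suc j) ` V = {(y ^^ Suc j) w + B w ((y ^^ j) u) *s e + c *s (y ^^ j) u | w c. w \<in> W \<and> c \<in> K}"
    (is "_ = ?R")
proof (intro equalityI subsetI)
  fix z assume "z \<in> (lift u y ^^ Suc j) ` V"
  then obtain v where v: "v \<in> V" "z = (lift u y ^^ Suc j) v" by auto
  show "z \<in> ?R" unfolding v(2) lift_pow[OF u y v(1)]
    using pr_in[OF v(1)] coeffs(2)[OF v(1)]
    by (intro CollectI exI[of _ "pr v"] exI[of _ "- B v e"]) simp
next
  fix z assume "z \<in> ?R"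
  then obtain w c where z: "z = (y ^^ Suc j) w + B w ((y ^^ j) u) *s e + c *s (y ^^ j) u" "w \<in> W" "c \<in> K" by auto
  have v: "0 *s e + w + c *s f \<in> V" "B (0 *s e + w + c *s f) e = - c" "B (0 *s e + w + c *s f) f = 0"
    using H(3)[of 0 c w] z by auto
  have "pr (0 *s e + w + c *s f) = w" unfolding pr_def v(2,3) by simp
  then have "(lift u y ^^ Suc j) (0 *s e + w + c *s f) = z"
    unfolding lift_pow[OF u y v(1)] v(2) z by simp
  then show "z \<in> (lift u y ^^ Suc j) ` V" using v(1) by (metis imageI)
qed

text \<open>The powers of a lift have the rank of the powers of its reduction, increased by two as long as the next power of the reduction does not absorb \<open>u\<close>: the self-adjointness makes the corrections along \<open>e\<close> and along \<open>u\<close> come in pairs.\<close>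

lemma lift_rank:
  assumes u: "u \<in> W" and y: "y \<in> alt_endos W B"
  shows "(y ^^ j) u \<in> (y ^^ Suc j) ` W \<Longrightarrow>
          card ((lift u y ^^ Suc j) ` V) = card ((y ^^ Suc j) ` W) \<and> e \<notin> (lift u y ^^ Suc j) ` V"
    and "(y ^^ j) u \<notin> (y ^^ Suc j) ` W \<Longrightarrow>
          card ((lift u y ^^ Suc j) ` V) = (card K)\<^sup>2 * card ((y ^^ Suc j) ` W) \<and> e \<in> (lift u y ^^ Suc j) ` V"
proof -
  have yl: "klin W y" "\<forall>w\<in>W. B (y w) w = 0" using y unfolding alt_endos_def by auto
  define T where "T = y ^^ Suc j"
  define t where "t = (y ^^ j) u"
  have Tl: "klin W T" unfolding T_def by (rule klin_pow[OF yl(1)])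
  have tW: "t \<in> W" unfolding t_def using klinD(1)[OF klin_pow[OF yl(1)] u] .
  have im: "(lift u y ^^ Suc j) ` V = {T w + B w t *s e + c *s t | w c. w \<in> W \<and> c \<in> K}"
    unfolding T_def t_def by (rule lift_pow_image[OF u y])
  have kT: "ksub (T ` W)" by (rule ksub_image[OF Tl H(1) order_refl H(1)])
  have TW: "T ` W \<subseteq> W" using klinD(1)[OF Tl] by auto
  have BK: "w \<in> W \<Longrightarrow> w' \<in> W \<Longrightarrow> B w w' \<in> K" for w w' using A(1) WV by blast
  show "card ((lift u y ^^ Suc j) ` V) = card ((y ^^ Suc j) ` W) \<and> e \<notin> (lift u y ^^ Suc j) ` V"
    if hyp: "(y ^^ j) u \<in> (y ^^ Suc j) ` W"
  proof -
    obtain v where v: "v \<in> W" "t = T v" using hyp unfolding t_def T_def by auto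
    have Bv: "B w t = B (T w) v" if "w \<in> W" for w
      unfolding v(2) T_def by (rule alt_pow(1)[OF H(1) BW yl that v(1), symmetric])
    have vt: "B v t = 0" unfolding Bv[OF v(1)] T_def by (rule alt_pow(2)[OF H(1) BW yl v(1)])
    have e1: "{T w + B w t *s e + c *s t | w c. w \<in> W \<and> c \<in> K} = (\<lambda>z. z + B z v *s e) ` (T ` W)" (is "?L = ?R")
    proof (intro equalityI subsetI)
      fix z assume "z \<in> ?L"
      then obtain w c where z: "z = T w + B w t *s e + c *s t" "w \<in> W" "c \<in> K" by auto
      have cv: "c *s v \<in> W" "w + c *s v \<in> W" using ksubD(3,4)[OF H(1)] v z by auto
      have Tw: "T (w + c *s v) = T w + c *s t" using klinD[OF Tl] z v cv by simp
      have "B (T (w + c *s v)) v = B (w + c *s v) t" using Bv[OF cv(2)] by simp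
      also have "\<dots> = B w t" using altformD(3)[OF BW tW z(2) cv(1)] altformD(5)[OF BW tW v(1) z(3)] vt by simp
      finally have "z = T (w + c *s v) + B (T (w + c *s v)) v *s e" unfolding z Tw by (simp add: algebra_simps)
      then show "z \<in> ?R" using cv(2) by blast
    next
      fix z assume "z \<in> ?R"
      then obtain w where w: "w \<in> W" "z = T w + B (T w) v *s e" by auto
      then show "z \<in> ?L" using Bv[OF w(1)] by (intro CollectI exI[of _ w] exI[of _ 0]) simp
    qed
    have inj: "inj_on (\<lambda>z. z + B z v *s e) (T ` W)"
    proof (rule inj_onI)
      fix z z' assume z: "z \<in> T ` W" "z' \<in> T ` W" "z + B z v *s e = z' + B z' v *s e"
      have "z \<in> W" "z' \<in> W" using z TW by auto
      then show "z = z'" using W_Ke[OF _ BK _ BK z(3)] v(1) by simp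
    qed
    have "e \<notin> (\<lambda>z. z + B z v *s e) ` (T ` W)"
    proof
      assume "e \<in> (\<lambda>z. z + B z v *s e) ` (T ` W)"
      then obtain z where z: "z \<in> W" "0 + 1 *s e = z + B z v *s e" using TW by auto
      have "0 = z \<and> 1 = B z v" by (rule W_Ke[OF ksubD(2)[OF H(1)] K_closed(2) z(1) BK[OF z(1) v(1)] z(2)])
      then show False using A'(2)[OF WV(2)[OF v(1)]] by auto
    qed
    then show ?thesis unfolding im e1 using card_image[OF inj] unfolding T_def by simp
  qed
  show "card ((lift u y ^^ Suc j) ` V) = (card K)\<^sup>2 * card ((y ^^ Suc j) ` W) \<and> e \<in> (lift u y ^^ Suc j) ` V"
    if "(y ^^ j) u \<notin> (y ^^ Suc j) ` W"
  proof -
    have nt: "t \<notin> T ` W" using that unfolding t_def T_def .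
    obtain w0 where w0: "w0 \<in> W" "T w0 = 0" "B w0 t \<noteq> 0"
      using image_pow_eq[OF H(1) BW ndW yl tW, of "Suc j"] nt unfolding T_def by blast
    have e1: "{T w + B w t *s e + c *s t | w c. w \<in> W \<and> c \<in> K} = (\<lambda>((z, a), c). z + a *s e + c *s t) ` ((T ` W \<times> K) \<times> K)" (is "?L = ?R")
    proof (intro equalityI subsetI)
      fix z assume "z \<in> ?L"
      then obtain w c where z: "z = T w + B w t *s e + c *s t" "w \<in> W" "c \<in> K" by auto
      then have "((T w, B w t), c) \<in> (T ` W \<times> K) \<times> K" using BK tW by auto
      then show "z \<in> ?R" unfolding z(1) by force
    next
      fix z assume "z \<in> ?R"
      then obtain w a c where z: "w \<in> W" "a \<in> K" "c \<in> K" "z = T w + a *s e + c *s t" by auto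
      define d where "d = (a - B w t) / B w0 t"
      have dK: "d \<in> K" unfolding d_def using z BK tW w0 by simp
      have m: "d *s w0 \<in> W" using ksubD(4)[OF H(1) dK w0(1)] .
      have "T (w + d *s w0) = T w" using klinD(2)[OF Tl z(1) m] klinD(3)[OF Tl dK w0(1)] w0 by simp
      moreover have "B (w + d *s w0) t = a"
        using altformD(3)[OF BW tW z(1) m] altformD(5)[OF BW tW w0(1) dK] w0(3) unfolding d_def by simp
      ultimately show "z \<in> ?L" unfolding z(4) using z(3) ksubD(3)[OF H(1) z(1) m]
        by (intro CollectI exI[of _ "w + d *s w0"] exI[of _ c]) simp
    qed
    have inj: "inj_on (\<lambda>((z, a), c). z + a *s e + c *s t) ((T ` W \<times> K) \<times> K)"
    proof (rule inj_onI)
      fix p p' assume pp: "p \<in> (T ` W \<times> K) \<times> K" "p' \<in> (T ` W \<times> K) \<times> K"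
        and eq: "(\<lambda>((z, a), c). z + a *s e + c *s t) p = (\<lambda>((z, a), c). z + a *s e + c *s t) p'"
      obtain z a c z' a' c' where p: "p = ((z, a), c)" "p' = ((z', a'), c')" by (metis surj_pair)
      have m: "z \<in> T ` W" "z' \<in> T ` W" "a \<in> K" "a' \<in> K" "c \<in> K" "c' \<in> K" using pp p by auto
      have "(z + c *s t) + a *s e = (z' + c' *s t) + a' *s e" using eq p by (simp add: algebra_simps)
      moreover have "z + c *s t \<in> W" "z' + c' *s t \<in> W"
        using ksubD(3)[OF H(1) subsetD[OF TW m(1)] ksubD(4)[OF H(1) m(5) tW]]
          ksubD(3)[OF H(1) subsetD[OF TW m(2)] ksubD(4)[OF H(1) m(6) tW]] .
      ultimately have E: "z + c *s t = z' + c' *s t" "a = a'"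
        using W_Ke[OF _ m(3) _ m(4)] by simp_all
      have "c = c'"
      proof (rule ccontr)
        assume "c \<noteq> c'"
        have "(c - c') *s t = z' - z" using E by (simp add: algebra_simps)
        then have "inverse (c - c') *s ((c - c') *s t) = inverse (c - c') *s (z' - z)" by simp
        then have "t = inverse (c - c') *s (z' - z)" using \<open>c \<noteq> c'\<close> by simp
        then have "t \<in> T ` W" using ksubD(4,6)[OF kT] m by simp
        then show False using nt by simp
      qed
      then show "p = p'" using E p by simp
    qed
    have "e \<in> ?R"
    proof -
      have *: "((0, 1), 0) \<in> (T ` W \<times> K) \<times> K" using ksubD(2)[OF kT] by simp
      show ?thesis by (rule image_eqI[OF _ *]) simp
    qed
    then show ?thesis unfolding im e1 card_image[OF inj]
      unfolding T_def by (simp add: card_cartesian_product power2_eq_square)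
  qed
qed

end

section \<open>The recursion for operators with given ranks of powers\<close>

definition switch_count :: "nat \<Rightarrow> (nat \<Rightarrow> nat) \<Rightarrow> nat \<Rightarrow> int" where
  "switch_count q r j0 = int q ^ (r (Suc j0) + r 0 - r j0) -
     (if j0 = 0 then 0 else int q ^ (r j0 + r 0 - r (j0 - 1)))"

definition height_count :: "nat \<Rightarrow> (nat \<Rightarrow> nat) \<Rightarrow> nat \<Rightarrow> int" where
  "height_count q r j0 = int q ^ (r j0 - r (Suc j0)) - int q ^ (r (Suc j0) - r (Suc (Suc j0)))"

definition drop_rank :: "(nat \<Rightarrow> nat) \<Rightarrow> nat \<Rightarrow> nat \<Rightarrow> nat" where
  "drop_rank r j0 = (\<lambda>j. if j \<le> j0 then r j - 2 else r j)"

context kspace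
begin

text \<open>Vectors \<open>u\<close> whose chain has no jump at the step \<open>j\<close>; the sets increase with \<open>j\<close>, and the difference of two consecutive ones consists of the vectors whose chain jumps for the last time just before.\<close>

definition stuck :: "'b set \<Rightarrow> ('b \<Rightarrow> 'b) \<Rightarrow> nat \<Rightarrow> 'b set" where
  "stuck V x j = {u \<in> V. (x ^^ j) u \<in> (x ^^ Suc j) ` V}"

lemma stuck_mono:
  assumes "klin V x" "i \<le> j"
  shows "stuck V x i \<subseteq> stuck V x j"
proof
  fix u assume "u \<in> stuck V x i"
  then obtain w where w: "u \<in> V" "w \<in> V" "(x ^^ i) u = (x ^^ Suc i) w" unfolding stuck_def by auto
  have "(x ^^ (j - i)) ((x ^^ i) u) = (x ^^ (j - i)) ((x ^^ Suc i) w)" using w by simp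
  then have "(x ^^ j) u = (x ^^ Suc j) w"
    using assms(2) by (simp add: funpow_add[symmetric, unfolded comp_def fun_eq_iff] del: funpow.simps)
  then show "u \<in> stuck V x j" using w unfolding stuck_def by blast
qed

lemma card_stuck:
  assumes V: "ksub V" and x: "klin V x"
  shows "card (stuck V x j) * card ((x ^^ j) ` V) = card ((x ^^ Suc j) ` V) * card V"
proof -
  have kj: "klin V (x ^^ j)" by (rule klin_pow[OF x])
  have sub: "stuck V x j \<subseteq> V" unfolding stuck_def by auto
  have im: "(x ^^ j) ` stuck V x j = (x ^^ Suc j) ` V"
  proof (intro equalityI subsetI)
    fix z assume "z \<in> (x ^^ Suc j) ` V"
    then obtain w where w: "w \<in> V" "z = (x ^^ Suc j) w" by auto
    have "(x ^^ j) (x w) = (x ^^ Suc j) w" by (simp add: funpow_swap1)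
    then show "z \<in> (x ^^ j) ` stuck V x j" unfolding w(2) stuck_def
      using w(1) klinD(1)[OF x w(1)] by (metis (mono_tags, lifting) imageI mem_Collect_eq)
  qed (auto simp: stuck_def)
  have k0: "{u \<in> stuck V x j. (x ^^ j) u = 0} = {u \<in> V. (x ^^ j) u = 0}"
    unfolding stuck_def using klinD'(1)[OF klin_pow[OF x, of "Suc j"] V] ksubD(2)[OF V] by force
  have iV: "ksub ((x ^^ Suc j) ` V)" by (rule ksub_image[OF klin_pow[OF x] V order_refl V])
  have "card (stuck V x j) = card ((x ^^ j) ` stuck V x j) * card {u \<in> stuck V x j. (x ^^ j) u = 0}"
  proof (rule card_additive_image_kernel)
    show "finite (stuck V x j)" using sub ksubD(1)[OF V] by (rule finite_subset)
    show "0 \<in> stuck V x j" unfolding stuck_def using ksubD(2)[OF V] ksubD(2)[OF iV] klinD'(1)[OF kj V] by simp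
    fix u v assume uv: "u \<in> stuck V x j" "v \<in> stuck V x j"
    then have uvV: "u \<in> V" "v \<in> V" unfolding stuck_def by auto
    show *: "(x ^^ j) (u - v) = (x ^^ j) u - (x ^^ j) v" by (rule klinD'(3)[OF kj V uvV])
    show "u - v \<in> stuck V x j" using uv uvV ksubD(6)[OF V uvV] ksubD(6)[OF iV] * unfolding stuck_def by simp
  qed
  then show ?thesis unfolding im k0 using card_klin[OF kj V] by (simp add: ac_simps)
qed

lemma rank_antimono:
  assumes V: "ksub V" and x: "x \<in> ranked V B r" and ij: "i \<le> j"
  shows "r j \<le> r i"
proof -
  have xl: "klin V x" "\<And>j. card ((x ^^ j) ` V) = card K ^ r j" using x unfolding ranked_def alt_endos_def by auto
  have "card ((x ^^ j) ` V) \<le> card ((x ^^ i) ` V)"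
    by (rule card_mono[OF finite_imageI[OF ksubD(1)[OF V]] image_pow_mono[OF xl(1) ij]])
  then have "card K ^ r j \<le> card K ^ r i" unfolding xl(2) .
  moreover have "1 < card K" using card_K_ge_2 by linarith
  ultimately show ?thesis by (metis power_le_imp_le_exp)
qed

lemma card_switch:
  assumes V: "ksub V" and x: "x \<in> ranked V B r"
  shows "int (card {u \<in> V. \<forall>j. (x ^^ j) u \<notin> (x ^^ Suc j) ` V \<longleftrightarrow> j < j0}) = switch_count (card K) r j0"
proof -
  have xl: "klin V x" "\<And>j. card ((x ^^ j) ` V) = card K ^ r j" using x unfolding ranked_def alt_endos_def by auto
  have cV: "card V = card K ^ r 0" using xl(2)[of 0] by simp
  have q: "card K > 0" using card_K_ge_2 by simp
  have cs: "card (stuck V x j) = card K ^ (r (Suc j) + r 0 - r j)" for j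
  proof -
    have "r j \<le> r (Suc j) + r 0" using rank_antimono[OF V x, of 0 j] by simp
    then have "card K ^ (r (Suc j) + r 0 - r j) * card K ^ r j = card K ^ r (Suc j) * card K ^ r 0"
      by (simp flip: power_add)
    also have "\<dots> = card (stuck V x j) * card K ^ r j"
      by (simp only: card_stuck[OF V xl(1), of j, unfolded xl(2) cV])
    finally have "card K ^ r j * card K ^ (r (Suc j) + r 0 - r j) = card K ^ r j * card (stuck V x j)"
      by (simp only: mult.commute)
    then show ?thesis using q by (metis mult_left_cancel power_not_zero neq0_conv)
  qed
  have fin: "finite (stuck V x j)" for j unfolding stuck_def using ksubD(1)[OF V] by simp
  let ?S = "{u \<in> V. \<forall>j. (x ^^ j) u \<notin> (x ^^ Suc j) ` V \<longleftrightarrow> j < j0}"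
  have S: "u \<in> ?S \<longleftrightarrow> u \<in> V \<and> (\<forall>j. u \<in> stuck V x j \<longleftrightarrow> j0 \<le> j)" for u
    unfolding stuck_def by (auto simp: not_less[symmetric] simp del: funpow.simps)
  show ?thesis
  proof (cases "j0 = 0")
    case True
    have "?S = stuck V x 0"
    proof (intro equalityI subsetI)
      fix u assume "u \<in> stuck V x 0"
      then have "u \<in> V" "\<forall>j. u \<in> stuck V x j" using stuck_mono[OF xl(1), of 0] unfolding stuck_def[of V x 0] by auto
      then show "u \<in> ?S" unfolding S using True by simp
    qed (use S True in auto)
    then show ?thesis using cs[of 0] True by (simp add: switch_count_def)
  next
    case False
    have sub: "stuck V x (j0 - 1) \<subseteq> stuck V x j0" by (rule stuck_mono[OF xl(1)]) simp
    have "?S = stuck V x j0 - stuck V x (j0 - 1)"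
    proof (intro equalityI subsetI)
      fix u assume "u \<in> ?S"
      then show "u \<in> stuck V x j0 - stuck V x (j0 - 1)" unfolding S using False by auto
    next
      fix u assume u: "u \<in> stuck V x j0 - stuck V x (j0 - 1)"
      have "u \<in> stuck V x j \<longleftrightarrow> j0 \<le> j" for j
      proof
        assume "u \<in> stuck V x j"
        then have "\<not> j \<le> j0 - 1" using u stuck_mono[OF xl(1), of j "j0 - 1"] by blast
        then show "j0 \<le> j" by simp
      next
        assume "j0 \<le> j"
        then show "u \<in> stuck V x j" using u stuck_mono[OF xl(1), of j0 j] by auto
      qed
      moreover have "u \<in> V" using u unfolding stuck_def by auto
      ultimately show "u \<in> ?S" unfolding S by blast
    qed
    then have "card ?S = card (stuck V x j0) - card (stuck V x (j0 - 1))"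
      using card_Diff_subset[OF fin sub] by simp
    moreover have "card (stuck V x (j0 - 1)) \<le> card (stuck V x j0)" by (rule card_mono[OF fin sub])
    ultimately have "int (card ?S) = int (card (stuck V x j0)) - int (card (stuck V x (j0 - 1)))" by simp
    then show ?thesis unfolding cs switch_count_def using False by simp
  qed
qed

lemma card_height:
  assumes V: "ksub V" and x: "x \<in> ranked V B r"
  shows "int (card {e \<in> V. x e = 0 \<and> e \<in> (x ^^ j0) ` V \<and> e \<notin> (x ^^ Suc j0) ` V}) = height_count (card K) r j0"
proof -
  have xl: "klin V x" "\<And>j. card ((x ^^ j) ` V) = card K ^ r j" using x unfolding ranked_def alt_endos_def by auto
  have q: "card K > 0" using card_K_ge_2 by simp
  define Z where "Z j = {e \<in> (x ^^ j) ` V. x e = 0}" for j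
  have IV: "(x ^^ j) ` V \<subseteq> V" for j using klinD(1)[OF klin_pow[OF xl(1)]] by auto
  have kI: "ksub ((x ^^ j) ` V)" for j by (rule ksub_image[OF klin_pow[OF xl(1)] V order_refl V])
  have cZ: "card (Z j) = card K ^ (r j - r (Suc j))" for j
  proof -
    have im: "x ` ((x ^^ j) ` V) = (x ^^ Suc j) ` V" by (simp add: image_comp)
    have lin: "klin ((x ^^ j) ` V) x" unfolding klin_def
    proof (intro conjI ballI)
      fix u assume u: "u \<in> (x ^^ j) ` V"
      have "x u \<in> (x ^^ Suc j) ` V" using u by (auto simp flip: im)
      then show "x u \<in> (x ^^ j) ` V" using image_pow_mono[OF xl(1), of j "Suc j"] by auto
    qed (use IV[of j] klinD[OF xl(1)] in blast)+
    have "card K ^ r j = card K ^ r (Suc j) * card (Z j)"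
      using card_klin[OF lin kI] unfolding im xl(2) Z_def .
    moreover have "card K ^ r j = card K ^ r (Suc j) * card K ^ (r j - r (Suc j))"
      using rank_antimono[OF V x, of j "Suc j"] by (simp flip: power_add)
    ultimately show ?thesis using q by (metis mult_left_cancel power_not_zero neq0_conv)
  qed
  have sub: "Z (Suc j0) \<subseteq> Z j0" unfolding Z_def using image_pow_mono[OF xl(1), of j0 "Suc j0"] by auto
  have fin: "finite (Z j)" for j unfolding Z_def using ksubD(1)[OF V] by simp
  have "{e \<in> V. x e = 0 \<and> e \<in> (x ^^ j0) ` V \<and> e \<notin> (x ^^ Suc j0) ` V} = Z j0 - Z (Suc j0)"
    unfolding Z_def using IV[of j0] by (auto simp del: funpow.simps)
  then have "int (card {e \<in> V. x e = 0 \<and> e \<in> (x ^^ j0) ` V \<and> e \<notin> (x ^^ Suc j0) ` V}) = int (card (Z j0)) - int (card (Z (Suc j0)))"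
    using card_Diff_subset[OF fin sub] card_mono[OF fin sub] by simp
  then show ?thesis unfolding cZ height_count_def by simp
qed

lemma finite_ranked: "ksub V \<Longrightarrow> finite (ranked V B r)"
  by (rule finite_subset[OF _ finite_alt_endos]) (auto simp: ranked_def)

end

context hyperbolic_plane
begin

lemma lift_ranked_iff:
  assumes u: "u \<in> W" and y: "y \<in> alt_endos W B" and r: "\<And>j. j \<le> j0 \<Longrightarrow> 2 \<le> r j"
  shows "lift u y \<in> ranked V B r \<and> e \<in> (lift u y ^^ j0) ` V \<and> e \<notin> (lift u y ^^ Suc j0) ` V \<longleftrightarrow>
    y \<in> ranked W B (drop_rank r j0) \<and> (\<forall>j. (y ^^ j) u \<notin> (y ^^ Suc j) ` W \<longleftrightarrow> j < j0)"
proof -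
  have yl: "klin W y" using y unfolding alt_endos_def by auto
  have L: "lift u y \<in> alt_endos V B" "klin V (lift u y)" using lift_alt(1)[OF u y] unfolding alt_endos_def by auto
  define J where "J j \<longleftrightarrow> (y ^^ j) u \<notin> (y ^^ Suc j) ` W" for j
  have J: "e \<in> (lift u y ^^ Suc j) ` V \<longleftrightarrow> J j"
    "card ((lift u y ^^ Suc j) ` V) = (if J j then (card K)\<^sup>2 else 1) * card ((y ^^ Suc j) ` W)" for j
    unfolding J_def using lift_rank[OF u y, of j] by (auto simp del: funpow.simps)
  have Jm: "J j \<Longrightarrow> i \<le> j \<Longrightarrow> J i" for i j
    unfolding J_def using stuck_mono[OF yl, of i j] u unfolding stuck_def by (auto simp del: funpow.simps)
  have e0: "e \<in> (lift u y ^^ 0) ` V" using e by simp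
  have E: "e \<in> (lift u y ^^ j0) ` V \<and> e \<notin> (lift u y ^^ Suc j0) ` V \<longleftrightarrow> (\<forall>j. J j \<longleftrightarrow> j < j0)"
  proof
    assume a: "e \<in> (lift u y ^^ j0) ` V \<and> e \<notin> (lift u y ^^ Suc j0) ` V"
    show "\<forall>j. J j \<longleftrightarrow> j < j0"
    proof (intro allI iffI)
      fix j assume "J j"
      then show "j < j0" using Jm[of j j0] a J(1)[of j0] by (cases "j < j0") auto
    next
      fix j assume "j < j0"
      then obtain i where i: "j0 = Suc i" "j \<le> i" by (cases j0) auto
      then show "J j" using Jm[of i j] a J(1)[of i] by auto
    qed
  next
    assume "\<forall>j. J j \<longleftrightarrow> j < j0"
    then show "e \<in> (lift u y ^^ j0) ` V \<and> e \<notin> (lift u y ^^ Suc j0) ` V"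
      using J(1)[of j0] J(1)[of "j0 - 1"] e0 by (cases j0) (auto simp del: funpow.simps)
  qed
  have R: "lift u y \<in> ranked V B r \<longleftrightarrow> y \<in> ranked W B (drop_rank r j0)" if JJ: "\<forall>j. J j \<longleftrightarrow> j < j0"
  proof -
    have c: "card ((lift u y ^^ j) ` V) = (if j \<le> j0 then (card K)\<^sup>2 else 1) * card ((y ^^ j) ` W)" for j
    proof (cases j)
      case 0
      then show ?thesis using H(4) by simp
    next
      case (Suc i)
      then show ?thesis using J(2)[of i] JJ by (auto simp: less_eq_Suc_le simp del: funpow.simps)
    qed
    have "card ((lift u y ^^ j) ` V) = card K ^ r j \<longleftrightarrow> card ((y ^^ j) ` W) = card K ^ drop_rank r j0 j" for j
    proof (cases "j \<le> j0")
      case True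
      then have "card K ^ r j = (card K)\<^sup>2 * card K ^ (r j - 2)"
        using r[OF True] by (metis le_add_diff_inverse power_add)
      then show ?thesis unfolding c drop_rank_def using True card_K_ge_2 by simp
    qed (simp add: c drop_rank_def)
    then show ?thesis unfolding ranked_def using L y by simp
  qed
  have "lift u y \<in> ranked V B r \<and> e \<in> (lift u y ^^ j0) ` V \<and> e \<notin> (lift u y ^^ Suc j0) ` V \<longleftrightarrow>
    y \<in> ranked W B (drop_rank r j0) \<and> (\<forall>j. J j \<longleftrightarrow> j < j0)"
    using E R by argo
  then show ?thesis unfolding J_def .
qed

lemma card_lifts:
  assumes r: "\<And>j. j \<le> j0 \<Longrightarrow> 2 \<le> r j"
  shows "int (card {x \<in> ranked V B r. x e = 0 \<and> e \<in> (x ^^ j0) ` V \<and> e \<notin> (x ^^ Suc j0) ` V}) =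
    int (card (ranked W B (drop_rank r j0))) * switch_count (card K) (drop_rank r j0) j0"
proof -
  let ?r = "drop_rank r j0"
  let ?S = "Sigma (ranked W B ?r) (\<lambda>y. {u \<in> W. \<forall>j. (y ^^ j) u \<notin> (y ^^ Suc j) ` W \<longleftrightarrow> j < j0})"
  let ?T = "{x \<in> ranked V B r. x e = 0 \<and> e \<in> (x ^^ j0) ` V \<and> e \<notin> (x ^^ Suc j0) ` V}"
  have LR: "lift u y \<in> ranked V B r \<and> e \<in> (lift u y ^^ j0) ` V \<and> e \<notin> (lift u y ^^ Suc j0) ` V \<longleftrightarrow>
    y \<in> ranked W B ?r \<and> (\<forall>j. (y ^^ j) u \<notin> (y ^^ Suc j) ` W \<longleftrightarrow> j < j0)"
    if "u \<in> W" "y \<in> alt_endos W B" for u y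
    by (rule lift_ranked_iff[OF that]) (rule r)
  have "bij_betw (\<lambda>(y, u). lift u y) ?S ?T"
  proof (rule bij_betw_byWitness[where f' = "\<lambda>x. (red x, x f)"])
    show "\<forall>p\<in>?S. (\<lambda>x. (red x, x f)) ((\<lambda>(y, u). lift u y) p) = p"
      using lift_alt unfolding ranked_def by auto
    show "\<forall>x\<in>?T. (\<lambda>(y, u). lift u y) ((\<lambda>x. (red x, x f)) x) = x"
      using lift_red unfolding ranked_def by auto
    show "(\<lambda>(y, u). lift u y) ` ?S \<subseteq> ?T"
    proof clarify
      fix y u assume a: "y \<in> ranked W B ?r" "u \<in> W" "\<forall>j. (y ^^ j) u \<notin> (y ^^ Suc j) ` W \<longleftrightarrow> j < j0"
      then have y: "y \<in> alt_endos W B" unfolding ranked_def by auto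
      show "lift u y \<in> ranked V B r \<and> lift u y e = 0 \<and> e \<in> (lift u y ^^ j0) ` V \<and> e \<notin> (lift u y ^^ Suc j0) ` V"
        using LR[OF a(2) y] a(1,3) lift_alt(2)[OF a(2) y] by argo
    qed
    show "(\<lambda>x. (red x, x f)) ` ?T \<subseteq> ?S"
    proof
      fix p assume "p \<in> (\<lambda>x. (red x, x f)) ` ?T"
      then obtain x where x: "x \<in> ?T" "p = (red x, x f)" by blast
      then have a: "x \<in> alt_endos V B" "x e = 0" unfolding ranked_def by auto
      note L = lift_red[OF a]
      have "red x \<in> ranked W B ?r \<and> (\<forall>j. (red x ^^ j) (x f) \<notin> (red x ^^ Suc j) ` W \<longleftrightarrow> j < j0)"
        using LR[OF L(1,2)] x(1) unfolding L(3) mem_Collect_eq by argo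
      then show "p \<in> ?S" unfolding x(2) using L(1) by blast
    qed
  qed
  then have "card ?T = card ?S" by (simp add: bij_betw_same_card)
  also have "\<dots> = (\<Sum>y\<in>ranked W B ?r. card {u \<in> W. \<forall>j. (y ^^ j) u \<notin> (y ^^ Suc j) ` W \<longleftrightarrow> j < j0})"
    by (rule card_SigmaI) (use finite_ranked[OF H(1)] ksubD(1)[OF H(1)] in auto)
  finally have "int (card ?T) = (\<Sum>y\<in>ranked W B ?r. int (card {u \<in> W. \<forall>j. (y ^^ j) u \<notin> (y ^^ Suc j) ` W \<longleftrightarrow> j < j0}))"
    by simp
  also have "\<dots> = (\<Sum>y\<in>ranked W B ?r. switch_count (card K) ?r j0)"
    by (rule sum.cong[OF refl card_switch[OF H(1)]])
  finally show ?thesis by simp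
qed

end

context kspace
begin

text \<open>Pairs of an operator \<open>x\<close> with the given ranks and of a kernel vector \<open>e\<close> lying in the image of \<open>x ^^ j0\<close> and not in the image of the next power are counted in two ways. For fixed \<open>x\<close> their number is a difference of two powers of the field size. For fixed \<open>e\<close> the operators are the lifts of operators on a space that is smaller by a hyperbolic plane, with the ranks lowered by two up to \<open>j0\<close>.\<close>

lemma card_ranked_step:
  assumes V: "ksub V" and B: "altform V B" and nd: "nondegenerate V B"
    and r: "\<And>j. j \<le> j0 \<Longrightarrow> 2 \<le> r j"
    and IH: "\<And>W. ksub W \<Longrightarrow> altform W B \<Longrightarrow> nondegenerate W B \<Longrightarrow> card V = (card K)\<^sup>2 * card W \<Longrightarrow>
        int (card (ranked W B (drop_rank r j0))) * D = E"
  shows "int (card (ranked V B r)) * height_count (card K) r j0 * D =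
    (int (card V) - 1) * switch_count (card K) (drop_rank r j0) j0 * E"
proof -
  let ?P = "\<lambda>x e. x e = 0 \<and> e \<in> (x ^^ j0) ` V \<and> e \<notin> (x ^^ Suc j0) ` V"
  have finR: "finite (ranked V B r)" by (rule finite_ranked[OF V])
  have finV: "finite V" by (rule ksubD(1)[OF V])
  have per_e: "int (card {x \<in> ranked V B r. ?P x e}) * D =
      switch_count (card K) (drop_rank r j0) j0 * E" if ee: "e \<in> V - {0}" for e
  proof -
    obtain w where w: "w \<in> V" "B e w \<noteq> 0" using nd ee unfolding nondegenerate_def by blast
    obtain f where f: "f \<in> V" "B e f = 1" using hyperbolic_pair_exists[OF V B _ w] ee by blast
    interpret hyperbolic_plane scale K V B e f by unfold_locales (use V B nd ee f in auto)
    have "int (card (ranked W B (drop_rank r j0))) * D = E"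
      by (rule IH[OF H(1) BW ndW H(4)])
    then show ?thesis using card_lifts[of j0 r, OF r] by (simp add: mult.assoc mult.left_commute)
  qed
  have "(\<Sum>x\<in>ranked V B r. card {e \<in> V - {0}. ?P x e}) = (\<Sum>e\<in>V - {0}. card {x \<in> ranked V B r. ?P x e})"
    by (rule sum_multicount_gen[symmetric]) (use finR finV in auto)
  then have "(\<Sum>x\<in>ranked V B r. int (card {e \<in> V - {0}. ?P x e})) = (\<Sum>e\<in>V - {0}. int (card {x \<in> ranked V B r. ?P x e}))"
    by (metis (mono_tags, lifting) of_nat_sum sum.cong)
  moreover have "int (card {e \<in> V - {0}. ?P x e}) = height_count (card K) r j0" if x: "x \<in> ranked V B r" for x
  proof -
    have xl: "klin V x" using x unfolding ranked_def alt_endos_def by auto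
    have "0 \<in> (x ^^ Suc j0) ` V" by (rule ksubD(2)[OF ksub_image[OF klin_pow[OF xl] V order_refl V]])
    then have "{e \<in> V - {0}. ?P x e} = {e \<in> V. ?P x e}" by blast
    then show ?thesis using card_height[OF V x] by simp
  qed
  ultimately have "int (card (ranked V B r)) * height_count (card K) r j0 = (\<Sum>e\<in>V - {0}. int (card {x \<in> ranked V B r. ?P x e}))"
    by simp
  then have "int (card (ranked V B r)) * height_count (card K) r j0 * D =
      (\<Sum>e\<in>V - {0}. int (card {x \<in> ranked V B r. ?P x e}) * D)" by (simp add: sum_distrib_right)
  also have "\<dots> = (\<Sum>e\<in>V - {0}. switch_count (card K) (drop_rank r j0) j0 * E)"
    by (rule sum.cong[OF refl per_e])
  also have "\<dots> = int (card (V - {0})) * (switch_count (card K) (drop_rank r j0) j0 * E)" by simp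
  also have "int (card (V - {0})) = int (card V) - 1"
    using ksubD(1,2)[OF V] card_Diff_singleton[of 0 V] card_gt_0_iff[of V] by (auto simp: of_nat_diff)
  finally show ?thesis by simp
qed

end

section \<open>Counting operators of a given Jordan type\<close>

lemma partition_support:
  assumes "is_partition \<pi>"
  shows "{i. \<pi> i \<noteq> 0} = {..<plen \<pi>}"
proof -
  have fin: "finite {i. \<pi> i \<noteq> 0}" and am: "\<And>i j. i \<le> j \<Longrightarrow> \<pi> j \<le> \<pi> i"
    using assms unfolding is_partition_def by (auto dest: antimonoD)
  have dc: "j \<in> {i. \<pi> i \<noteq> 0} \<Longrightarrow> i \<le> j \<Longrightarrow> i \<in> {i. \<pi> i \<noteq> 0}" for i j using am[of i j] by auto
  obtain N where N: "\<pi> N = 0" using fin by (metis (mono_tags, lifting) UNIV_I finite_subset infinite_UNIV_nat mem_Collect_eq subsetI)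
  define L where "L = (LEAST N. \<pi> N = 0)"
  have "\<pi> L = 0" unfolding L_def using N by (rule LeastI)
  then have "{i. \<pi> i \<noteq> 0} = {..<L}"
    using am[of L] not_less_Least[of _ "\<lambda>N. \<pi> N = 0"] unfolding L_def[symmetric] by (force simp: not_less[symmetric])
  then show ?thesis unfolding plen_def by simp
qed

lemma partition_pos_iff: "is_partition \<pi> \<Longrightarrow> \<pi> i \<noteq> 0 \<longleftrightarrow> i < plen \<pi>"
  using partition_support[of \<pi>] by (metis (mono_tags, lifting) lessThan_iff mem_Collect_eq)

lemma partition_antimono: "is_partition \<pi> \<Longrightarrow> i \<le> j \<Longrightarrow> \<pi> j \<le> \<pi> i"
  unfolding is_partition_def by (auto dest: antimonoD)

lemma is_partitionI:
  assumes "\<And>i. \<pi> (Suc i) \<le> \<pi> i" "\<And>i. i \<ge> N \<Longrightarrow> \<pi> i = 0"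
  shows "is_partition \<pi>"
  unfolding is_partition_def
proof
  show "antimono \<pi>" by (rule antimonoI) (metis assms(1) lift_Suc_antimono_le)
  have "{i. \<pi> i \<noteq> 0} \<subseteq> {..<N}" using assms(2) by (force simp: not_le)
  then show "finite {i. \<pi> i \<noteq> 0}" by (rule finite_subset) simp
qed

lemma psize_partition: "is_partition \<pi> \<Longrightarrow> psize \<pi> = (\<Sum>i<plen \<pi>. \<pi> i)"
  unfolding psize_def by (simp only: partition_support)

text \<open>The rank of the power \<open>j\<close> of a nilpotent operator of Jordan type \<open>\<pi>\<close>.\<close>

definition boxes_beyond :: "part \<Rightarrow> nat \<Rightarrow> nat" where
  "boxes_beyond \<pi> j = (\<Sum>i<plen \<pi>. \<pi> i - j)"

lemma sum_beyond_plen: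
  assumes "is_partition \<pi>" "plen \<pi> \<le> N" "f 0 = (0::nat)"
  shows "(\<Sum>i<plen \<pi>. f (\<pi> i)) = (\<Sum>i<N. f (\<pi> i))"
proof (rule sum.mono_neutral_left)
  show "\<forall>i\<in>{..<N} - {..<plen \<pi>}. f (\<pi> i) = 0"
  proof
    fix i assume "i \<in> {..<N} - {..<plen \<pi>}"
    then have "\<pi> i = 0" using partition_pos_iff[OF assms(1), of i] by simp
    then show "f (\<pi> i) = 0" using assms(3) by simp
  qed
qed (use assms(2) in auto)

text \<open>Removing a box from the last nonempty row corresponds to reducing along a kernel vector of the height of a shortest Jordan block.\<close>

definition shrink :: "part \<Rightarrow> part" where
  "shrink \<pi> = \<pi>(plen \<pi> - 1 := \<pi> (plen \<pi> - 1) - 1)"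

lemma shrink_facts:
  assumes \<pi>: "is_partition \<pi>" and n: "psize \<pi> = Suc n"
  defines "j0 \<equiv> \<pi> (plen \<pi> - 1) - 1"
  shows "is_partition (shrink \<pi>)" "psize (shrink \<pi>) = n"
    "(\<lambda>j. 2 * boxes_beyond (shrink \<pi>) j) = drop_rank (\<lambda>j. 2 * boxes_beyond \<pi> j) j0"
    "\<And>j. j \<le> j0 \<Longrightarrow> 2 \<le> 2 * boxes_beyond \<pi> j"
    "boxes_beyond \<pi> (Suc j0) - boxes_beyond \<pi> (Suc (Suc j0)) < boxes_beyond \<pi> j0 - boxes_beyond \<pi> (Suc j0)"
proof -
  let ?l = "plen \<pi>" and ?\<sigma> = "shrink \<pi>"
  have l: "?l > 0"
  proof (rule ccontr)
    assume "\<not> ?l > 0"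
    then have "psize \<pi> = 0" using psize_partition[OF \<pi>] by simp
    then show False using n by simp
  qed
  define m where "m = ?l - 1"
  have lm: "?l = Suc m" using l m_def by simp
  have s1: "\<pi> m > 0" using partition_pos_iff[OF \<pi>, of m] lm by simp
  have j0: "\<pi> m = Suc j0" unfolding j0_def m_def[symmetric] using s1 by simp
  have \<sigma>: "?\<sigma> i = (if i = m then j0 else \<pi> i)" for i
    unfolding shrink_def m_def[symmetric] using j0 by simp
  have z: "\<pi> i = 0" if "i \<ge> Suc m" for i using partition_pos_iff[OF \<pi>, of i] that lm by simp
  show P: "is_partition ?\<sigma>"
  proof (rule is_partitionI)
    fix i show "?\<sigma> (Suc i) \<le> ?\<sigma> i"
      using partition_antimono[OF \<pi>, of i "Suc i"] z[of "Suc i"] j0 unfolding \<sigma> by auto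
    assume "i \<ge> Suc m" then show "?\<sigma> i = 0" using z unfolding \<sigma> by auto
  qed
  have "{i. ?\<sigma> i \<noteq> 0} \<subseteq> {i. \<pi> i \<noteq> 0}" unfolding \<sigma> using j0 by auto
  then have pl: "plen ?\<sigma> \<le> Suc m"
    unfolding plen_def[of ?\<sigma>] partition_support[OF \<pi>] lm using card_mono[OF finite_lessThan] by fastforce
  have eqm: "(\<Sum>i<m. f (?\<sigma> i)) = (\<Sum>i<m. f (\<pi> i))" for f :: "nat \<Rightarrow> nat"
    by (rule sum.cong) (auto simp: \<sigma>)
  have "psize ?\<sigma> = (\<Sum>i<Suc m. ?\<sigma> i)"
    using psize_partition[OF P] sum_beyond_plen[OF P pl, of "\<lambda>x. x"] by simp
  moreover have "psize \<pi> = (\<Sum>i<Suc m. \<pi> i)" using psize_partition[OF \<pi>] lm by simp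
  ultimately show "psize ?\<sigma> = n" using n eqm[of "\<lambda>x. x"] j0 by (simp add: \<sigma>)
  define a where "a j = (\<Sum>i<m. \<pi> i - j)" for j
  have b\<pi>: "boxes_beyond \<pi> j = a j + (Suc j0 - j)" for j
    unfolding boxes_beyond_def a_def lm using j0 by simp
  have b\<sigma>: "boxes_beyond ?\<sigma> j = a j + (j0 - j)" for j
    unfolding boxes_beyond_def a_def using sum_beyond_plen[OF P pl, of "\<lambda>x. x - j"] eqm[of "\<lambda>x. x - j"] by (simp add: \<sigma>)
  show "(\<lambda>j. 2 * boxes_beyond ?\<sigma> j) = drop_rank (\<lambda>j. 2 * boxes_beyond \<pi> j) j0"
    unfolding drop_rank_def b\<pi> b\<sigma> by (auto simp: fun_eq_iff)
  show "2 \<le> 2 * boxes_beyond \<pi> j" if "j \<le> j0" for j using that unfolding b\<pi> by simp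
  have "a j0 = (\<Sum>i<m. (\<pi> i - Suc j0) + 1)" unfolding a_def
  proof (rule sum.cong[OF refl])
    fix i assume "i \<in> {..<m}"
    then have "Suc j0 \<le> \<pi> i" using partition_antimono[OF \<pi>, of i m] j0 by simp
    then show "\<pi> i - j0 = (\<pi> i - Suc j0) + 1" by simp
  qed
  then have "a j0 = a (Suc j0) + m" unfolding a_def by (simp only: sum.distrib) simp
  moreover have "a (Suc j0) \<le> (\<Sum>i<m. (\<pi> i - Suc (Suc j0)) + 1)" unfolding a_def by (rule sum_mono) auto
  then have "a (Suc j0) \<le> a (Suc (Suc j0)) + m" unfolding a_def by (simp only: sum.distrib) simp
  ultimately show "boxes_beyond \<pi> (Suc j0) - boxes_beyond \<pi> (Suc (Suc j0)) < boxes_beyond \<pi> j0 - boxes_beyond \<pi> (Suc j0)"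
    unfolding b\<pi> by simp
qed

definition switch_poly :: "(nat \<Rightarrow> nat) \<Rightarrow> nat \<Rightarrow> int poly" where
  "switch_poly r j0 = monom 1 (r (Suc j0) + r 0 - r j0) -
     (if j0 = 0 then 0 else monom 1 (r j0 + r 0 - r (j0 - 1)))"

definition height_poly :: "(nat \<Rightarrow> nat) \<Rightarrow> nat \<Rightarrow> int poly" where
  "height_poly r j0 = monom 1 (r j0 - r (Suc j0)) - monom 1 (r (Suc j0) - r (Suc (Suc j0)))"

abbreviation "last_col \<pi> \<equiv> \<pi> (plen \<pi> - 1) - (1::nat)"

abbreviation "drank \<pi> \<equiv> (\<lambda>j. 2 * boxes_beyond \<pi> j)"

primrec type_denominator :: "nat \<Rightarrow> part \<Rightarrow> int poly" where
  "type_denominator 0 \<pi> = 1"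
| "type_denominator (Suc n) \<pi> = height_poly (drank \<pi>) (last_col \<pi>) * type_denominator n (shrink \<pi>)"

primrec type_numerator :: "nat \<Rightarrow> part \<Rightarrow> int poly" where
  "type_numerator 0 \<pi> = 1"
| "type_numerator (Suc n) \<pi> = (monom 1 (2 * Suc n) - 1) *
     switch_poly (drop_rank (drank \<pi>) (last_col \<pi>)) (last_col \<pi>) * type_numerator n (shrink \<pi>)"

lemma poly_switch: "poly (switch_poly r j0) (int q) = switch_count q r j0"
  unfolding switch_poly_def switch_count_def by (simp add: poly_monom)

lemma poly_height: "poly (height_poly r j0) (int q) = height_count q r j0"
  unfolding height_poly_def height_count_def by (simp add: poly_monom)

lemma type_denominator_pos:
  assumes "is_partition \<pi>" "psize \<pi> = n" "q \<ge> 2"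
  shows "poly (type_denominator n \<pi>) (int q) > 0"
  using assms(1,2)
proof (induction n arbitrary: \<pi>)
  case (Suc n)
  note S = shrink_facts[OF Suc(2,3)]
  have "int q ^ (drank \<pi> (Suc (last_col \<pi>)) - drank \<pi> (Suc (Suc (last_col \<pi>)))) < int q ^ (drank \<pi> (last_col \<pi>) - drank \<pi> (Suc (last_col \<pi>)))"
  proof (rule power_strict_increasing)
    show "drank \<pi> (Suc (last_col \<pi>)) - drank \<pi> (Suc (Suc (last_col \<pi>))) < drank \<pi> (last_col \<pi>) - drank \<pi> (Suc (last_col \<pi>))"
      using S(5) by linarith
  qed (use assms(3) in simp)
  then have "height_count q (drank \<pi>) (last_col \<pi>) > 0" unfolding height_count_def by simp
  then show ?case using Suc.IH[OF S(1,2)] by (simp add: poly_height)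
qed simp

context kspace
begin

text \<open>The double count along the shortest blocks expresses the number of operators by the one for a partition with one box less. It is a quotient of two integer polynomials in the size of the field, which do not depend on the field; the denominator is kept on the left since nothing here shows that it divides the numerator.\<close>

theorem card_ranked:
  assumes "ksub V" "altform V B" "nondegenerate V B" "card V = card K ^ (2 * n)"
    and "is_partition \<pi>" "psize \<pi> = n"
  shows "int (card (ranked V B (drank \<pi>))) * poly (type_denominator n \<pi>) (int (card K)) =
    poly (type_numerator n \<pi>) (int (card K))"
  using assms
proof (induction n arbitrary: V \<pi>)
  case 0
  have pi0: "\<pi> i = 0" for i
    using 0(5,6) unfolding psize_def is_partition_def by (metis (mono_tags, lifting) mem_Collect_eq sum_eq_0_iff)
  have V0: "V = {0}" using 0(4) ksubD(2)[OF 0(1)] by (metis card_1_singletonE mult_0_right power_0 singletonD)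
  have "ranked V B (drank \<pi>) = {\<lambda>_. 0}"
  proof (intro equalityI subsetI)
    fix x assume "x \<in> ranked V B (drank \<pi>)"
    then have "x v = 0" for v unfolding ranked_def alt_endos_def klin_def V0 by (cases "v = 0") auto
    then show "x \<in> {\<lambda>_. 0}" by auto
  next
    fix x :: "'b \<Rightarrow> 'b" assume "x \<in> {\<lambda>_. 0}"
    then have x: "x = (\<lambda>_. 0)" by simp
    have "(x ^^ j) 0 = 0" for j by (induction j) (simp_all add: x)
    moreover have "boxes_beyond \<pi> j = 0" for j unfolding boxes_beyond_def using pi0 by simp
    moreover have "B 0 0 = 0" using altformD(6)[OF 0(2)] V0 by auto
    ultimately show "x \<in> ranked V B (drank \<pi>)"
      unfolding ranked_def alt_endos_def klin_def V0 by (auto simp: x)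
  qed
  then show ?case by simp
next
  case (Suc n)
  note S = shrink_facts[OF Suc(6,7)]
  let ?q = "card K" and ?j = "last_col \<pi>"
  have "int (card (ranked V B (drank \<pi>))) * height_count ?q (drank \<pi>) ?j * poly (type_denominator n (shrink \<pi>)) (int ?q) =
    (int (card V) - 1) * switch_count ?q (drop_rank (drank \<pi>) ?j) ?j * poly (type_numerator n (shrink \<pi>)) (int ?q)"
  proof (rule card_ranked_step[OF Suc(2,3,4)])
    show "2 \<le> drank \<pi> j" if "j \<le> ?j" for j using S(4) that .
    fix W assume W: "ksub W" "altform W B" "nondegenerate W B" "card V = ?q\<^sup>2 * card W"
    have "?q\<^sup>2 * card W = ?q\<^sup>2 * ?q ^ (2 * n)" using W(4) Suc(5) by (simp flip: power_add)
    then have "card W = ?q ^ (2 * n)" using card_K_ge_2 by simp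
    then show "int (card (ranked W B (drop_rank (drank \<pi>) ?j))) * poly (type_denominator n (shrink \<pi>)) (int ?q) =
         poly (type_numerator n (shrink \<pi>)) (int ?q)"
      using Suc.IH[OF W(1-3) _ S(1,2)] unfolding S(3) by simp
  qed
  then show ?case using Suc(5) by (simp add: poly_height poly_switch poly_monom mult.assoc)
qed

end

section \<open>Rational Jordan bases\<close>

definition sc :: "'a::field \<Rightarrow> (nat \<Rightarrow> 'a) \<Rightarrow> nat \<Rightarrow> 'a" where
  "sc c f = (\<lambda>i. c * f i)"

lemma vector_space_sc: "vector_space (sc :: 'a::field \<Rightarrow> _)"
  by unfold_locales (auto simp: sc_def fun_eq_iff algebra_simps)

lemma sum_apply: "(\<Sum>i\<in>A. F i) j = (\<Sum>i\<in>A. F i j)"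
  by (induction A rule: infinite_finite_induct) auto

definition alin :: "((nat \<Rightarrow> 'a::field) \<Rightarrow> (nat \<Rightarrow> 'a)) \<Rightarrow> bool" where
  "alin X \<longleftrightarrow> (\<forall>f g. X (f + g) = X f + X g) \<and> (\<forall>c f. X (sc c f) = sc c (X f))"

definition afun :: "((nat \<Rightarrow> 'a::field) \<Rightarrow> 'a) \<Rightarrow> bool" where
  "afun \<psi> \<longleftrightarrow> (\<forall>f g. \<psi> (f + g) = \<psi> f + \<psi> g) \<and> (\<forall>c f. \<psi> (sc c f) = c * \<psi> f)"

interpretation sc: vector_space "sc :: 'a::field \<Rightarrow> _" by (rule vector_space_sc)

lemma sc_if: "sc (if P then 1 else 0) v = (if P then v else 0)"
  by simp

lemma alinD:
  assumes "alin X"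
  shows "X (f + g) = X f + X g" "X (sc c f) = sc c (X f)" "X 0 = 0" "X (- f) = - X f" "X (f - g) = X f - X g"
proof -
  show *: "X (f + g) = X f + X g" "X (sc c f) = sc c (X f)" for f g c using assms unfolding alin_def by auto
  show z: "X 0 = 0" using *(2)[of 0 0] by simp
  show m: "X (- f) = - X f" for f using *(2)[of "-1" f] by simp
  show "X (f - g) = X f - X g" using *(1)[of f "-g"] m by simp
qed

lemma afunD:
  assumes "afun X"
  shows "X (f + g) = X f + X g" "X (sc c f) = c * X f" "X 0 = 0" "X (- f) = - X f" "X (f - g) = X f - X g"
proof -
  show *: "X (f + g) = X f + X g" "X (sc c f) = c * X f" for f g c using assms unfolding afun_def by auto
  show z: "X 0 = 0" using *(2)[of 0 0] by simp
  show m: "X (- f) = - X f" for f using *(2)[of "-1" f] by simp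
  show "X (f - g) = X f - X g" using *(1)[of f "-g"] m by simp
qed

lemma alin_sum:
  assumes "alin X"
  shows "X (\<Sum>i\<in>A. F i) = (\<Sum>i\<in>A. X (F i))"
proof (induction A rule: infinite_finite_induct)
  case (insert a A)
  then show ?case by (simp only: sum.insert alinD(1)[OF assms] simp_thms)
qed (simp_all only: sum.infinite sum.empty alinD(3)[OF assms] simp_thms)

lemma afun_sum:
  assumes "afun X"
  shows "X (\<Sum>i\<in>A. F i) = (\<Sum>i\<in>A. X (F i))"
proof (induction A rule: infinite_finite_induct)
  case (insert a A)
  then show ?case by (simp only: sum.insert afunD(1)[OF assms] simp_thms)
qed (simp_all only: sum.infinite sum.empty afunD(3)[OF assms] simp_thms)

lemma alin_pow: "alin X \<Longrightarrow> alin (X ^^ j)"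
  by (induction j) (simp_all add: alin_def)

lemma afun_comp: "afun \<psi> \<Longrightarrow> alin X \<Longrightarrow> afun (\<lambda>f. \<psi> (X f))"
  unfolding afun_def alin_def by simp

definition uvec :: "nat \<Rightarrow> nat \<Rightarrow> 'a::field" where
  "uvec i = (\<lambda>j. if j = i then 1 else 0)"

definition VA :: "nat \<Rightarrow> (nat \<Rightarrow> 'a::field) set" where
  "VA M = {f. \<forall>i\<ge>M. f i = 0}"

lemma VA_expand: "f \<in> VA M \<Longrightarrow> f = (\<Sum>i<M. sc (f i) (uvec i))"
  unfolding VA_def sc_def uvec_def by (auto simp: fun_eq_iff sum_apply if_distrib not_less cong: if_cong)

lemma alin_eqI:
  assumes "alin X" "alin Y" "f \<in> VA M" "\<And>i. i < M \<Longrightarrow> X (uvec i) = Y (uvec i)"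
  shows "X f = Y f"
  by (subst (1 2) VA_expand[OF assms(3)]) (simp add: alinD[OF assms(1)] alinD[OF assms(2)] alin_sum[OF assms(1)] alin_sum[OF assms(2)] assms(4))

lemma afun_eqI:
  assumes "afun X" "afun Y" "f \<in> VA M" "\<And>i. i < M \<Longrightarrow> X (uvec i) = Y (uvec i)"
  shows "X f = Y f"
  by (subst (1 2) VA_expand[OF assms(3)]) (simp add: afunD[OF assms(1)] afunD[OF assms(2)] afun_sum[OF assms(1)] afun_sum[OF assms(2)] assms(4))

locale coord_space = finite_subfield K for K :: "'a::field set" +
  fixes M :: nat
begin

sublocale kspace sc K
  by unfold_locales

definition VK :: "(nat \<Rightarrow> 'a) set" where
  "VK = {f. (\<forall>i<M. f i \<in> K) \<and> (\<forall>i\<ge>M. f i = 0)}"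

lemma VK_VA: "f \<in> VK \<Longrightarrow> f \<in> VA M" unfolding VK_def VA_def by auto

lemma uvec_VK: "i < M \<Longrightarrow> uvec i \<in> VK" unfolding VK_def uvec_def by auto

lemma ksub_VK: "ksub VK" unfolding ksub_def
proof (intro conjI ballI)
  show "finite VK" unfolding VK_def
    by (rule finite_subset[OF _ finite_set_of_finite_funs[of "{..<M}" K 0]]) (use finite_K in auto)
qed (auto simp: VK_def sc_def)

lemma card_VK: "card VK = card K ^ M"
proof -
  have "bij_betw (\<lambda>f. \<lambda>i. if i < M then f i else 0) ({..<M} \<rightarrow>\<^sub>E K) VK"
    by (rule bij_betw_byWitness[where f' = "\<lambda>f. restrict f {..<M}"])
      (auto simp: VK_def fun_eq_iff PiE_def extensional_def Pi_def)
  then have "card VK = card ({..<M} \<rightarrow>\<^sub>E K)" by (simp add: bij_betw_same_card)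
  then show ?thesis by (simp add: card_PiE)
qed

definition ratop :: "((nat \<Rightarrow> 'a) \<Rightarrow> (nat \<Rightarrow> 'a)) \<Rightarrow> bool" where
  "ratop X \<longleftrightarrow> alin X \<and> (\<forall>f\<in>VK. X f \<in> VK)"

definition ratfun :: "((nat \<Rightarrow> 'a) \<Rightarrow> 'a) \<Rightarrow> bool" where
  "ratfun \<psi> \<longleftrightarrow> afun \<psi> \<and> (\<forall>f\<in>VK. \<psi> f \<in> K)"

lemma ratop_pow: "ratop X \<Longrightarrow> ratop (X ^^ j)"
proof -
  assume X: "ratop X"
  have "f \<in> VK \<Longrightarrow> (X ^^ j) f \<in> VK" for f using X unfolding ratop_def by (induction j) auto
  then show "ratop (X ^^ j)" using X alin_pow unfolding ratop_def by blast
qed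

lemma ratop_klin: "ratop X \<Longrightarrow> klin VK X"
  unfolding ratop_def klin_def by (auto simp: alinD)

lemma ratfun_comp: "ratfun \<psi> \<Longrightarrow> ratop X \<Longrightarrow> ratfun (\<lambda>f. \<psi> (X f))"
  unfolding ratfun_def ratop_def using afun_comp by auto

lemma ratop_VA: "ratop X \<Longrightarrow> f \<in> VA M \<Longrightarrow> X f \<in> VA M"
proof -
  assume X: "ratop X" and f: "f \<in> VA M"
  have a: "alin X" using X unfolding ratop_def by simp
  have "X f = (\<Sum>i<M. sc (f i) (X (uvec i)))" by (subst VA_expand[OF f]) (simp add: alinD[OF a] alin_sum[OF a])
  moreover have "X (uvec i) \<in> VA M" if "i < M" for i using X uvec_VK[OF that] VK_VA unfolding ratop_def by blast
  ultimately show "X f \<in> VA M" unfolding VA_def by (simp add: sum_apply sc_def)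
qed

lemma adjust_functional:
  assumes X: "ratop X" and L: "L > 0" "(X ^^ L) e = 0" and \<phi>: "ratfun \<phi>" "\<phi> ((X ^^ (L - 1)) e) = 1" and e: "e \<in> VK"
  shows "\<exists>\<psi>. ratfun \<psi> \<and> (\<forall>b. \<psi> ((X ^^ b) e) = (if Suc b = L then 1 else 0))"
proof -
  have lin: "alin (X ^^ j)" for j using X alin_pow unfolding ratop_def by auto
  have z: "(X ^^ b) e = 0" if "b \<ge> L" for b
  proof -
    have "(X ^^ b) e = (X ^^ (b - L)) ((X ^^ L) e)" using that by (metis comp_apply funpow_add le_add_diff_inverse2)
    then show ?thesis using L(2) alinD(3)[OF lin] by simp
  qed
  have "\<exists>\<psi>. ratfun \<psi> \<and> \<psi> ((X ^^ (L - 1)) e) = 1 \<and> (\<forall>b. L - 1 - d \<le> b \<longrightarrow> b \<noteq> L - 1 \<longrightarrow> \<psi> ((X ^^ b) e) = 0)" for d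
  proof (induction d)
    case 0
    have "\<phi> ((X ^^ b) e) = 0" if "L - 1 \<le> b" "b \<noteq> L - 1" for b
      using z[of b] that L(1) afunD(3)[of \<phi>] \<phi>(1) unfolding ratfun_def by simp
    then show ?case using \<phi> by auto
  next
    case (Suc d)
    then obtain \<psi> where \<psi>: "ratfun \<psi>" "\<psi> ((X ^^ (L - 1)) e) = 1" "\<And>b. L - 1 - d \<le> b \<Longrightarrow> b \<noteq> L - 1 \<Longrightarrow> \<psi> ((X ^^ b) e) = 0"
      by blast
    have a: "afun \<psi>" using \<psi>(1) unfolding ratfun_def by simp
    show ?case
    proof (cases "Suc d \<le> L - 1")
      case False
      then show ?thesis using \<psi> by (intro exI[of _ \<psi>]) auto
    next
      case True
      define c where "c = \<psi> ((X ^^ (L - 1 - Suc d)) e)"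
      have eK: "(X ^^ b) e \<in> VK" for b using ratop_pow[OF X] e unfolding ratop_def by blast
      have cK: "c \<in> K" unfolding c_def using \<psi>(1) eK unfolding ratfun_def by blast
      define \<psi>' where "\<psi>' f = \<psi> f - c * \<psi> ((X ^^ Suc d) f)" for f
      have s: "(X ^^ Suc d) ((X ^^ b) e) = (X ^^ (Suc d + b)) e" for b by (simp only: funpow_add o_apply)
      have r2: "ratfun (\<lambda>f. \<psi> ((X ^^ Suc d) f))" by (rule ratfun_comp[OF \<psi>(1) ratop_pow[OF X]])
      have "ratfun \<psi>'"
        using \<psi>(1) r2 cK unfolding ratfun_def afun_def \<psi>'_def by (simp del: funpow.simps add: algebra_simps)
      moreover have "\<psi>' ((X ^^ (L - 1)) e) = 1"
        unfolding \<psi>'_def s using z[of "Suc d + (L - 1)"] \<psi>(2) L(1) afunD(3)[OF a] by simp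
      moreover have "\<psi>' ((X ^^ b) e) = 0" if b: "L - 1 - Suc d \<le> b" "b \<noteq> L - 1" for b
      proof (cases "b = L - 1 - Suc d")
        case True2: True
        have "Suc d + b = L - 1" using True True2 by simp
        then have "\<psi>' ((X ^^ b) e) = \<psi> ((X ^^ b) e) - c" unfolding \<psi>'_def s using \<psi>(2) by simp
        then show ?thesis unfolding c_def True2 by simp
      next
        case False
        then have "L - 1 - d \<le> b" "Suc d + b \<ge> L" using b True by auto
        then show ?thesis unfolding \<psi>'_def s using \<psi>(3)[of b] z[of "Suc d + b"] b(2) afunD(3)[OF a] by simp
      qed
      ultimately show ?thesis by blast
    qed
  qed
  from this[of L] obtain \<psi> where \<psi>: "ratfun \<psi>" "\<psi> ((X ^^ (L - 1)) e) = 1" "\<And>b. b \<noteq> L - 1 \<Longrightarrow> \<psi> ((X ^^ b) e) = 0"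
    by auto
  then show ?thesis using L(1) by (intro exI[of _ \<psi>]) auto
qed

definition chains :: "((nat \<Rightarrow> 'a) \<Rightarrow> (nat \<Rightarrow> 'a)) \<Rightarrow> nat \<Rightarrow> (nat \<Rightarrow> nat \<Rightarrow> 'a) \<Rightarrow> (nat \<Rightarrow> nat) \<Rightarrow> (nat \<Rightarrow> (nat \<Rightarrow> 'a) \<Rightarrow> 'a) \<Rightarrow> bool" where
  "chains X N e L \<psi> \<longleftrightarrow>
    (\<forall>k<N. e k \<in> VK \<and> 0 < L k \<and> (X ^^ L k) (e k) = 0 \<and> ratfun (\<psi> k) \<and> (\<forall>f\<in>VK. \<psi> k ((X ^^ L k) f) = 0)) \<and>
    (\<forall>k<N. \<forall>l<N. \<forall>b. \<psi> k ((X ^^ b) (e l)) = (if k = l \<and> Suc b = L k then 1 else 0))"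

definition chain_part :: "((nat \<Rightarrow> 'a) \<Rightarrow> (nat \<Rightarrow> 'a)) \<Rightarrow> nat \<Rightarrow> (nat \<Rightarrow> nat \<Rightarrow> 'a) \<Rightarrow> (nat \<Rightarrow> nat) \<Rightarrow> (nat \<Rightarrow> (nat \<Rightarrow> 'a) \<Rightarrow> 'a) \<Rightarrow> (nat \<Rightarrow> 'a) \<Rightarrow> (nat \<Rightarrow> 'a)" where
  "chain_part X N e L \<psi> f = (\<Sum>k<N. \<Sum>a<L k. sc (\<psi> k ((X ^^ (L k - 1 - a)) f)) ((X ^^ a) (e k)))"

definition unseen :: "((nat \<Rightarrow> 'a) \<Rightarrow> (nat \<Rightarrow> 'a)) \<Rightarrow> nat \<Rightarrow> (nat \<Rightarrow> (nat \<Rightarrow> 'a) \<Rightarrow> 'a) \<Rightarrow> (nat \<Rightarrow> 'a) set" where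
  "unseen X N \<psi> = {f \<in> VK. \<forall>k<N. \<forall>b. \<psi> k ((X ^^ b) f) = 0}"

lemma chains_pow_zero:
  assumes X: "ratop X" and c: "chains X N e L \<psi>" and k: "k < N" "b \<ge> L k"
  shows "(X ^^ b) (e k) = 0" "f \<in> VK \<Longrightarrow> \<psi> k ((X ^^ b) f) = 0"
proof -
  have b: "b = (b - L k) + L k" "b = L k + (b - L k)" using k by auto
  have "(X ^^ b) (e k) = (X ^^ (b - L k)) ((X ^^ L k) (e k))" using b(1) by (metis comp_apply funpow_add)
  then show "(X ^^ b) (e k) = 0"
    using c k(1) alinD(3)[OF alin_pow, of X] X unfolding chains_def ratop_def by simp
  assume f: "f \<in> VK"
  have "(X ^^ b) f = (X ^^ L k) ((X ^^ (b - L k)) f)" using b(2) by (metis comp_apply funpow_add)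
  moreover have "(X ^^ (b - L k)) f \<in> VK" using ratop_pow[OF X] f unfolding ratop_def by blast
  ultimately show "\<psi> k ((X ^^ b) f) = 0" using c k(1) unfolding chains_def by simp
qed

lemma chain_part_ratop:
  assumes X: "ratop X" and c: "chains X N e L \<psi>"
  shows "ratop (chain_part X N e L \<psi>)"
proof -
  have lin: "alin (X ^^ j)" for j using X alin_pow unfolding ratop_def by auto
  have \<psi>: "ratfun (\<psi> k)" "e k \<in> VK" if "k < N" for k using c that unfolding chains_def by auto
  have a: "afun (\<psi> k)" if "k < N" for k using \<psi>[OF that] unfolding ratfun_def by auto
  have XK: "f \<in> VK \<Longrightarrow> (X ^^ j) f \<in> VK" for f j using ratop_pow[OF X] unfolding ratop_def by blast
  show ?thesis unfolding ratop_def alin_def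
  proof (intro conjI allI ballI)
    show "chain_part X N e L \<psi> (f + g) = chain_part X N e L \<psi> f + chain_part X N e L \<psi> g" for f g
      unfolding chain_part_def by (simp add: alinD(1)[OF lin] afunD(1)[OF a] sc.scale_left_distrib sum.distrib)
    show "chain_part X N e L \<psi> (sc c f) = sc c (chain_part X N e L \<psi> f)" for c f
      unfolding chain_part_def by (simp add: alinD(2)[OF lin] afunD(2)[OF a] sc.scale_sum_right)
    fix f assume f: "f \<in> VK"
    have t: "sc (\<psi> k ((X ^^ (L k - 1 - j)) f)) ((X ^^ j) (e k)) \<in> VK" if "k < N" for k j
      using ksubD(4)[OF ksub_VK] \<psi>[OF that] XK f unfolding ratfun_def by blast
    have s: "(\<Sum>i\<in>A. F i) \<in> VK" if "\<And>i. i \<in> A \<Longrightarrow> F i \<in> VK" for A :: "nat set" and F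
      using that by (induction A rule: infinite_finite_induct) (auto intro: ksubD[OF ksub_VK])
    show "chain_part X N e L \<psi> f \<in> VK" unfolding chain_part_def using t by (intro s) auto
  qed
qed

lemma chain_part_chain:
  assumes X: "ratop X" and c: "chains X N e L \<psi>" and l: "l < N"
  shows "chain_part X N e L \<psi> ((X ^^ b) (e l)) = (X ^^ b) (e l)"
proof -
  have d: "\<psi> k ((X ^^ (L k - 1 - a)) ((X ^^ b) (e l))) = (if k = l \<and> a = b then 1 else 0)" if "k < N" "a < L k" for k a
  proof -
    have "(X ^^ (L k - 1 - a)) ((X ^^ b) (e l)) = (X ^^ (L k - 1 - a + b)) (e l)" by (simp only: funpow_add o_apply)
    then have "\<psi> k ((X ^^ (L k - 1 - a)) ((X ^^ b) (e l))) = (if k = l \<and> Suc (L k - 1 - a + b) = L k then 1 else 0)"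
      using c that l unfolding chains_def by simp
    moreover have "Suc (L k - 1 - a + b) = L k \<longleftrightarrow> a = b" using that by auto
    ultimately show ?thesis by simp
  qed
  have "chain_part X N e L \<psi> ((X ^^ b) (e l)) = (\<Sum>k<N. \<Sum>a<L k. sc (if k = l \<and> a = b then 1 else 0) ((X ^^ a) (e k)))"
    unfolding chain_part_def by (intro sum.cong refl) (use d in auto)
  also have "\<dots> = (\<Sum>k<N. if k = l then (\<Sum>a<L k. if a = b then (X ^^ a) (e k) else 0) else 0)"
    unfolding sc_if by (intro sum.cong refl) (simp cong: if_cong)
  also have "\<dots> = (\<Sum>a<L l. if a = b then (X ^^ a) (e l) else 0)" using l by simp
  also have "\<dots> = (X ^^ b) (e l)"
    using chains_pow_zero(1)[OF X c l, of b] by simp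
  finally show ?thesis .
qed

lemma chain_part_dual:
  assumes X: "ratop X" and c: "chains X N e L \<psi>" and k: "k < N" and f: "f \<in> VK"
  shows "\<psi> k ((X ^^ b) (chain_part X N e L \<psi> f)) = \<psi> k ((X ^^ b) f)"
proof -
  have lin: "alin (X ^^ j)" for j using X alin_pow unfolding ratop_def by auto
  have a: "afun (\<psi> k)" using c k unfolding chains_def ratfun_def by auto
  have d: "\<psi> k ((X ^^ b) ((X ^^ j) (e l))) = (if k = l \<and> Suc (b + j) = L k then 1 else 0)" if "l < N" for l j
    using c k that unfolding chains_def by (simp add: funpow_add[symmetric, unfolded o_def fun_eq_iff])
  have "\<psi> k ((X ^^ b) (chain_part X N e L \<psi> f)) =
     (\<Sum>l<N. \<Sum>j<L l. \<psi> l ((X ^^ (L l - 1 - j)) f) * (if k = l \<and> Suc (b + j) = L k then 1 else 0))"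
    unfolding chain_part_def by (simp add: alinD(2)[OF lin] alin_sum[OF lin] afunD(2)[OF a] afun_sum[OF a] d)
  also have "\<dots> = (\<Sum>l<N. if l = k then (\<Sum>j<L l. if Suc (b + j) = L k then \<psi> l ((X ^^ (L l - 1 - j)) f) else 0) else 0)"
    by (intro sum.cong refl) (auto intro!: sum.cong)
  also have "\<dots> = (\<Sum>j<L k. if Suc (b + j) = L k then \<psi> k ((X ^^ (L k - 1 - j)) f) else 0)" using k by simp
  also have "\<dots> = \<psi> k ((X ^^ b) f)"
  proof (cases "b < L k")
    case True
    have "(\<Sum>j<L k. if Suc (b + j) = L k then \<psi> k ((X ^^ (L k - 1 - j)) f) else 0) =
      (\<Sum>j<L k. if j = L k - 1 - b then \<psi> k ((X ^^ b) f) else 0)"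
      using True by (intro sum.cong refl) auto
    then show ?thesis using True by simp
  next
    case False
    then show ?thesis using chains_pow_zero(2)[OF X c k _ f, of b] by simp
  qed
  finally show ?thesis .
qed

lemma chain_part_unseen: "f \<in> unseen X N \<psi> \<Longrightarrow> chain_part X N e L \<psi> f = 0"
  unfolding unseen_def chain_part_def by simp

lemma unseen_pow:
  assumes "ratop X" "f \<in> unseen X N \<psi>"
  shows "(X ^^ j) f \<in> unseen X N \<psi>"
  using assms(2) ratop_pow[OF assms(1), of j] unfolding unseen_def ratop_def
  by (auto simp: funpow_add[symmetric, unfolded o_def fun_eq_iff])

lemma residue_unseen:
  assumes X: "ratop X" and c: "chains X N e L \<psi>" and f: "f \<in> VK"
  shows "f - chain_part X N e L \<psi> f \<in> unseen X N \<psi>"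
proof -
  have lin: "alin (X ^^ j)" for j using X alin_pow unfolding ratop_def by auto
  have a: "afun (\<psi> k)" if "k < N" for k using c that unfolding chains_def ratfun_def by auto
  have "chain_part X N e L \<psi> f \<in> VK" using chain_part_ratop[OF X c] f unfolding ratop_def by blast
  then show ?thesis unfolding unseen_def
    using ksubD(6)[OF ksub_VK f] chain_part_dual[OF X c _ f] by (simp add: alinD(5)[OF lin] afunD(5)[OF a])
qed

lemma chains_extend:
  assumes X: "ratop X" and nil: "\<And>f. f \<in> VK \<Longrightarrow> (X ^^ m) f = 0" and c: "chains X N e L \<psi>"
    and ne: "unseen X N \<psi> \<noteq> {0}"
  shows "\<exists>e' L' \<psi>'. chains X (Suc N) e' L' \<psi>' \<and> unseen X (Suc N) \<psi>' \<subset> unseen X N \<psi>"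
proof -
  let ?C = "unseen X N \<psi>"
  have lin: "alin (X ^^ j)" for j using X alin_pow unfolding ratop_def by auto
  have a: "afun (\<psi> k)" if "k < N" for k using c that unfolding chains_def ratfun_def by auto
  have CV: "?C \<subseteq> VK" unfolding unseen_def by auto
  define R where "R f = f - chain_part X N e L \<psi> f" for f
  have Rr: "ratop R" using chain_part_ratop[OF X c] ksubD(6)[OF ksub_VK] unfolding ratop_def alin_def R_def
    by (auto simp: sc.scale_right_diff_distrib)
  have RC: "f \<in> ?C \<Longrightarrow> R f = f" for f unfolding R_def using chain_part_unseen by simp
  have R_in: "f \<in> VK \<Longrightarrow> R f \<in> ?C" for f unfolding R_def by (rule residue_unseen[OF X c])
  have R_chain: "l < N \<Longrightarrow> R ((X ^^ b) (e l)) = 0" for l b unfolding R_def using chain_part_chain[OF X c] by simp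
  have Ra: "alin R" using Rr unfolding ratop_def by simp
  have R_pow: "R ((X ^^ j) f) = (X ^^ j) (R f)" if f: "f \<in> VK" for j f
  proof -
    have "R ((X ^^ j) (chain_part X N e L \<psi> f)) = 0"
      unfolding chain_part_def
      by (simp add: alinD(2)[OF lin] alin_sum[OF lin] alinD(2)[OF Ra] alin_sum[OF Ra] funpow_add[symmetric, unfolded o_def fun_eq_iff] R_chain)
    moreover have "R ((X ^^ j) (R f)) = (X ^^ j) (R f)" by (rule RC[OF unseen_pow[OF X R_in[OF f]]])
    moreover have "(X ^^ j) f = (X ^^ j) (R f) + (X ^^ j) (chain_part X N e L \<psi> f)"
      unfolding R_def by (simp flip: alinD(1)[OF lin])
    ultimately show ?thesis by (simp add: alinD(1)[OF Ra])
  qed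
  define l where "l = (LEAST l. \<forall>f\<in>?C. (X ^^ l) f = 0)"
  have lP: "\<forall>f\<in>?C. (X ^^ l) f = 0" unfolding l_def by (rule LeastI[of _ m]) (use nil CV in auto)
  have "0 \<in> ?C" unfolding unseen_def using ksubD(2)[OF ksub_VK] by (simp add: alinD(3)[OF lin] afunD(3)[OF a])
  then obtain w where w: "w \<in> ?C" "w \<noteq> 0" using ne by auto
  have l0: "l > 0" using lP w by (cases l) auto
  have "\<not> (\<forall>f\<in>?C. (X ^^ (l - 1)) f = 0)" using not_less_Least[of "l - 1" "\<lambda>l. \<forall>f\<in>?C. (X ^^ l) f = 0"] l0 unfolding l_def[symmetric] by simp
  then obtain e0 where e0: "e0 \<in> ?C" "(X ^^ (l - 1)) e0 \<noteq> 0" by auto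
  have e0K: "e0 \<in> VK" "(X ^^ (l - 1)) e0 \<in> VK" using e0 CV ratop_pow[OF X] unfolding ratop_def by blast+
  obtain i where i: "(X ^^ (l - 1)) e0 i \<noteq> 0" using e0(2) by (auto simp: fun_eq_iff)
  then have iM: "i < M" using e0K(2) unfolding VK_def by (auto simp: not_le[symmetric])
  have "ratfun (\<lambda>f. f i / (X ^^ (l - 1)) e0 i)"
    using e0K(2) iM unfolding ratfun_def afun_def VK_def sc_def by (auto simp: add_divide_distrib)
  from adjust_functional[OF X l0 _ this _ e0K(1)] lP e0(1) i
  obtain \<psi>0 where \<psi>0: "ratfun \<psi>0" "\<And>b. \<psi>0 ((X ^^ b) e0) = (if Suc b = l then 1 else 0)" by auto
  define e' where "e' = e(N := e0)"
  define L' where "L' = L(N := l)"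
  define \<psi>' where "\<psi>' = \<psi>(N := (\<lambda>f. \<psi>0 (R f)))"
  have a0: "afun \<psi>0" using \<psi>0(1) unfolding ratfun_def by simp
  have old: "e' k = e k" "L' k = L k" "\<psi>' k = \<psi> k" if "k < N" for k
    unfolding e'_def L'_def \<psi>'_def using that by auto
  have new: "e' N = e0" "L' N = l" "\<psi>' N = (\<lambda>f. \<psi>0 (R f))" unfolding e'_def L'_def \<psi>'_def by auto
  have "chains X (Suc N) e' L' \<psi>'" unfolding chains_def
  proof (intro conjI allI impI ballI)
    fix k assume k: "k < Suc N"
    have kk: "e' k \<in> VK \<and> 0 < L' k \<and> (X ^^ L' k) (e' k) = 0 \<and> ratfun (\<psi>' k) \<and> (\<forall>f\<in>VK. \<psi>' k ((X ^^ L' k) f) = 0)"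
    proof (cases "k = N")
      case False
      then show ?thesis using c k old[of k] unfolding chains_def by simp
    next
      case True
      have "\<psi>0 (R ((X ^^ l) f)) = 0" if "f \<in> VK" for f
        using R_pow[OF that, of l] lP R_in[OF that] afunD(3)[OF a0] by simp
      then show ?thesis unfolding True new using e0K l0 lP e0 ratfun_comp[OF \<psi>0(1) Rr] by blast
    qed
    then show "e' k \<in> VK" "0 < L' k" "(X ^^ L' k) (e' k) = 0" "ratfun (\<psi>' k)" "\<And>f. f \<in> VK \<Longrightarrow> \<psi>' k ((X ^^ L' k) f) = 0" by auto
    fix j b assume j: "j < Suc N"
    have RR: "R ((X ^^ b) e0) = (X ^^ b) e0" by (rule RC[OF unseen_pow[OF X e0(1)]])
    consider "k < N" "j < N" | "k < N" "j = N" | "k = N" "j < N" | "k = N" "j = N" using k j by linarith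
    then show "\<psi>' k ((X ^^ b) (e' j)) = (if k = j \<and> Suc b = L' k then 1 else 0)"
    proof cases
      case 1
      then show ?thesis using c old unfolding chains_def by simp
    next
      case 2
      then show ?thesis using e0(1) unfolding old(3)[OF 2(1)] 2(2) new unseen_def by simp
    next
      case 3
      then show ?thesis using R_chain[OF 3(2)] afunD(3)[OF a0] unfolding 3(1) new old[OF 3(2)] by simp
    next
      case 4
      then show ?thesis unfolding 4 new RR \<psi>0(2) by simp
    qed
  qed
  moreover have "unseen X (Suc N) \<psi>' \<subset> ?C"
  proof
    show "unseen X (Suc N) \<psi>' \<subseteq> ?C"
    proof
      fix f assume f: "f \<in> unseen X (Suc N) \<psi>'"
      have "\<psi> k ((X ^^ b) f) = 0" if "k < N" for k b
      proof -
        have "\<psi>' k ((X ^^ b) f) = 0" using f that unfolding unseen_def by simp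
        then show ?thesis using old(3)[OF that] by simp
      qed
      then show "f \<in> ?C" using f unfolding unseen_def by simp
    qed
    have "\<psi>' N ((X ^^ (l - 1)) e0) = 1"
      unfolding new using RC[OF unseen_pow[OF X e0(1), of "l - 1"]] \<psi>0(2)[of "l - 1"] l0 by simp
    moreover have "\<psi>' N ((X ^^ (l - 1)) e0) = 0" if "e0 \<in> unseen X (Suc N) \<psi>'"
      using that unfolding unseen_def by (simp del: One_nat_def)
    ultimately have "e0 \<notin> unseen X (Suc N) \<psi>'" by (metis zero_neq_one)
    then show "unseen X (Suc N) \<psi>' \<noteq> ?C" using e0(1) by blast
  qed
  ultimately show ?thesis by blast
qed

text \<open>A vector of maximal order in the part that the chains do not see yet spans a new chain. A functional that is one on the last vector of this chain can be corrected to be dual to the whole chain, and its kernel conditions split the chain off. All choices are made over \<open>K\<close>, so the chains are rational.\<close>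

theorem rational_jordan_basis:
  assumes X: "ratop X" and nil: "\<And>f. f \<in> VK \<Longrightarrow> (X ^^ m) f = 0"
  shows "\<exists>N e L \<psi>. chains X N e L \<psi> \<and> (\<forall>f\<in>VA M. chain_part X N e L \<psi> f = f)"
proof -
  have "\<exists>N e L \<psi>. chains X N e L \<psi> \<and> unseen X N \<psi> = {0}" if "chains X N e L \<psi>" for N e L \<psi>
    using that
  proof (induction "card (unseen X N \<psi>)" arbitrary: N e L \<psi> rule: less_induct)
    case less
    show ?case
    proof (cases "unseen X N \<psi> = {0}")
      case False
      obtain e' L' \<psi>' where n: "chains X (Suc N) e' L' \<psi>'" "unseen X (Suc N) \<psi>' \<subset> unseen X N \<psi>"
        using chains_extend[OF X nil less(2) False] by blast
      have "finite (unseen X N \<psi>)" unfolding unseen_def using ksubD(1)[OF ksub_VK] by simp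
      then show ?thesis using less(1)[OF psubset_card_mono[OF _ n(2)] n(1)] by blast
    qed (use less(2) in blast)
  qed
  moreover have "chains X 0 (\<lambda>_. 0) (\<lambda>_. 0) (\<lambda>_ _. 0)" unfolding chains_def by simp
  ultimately obtain N e L \<psi> where c: "chains X N e L \<psi>" "unseen X N \<psi> = {0}" by blast
  have K: "chain_part X N e L \<psi> f = f" if "f \<in> VK" for f
    using residue_unseen[OF X c(1) that] c(2) by simp
  have "chain_part X N e L \<psi> f = f" if f: "f \<in> VA M" for f
  proof -
    have "chain_part X N e L \<psi> f = (\<lambda>f. f) f"
      by (rule alin_eqI[OF _ _ f]) (use chain_part_ratop[OF X c(1)] K uvec_VK in \<open>auto simp: ratop_def alin_def\<close>)
    then show ?thesis .
  qed
  then show ?thesis using c(1) by blast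
qed

end

section \<open>Coordinates along a Jordan basis\<close>

text \<open>The functionals \<open>\<psi> k\<close> read off the last coordinate of each chain; composing with powers of \<open>X\<close> gives all coordinates. They are rational and linear over the whole field, so kernels and images are cut out by the same coordinates over \<open>K\<close> and over the algebraically closed field.\<close>

locale jordan_coords = coord_space K M for K :: "'a::field set" and M +
  fixes X :: "(nat \<Rightarrow> 'a) \<Rightarrow> (nat \<Rightarrow> 'a)" and N :: nat and e :: "nat \<Rightarrow> nat \<Rightarrow> 'a"
    and L :: "nat \<Rightarrow> nat" and \<psi> :: "nat \<Rightarrow> (nat \<Rightarrow> 'a) \<Rightarrow> 'a"
  assumes X: "ratop X" and chains: "chains X N e L \<psi>"
    and full: "f \<in> VA M \<Longrightarrow> chain_part X N e L \<psi> f = f"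
begin

definition crd :: "nat \<Rightarrow> nat \<Rightarrow> (nat \<Rightarrow> 'a) \<Rightarrow> 'a" where
  "crd k a f = \<psi> k ((X ^^ (L k - 1 - a)) f)"

definition comb :: "(nat \<Rightarrow> nat \<Rightarrow> 'a) \<Rightarrow> (nat \<Rightarrow> 'a)" where
  "comb \<gamma> = (\<Sum>k<N. \<Sum>a<L k. sc (\<gamma> k a) ((X ^^ a) (e k)))"

lemma lin: "alin (X ^^ j)" and \<psi>_afun: "k < N \<Longrightarrow> afun (\<psi> k)" and e_VK: "k < N \<Longrightarrow> e k \<in> VK"
  and \<psi>_ratfun: "k < N \<Longrightarrow> ratfun (\<psi> k)" and L_pos: "k < N \<Longrightarrow> 0 < L k"
  and pow_VK: "f \<in> VK \<Longrightarrow> (X ^^ j) f \<in> VK" and pow_VA: "f \<in> VA M \<Longrightarrow> (X ^^ j) f \<in> VA M"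
  using X alin_pow chains ratop_pow[OF X] ratop_VA[OF ratop_pow[OF X]] unfolding ratop_def chains_def ratfun_def by auto

lemma pow_e_VK: "k < N \<Longrightarrow> (X ^^ a) (e k) \<in> VK"
  using pow_VK e_VK by auto

lemma pow_e_zero: "k < N \<Longrightarrow> L k \<le> b \<Longrightarrow> (X ^^ b) (e k) = 0"
  using chains_pow_zero(1)[OF X chains] by auto

lemma afun_\<psi>_pow: "k < N \<Longrightarrow> afun (\<lambda>f. \<psi> k ((X ^^ b) f))"
  by (rule afun_comp[OF \<psi>_afun lin])

lemma \<psi>_pow_zero:
  assumes k: "k < N" "L k \<le> b" and f: "f \<in> VA M"
  shows "\<psi> k ((X ^^ b) f) = 0"
proof -
  have "afun (\<lambda>_. 0)" unfolding afun_def by simp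
  from afun_eqI[OF afun_\<psi>_pow[OF k(1)] this f] show ?thesis
    using chains_pow_zero(2)[OF X chains k] uvec_VK by auto
qed

lemma crd_afun: "k < N \<Longrightarrow> afun (crd k a)"
  unfolding crd_def[abs_def] by (rule afun_\<psi>_pow)

lemma crd_K: "k < N \<Longrightarrow> f \<in> VK \<Longrightarrow> crd k a f \<in> K"
  unfolding crd_def using \<psi>_ratfun pow_VK unfolding ratfun_def by auto

lemma expand: "f \<in> VA M \<Longrightarrow> comb (\<lambda>k a. crd k a f) = f"
  using full unfolding comb_def chain_part_def crd_def by simp

lemma crd_basis:
  assumes "k < N" "l < N" "a < L k"
  shows "crd k a ((X ^^ b) (e l)) = (if k = l \<and> a = b then 1 else 0)"
proof -
  have "(X ^^ (L k - 1 - a)) ((X ^^ b) (e l)) = (X ^^ (L k - 1 - a + b)) (e l)" by (simp only: funpow_add o_apply)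
  then have "crd k a ((X ^^ b) (e l)) = (if k = l \<and> Suc (L k - 1 - a + b) = L k then 1 else 0)"
    using chains assms unfolding chains_def crd_def by simp
  moreover have "Suc (L k - 1 - a + b) = L k \<longleftrightarrow> a = b" using assms(3) by auto
  ultimately show ?thesis by simp
qed

lemma crd_comb:
  assumes "k < N" "a < L k"
  shows "crd k a (comb \<gamma>) = \<gamma> k a"
proof -
  note A = crd_afun[OF assms(1), of a]
  have "crd k a (comb \<gamma>) = (\<Sum>l<N. \<Sum>b<L l. \<gamma> l b * (if k = l \<and> a = b then 1 else 0))"
    unfolding comb_def afun_sum[OF A] afunD(2)[OF A]
    by (intro sum.cong refl) (simp add: crd_basis[OF assms(1) _ assms(2)])
  also have "\<dots> = (\<Sum>l<N. \<Sum>b<L l. if k = l \<and> a = b then \<gamma> l b else 0)"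
    by (intro sum.cong refl) simp
  also have "\<dots> = (\<Sum>l<N. if k = l then (\<Sum>b<L l. if a = b then \<gamma> l b else 0) else 0)"
    by (intro sum.cong refl) (simp cong: if_cong)
  also have "\<dots> = \<gamma> k a" using assms by simp
  finally show ?thesis .
qed

lemma VK_sum: "(\<And>i. i \<in> A \<Longrightarrow> F i \<in> VK) \<Longrightarrow> (\<Sum>i\<in>A. F i) \<in> VK"
proof (induction A rule: infinite_finite_induct)
  case (insert a A)
  then have "F a + sum F A \<in> VK" using ksubD(3)[OF ksub_VK] by blast
  then show ?case using insert(1,2) by (simp only: sum.insert simp_thms)
qed (use ksubD(2)[OF ksub_VK] in \<open>simp_all only: sum.infinite sum.empty simp_thms\<close>)

lemma comb_VK: "(\<And>k a. k < N \<Longrightarrow> a < L k \<Longrightarrow> \<gamma> k a \<in> K) \<Longrightarrow> comb \<gamma> \<in> VK"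
  unfolding comb_def by (intro VK_sum ksubD(4)[OF ksub_VK] pow_e_VK) auto

lemma comb_VA: "comb \<gamma> \<in> VA M"
proof -
  have "(X ^^ a) (e k) i = 0" if "k < N" "i \<ge> M" for a k i using pow_e_VK[OF that(1)] that(2) unfolding VK_def by auto
  then show ?thesis unfolding comb_def VA_def by (simp add: sum_apply sc_def)
qed

lemma crd_ext:
  assumes "f \<in> VA M" "g \<in> VA M" "\<And>k a. k < N \<Longrightarrow> a < L k \<Longrightarrow> crd k a f = crd k a g"
  shows "f = g"
proof -
  have "comb (\<lambda>k a. crd k a f) = comb (\<lambda>k a. crd k a g)" unfolding comb_def by (intro sum.cong refl) (use assms(3) in auto)
  then show ?thesis using expand assms by simp
qed

lemma crd_zero: "k < N \<Longrightarrow> crd k a 0 = 0"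
  by (rule afunD(3)[OF crd_afun])

lemma zero_VA: "0 \<in> VA M" unfolding VA_def by simp

lemma crd_pow:
  assumes "k < N" "a < L k" "f \<in> VA M"
  shows "crd k a ((X ^^ j) f) = (if j \<le> a then crd k (a - j) f else 0)"
proof -
  have "(X ^^ (L k - 1 - a)) ((X ^^ j) f) = (X ^^ (L k - 1 - a + j)) f" by (simp only: funpow_add o_apply)
  then have c: "crd k a ((X ^^ j) f) = \<psi> k ((X ^^ (L k - 1 - a + j)) f)" unfolding crd_def by simp
  show ?thesis
  proof (cases "j \<le> a")
    case True
    then have "L k - 1 - a + j = L k - 1 - (a - j)" using assms(2) by simp
    then show ?thesis using c True unfolding crd_def by simp
  next
    case False
    then show ?thesis using c \<psi>_pow_zero[OF assms(1) _ assms(3), of "L k - 1 - a + j"] assms(2) by simp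
  qed
qed

lemma kernel_iff:
  assumes f: "f \<in> VA M"
  shows "(X ^^ j) f = 0 \<longleftrightarrow> (\<forall>k<N. \<forall>a. a + j < L k \<longrightarrow> crd k a f = 0)"
proof
  assume z: "(X ^^ j) f = 0"
  show "\<forall>k<N. \<forall>a. a + j < L k \<longrightarrow> crd k a f = 0"
  proof (intro allI impI)
    fix k a assume "k < N" "a + j < L k"
    then show "crd k a f = 0" using crd_pow[of k "a + j" f j] f crd_zero[of k "a + j"] unfolding z by simp
  qed
next
  assume *: "\<forall>k<N. \<forall>a. a + j < L k \<longrightarrow> crd k a f = 0"
  show "(X ^^ j) f = 0"
  proof (rule crd_ext[OF pow_VA[OF f] zero_VA])
    fix k a assume ka: "k < N" "a < L k"
    show "crd k a ((X ^^ j) f) = crd k a 0"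
      unfolding crd_pow[OF ka f] crd_zero[OF ka(1)] using * ka by auto
  qed
qed

lemma image_iff_crd:
  assumes f: "f \<in> VA M"
  shows "f \<in> (X ^^ j) ` VA M \<longleftrightarrow> (\<forall>k<N. \<forall>a<L k. a < j \<longrightarrow> crd k a f = 0)"
    and "f \<in> VK \<Longrightarrow> f \<in> (X ^^ j) ` VK \<longleftrightarrow> (\<forall>k<N. \<forall>a<L k. a < j \<longrightarrow> crd k a f = 0)"
proof -
  let ?Z = "\<forall>k<N. \<forall>a<L k. a < j \<longrightarrow> crd k a f = 0"
  define g where "g = comb (\<lambda>k a. if a + j < L k then crd k (a + j) f else 0)"
  have gf: "(X ^^ j) g = f" if ?Z
  proof (rule crd_ext[OF pow_VA f])
    show "g \<in> VA M" unfolding g_def by (rule comb_VA)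
    fix k a assume ka: "k < N" "a < L k"
    show "crd k a ((X ^^ j) g) = crd k a f"
      unfolding crd_pow[OF ka \<open>g \<in> VA M\<close>] using that ka crd_comb[OF ka(1), of "a - j"] unfolding g_def by auto
  qed
  have imp: "?Z" if im: "f \<in> (X ^^ j) ` VA M"
  proof (intro allI impI)
    obtain h where h: "h \<in> VA M" "f = (X ^^ j) h" using im by auto
    fix k a assume "k < N" "a < L k" "a < j"
    then show "crd k a f = 0" unfolding h(2) using crd_pow[of k a h j] h(1) by simp
  qed
  show "f \<in> (X ^^ j) ` VA M \<longleftrightarrow> ?Z"
  proof
    assume ?Z
    moreover have "g \<in> VA M" unfolding g_def by (rule comb_VA)
    ultimately show "f \<in> (X ^^ j) ` VA M" using gf by (metis imageI)
  qed (rule imp)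
  assume fK: "f \<in> VK"
  show "f \<in> (X ^^ j) ` VK \<longleftrightarrow> ?Z"
  proof
    assume "f \<in> (X ^^ j) ` VK" then show ?Z using imp VK_VA by blast
  next
    assume z: ?Z
    have "g \<in> VK" unfolding g_def by (rule comb_VK) (use crd_K fK in auto)
    then show "f \<in> (X ^^ j) ` VK" using gf[OF z] by (metis imageI)
  qed
qed

lemma reach_iff:
  assumes f: "f \<in> VA M"
  shows "(X ^^ j) f \<in> (X ^^ m) ` VA M \<longleftrightarrow> (\<forall>k<N. \<forall>a. a + j < m \<and> a + j < L k \<longrightarrow> crd k a f = 0)"
proof -
  have "(X ^^ j) f \<in> (X ^^ m) ` VA M \<longleftrightarrow> (\<forall>k<N. \<forall>a<L k. a < m \<longrightarrow> crd k a ((X ^^ j) f) = 0)"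
    by (rule image_iff_crd(1)[OF pow_VA[OF f]])
  also have "\<dots> \<longleftrightarrow> (\<forall>k<N. \<forall>a. a + j < m \<and> a + j < L k \<longrightarrow> crd k a f = 0)"
  proof (intro iffI allI impI)
    fix k a assume *: "\<forall>k<N. \<forall>a<L k. a < m \<longrightarrow> crd k a ((X ^^ j) f) = 0" "k < N" "a + j < m \<and> a + j < L k"
    then show "crd k a f = 0" using crd_pow[of k "a + j" f j] f by auto
  next
    fix k a assume *: "\<forall>k<N. \<forall>a. a + j < m \<and> a + j < L k \<longrightarrow> crd k a f = 0" "k < N" "a < L k" "a < m"
    show "crd k a ((X ^^ j) f) = 0"
      unfolding crd_pow[OF *(2,3) f] using *(1)[rule_format, OF *(2), of "a - j"] *(3,4) by auto
  qed
  finally show ?thesis .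
qed

text \<open>The coordinate description of an image is the same over both fields.\<close>

lemma reach_rational:
  assumes f: "f \<in> VK"
  shows "(X ^^ j) f \<in> (X ^^ m) ` VK \<longleftrightarrow> (X ^^ j) f \<in> (X ^^ m) ` VA M"
  using image_iff_crd[OF pow_VA[OF VK_VA[OF f]]] pow_VK[OF f] by simp

lemma card_coord_space:
  "card {f \<in> VK. \<forall>k<N. \<forall>a<L k. a < s k \<longrightarrow> crd k a f = 0} = card K ^ (\<Sum>k<N. L k - s k)"
proof -
  let ?I = "SIGMA k:{..<N}. {s k..<L k}"
  have "bij_betw (\<lambda>\<gamma>. comb (\<lambda>k a. if s k \<le> a then \<gamma> (k, a) else 0)) (?I \<rightarrow>\<^sub>E K) {f \<in> VK. \<forall>k<N. \<forall>a<L k. a < s k \<longrightarrow> crd k a f = 0}"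
    (is "bij_betw ?F _ ?S")
  proof (rule bij_betw_byWitness[where f' = "\<lambda>f. restrict (\<lambda>(k, a). crd k a f) ?I"])
    show "\<forall>\<gamma>\<in>?I \<rightarrow>\<^sub>E K. restrict (\<lambda>(k, a). crd k a (?F \<gamma>)) ?I = \<gamma>"
    proof
      fix \<gamma> assume g: "\<gamma> \<in> ?I \<rightarrow>\<^sub>E K"
      show "restrict (\<lambda>(k, a). crd k a (?F \<gamma>)) ?I = \<gamma>"
      proof
        fix p show "restrict (\<lambda>(k, a). crd k a (?F \<gamma>)) ?I p = \<gamma> p"
        proof (cases "p \<in> ?I")
          case False
          then show ?thesis using PiE_arb[OF g False] by simp
        qed (auto simp: crd_comb)
      qed
    qed
    show "\<forall>f\<in>?S. ?F (restrict (\<lambda>(k, a). crd k a f) ?I) = f"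
    proof
      fix f assume f: "f \<in> ?S"
      show "?F (restrict (\<lambda>(k, a). crd k a f) ?I) = f"
      proof (rule crd_ext[OF comb_VA])
        show "f \<in> VA M" using f VK_VA by auto
      qed (use f in \<open>auto simp: crd_comb\<close>)
    qed
    show "?F ` (?I \<rightarrow>\<^sub>E K) \<subseteq> ?S"
    proof
      fix g assume "g \<in> ?F ` (?I \<rightarrow>\<^sub>E K)"
      then obtain \<gamma> where \<gamma>: "\<gamma> \<in> ?I \<rightarrow>\<^sub>E K" "g = ?F \<gamma>" by auto
      have "?F \<gamma> \<in> VK" by (rule comb_VK) (use \<gamma>(1) in \<open>auto simp: PiE_def Pi_def\<close>)
      then show "g \<in> ?S" unfolding \<gamma>(2) by (auto simp: crd_comb)
    qed
    show "(\<lambda>f. restrict (\<lambda>(k, a). crd k a f) ?I) ` ?S \<subseteq> ?I \<rightarrow>\<^sub>E K"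
      using crd_K by (auto simp: PiE_def Pi_def)
  qed
  then have "card ?S = card (?I \<rightarrow>\<^sub>E K)" by (simp add: bij_betw_same_card)
  also have "\<dots> = card K ^ card ?I" by (simp add: card_PiE)
  also have "card ?I = (\<Sum>k<N. L k - s k)" by simp
  finally show ?thesis .
qed

lemma card_image_pow: "card ((X ^^ j) ` VK) = card K ^ (\<Sum>k<N. L k - j)"
proof -
  have "(X ^^ j) ` VK = {f \<in> VK. \<forall>k<N. \<forall>a<L k. a < j \<longrightarrow> crd k a f = 0}"
    using image_iff_crd(2)[OF VK_VA] pow_VK by auto
  then show ?thesis using card_coord_space[of "\<lambda>_. j"] by simp
qed

lemma sum_L: "(\<Sum>k<N. L k) = M"
proof -
  have "card K ^ (\<Sum>k<N. L k) = card K ^ M" using card_image_pow[of 0] card_VK by simp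
  moreover have "1 < card K" using card_K_ge_2 by linarith
  ultimately show ?thesis by (metis power_inject_exp)
qed

text \<open>The kernel of \<open>X ^^ j\<close> has a basis of rational vectors. The quadratic function vanishes on the basis vectors and, by polarization, its bilinear form vanishes on pairs of them, so it vanishes on all linear combinations.\<close>

lemma quadratic_vanish:
  assumes \<phi>: "\<And>f g. f \<in> VA M \<Longrightarrow> g \<in> VA M \<Longrightarrow> \<phi> (f + g) = \<phi> f + \<phi> g + \<beta> f g" "\<And>c f. f \<in> VA M \<Longrightarrow> \<phi> (sc c f) = c ^ 2 * (\<phi> f :: 'a)"
    and \<beta>: "\<And>f. f \<in> VA M \<Longrightarrow> afun (\<beta> f)" "\<And>f. f \<in> VA M \<Longrightarrow> afun (\<lambda>g. \<beta> g f)"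
    and van: "\<And>f. f \<in> VK \<Longrightarrow> (X ^^ j) f = 0 \<Longrightarrow> \<phi> f = 0"
    and f: "f \<in> VA M" "(X ^^ j) f = 0"
  shows "\<phi> f = 0"
proof -
  let ?I = "{(k, a). k < N \<and> a < L k \<and> L k \<le> a + j}"
  define b where "b p = (X ^^ snd p) (e (fst p))" for p
  have bK: "b p \<in> VK" "(X ^^ j) (b p) = 0" if "p \<in> ?I" for p
  proof -
    show "b p \<in> VK" unfolding b_def using that pow_e_VK by auto
    have "(X ^^ j) (b p) = (X ^^ (j + snd p)) (e (fst p))" unfolding b_def by (simp only: funpow_add o_apply)
    then show "(X ^^ j) (b p) = 0" using that pow_e_zero[of "fst p" "j + snd p"] by auto
  qed
  have bb: "\<beta> (b p) (b p') = 0" if "p \<in> ?I" "p' \<in> ?I" for p p'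
  proof -
    have "\<phi> (b p + b p') = 0" using van[OF ksubD(3)[OF ksub_VK bK(1)[OF that(1)] bK(1)[OF that(2)]]]
        bK(2)[OF that(1)] bK(2)[OF that(2)] by (simp add: alinD(1)[OF lin])
    then show ?thesis using \<phi>(1)[OF VK_VA VK_VA, OF bK(1) bK(1), OF that] van[OF bK[OF that(1)]] van[OF bK[OF that(2)]] by simp
  qed
  have fin: "finite ?I" by (rule finite_subset[of _ "SIGMA k:{..<N}. {..<L k}"]) auto
  have S: "(\<Sum>p\<in>A. sc (c p) (b p)) \<in> VA M \<and> \<phi> (\<Sum>p\<in>A. sc (c p) (b p)) = 0 \<and> (\<forall>p'\<in>?I. \<beta> (\<Sum>p\<in>A. sc (c p) (b p)) (b p') = 0)"
    if "finite A" "A \<subseteq> ?I" for A c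
    using that
  proof (induction A rule: finite_induct)
    case empty
    have "\<phi> 0 = 0" using \<phi>(2)[OF zero_VA, of 0] by simp
    moreover have "\<beta> 0 (b p') = 0" if "p' \<in> ?I" for p'
      by (rule afunD(3)[OF \<beta>(2)[OF VK_VA[OF bK(1)[OF that]]]])
    ultimately show ?case unfolding sum.empty using zero_VA by blast
  next
    case (insert p A)
    let ?s = "\<Sum>p\<in>A. sc (c p) (b p)"
    have p: "p \<in> ?I" "b p \<in> VA M" using insert(4) bK(1) VK_VA by auto
    have IH: "?s \<in> VA M" "\<phi> ?s = 0" "\<And>p'. p' \<in> ?I \<Longrightarrow> \<beta> ?s (b p') = 0" using insert by auto
    have scp: "sc (c p) (b p) \<in> VA M" using p(2) unfolding VA_def sc_def by simp
    have sum: "(\<Sum>p\<in>insert p A. sc (c p) (b p)) = ?s + sc (c p) (b p)" unfolding sum.insert[OF insert(1,2)] by (rule add.commute)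
    have "\<phi> (?s + sc (c p) (b p)) = 0"
      using \<phi>(1)[OF IH(1) scp] \<phi>(2)[OF p(2)] van[OF bK[OF p(1)]] afunD(2)[OF \<beta>(1)[OF IH(1)]] IH(2) IH(3)[OF p(1)] by simp
    moreover have "\<beta> (?s + sc (c p) (b p)) (b p') = 0" if "p' \<in> ?I" for p'
      using afunD(1,2)[OF \<beta>(2)[OF VK_VA[OF bK(1)[OF that]]]] IH(3)[OF that] bb[OF p(1) that] by simp
    moreover have "?s + sc (c p) (b p) \<in> VA M" using IH(1) scp unfolding VA_def by simp
    ultimately show ?case unfolding sum by blast
  qed
  have "f = comb (\<lambda>k a. crd k a f)" using expand[OF f(1)] by simp
  also have "\<dots> = (\<Sum>p\<in>(SIGMA k:{..<N}. {..<L k}). sc (crd (fst p) (snd p) f) (b p))"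
    unfolding comb_def b_def by (subst sum.Sigma) (auto intro!: sum.cong)
  also have "\<dots> = (\<Sum>p\<in>?I. sc (crd (fst p) (snd p) f) (b p))"
  proof (rule sum.mono_neutral_right)
    show "\<forall>p\<in>(SIGMA k:{..<N}. {..<L k}) - ?I. sc (crd (fst p) (snd p) f) (b p) = 0"
      using f(2) unfolding kernel_iff[OF f(1)] by auto
  qed auto
  finally show ?thesis using S[OF fin order_refl, of "\<lambda>p. crd (fst p) (snd p) f"] by simp
qed

end

section \<open>Matrices and their Jordan types\<close>

definition mop :: "nat \<Rightarrow> 'a::field mat \<Rightarrow> (nat \<Rightarrow> 'a) \<Rightarrow> nat \<Rightarrow> 'a" where
  "mop M x f = (\<lambda>i. if i < M then (\<Sum>j<M. x $$ (i, j) * f j) else 0)"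

definition fv :: "'a::field vec \<Rightarrow> nat \<Rightarrow> 'a" where
  "fv v = (\<lambda>i. if i < dim_vec v then v $ i else 0)"

lemma mop_alin: "alin (mop M x)"
  unfolding alin_def mop_def sc_def
  by (auto simp: fun_eq_iff algebra_simps sum.distrib sum_distrib_left)

lemma fv_mult: "x \<in> carrier_mat M M \<Longrightarrow> v \<in> carrier_vec M \<Longrightarrow> fv (x *\<^sub>v v) = mop M x (fv v)"
  unfolding fv_def mop_def by (auto simp: fun_eq_iff scalar_prod_def lessThan_atLeast0)

lemma fv_inj: "u \<in> carrier_vec M \<Longrightarrow> v \<in> carrier_vec M \<Longrightarrow> fv u = fv v \<longleftrightarrow> u = v"
  unfolding fv_def by (auto simp: fun_eq_iff intro!: eq_vecI)

lemma fv_zero: "fv (0\<^sub>v M) = 0"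
  unfolding fv_def by (simp add: fun_eq_iff)

lemma fv_eq_zero: "v \<in> carrier_vec M \<Longrightarrow> fv v = 0 \<longleftrightarrow> v = 0\<^sub>v M"
  using fv_inj[of v M "0\<^sub>v M"] by (simp add: fv_zero)

lemma fv_add: "u \<in> carrier_vec M \<Longrightarrow> v \<in> carrier_vec M \<Longrightarrow> fv (u + v) = fv u + fv v"
  unfolding fv_def by (auto simp: fun_eq_iff)

lemma fv_smult: "fv (c \<cdot>\<^sub>v v) = sc c (fv v)"
  unfolding fv_def sc_def by (auto simp: fun_eq_iff)

lemma fv_vec: "f \<in> VA M \<Longrightarrow> fv (vec M f) = f"
  unfolding fv_def VA_def by (auto simp: fun_eq_iff)

lemma fv_VA: "v \<in> carrier_vec M \<Longrightarrow> fv v \<in> VA M"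
  unfolding fv_def VA_def by auto

lemma fv_unit: "i < M \<Longrightarrow> fv (unit_vec M i) = uvec i"
  unfolding fv_def uvec_def by (auto simp: fun_eq_iff unit_vec_def)

lemma fv_pow: "x \<in> carrier_mat M M \<Longrightarrow> v \<in> carrier_vec M \<Longrightarrow> fv ((x ^\<^sub>m j) *\<^sub>v v) = (mop M x ^^ j) (fv v)"
proof (induction j arbitrary: v)
  case (Suc j)
  have "(x ^\<^sub>m Suc j) *\<^sub>v v = (x ^\<^sub>m j) *\<^sub>v (x *\<^sub>v v)"
    using Suc(2,3) by (simp add: assoc_mult_mat_vec[OF pow_carrier_mat[OF Suc(2)] Suc(2,3)])
  moreover have "x *\<^sub>v v \<in> carrier_vec M" using Suc by simp
  ultimately show ?case using Suc.IH[OF Suc(2)] fv_mult[OF Suc(2,3)] by (simp add: funpow_swap1)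
qed simp

lemma fv_nilpotent:
  assumes "x \<in> carrier_mat M M" "x ^\<^sub>m m = 0\<^sub>m M M" "f \<in> VA M"
  shows "(mop M x ^^ m) f = 0"
proof -
  have "(mop M x ^^ m) (fv (vec M f)) = fv ((x ^\<^sub>m m) *\<^sub>v vec M f)" using fv_pow[OF assms(1)] by simp
  also have "(x ^\<^sub>m m) *\<^sub>v vec M f = 0\<^sub>v M" unfolding assms(2) by (rule eq_vecI) (auto simp: scalar_prod_def)
  finally show ?thesis using fv_vec[OF assms(3)] fv_zero by metis
qed

lemma mop_uvec: "x \<in> carrier_mat M M \<Longrightarrow> r < M \<Longrightarrow> c < M \<Longrightarrow> mop M x (uvec r) c = x $$ (c, r)"
  unfolding mop_def uvec_def by (simp add: if_distrib[of "\<lambda>t. _ * t"] cong: if_cong)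

lemma (in coord_space) mop_ratop:
  assumes "x \<in> carrier_mat M M" "elements_mat x \<subseteq> K"
  shows "ratop (mop M x)"
proof -
  have e: "x $$ (i, j) \<in> K" if "i < M" "j < M" for i j using assms(2) elements_matI[OF assms(1) that refl] by blast
  show ?thesis unfolding ratop_def using mop_alin by (auto simp: VK_def mop_def intro!: K_sum K_closed(4) e)
qed

lemma (in coord_space) fv_VK: "v \<in> carrier_vec M \<Longrightarrow> fv v \<in> VK \<longleftrightarrow> vec_set v \<subseteq> K"
  unfolding VK_def fv_def by (auto simp: vec_set_def)

primrec bpos :: "nat list \<Rightarrow> nat \<Rightarrow> nat \<times> nat" where
  "bpos [] p = (0, p)"
| "bpos (n # ns) p = (if p < n then (0, p) else apfst Suc (bpos ns (p - n)))"

lemma bpos_valid: "p < sum_list ns \<Longrightarrow> fst (bpos ns p) < length ns \<and> snd (bpos ns p) < ns ! fst (bpos ns p)"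
  by (induction ns arbitrary: p) (auto simp: less_diff_conv2)

lemma bpos_inj: "p < sum_list ns \<Longrightarrow> r < sum_list ns \<Longrightarrow> bpos ns p = bpos ns r \<Longrightarrow> p = r"
proof (induction ns arbitrary: p r)
  case (Cons n ns)
  show ?case
  proof (cases "p < n \<or> r < n")
    case True
    then show ?thesis using Cons(4) by (auto split: if_splits simp: apfst_def map_prod_def split_beta)
  next
    case False
    then have "apfst Suc (bpos ns (p - n)) = apfst Suc (bpos ns (r - n))" using Cons(4) by simp
    then have "bpos ns (p - n) = bpos ns (r - n)" by (simp add: prod_eq_iff)
    then have "p - n = r - n" using Cons.IH[of "p - n" "r - n"] Cons(2,3) False by auto
    then show ?thesis using False by auto
  qed
qed simp

lemma sum_lessThan_add:
  fixes f :: "nat \<Rightarrow> 'a::comm_monoid_add"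
  shows "(\<Sum>r<n + s. f r) = (\<Sum>r<n. f r) + (\<Sum>r<s. f (n + r))"
  by (induction s) (simp_all add: add.assoc)

lemma sum_bpos:
  fixes g :: "nat \<times> nat \<Rightarrow> 'a::comm_monoid_add"
  shows "(\<Sum>r<sum_list ns. g (bpos ns r)) = (\<Sum>k<length ns. \<Sum>i<ns ! k. g (k, i))"
proof (induction ns arbitrary: g)
  case (Cons n ns)
  have "(\<Sum>r<sum_list (n # ns). g (bpos (n # ns) r)) =
     (\<Sum>r<n. g (bpos (n # ns) r)) + (\<Sum>r<sum_list ns. g (bpos (n # ns) (n + r)))"
    by (simp only: sum_list.Cons sum_lessThan_add)
  also have "\<dots> = (\<Sum>r<n. g (0, r)) + (\<Sum>r<sum_list ns. g (apfst Suc (bpos ns r)))"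
    by (intro arg_cong2[where f = plus] sum.cong refl) auto
  also have "\<dots> = (\<Sum>r<n. g (0, r)) + (\<Sum>k<length ns. \<Sum>i<ns ! k. g (Suc k, i))"
    using Cons[of "\<lambda>p. g (apfst Suc p)"] by simp
  finally show ?case by (simp add: sum.lessThan_Suc_shift del: sum.lessThan_Suc)
qed simp

lemma jordan_matrix_entry:
  "p < sum_list ns \<Longrightarrow> r < sum_list ns \<Longrightarrow>
    jordan_matrix (map (\<lambda>n. (n, 0 :: 'a::field)) ns) $$ (p, r) =
    (if fst (bpos ns p) = fst (bpos ns r) \<and> snd (bpos ns r) = Suc (snd (bpos ns p)) then 1 else 0)"
proof (induction ns arbitrary: p r)
  case (Cons n ns)
  let ?J = "jordan_matrix (map (\<lambda>n. (n, 0 :: 'a)) ns)"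
  have dim: "dim_row ?J = sum_list ns" "dim_col ?J = sum_list ns" by (simp_all add: o_def)
  have "jordan_matrix (map (\<lambda>n. (n, 0 :: 'a)) (n # ns)) =
     four_block_mat (jordan_block n 0) (0\<^sub>m n (sum_list ns)) (0\<^sub>m (sum_list ns) n) ?J"
    using dim unfolding jordan_matrix_def by (simp add: Let_def)
  then have "jordan_matrix (map (\<lambda>n. (n, 0 :: 'a)) (n # ns)) $$ (p, r) =
    (if p < n then if r < n then jordan_block n 0 $$ (p, r) else 0 else if r < n then 0 else ?J $$ (p - n, r - n))"
    using Cons(2,3) dim by (auto simp: index_mat_four_block)
  then show ?case using Cons.IH[of "p - n" "r - n"] Cons(2,3) by auto
qed simp

context jordan_coords
begin

text \<open>The vectors of the chains are the columns of the base change matrix.\<close>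

lemma jordan_nf_of_coords:
  assumes x: "x \<in> carrier_mat M M" and Xx: "X = mop M x"
  shows "jordan_nf x (map (\<lambda>k. (L k, 0)) [0..<N])"
proof -
  define ns where "ns = map L [0..<N]"
  define J where "J = jordan_matrix (map (\<lambda>n. (n, 0 :: 'a)) ns)"
  have sM: "sum_list ns = M"
    unfolding ns_def sum_L[symmetric] by (simp add: interv_sum_list_conv_sum_set_nat lessThan_atLeast0)
  have J: "J \<in> carrier_mat M M" unfolding J_def by (rule carrier_matI) (simp_all add: sM o_def)
  have valid: "fst (bpos ns r) < N \<and> snd (bpos ns r) < L (fst (bpos ns r))" if "r < M" for r
    using bpos_valid[of r ns] that sM unfolding ns_def by auto
  define col where "col p = (X ^^ (L (fst p) - 1 - snd p)) (e (fst p))" for p :: "nat \<times> nat"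
  define P where "P = mat M M (\<lambda>(c, r). col (bpos ns r) c)"
  define Q where "Q = mat M M (\<lambda>(r, c). crd (fst (bpos ns r)) (L (fst (bpos ns r)) - 1 - snd (bpos ns r)) (uvec c))"
  have P: "P \<in> carrier_mat M M" and Q: "Q \<in> carrier_mat M M" unfolding P_def Q_def by auto
  have colVA: "col (bpos ns r) \<in> VA M" if "r < M" for r
    unfolding col_def using pow_e_VK[of "fst (bpos ns r)"] valid[OF that] VK_VA by auto
  have PJ: "x * P = P * J"
  proof (rule eq_matI)
    fix c r assume cr: "c < dim_row (P * J)" "r < dim_col (P * J)"
    then have cM: "c < M" and rM: "r < M" using P J by auto
    obtain k i where ki: "bpos ns r = (k, i)" by (metis surj_pair)
    have v: "k < N" "i < L k" using valid[OF rM] ki by auto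
    have "(x * P) $$ (c, r) = (\<Sum>j<M. x $$ (c, j) * col (k, i) j)"
      using x cM rM by (simp add: P_def scalar_prod_def lessThan_atLeast0 ki)
    also have "\<dots> = X (col (k, i)) c" unfolding Xx mop_def using cM by simp
    also have "X (col (k, i)) = (X ^^ (L k - i)) (e k)"
    proof -
      have "L k - i = Suc (L k - 1 - i)" using v by simp
      then show ?thesis unfolding col_def by simp
    qed
    also have "(X ^^ (L k - i)) (e k) c = (if i = 0 then 0 else col (k, i - 1) c)"
      using pow_e_zero[OF v(1), of "L k"] v unfolding col_def by auto
    finally have 1: "(x * P) $$ (c, r) = (if i = 0 then 0 else col (k, i - 1) c)" .
    have "(P * J) $$ (c, r) = (\<Sum>p<M. col (bpos ns p) c * J $$ (p, r))"
      using J cM rM by (simp add: P_def scalar_prod_def lessThan_atLeast0)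
    also have "\<dots> = (\<Sum>p<sum_list ns. (\<lambda>(k', i'). if k' = k \<and> i = Suc i' then col (k', i') c else 0) (bpos ns p))"
      unfolding sM by (intro sum.cong refl) (use rM ki in \<open>auto simp: J_def jordan_matrix_entry sM split: prod.splits\<close>)
    also have "\<dots> = (\<Sum>k'<N. \<Sum>i'<L k'. if k' = k \<and> i = Suc i' then col (k', i') c else 0)"
      unfolding sum_bpos unfolding ns_def by simp
    also have "\<dots> = (\<Sum>k'<N. if k' = k then (\<Sum>i'<L k'. if i = Suc i' then col (k', i') c else 0) else 0)"
      by (intro sum.cong refl) (simp cong: if_cong)
    also have "\<dots> = (\<Sum>i'<L k. if i = Suc i' then col (k, i') c else 0)" using v by simp
    also have "\<dots> = (if i = 0 then 0 else col (k, i - 1) c)"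
      using v by (cases i) (auto cong: if_cong)
    finally show "(x * P) $$ (c, r) = (P * J) $$ (c, r)" using 1 by simp
  qed (use x P J in auto)
  have QP: "Q * P = 1\<^sub>m M"
  proof (rule eq_matI)
    fix p r assume "p < dim_row (1\<^sub>m M)" "r < dim_col (1\<^sub>m M)"
    then have pr: "p < M" "r < M" by auto
    note v = valid[OF pr(1)] valid[OF pr(2)]
    let ?k = "fst (bpos ns p)" and ?a = "L (fst (bpos ns p)) - 1 - snd (bpos ns p)"
    have "(Q * P) $$ (p, r) = (\<Sum>c<M. col (bpos ns r) c * crd ?k ?a (uvec c))"
      using pr by (simp add: P_def Q_def scalar_prod_def lessThan_atLeast0 mult.commute)
    also have "\<dots> = crd ?k ?a (col (bpos ns r))"
      by (subst (2) VA_expand[OF colVA[OF pr(2)]]) (use v in \<open>simp add: afun_sum[OF crd_afun] afunD(2)[OF crd_afun]\<close>)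
    also have "\<dots> = (if bpos ns p = bpos ns r then 1 else 0)"
      unfolding col_def using v by (subst crd_basis) (auto simp: prod_eq_iff)
    also have "\<dots> = 1\<^sub>m M $$ (p, r)" using bpos_inj[of p ns r] pr sM by auto
    finally show "(Q * P) $$ (p, r) = 1\<^sub>m M $$ (p, r)" .
  qed (use P Q in auto)
  have PQ: "P * Q = 1\<^sub>m M" by (rule mat_mult_left_right_inverse[OF Q P QP])
  have "x = x * (P * Q)" unfolding PQ using x by simp
  also have "\<dots> = P * J * Q" unfolding PJ[symmetric] using assoc_mult_mat[OF x P Q] by simp
  finally have "similar_mat_wit x J P Q" by (intro similar_mat_witI[OF PQ QP _ x J P Q])
  then have "similar_mat x J" unfolding similar_mat_def by blast
  moreover have "map (\<lambda>n. (n, 0 :: 'a)) ns = map (\<lambda>k. (L k, 0)) [0..<N]" unfolding ns_def by simp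
  ultimately show ?thesis unfolding jordan_nf_def J_def using L_pos by force
qed

end

text \<open>The ranks of the powers are the sums of the truncated block sizes, and second differences of these sums recover the multiplicity of each block size.\<close>

lemma truncated_sums_determine:
  fixes A B :: "nat multiset"
  assumes "0 \<notin># A" "0 \<notin># B"
  shows "(\<And>j. (\<Sum>x\<in>#A. min j x) = (\<Sum>x\<in>#B. min j x)) \<Longrightarrow> A = B"
    and "(\<And>j. (\<Sum>x\<in>#A. x - j) = (\<Sum>x\<in>#B. x - j)) \<Longrightarrow> A = B"
proof -
  have c1: "count C (Suc j) + (\<Sum>x\<in>#C. min j x) + (\<Sum>x\<in>#C. min (Suc (Suc j)) x) =
      (\<Sum>x\<in>#C. min (Suc j) x) + (\<Sum>x\<in>#C. min (Suc j) x)" for C j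
  proof (induction C)
    case (add x C)
    have "(if x = Suc j then 1 else 0) + min j x + min (Suc (Suc j)) x = min (Suc j) x + min (Suc j) x"
      by (auto simp: min_def)
    then show ?case using add by (cases "x = Suc j") simp_all
  qed simp
  have c2: "count C (Suc j) + ((\<Sum>x\<in>#C. x - Suc j) + (\<Sum>x\<in>#C. x - Suc j)) =
      (\<Sum>x\<in>#C. x - j) + (\<Sum>x\<in>#C. x - Suc (Suc j))" for C :: "nat multiset" and j
  proof (induction C)
    case (add x C)
    have "(if x = Suc j then 1 else 0) + ((x - Suc j) + (x - Suc j)) = (x - j) + (x - Suc (Suc j))"
      by auto
    then show ?case using add by (cases "x = Suc j") simp_all
  qed simp
  {
    assume "\<And>j. (\<Sum>x\<in>#A. min j x) = (\<Sum>x\<in>#B. min j x)"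
    then have "count A (Suc j) = count B (Suc j)" for j using c1[of A j] c1[of B j] by simp
    then show "A = B" using assms by (intro multiset_eqI) (metis not0_implies_Suc not_in_iff)
  }
  {
    assume "\<And>j. (\<Sum>x\<in>#A. x - j) = (\<Sum>x\<in>#B. x - j)"
    then have "count A (Suc j) = count B (Suc j)" for j using c2[of A j] c2[of B j] by simp
    then show "A = B" using assms by (intro multiset_eqI) (metis not0_implies_Suc not_in_iff)
  }
qed

lemma reindex_by_multiset:
  fixes N N' :: nat and L \<pi> :: "nat \<Rightarrow> nat"
  assumes "image_mset L (mset_set {..<N}) = image_mset \<pi> (mset_set {..<N'})"
  shows "N' = N" "\<exists>p. bij_betw p {..<N} {..<N} \<and> (\<forall>i<N. L (p i) = \<pi> i)"
proof -
  have "size (image_mset L (mset_set {..<N})) = size (image_mset \<pi> (mset_set {..<N'}))" using assms by simp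
  then show N: "N' = N" by simp
  have m: "mset (map \<pi> [0..<N]) = mset (map L [0..<N])"
    using assms N by (simp add: lessThan_atLeast0 flip: mset_map mset_upt)
  obtain p where p: "p permutes {..<length (map L [0..<N])}" "permute_list p (map L [0..<N]) = map \<pi> [0..<N]"
    using mset_eq_permutation[OF m] by auto
  have pp: "p permutes {..<N}" using p(1) by simp
  have "L (p i) = \<pi> i" if "i < N" for i
  proof -
    have "permute_list p (map L [0..<N]) ! i = map L [0..<N] ! p i" using permute_list_nth[OF p(1)] that by simp
    moreover have "p i < N" using permutes_in_image[OF pp, of i] that by simp
    ultimately show ?thesis using p(2) that by simp
  qed
  then show "\<exists>p. bij_betw p {..<N} {..<N} \<and> (\<forall>i<N. L (p i) = \<pi> i)" using permutes_imp_bij[OF pp] by blast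
qed

context jordan_coords
begin

lemma reindexed:
  assumes p: "bij_betw p {..<N} {..<N}" and \<pi>: "\<And>i. i < N \<Longrightarrow> L (p i) = \<pi> i"
  shows "jordan_coords K M X N (e \<circ> p) \<pi> (\<psi> \<circ> p)"
proof -
  have pN: "p i < N" if "i < N" for i using p that bij_betwE by blast
  have inj: "p k = p l \<longleftrightarrow> k = l" if "k < N" "l < N" for k l
    using p that unfolding bij_betw_def by (auto dest: inj_onD)
  show ?thesis
  proof unfold_locales
    show "ratop X" by (rule X)
    show "chains X N (e \<circ> p) \<pi> (\<psi> \<circ> p)"
      using chains pN inj \<pi> unfolding chains_def o_def by metis
    fix f :: "nat \<Rightarrow> 'a" assume f: "f \<in> VA M"
    let ?F = "\<lambda>k. \<Sum>a<L k. sc (\<psi> k ((X ^^ (L k - 1 - a)) f)) ((X ^^ a) (e k))"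
    have "chain_part X N (e \<circ> p) \<pi> (\<psi> \<circ> p) f = (\<Sum>i<N. ?F (p i))"
      unfolding chain_part_def by (rule sum.cong[OF refl]) (simp add: \<pi>)
    also have "\<dots> = (\<Sum>k<N. ?F k)" by (rule sum.reindex_bij_betw[OF p])
    also have "\<dots> = f" using full[OF f] unfolding chain_part_def .
    finally show "chain_part X N (e \<circ> p) \<pi> (\<psi> \<circ> p) f = f" .
  qed
qed

end

context coord_space
begin

text \<open>The Jordan type over the algebraically closed field is read off from ranks of powers. These ranks agree with the ones over \<open>K\<close> because a rational Jordan basis exists, so the type is visible in the numbers of rational points of the images.\<close>

lemma jordan_type_iff:
  assumes x: "x \<in> carrier_mat M M" "elements_mat x \<subseteq> K" "x \<in> nilpotent_mats M" and \<pi>: "is_partition \<pi>"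
  shows "has_jordan_type x \<pi> \<longleftrightarrow> (\<exists>e \<psi>. jordan_coords K M (mop M x) (plen \<pi>) e \<pi> \<psi>)" (is "_ \<longleftrightarrow> ?C")
    and "has_jordan_type x \<pi> \<longleftrightarrow> (\<forall>j. card ((mop M x ^^ j) ` VK) = card K ^ boxes_beyond \<pi> j)"
proof -
  obtain m where m: "x ^\<^sub>m m = 0\<^sub>m M M" using x(3) unfolding nilpotent_mats_def by auto
  have r: "ratop (mop M x)" by (rule mop_ratop[OF x(1,2)])
  obtain N e L \<psi> where c: "chains (mop M x) N e L \<psi>" "\<forall>f\<in>VA M. chain_part (mop M x) N e L \<psi> f = f"
    using rational_jordan_basis[OF r fv_nilpotent[OF x(1) m VK_VA]] by blast
  interpret J: jordan_coords K M "mop M x" N e L \<psi> by unfold_locales (use r c in auto)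
  let ?A = "image_mset L (mset_set {..<N})" and ?B = "image_mset \<pi> (mset_set {..<plen \<pi>})"
  have z1: "0 \<notin># ?A" using J.L_pos by force
  have z2: "0 \<notin># ?B"
  proof
    assume "0 \<in># ?B"
    then obtain i where "i < plen \<pi>" "\<pi> i = 0" by auto
    then show False using partition_pos_iff[OF \<pi>, of i] by simp
  qed
  note z = z1 z2
  have s: "(\<Sum>y\<in>#image_mset F (mset_set {..<n}). g y) = (\<Sum>k<n. g (F k))" for F :: "nat \<Rightarrow> nat" and g :: "nat \<Rightarrow> nat" and n
    by (simp add: sum_unfold_sum_mset image_mset.compositionality o_def)
  have AB: ?C if hyp: "?A = ?B"
  proof -
    obtain p where p: "bij_betw p {..<N} {..<N}" "\<forall>i<N. L (p i) = \<pi> i" "plen \<pi> = N"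
      using reindex_by_multiset(1)[OF hyp] reindex_by_multiset(2)[OF hyp] by blast
    have "jordan_coords K M (mop M x) N (e \<circ> p) \<pi> (\<psi> \<circ> p)" by (rule J.reindexed[OF p(1)]) (use p(2) in simp)
    then show ?C unfolding p(3) by (intro exI)
  qed
  have d1: "dim_gen_eigenspace x 0 j = (\<Sum>k<N. min j (L k))" for j
    using dim_gen_eigenspace[OF J.jordan_nf_of_coords[OF x(1) refl], of 0 j]
    by (simp add: filter_map o_def split_def interv_sum_list_conv_sum_set_nat lessThan_atLeast0)
  show 1: "has_jordan_type x \<pi> \<longleftrightarrow> ?C"
  proof
    assume h: "has_jordan_type x \<pi>"
    have d2: "dim_gen_eigenspace x 0 j = (\<Sum>k<plen \<pi>. min j (\<pi> k))" for j
      using dim_gen_eigenspace[OF h[unfolded has_jordan_type_def], of 0 j]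
      by (simp add: filter_map o_def split_def interv_sum_list_conv_sum_set_nat lessThan_atLeast0)
    have "?A = ?B" by (rule truncated_sums_determine(1)[OF z]) (unfold s, use d1 d2 in metis)
    then show ?C by (rule AB)
  next
    assume ?C
    then obtain e' \<psi>' where "jordan_coords K M (mop M x) (plen \<pi>) e' \<pi> \<psi>'" by blast
    then show "has_jordan_type x \<pi>" unfolding has_jordan_type_def
      using jordan_coords.jordan_nf_of_coords[OF _ x(1) refl] by blast
  qed
  show "has_jordan_type x \<pi> \<longleftrightarrow> (\<forall>j. card ((mop M x ^^ j) ` VK) = card K ^ boxes_beyond \<pi> j)"
  proof
    assume "has_jordan_type x \<pi>"
    then obtain e' \<psi>' where "jordan_coords K M (mop M x) (plen \<pi>) e' \<pi> \<psi>'" using 1 by blast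
    then show "\<forall>j. card ((mop M x ^^ j) ` VK) = card K ^ boxes_beyond \<pi> j"
      using jordan_coords.card_image_pow unfolding boxes_beyond_def by blast
  next
    assume h: "\<forall>j. card ((mop M x ^^ j) ` VK) = card K ^ boxes_beyond \<pi> j"
    have "(\<Sum>k<N. L k - j) = (\<Sum>k<plen \<pi>. \<pi> k - j)" for j
    proof -
      have "card K ^ (\<Sum>k<N. L k - j) = card K ^ boxes_beyond \<pi> j" using h J.card_image_pow by simp
      moreover have "1 < card K" using card_K_ge_2 by linarith
      ultimately show ?thesis unfolding boxes_beyond_def by (metis power_inject_exp)
    qed
    then have "?A = ?B" by (intro truncated_sums_determine(2)[OF z]) (unfold s, simp)
    then show "has_jordan_type x \<pi>" using AB 1 by blast
  qed
qed

end

section \<open>Depths of a vector along a partition\<close>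

text \<open>Along the parts of the Jordan type these numbers classify the pairs of a vector and an operator.\<close>

definition depth :: "'v set \<Rightarrow> ('v \<Rightarrow> 'v) \<Rightarrow> nat \<Rightarrow> 'v \<Rightarrow> nat" where
  "depth V X m f = (LEAST j. (X ^^ j) f \<in> (X ^^ m) ` V)"

lemma depth_le_iff:
  assumes X: "X ` V \<subseteq> V" and f: "f \<in> V"
  shows "depth V X m f \<le> j \<longleftrightarrow> (X ^^ j) f \<in> (X ^^ m) ` V"
proof -
  have up: "(X ^^ j) f \<in> (X ^^ m) ` V" if "(X ^^ i) f \<in> (X ^^ m) ` V" "i \<le> j" for i j
  proof -
    obtain w where w: "w \<in> V" "(X ^^ i) f = (X ^^ m) w" using \<open>(X ^^ i) f \<in> (X ^^ m) ` V\<close> by auto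
    have P: "(X ^^ d) w \<in> V" for d :: nat by (induction d) (use w(1) X in auto)
    have "(X ^^ j) f = (X ^^ (j - i)) ((X ^^ i) f)" using \<open>i \<le> j\<close> by (metis comp_apply funpow_add le_add_diff_inverse2)
    also have "\<dots> = (X ^^ (j - i + m)) w" unfolding w(2) by (simp only: funpow_add o_apply)
    also have "\<dots> = (X ^^ m) ((X ^^ (j - i)) w)" by (simp only: funpow_add o_apply add.commute[of "j - i" m])
    finally show ?thesis using P by blast
  qed
  have ex: "(X ^^ m) f \<in> (X ^^ m) ` V" using f by simp
  have "(X ^^ depth V X m f) f \<in> (X ^^ m) ` V" unfolding depth_def by (rule LeastI[where P = "\<lambda>j. (X ^^ j) f \<in> (X ^^ m) ` V", OF ex])
  then show ?thesis using up Least_le[of "\<lambda>j. (X ^^ j) f \<in> (X ^^ m) ` V" j] unfolding depth_def by blast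
qed

lemma depth_le_self: "f \<in> V \<Longrightarrow> depth V X m f \<le> m"
  unfolding depth_def by (rule Least_le) auto

lemma depth_mono:
  assumes X: "X ` V \<subseteq> V" and f: "f \<in> V" and m: "m \<le> m'"
  shows "depth V X m f \<le> depth V X m' f"
proof -
  obtain w where w: "w \<in> V" "(X ^^ depth V X m' f) f = (X ^^ m') w"
    using depth_le_iff[OF X f, of m' "depth V X m' f"] by auto
  have P: "(X ^^ d) w \<in> V" for d :: nat by (induction d) (use w(1) X in auto)
  have "(X ^^ m') w = (X ^^ m) ((X ^^ (m' - m)) w)" using m by (metis comp_apply funpow_add le_add_diff_inverse)
  then show ?thesis using w P depth_le_iff[OF X f, of m] by (metis imageI)
qed

lemma depth_add:
  assumes X: "X ` V \<subseteq> V" and f: "f \<in> V"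
  shows "depth V X (m + d) f \<le> depth V X m f + d"
proof -
  obtain w where w: "w \<in> V" "(X ^^ depth V X m f) f = (X ^^ m) w"
    using depth_le_iff[OF X f, of m "depth V X m f"] by auto
  have "(X ^^ (depth V X m f + d)) f = (X ^^ d) ((X ^^ depth V X m f) f)" by (simp only: funpow_add o_apply add.commute[of _ d])
  also have "\<dots> = (X ^^ (m + d)) w" unfolding w(2) by (simp only: funpow_add o_apply add.commute[of m d])
  finally show ?thesis using w(1) depth_le_iff[OF X f, of "m + d"] by (metis imageI)
qed

text \<open>Enlarging \<open>m\<close> by \<open>d\<close> cannot lower the depth and raises it by at most \<open>d\<close>.\<close>

lemma depth_bipartition:
  assumes X: "X ` V \<subseteq> V" and f: "f \<in> V" and \<pi>: "is_partition \<pi>"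
  shows "is_partition (\<lambda>i. depth V X (\<pi> i) f)" "is_partition (\<lambda>i. \<pi> i - depth V X (\<pi> i) f)"
proof -
  have z: "\<pi> i = 0" if "i \<ge> plen \<pi>" for i using partition_pos_iff[OF \<pi>, of i] that by simp
  have a: "\<pi> (Suc i) \<le> \<pi> i" for i using partition_antimono[OF \<pi>, of i "Suc i"] by simp
  show "is_partition (\<lambda>i. depth V X (\<pi> i) f)"
  proof (rule is_partitionI[of _ "plen \<pi>"])
    show "depth V X (\<pi> (Suc i)) f \<le> depth V X (\<pi> i) f" for i by (rule depth_mono[OF X f a])
    show "depth V X (\<pi> i) f = 0" if "plen \<pi> \<le> i" for i using depth_le_self[OF f, of X "\<pi> i"] z[OF that] by simp
  qed
  show "is_partition (\<lambda>i. \<pi> i - depth V X (\<pi> i) f)"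
  proof (rule is_partitionI[of _ "plen \<pi>"])
    fix i
    have "depth V X (\<pi> (Suc i) + (\<pi> i - \<pi> (Suc i))) f \<le> depth V X (\<pi> (Suc i)) f + (\<pi> i - \<pi> (Suc i))"
      by (rule depth_add[OF X f])
    then show "\<pi> (Suc i) - depth V X (\<pi> (Suc i)) f \<le> \<pi> i - depth V X (\<pi> i) f" using a[of i] by simp
  qed (use z in auto)
qed

lemma plen_pdouble: "is_partition \<pi> \<Longrightarrow> plen (pdouble \<pi>) = 2 * plen \<pi>"
  and partition_pdouble: "is_partition \<pi> \<Longrightarrow> is_partition (pdouble \<pi>)"
proof -
  assume \<pi>: "is_partition \<pi>"
  show P: "is_partition (pdouble \<pi>)"
  proof (rule is_partitionI[of _ "2 * plen \<pi>"])
    show "pdouble \<pi> (Suc i) \<le> pdouble \<pi> i" for i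
      unfolding pdouble_def by (rule partition_antimono[OF \<pi>]) (simp add: div_le_mono)
    fix i assume "2 * plen \<pi> \<le> i"
    then have "plen \<pi> \<le> i div 2" by simp
    then show "pdouble \<pi> i = 0" using partition_pos_iff[OF \<pi>, of "i div 2"] unfolding pdouble_def by simp
  qed
  have "i < plen (pdouble \<pi>) \<longleftrightarrow> i < 2 * plen \<pi>" for i
    using partition_pos_iff[OF P, of i] partition_pos_iff[OF \<pi>, of "i div 2"] unfolding pdouble_def by auto
  then show "plen (pdouble \<pi>) = 2 * plen \<pi>" by (metis linorder_neqE_nat less_irrefl)
qed

lemma sum_pairs: "(\<Sum>k<2 * P. F k) = (\<Sum>i<P. F (2 * i) + F (Suc (2 * i)) :: 'b::comm_monoid_add)"
  by (induction P) (simp_all add: add.assoc)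

lemma sum_pdouble: "(\<Sum>k<2 * P. g (pdouble \<pi> k)) = 2 * (\<Sum>i<P. g (\<pi> i) :: nat)"
  unfolding sum_pairs by (simp add: pdouble_def sum_distrib_left mult_2)

lemma boxes_beyond_pdouble: "is_partition \<pi> \<Longrightarrow> boxes_beyond (pdouble \<pi>) j = 2 * boxes_beyond \<pi> j"
  unfolding boxes_beyond_def plen_pdouble using sum_pdouble[where g = "\<lambda>x. x - j"] by (simp only: )

lemma partition_padd: "is_partition \<rho> \<Longrightarrow> is_partition \<sigma> \<Longrightarrow> is_partition (padd \<rho> \<sigma>)"
proof (rule is_partitionI[of _ "max (plen \<rho>) (plen \<sigma>)"])
  assume p: "is_partition \<rho>" "is_partition \<sigma>"
  show "padd \<rho> \<sigma> (Suc i) \<le> padd \<rho> \<sigma> i" for i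
    unfolding padd_def using partition_antimono[OF p(1), of i "Suc i"] partition_antimono[OF p(2), of i "Suc i"] by simp
  show "padd \<rho> \<sigma> i = 0" if "max (plen \<rho>) (plen \<sigma>) \<le> i" for i
    using that partition_pos_iff[OF p(1), of i] partition_pos_iff[OF p(2), of i] unfolding padd_def by simp
qed

lemma psize_upto: "is_partition \<pi> \<Longrightarrow> plen \<pi> \<le> P \<Longrightarrow> psize \<pi> = (\<Sum>i<P. \<pi> i)"
  using psize_partition[of \<pi>] sum_beyond_plen[of \<pi> P "\<lambda>x. x"] by simp

lemma plen_mono: "is_partition \<rho> \<Longrightarrow> is_partition \<pi> \<Longrightarrow> (\<And>i. \<rho> i \<le> \<pi> i) \<Longrightarrow> plen \<rho> \<le> plen \<pi>"
proof (rule ccontr)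
  assume a: "is_partition \<rho>" "is_partition \<pi>" "\<And>i. \<rho> i \<le> \<pi> i" "\<not> plen \<rho> \<le> plen \<pi>"
  then have "\<rho> (plen \<pi>) \<noteq> 0" using partition_pos_iff[OF a(1)] by simp
  then show False using a(3)[of "plen \<pi>"] partition_pos_iff[OF a(2), of "plen \<pi>"] by simp
qed

lemma psize_padd: "is_partition \<rho> \<Longrightarrow> is_partition \<sigma> \<Longrightarrow> psize (padd \<rho> \<sigma>) = psize \<rho> + psize \<sigma>"
proof -
  assume p: "is_partition \<rho>" "is_partition \<sigma>"
  let ?P = "plen (padd \<rho> \<sigma>)"
  have "plen \<rho> \<le> ?P" "plen \<sigma> \<le> ?P"
    using plen_mono[OF p(1) partition_padd[OF p]] plen_mono[OF p(2) partition_padd[OF p]] by (auto simp: padd_def)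
  then show ?thesis using psize_upto[OF p(1), of ?P] psize_upto[OF p(2), of ?P] psize_upto[OF partition_padd[OF p], of ?P]
    by (simp add: padd_def sum.distrib)
qed

locale exotic_coords = jordan_coords K M X "plen (pdouble (padd \<rho> \<sigma>))" e "pdouble (padd \<rho> \<sigma>)" \<psi>
  for K :: "'a::field set" and M X e \<psi> and \<rho> \<sigma> :: part +
  assumes \<rho>: "is_partition \<rho>" and \<sigma>: "is_partition \<sigma>"
begin

abbreviation "\<pi> \<equiv> padd \<rho> \<sigma>"
abbreviation "N \<equiv> plen (pdouble \<pi>)"

lemma \<pi>: "is_partition \<pi>" by (rule partition_padd[OF \<rho> \<sigma>])

lemma N_eq: "N = 2 * plen \<pi>" by (rule plen_pdouble[OF \<pi>])

lemma kN: "k < N \<longleftrightarrow> k div 2 < plen \<pi>" unfolding N_eq by auto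

definition W :: "(nat \<Rightarrow> 'a) set" where
  "W = {f \<in> VA M. \<forall>k<N. \<forall>a<\<sigma> (k div 2). crd k a f = 0}"

lemma L_eq: "pdouble \<pi> k = \<rho> (k div 2) + \<sigma> (k div 2)" unfolding pdouble_def padd_def ..

text \<open>Upper bounds on all depths ask that in the block of size \<open>\<pi> i\<close> the first \<open>\<sigma> i\<close> coordinates vanish; what a bound says about the other blocks follows, since \<open>\<rho>\<close> and \<open>\<sigma>\<close> are both weakly decreasing.\<close>

lemma reach_W:
  assumes f: "f \<in> VA M"
  shows "f \<in> W \<longleftrightarrow> (\<forall>i. (X ^^ \<rho> i) f \<in> (X ^^ \<pi> i) ` VA M)"
proof
  assume fW: "f \<in> W"
  show "\<forall>i. (X ^^ \<rho> i) f \<in> (X ^^ \<pi> i) ` VA M"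
    unfolding reach_iff[OF f]
  proof (intro allI impI)
    fix i k a assume k: "k < N" and a: "a + \<rho> i < \<pi> i \<and> a + \<rho> i < pdouble \<pi> k"
    have "a < \<sigma> (k div 2)"
    proof (cases "k div 2 \<le> i")
      case True
      then have "\<sigma> i \<le> \<sigma> (k div 2)" by (rule partition_antimono[OF \<sigma>])
      then show ?thesis using a unfolding padd_def by simp
    next
      case False
      then have "\<rho> (k div 2) \<le> \<rho> i" by (intro partition_antimono[OF \<rho>]) simp
      then show ?thesis using a unfolding L_eq by simp
    qed
    then show "crd k a f = 0" using fW k unfolding W_def by blast
  qed
next
  assume h: "\<forall>i. (X ^^ \<rho> i) f \<in> (X ^^ \<pi> i) ` VA M"
  have "crd k a f = 0" if "k < N" "a < \<sigma> (k div 2)" for k a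
  proof -
    have "a + \<rho> (k div 2) < \<pi> (k div 2) \<and> a + \<rho> (k div 2) < pdouble \<pi> k"
      using that(2) unfolding pdouble_def padd_def by simp
    then show ?thesis using h[rule_format, of "k div 2", unfolded reach_iff[OF f]] that(1) by blast
  qed
  then show "f \<in> W" using f unfolding W_def by simp
qed

definition gen :: "(nat \<Rightarrow> 'a) \<Rightarrow> bool" where
  "gen f \<longleftrightarrow> (\<forall>i. \<rho> i > 0 \<longrightarrow> (X ^^ (\<rho> i - 1)) f \<notin> (X ^^ \<pi> i) ` VA M)"

lemma X_VA: "X ` VA M \<subseteq> VA M" using pow_VA[of _ 1] by auto

lemma depth_iff:
  assumes f: "f \<in> VA M"
  shows "(\<forall>i. depth (VA M) X (\<pi> i) f = \<rho> i) \<longleftrightarrow> f \<in> W \<and> gen f"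
proof -
  have "depth (VA M) X (\<pi> i) f = \<rho> i \<longleftrightarrow> (X ^^ \<rho> i) f \<in> (X ^^ \<pi> i) ` VA M \<and>
    (\<rho> i > 0 \<longrightarrow> (X ^^ (\<rho> i - 1)) f \<notin> (X ^^ \<pi> i) ` VA M)" for i
    using depth_le_iff[OF X_VA f, of "\<pi> i" "\<rho> i"] depth_le_iff[OF X_VA f, of "\<pi> i" "\<rho> i - 1"] by (cases "\<rho> i") auto
  then show ?thesis unfolding reach_W[OF f] gen_def by blast
qed

lemma card_W: "card (W \<inter> VK) = card K ^ (2 * psize \<rho>)"
proof -
  have "W \<inter> VK = {f \<in> VK. \<forall>k<N. \<forall>a<pdouble \<pi> k. a < pdouble \<sigma> k \<longrightarrow> crd k a f = 0}"
  proof -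
    have "\<sigma> (k div 2) \<le> pdouble \<pi> k" "pdouble \<sigma> k = \<sigma> (k div 2)" for k
      by (simp_all add: pdouble_def padd_def)
    then have "(\<forall>a<pdouble \<pi> k. a < pdouble \<sigma> k \<longrightarrow> crd k a f = 0) \<longleftrightarrow> (\<forall>a<\<sigma> (k div 2). crd k a f = 0)" for k f
      by (metis less_le_trans)
    then show ?thesis unfolding W_def using VK_VA by blast
  qed
  then have "card (W \<inter> VK) = card K ^ (\<Sum>k<N. pdouble \<pi> k - pdouble \<sigma> k)" using card_coord_space by simp
  also have "(\<Sum>k<N. pdouble \<pi> k - pdouble \<sigma> k) = (\<Sum>k<2 * plen \<pi>. pdouble \<rho> k)"
    unfolding N_eq by (rule sum.cong) (auto simp: pdouble_def padd_def)
  also have "\<dots> = 2 * psize \<rho>"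
    using sum_pdouble[of "\<lambda>x. x" \<rho> "plen \<pi>"] psize_upto[OF \<rho>, of "plen \<pi>"] plen_mono[OF \<rho> \<pi>] by (simp add: padd_def)
  finally show ?thesis .
qed

end

definition halves_below :: "part \<Rightarrow> part \<Rightarrow> part set" where
  "halves_below \<pi> \<rho> = {\<rho>'. is_partition \<rho>' \<and> (\<forall>i. \<rho>' i \<le> \<pi> i) \<and> is_partition (\<lambda>i. \<pi> i - \<rho>' i) \<and>
     (\<forall>i. \<rho>' i \<le> \<rho> i) \<and> psize \<rho>' < psize \<rho>}"

function half_count :: "part \<Rightarrow> part \<Rightarrow> int poly" where
  "half_count \<pi> \<rho> = monom 1 (2 * psize \<rho>) - (\<Sum>\<rho>'\<in>halves_below \<pi> \<rho>. half_count \<pi> \<rho>')"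
  by auto
termination
  by (relation "measure (\<lambda>(\<pi>, \<rho>). psize \<rho>)") (auto simp: halves_below_def)

declare half_count.simps [simp del]

lemma psize_less:
  assumes "is_partition \<rho>'" "is_partition \<rho>" "\<And>i. \<rho>' i \<le> \<rho> i" "\<rho>' \<noteq> \<rho>"
  shows "psize \<rho>' < psize \<rho>"
proof -
  obtain i where i: "\<rho>' i \<noteq> \<rho> i" using assms(4) by auto
  then have "\<rho>' i < \<rho> i" using assms(3)[of i] by simp
  moreover from this have "i < plen \<rho>" using partition_pos_iff[OF assms(2), of i] by simp
  ultimately have "(\<Sum>i<plen \<rho>. \<rho>' i) < (\<Sum>i<plen \<rho>. \<rho> i)"
    by (intro sum_strict_mono_ex1) (use assms(3) in auto)
  then show ?thesis using psize_upto[OF assms(1) plen_mono[OF assms(1-3)]] psize_partition[OF assms(2)] by simp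
qed

lemma finite_halves: "finite (halves_below \<pi> \<rho>)" if "is_partition \<pi>"
proof (rule finite_subset)
  show "halves_below \<pi> \<rho> \<subseteq> {f. \<forall>i. (i \<in> {..<plen \<pi>} \<longrightarrow> f i \<in> {..\<pi> 0}) \<and> (i \<notin> {..<plen \<pi>} \<longrightarrow> f i = 0)}"
  proof (intro subsetI CollectI allI conjI impI)
    fix f i assume f: "f \<in> halves_below \<pi> \<rho>"
    then have le: "f i \<le> \<pi> i" unfolding halves_below_def by auto
    show "f i \<in> {..\<pi> 0}" using le partition_antimono[OF that, of 0 i] by simp
    assume "i \<notin> {..<plen \<pi>}" then show "f i = 0" using le partition_pos_iff[OF that, of i] by simp
  qed
qed (rule finite_set_of_finite_funs; simp)

text \<open>The vectors whose depths are bounded by \<open>\<rho>\<close> form the subspace \<open>W\<close> of known size. Subtracting the vectors with smaller depths is a recursion, and it has the same shape for all fields, which makes the number a polynomial in the field size.\<close>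

lemma (in coord_space) card_depth:
  assumes J: "jordan_coords K M X (plen (pdouble \<pi>)) e (pdouble \<pi>) \<psi>" and \<pi>: "is_partition \<pi>"
  shows "is_partition \<rho> \<Longrightarrow> (\<And>i. \<rho> i \<le> \<pi> i) \<Longrightarrow> is_partition (\<lambda>i. \<pi> i - \<rho> i) \<Longrightarrow>
    int (card {f \<in> VK. \<forall>i. depth (VA M) X (\<pi> i) f = \<rho> i}) = poly (half_count \<pi> \<rho>) (int (card K))"
proof (induction "psize \<rho>" arbitrary: \<rho> rule: less_induct)
  case less
  let ?\<sigma> = "\<lambda>i. \<pi> i - \<rho> i"
  have pa: "padd \<rho> ?\<sigma> = \<pi>" unfolding padd_def using less(3) by auto
  interpret J: jordan_coords K M X "plen (pdouble \<pi>)" e "pdouble \<pi>" \<psi> by (rule J)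
  interpret E: exotic_coords K M X e \<psi> \<rho> ?\<sigma>
    by (rule exotic_coords.intro) (use J pa less in \<open>auto simp: exotic_coords_axioms_def\<close>)
  note [simp] = pa
  let ?D = "\<lambda>\<rho>. {f \<in> VK. \<forall>i. depth (VA M) X (\<pi> i) f = \<rho> i}"
  let ?H = "halves_below \<pi> \<rho>"
  have nH: "\<rho> \<notin> ?H" unfolding halves_below_def by auto
  have fH: "finite ?H" by (rule finite_halves[OF \<pi>])
  have finD: "finite (?D r)" for r using ksubD(1)[OF ksub_VK] by simp
  have "E.W \<inter> VK = (\<Union>\<rho>'\<in>insert \<rho> ?H. ?D \<rho>')"
  proof (intro equalityI subsetI)
    fix f assume f: "f \<in> E.W \<inter> VK"
    then have fA: "f \<in> VA M" and fK: "f \<in> VK" using VK_VA by auto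
    define \<rho>' where "\<rho>' i = depth (VA M) X (\<pi> i) f" for i
    have le: "\<rho>' i \<le> \<rho> i" for i
      using E.reach_W[OF fA] f depth_le_iff[OF E.X_VA fA, of "\<pi> i" "\<rho> i"] unfolding \<rho>'_def by simp
    have p: "is_partition \<rho>'" "is_partition (\<lambda>i. \<pi> i - \<rho>' i)"
      unfolding \<rho>'_def by (rule depth_bipartition[OF E.X_VA fA \<pi>]; assumption)+
    have "\<rho>' \<in> insert \<rho> ?H"
    proof (cases "\<rho>' = \<rho>")
      case False
      then show ?thesis unfolding halves_below_def using p le le_trans[OF le less(3)] psize_less[OF p(1) less(2) le] by simp
    qed simp
    then show "f \<in> (\<Union>\<rho>'\<in>insert \<rho> ?H. ?D \<rho>')" using fK unfolding \<rho>'_def by blast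
  next
    fix f assume "f \<in> (\<Union>\<rho>'\<in>insert \<rho> ?H. ?D \<rho>')"
    then obtain \<rho>' where r: "\<rho>' \<in> insert \<rho> ?H" "f \<in> VK" "\<forall>i. depth (VA M) X (\<pi> i) f = \<rho>' i" by auto
    have fA: "f \<in> VA M" using r VK_VA by auto
    have "\<rho>' i \<le> \<rho> i" for i using r(1) unfolding halves_below_def by auto
    then have "(X ^^ \<rho> i) f \<in> (X ^^ \<pi> i) ` VA M" for i
      using depth_le_iff[OF E.X_VA fA, of "\<pi> i" "\<rho> i"] r(3) by auto
    then show "f \<in> E.W \<inter> VK" using E.reach_W[OF fA] r(2) by simp
  qed
  then have "card K ^ (2 * psize \<rho>) = card (\<Union>\<rho>'\<in>insert \<rho> ?H. ?D \<rho>')" using E.card_W by simp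
  also have "\<dots> = (\<Sum>\<rho>'\<in>insert \<rho> ?H. card (?D \<rho>'))"
    by (rule card_UN_disjoint) (use fH finD in \<open>auto simp: fun_eq_iff\<close>)
  also have "\<dots> = card (?D \<rho>) + (\<Sum>\<rho>'\<in>?H. card (?D \<rho>'))" using fH nH by simp
  finally have "int (card K ^ (2 * psize \<rho>)) = int (card (?D \<rho>)) + (\<Sum>\<rho>'\<in>?H. int (card (?D \<rho>')))" by simp
  also have "(\<Sum>\<rho>'\<in>?H. int (card (?D \<rho>'))) = (\<Sum>\<rho>'\<in>?H. poly (half_count \<pi> \<rho>') (int (card K)))"
    by (rule sum.cong[OF refl], rule less(1)) (auto simp: halves_below_def)
  finally show ?case by (subst half_count.simps) (simp add: poly_monom poly_sum)
qed

section \<open>Polynomial functions\<close>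

lemma poly_fun_sum: "(\<And>i. i \<in> A \<Longrightarrow> F i \<in> poly_fun m) \<Longrightarrow> (\<lambda>v. \<Sum>i\<in>A. F i v) \<in> poly_fun m"
  by (induction A rule: infinite_finite_induct) (auto intro: poly_fun.intros)

lemma poly_fun_prod: "(\<And>i. i \<in> A \<Longrightarrow> F i \<in> poly_fun m) \<Longrightarrow> (\<lambda>v. \<Prod>i\<in>A. F i v) \<in> poly_fun m"
  by (induction A rule: infinite_finite_induct) (auto intro: poly_fun.intros)

lemma poly_fun_det:
  assumes "\<And>i j. i < n \<Longrightarrow> j < n \<Longrightarrow> F i j \<in> poly_fun m"
  shows "(\<lambda>v. det (mat n n (\<lambda>(i, j). F i j v))) \<in> poly_fun m"
proof -
  have "det (mat n n (\<lambda>(i, j). F i j v)) =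
      (\<Sum>p\<in>{p. p permutes {0..<n}}. signof p * (\<Prod>i = 0..<n. F i (p i) v))" for v
    by (subst det_def'[of _ n]) (auto intro!: sum.cong prod.cong dest: permutes_in_image)
  moreover have "(\<lambda>v. \<Sum>p\<in>{p. p permutes {0..<n}}. signof p * (\<Prod>i = 0..<n. F i (p i) v)) \<in> poly_fun m"
  proof (intro poly_fun_sum poly_fun.mult poly_fun_prod poly_fun.const)
    fix p i assume "p \<in> {p. p permutes {0..<n}}" "i \<in> {0..<n}"
    then show "F i (p i) \<in> poly_fun m" using assms[of i "p i"] permutes_in_image[of p "{0..<n}" i] by auto
  qed
  ultimately show ?thesis by simp
qed

lemma poly_fun_line:
  assumes "F \<in> poly_fun m" "v \<in> carrier_vec m" "w \<in> carrier_vec m"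
  shows "\<exists>p. \<forall>t. F (v + t \<cdot>\<^sub>v w) = poly p t"
  using assms(1)
proof induction
  case (const c)
  show ?case by (intro exI[of _ "[:c:]"]) simp
next
  case (coord i)
  show ?case by (intro exI[of _ "[:v $ i, w $ i:]"]) (use coord assms in \<open>auto simp: mult.commute\<close>)
next
  case (add f g)
  then obtain p p' where "\<forall>t. f (v + t \<cdot>\<^sub>v w) = poly p t" "\<forall>t. g (v + t \<cdot>\<^sub>v w) = poly p' t" by auto
  then show ?case by (intro exI[of _ "p + p'"]) simp
next
  case (mult f g)
  then obtain p p' where "\<forall>t. f (v + t \<cdot>\<^sub>v w) = poly p t" "\<forall>t. g (v + t \<cdot>\<^sub>v w) = poly p' t" by auto
  then show ?case by (intro exI[of _ "p * p'"]) simp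
qed

lemma infinite_alg_closed: "infinite (UNIV :: 'a::alg_closed_field set)"
proof
  assume fin: "finite (UNIV :: 'a set)"
  define p where "p = (\<Prod>a\<in>(UNIV :: 'a set). [:- a, 1:]) + 1"
  have "degree (\<Prod>a\<in>(UNIV :: 'a set). [:- a, 1:]) = card (UNIV :: 'a set)"
    by (subst degree_prod_eq_sum_degree) (auto simp: fin)
  moreover have "card (UNIV :: 'a set) > 0" using fin by (simp add: card_gt_0_iff)
  ultimately have "degree p > 0" unfolding p_def by (metis degree_add_eq_left degree_1)
  then obtain a where "poly p a = 0" using alg_closed_imp_poly_has_root by blast
  moreover have "poly (\<Prod>a\<in>(UNIV :: 'a set). [:- a, 1:]) a = 0" using fin by (simp add: poly_prod) 
  ultimately show False unfolding p_def by simp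
qed

section \<open>Invertible matrices and operators\<close>

lemma invertible_iff_inverse:
  assumes "A \<in> carrier_mat n n"
  shows "invertible_mat (A :: 'a::field mat) \<longleftrightarrow> (\<exists>B\<in>carrier_mat n n. A * B = 1\<^sub>m n \<and> B * A = 1\<^sub>m n)"
proof
  assume "invertible_mat A"
  then obtain B where B: "inverts_mat A B" "inverts_mat B A" unfolding invertible_mat_def by auto
  have "A * B = 1\<^sub>m n" "B * A = 1\<^sub>m (dim_row B)" using B assms unfolding inverts_mat_def by auto
  moreover from this have "dim_col B = n" "dim_row B = n" using assms by (metis index_mult_mat(3) index_one_mat(3), metis index_mult_mat(3) index_one_mat(3) carrier_matD(2))
  ultimately show "\<exists>B\<in>carrier_mat n n. A * B = 1\<^sub>m n \<and> B * A = 1\<^sub>m n" by (intro bexI[of _ B]) auto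
next
  assume "\<exists>B\<in>carrier_mat n n. A * B = 1\<^sub>m n \<and> B * A = 1\<^sub>m n"
  then show "invertible_mat A" using assms unfolding invertible_mat_def inverts_mat_def square_mat.simps by auto
qed

lemma invertible_of_det:
  assumes "A \<in> carrier_mat n n" "det A \<noteq> (0 :: 'a::field)"
  shows "invertible_mat A"
proof -
  have "A \<in> Units (ring_mat TYPE('a) n ())" by (rule det_non_zero_imp_unit[OF assms])
  then show ?thesis unfolding invertible_iff_inverse[OF assms(1)] Units_def by (auto simp: ring_mat_simps)
qed

lemma mop_mult:
  assumes "A \<in> carrier_mat M M" "B \<in> carrier_mat M M" "f \<in> VA M"
  shows "mop M (A * B) f = mop M A (mop M B f)"
proof -
  let ?v = "vec M f"
  have f: "fv ?v = f" by (rule fv_vec[OF assms(3)])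
  have "fv ((A * B) *\<^sub>v ?v) = fv (A *\<^sub>v (B *\<^sub>v ?v))" using assms(1,2) by simp
  then show ?thesis using fv_mult[of "A * B" M ?v] fv_mult[of A M "B *\<^sub>v ?v"] fv_mult[of B M ?v] assms(1,2) f by simp
qed

lemma mop_one: "f \<in> VA M \<Longrightarrow> mop M (1\<^sub>m M) f = f"
  using fv_mult[of "1\<^sub>m M" M "vec M f"] fv_vec[of f M] by simp

lemma uvec_VA: "r < M \<Longrightarrow> uvec r \<in> VA M" unfolding VA_def uvec_def by auto

lemma mop_ext:
  assumes "A \<in> carrier_mat M M" "B \<in> carrier_mat M M" "\<And>r. r < M \<Longrightarrow> mop M A (uvec r) = mop M B (uvec r)"
  shows "A = B"
proof (rule eq_matI)
  fix i j assume "i < dim_row B" "j < dim_col B"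
  then have "i < M" "j < M" using assms(2) by auto
  then show "A $$ (i, j) = B $$ (i, j)"
    using assms(3)[of j] mop_uvec[OF assms(1), of j i] mop_uvec[OF assms(2), of j i] by simp
qed (use assms in auto)

lemma mop_VA: "mop M A f \<in> VA M" unfolding mop_def VA_def by simp

definition matr :: "nat \<Rightarrow> ((nat \<Rightarrow> 'a::field) \<Rightarrow> nat \<Rightarrow> 'a) \<Rightarrow> 'a mat" where
  "matr M h = mat M M (\<lambda>(i, j). h (uvec j) i)"

lemma matr_carrier [simp]: "matr M h \<in> carrier_mat M M" unfolding matr_def by simp

lemma mop_matr:
  assumes "alin h" "\<forall>f\<in>VA M. h f \<in> VA M" "f \<in> VA M"
  shows "mop M (matr M h) f = h f"
proof (rule alin_eqI[OF mop_alin assms(1,3)])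
  fix r assume r: "r < M"
  show "mop M (matr M h) (uvec r) = h (uvec r)"
  proof
    fix i show "mop M (matr M h) (uvec r) i = h (uvec r) i"
    proof (cases "i < M")
      case True
      then show ?thesis using mop_uvec[OF matr_carrier r True, of h] r unfolding matr_def by simp
    next
      case False
      then show ?thesis using bspec[OF assms(2) uvec_VA[OF r]] mop_VA[of M "matr M h" "uvec r"] unfolding VA_def by simp
    qed
  qed
qed

definition commuting :: "nat \<Rightarrow> ((nat \<Rightarrow> 'a::field) \<Rightarrow> nat \<Rightarrow> 'a) \<Rightarrow> ((nat \<Rightarrow> 'a) \<Rightarrow> nat \<Rightarrow> 'a) set" where
  "commuting M X = {h. alin h \<and> (\<forall>f\<in>VA M. h f \<in> VA M \<and> h (X f) = X (h f))}"

lemma VA_closed: "f \<in> VA M \<Longrightarrow> g \<in> VA M \<Longrightarrow> f + g \<in> VA M" "f \<in> VA M \<Longrightarrow> sc c f \<in> VA M" "0 \<in> VA M"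
  "f \<in> VA M \<Longrightarrow> g \<in> VA M \<Longrightarrow> f - g \<in> VA M"
  unfolding VA_def sc_def by auto

lemma commuting_zero:
  fixes X :: "(nat \<Rightarrow> 'a::field) \<Rightarrow> nat \<Rightarrow> 'a"
  shows "alin X \<Longrightarrow> (\<lambda>_. 0) \<in> commuting M X" (is "_ \<Longrightarrow> ?thesis")
proof -
  assume X: "alin X"
  have "alin (\<lambda>_ :: nat \<Rightarrow> 'a. 0 :: nat \<Rightarrow> 'a)" unfolding alin_def by simp
  then show ?thesis unfolding commuting_def
    by (intro CollectI conjI ballI) (simp_all add: alinD(3)[OF X] VA_closed(3))
qed

lemma commuting_add:
  "alin X \<Longrightarrow> h \<in> commuting M X \<Longrightarrow> h' \<in> commuting M X \<Longrightarrow> (\<lambda>f. h f + h' f) \<in> commuting M X"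
  unfolding commuting_def by (auto simp: VA_closed(1) alinD(1)) (auto simp: alin_def sc.scale_right_distrib)

lemma commuting_scale:
  "alin X \<Longrightarrow> h \<in> commuting M X \<Longrightarrow> (\<lambda>f. sc c (h f)) \<in> commuting M X"
  unfolding commuting_def by (auto simp: VA_closed(2) alinD(2)) (auto simp: alin_def sc.scale_right_distrib mult.commute)

lemma commuting_sum:
  assumes "alin X" "\<And>i. i \<in> A \<Longrightarrow> H i \<in> commuting M X"
  shows "(\<lambda>f. \<Sum>i\<in>A. H i f) \<in> commuting M X"
  using assms(2)
proof (induction A rule: infinite_finite_induct)
  case (insert a A)
  have "(\<lambda>f. H a f + (\<Sum>i\<in>A. H i f)) \<in> commuting M X"
    by (rule commuting_add[OF assms(1)]) (use insert in auto)
  then show ?case unfolding sum.insert[OF insert(1,2)] .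
qed (unfold sum.empty sum.infinite, rule commuting_zero[OF assms(1)], rule commuting_zero[OF assms(1)])

lemma commuting_id: "(\<lambda>f. f) \<in> commuting M X" unfolding commuting_def alin_def by simp

lemma commuting_pow:
  assumes "alin X" "h \<in> commuting M X" "f \<in> VA M" "\<And>g. g \<in> VA M \<Longrightarrow> X g \<in> VA M"
  shows "h ((X ^^ j) f) = (X ^^ j) (h f)"
proof (induction j)
  case (Suc j)
  have "(X ^^ j) f \<in> VA M" by (induction j) (use assms in auto)
  then show ?case using assms(2) Suc unfolding commuting_def by simp
qed simp

lemma matr_commutes:
  assumes x: "x \<in> carrier_mat M M" and h: "h \<in> commuting M (mop M x)"
  shows "matr M h * x = x * matr M h"
proof (rule mop_ext)
  fix r assume r: "r < M"
  have hh: "alin h" "\<forall>f\<in>VA M. h f \<in> VA M" "h (mop M x (uvec r)) = mop M x (h (uvec r))"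
    using h uvec_VA[OF r] unfolding commuting_def by auto
  show "mop M (matr M h * x) (uvec r) = mop M (x * matr M h) (uvec r)"
    using mop_mult[OF matr_carrier x uvec_VA[OF r]] mop_mult[OF x matr_carrier uvec_VA[OF r]]
      mop_matr[OF hh(1,2) mop_VA] mop_matr[OF hh(1,2) uvec_VA[OF r]] hh(3) by simp
qed (rule mult_carrier_mat[OF matr_carrier x], rule mult_carrier_mat[OF x matr_carrier])

lemma commuting_mop:
  fixes x :: "'a::field mat"
  assumes "x \<in> carrier_mat M M" "g \<in> carrier_mat M M" "g * x = x * g"
  shows "mop M g \<in> commuting M (mop M x)"
  unfolding commuting_def
proof (intro CollectI conjI ballI mop_alin mop_VA)
  fix f :: "nat \<Rightarrow> 'a" assume f: "f \<in> VA M"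
  show "mop M g (mop M x f) = mop M x (mop M g f)"
    using mop_mult[OF assms(2,1) f] mop_mult[OF assms(1,2) f] assms(3) by simp
qed

context exotic_coords
begin

lemma X_alin: "alin X" using lin[of 1] by simp

definition transport :: "nat \<Rightarrow> nat \<Rightarrow> nat \<Rightarrow> (nat \<Rightarrow> 'a) \<Rightarrow> nat \<Rightarrow> 'a" where
  "transport l k b f = (\<Sum>a<pdouble \<pi> l. sc (crd l a f) ((X ^^ (a + b)) (e k)))"

lemma transport_commuting:
  assumes l: "l < N" and k: "k < N" and b: "pdouble \<pi> k \<le> pdouble \<pi> l + b"
  shows "transport l k b \<in> commuting M X"
  unfolding commuting_def
proof (intro CollectI conjI ballI)
  note C = crd_afun[OF l]
  show "alin (transport l k b)"
    unfolding alin_def transport_def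
    by (simp add: afunD(1,2)[OF C] sc.scale_left_distrib sum.distrib sc.scale_sum_right)
  fix f :: "nat \<Rightarrow> 'a" assume f: "f \<in> VA M"
  have "(X ^^ a) (e k) i = 0" if "i \<ge> M" for a i using pow_e_VK[OF k] that unfolding VK_def by auto
  then show "transport l k b f \<in> VA M" unfolding transport_def VA_def by (simp add: sum_apply sc_def)
  show "transport l k b (X f) = X (transport l k b f)"
  proof (cases "pdouble \<pi> l")
    case 0
    then show ?thesis unfolding transport_def by (simp only: lessThan_0 sum.empty alinD(3)[OF X_alin])
  next
    case (Suc n)
    have c: "crd l a (X f) = (if a = 0 then 0 else crd l (a - 1) f)" if "a < Suc n" for a
      using crd_pow[OF l _ f, of a 1] that Suc by auto
    have "transport l k b (X f) = (\<Sum>a<Suc n. sc (if a = 0 then 0 else crd l (a - 1) f) ((X ^^ (a + b)) (e k)))"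
      unfolding transport_def Suc by (rule sum.cong[OF refl]) (simp add: c)
    also have "\<dots> = sc 0 ((X ^^ (0 + b)) (e k)) + (\<Sum>a<n. sc (crd l a f) ((X ^^ (Suc a + b)) (e k)))"
      unfolding sum.lessThan_Suc_shift by simp
    also have "\<dots> = (\<Sum>a<n. sc (crd l a f) ((X ^^ (Suc a + b)) (e k)))" by simp
    also have "\<dots> = (\<Sum>a<n. sc (crd l a f) ((X ^^ (Suc a + b)) (e k))) + sc (crd l n f) ((X ^^ (Suc n + b)) (e k))"
      using pow_e_zero[OF k, of "Suc n + b"] b Suc by simp
    also have "\<dots> = (\<Sum>a<Suc n. sc (crd l a f) ((X ^^ (Suc a + b)) (e k)))" by (simp only: sum.lessThan_Suc)
    also have "\<dots> = X (transport l k b f)"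
      unfolding transport_def Suc alin_sum[OF X_alin] by (rule sum.cong[OF refl]) (simp add: alinD(2)[OF X_alin])
    finally show ?thesis .
  qed
qed

text \<open>A vector with exact depths has, for each block \<open>k\<close>, a block in which its first admissible coordinate is nonzero and from which the generator of the \<open>W\<close>-part of \<open>k\<close> is reached by an operator commuting with \<open>X\<close>.\<close>

lemma generic_generates:
  assumes f: "f \<in> VA M" and g: "gen f" and k: "k < N"
  shows "\<sigma> (k div 2) \<le> c \<Longrightarrow> \<exists>h\<in>commuting M X. h f = (X ^^ c) (e k)"
proof (induction "pdouble \<pi> k - c" arbitrary: c rule: less_induct)
  case less
  let ?i = "k div 2"
  show ?case
  proof (cases "pdouble \<pi> k \<le> c")
    case True
    then show ?thesis using pow_e_zero[OF k True] commuting_zero[OF X_alin] by (intro bexI[of _ "\<lambda>_. 0"]) auto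
  next
    case False
    then have \<rho>i: "\<rho> ?i > 0" using less(2) L_eq[of k] by simp
    then have "(X ^^ (\<rho> ?i - 1)) f \<notin> (X ^^ \<pi> ?i) ` VA M" using g unfolding gen_def by blast
    then have "\<not> (\<forall>k<N. \<forall>a. a + (\<rho> ?i - 1) < \<pi> ?i \<and> a + (\<rho> ?i - 1) < pdouble \<pi> k \<longrightarrow> crd k a f = 0)"
      unfolding reach_iff[OF f] .
    then obtain l a where la: "l < N" "a + (\<rho> ?i - 1) < \<pi> ?i" "a + (\<rho> ?i - 1) < pdouble \<pi> l" "crd l a f \<noteq> 0"
      by blast
    define a0 where "a0 = (LEAST a. crd l a f \<noteq> 0)"
    have a0: "crd l a0 f \<noteq> 0" unfolding a0_def using la(4) by (rule LeastI)
    have a0_le: "a0 \<le> a" unfolding a0_def using la(4) by (rule Least_le)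
    have lower: "crd l a' f = 0" if "a' < a0" for a' using not_less_Least[of a' "\<lambda>a. crd l a f \<noteq> 0"] that unfolding a0_def by simp
    have "a0 \<le> \<sigma> ?i" using a0_le la(2) \<rho>i unfolding padd_def by simp
    then have a0c: "a0 \<le> c" using less(2) by simp
    have aL: "a0 < pdouble \<pi> l" using a0_le la(3) by simp
    define b where "b = c - a0"
    have "pdouble \<pi> k \<le> pdouble \<pi> l + b"
      unfolding b_def using a0_le la(3) \<rho>i a0c less(2) L_eq[of k] by simp
    then have T: "transport l k b \<in> commuting M X" by (rule transport_commuting[OF la(1) k])
    have "\<exists>h\<in>commuting M X. h f = (X ^^ (a' + b)) (e k)" if "a' > a0" for a'
      by (rule less(1)) (use that a0c False less(2) in \<open>auto simp: b_def\<close>)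
    then have "\<forall>a'. \<exists>h. a' > a0 \<longrightarrow> h \<in> commuting M X \<and> h f = (X ^^ (a' + b)) (e k)" by blast
    from choice[OF this] obtain H where H: "\<forall>a'>a0. H a' \<in> commuting M X \<and> H a' f = (X ^^ (a' + b)) (e k)" by blast
    let ?A = "{a0<..<pdouble \<pi> l}" and ?u = "crd l a0 f"
    define h where "h = (\<lambda>g. sc (inverse ?u) (transport l k b g + sc (- 1) (\<Sum>a'\<in>?A. sc (crd l a' f) (H a' g))))"
    have "h \<in> commuting M X" unfolding h_def
      by (intro commuting_scale[OF X_alin] commuting_add[OF X_alin] commuting_sum[OF X_alin] T) (use H in auto)
    moreover have "h f = (X ^^ c) (e k)"
    proof -
      let ?t = "\<lambda>a'. sc (crd l a' f) ((X ^^ (a' + b)) (e k))"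
      have "transport l k b f = (\<Sum>a'\<in>insert a0 ?A. ?t a')"
        unfolding transport_def
      proof (rule sum.mono_neutral_right)
        show "\<forall>a'\<in>{..<pdouble \<pi> l} - insert a0 ?A. ?t a' = 0"
        proof
          fix a' assume "a' \<in> {..<pdouble \<pi> l} - insert a0 ?A"
          then have "a' < a0" by auto
          then show "?t a' = 0" using lower by simp
        qed
      qed (use aL in auto)
      also have "\<dots> = ?t a0 + (\<Sum>a'\<in>?A. ?t a')" by (rule sum.insert) auto
      also have "(\<Sum>a'\<in>?A. ?t a') = (\<Sum>a'\<in>?A. sc (crd l a' f) (H a' f))"
        by (rule sum.cong[OF refl]) (use H in auto)
      finally have tf: "transport l k b f = ?t a0 + (\<Sum>a'\<in>?A. sc (crd l a' f) (H a' f))" .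
      have "h f = sc (inverse ?u) (?t a0)" unfolding h_def tf
        by (simp only: sc.scale_minus_left sc.scale_one add.assoc right_minus add_0_right)
      then show ?thesis using a0 a0c unfolding b_def by simp
    qed
    ultimately show ?thesis by blast
  qed
qed

lemma W_commuting:
  assumes h: "h \<in> commuting M X" and f: "f \<in> W"
  shows "h f \<in> W"
proof -
  have fA: "f \<in> VA M" using f unfolding W_def by auto
  have hA: "g \<in> VA M \<Longrightarrow> h g \<in> VA M" for g using h unfolding commuting_def by auto
  have XA: "g \<in> VA M \<Longrightarrow> X g \<in> VA M" for g using X_VA by auto
  note P = commuting_pow[OF X_alin h _ XA]
  show ?thesis unfolding reach_W[OF hA[OF fA]]
  proof
    fix i
    obtain g where g: "g \<in> VA M" "(X ^^ \<rho> i) f = (X ^^ \<pi> i) g" using f unfolding reach_W[OF fA] by blast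
    have "(X ^^ \<rho> i) (h f) = h ((X ^^ \<rho> i) f)" using P[OF fA] by simp
    also have "\<dots> = (X ^^ \<pi> i) (h g)" unfolding g(2) using P[OF g(1)] by simp
    finally show "(X ^^ \<rho> i) (h f) \<in> (X ^^ \<pi> i) ` VA M" using hA[OF g(1)] by blast
  qed
qed

definition I :: "(nat \<times> nat) set" where
  "I = {(k, a). k < N \<and> \<sigma> (k div 2) \<le> a \<and> a < pdouble \<pi> k}"

lemma W_expand:
  assumes "f \<in> W"
  shows "(\<Sum>q\<in>I. sc (crd (fst q) (snd q) f) ((X ^^ snd q) (e (fst q)))) = f"
proof -
  have fA: "f \<in> VA M" using assms unfolding W_def by auto
  have "f = comb (\<lambda>k a. crd k a f)" using expand[OF fA] by simp
  also have "\<dots> = (\<Sum>q\<in>(SIGMA k:{..<N}. {..<pdouble \<pi> k}). sc (crd (fst q) (snd q) f) ((X ^^ snd q) (e (fst q))))"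
    unfolding comb_def by (subst sum.Sigma) (auto intro!: sum.cong)
  also have "\<dots> = (\<Sum>q\<in>I. sc (crd (fst q) (snd q) f) ((X ^^ snd q) (e (fst q))))"
  proof (rule sum.mono_neutral_right)
    show "\<forall>q\<in>(SIGMA k:{..<N}. {..<pdouble \<pi> k}) - I. sc (crd (fst q) (snd q) f) ((X ^^ snd q) (e (fst q))) = 0"
      using assms unfolding W_def I_def by auto
  qed (auto simp: I_def)
  finally show ?thesis by simp
qed

lemma W_closed: "f \<in> W \<Longrightarrow> g \<in> W \<Longrightarrow> f + g \<in> W" "f \<in> W \<Longrightarrow> sc c f \<in> W" "0 \<in> W"
  unfolding W_def using VA_closed by (auto simp: afunD[OF crd_afun])

end

section \<open>Open orbits of the centralizer\<close>

lemma fv_finsum: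
  assumes "finite A" "u \<in> A \<rightarrow> carrier_vec M"
  shows "fv (finsum_vec TYPE('a::field) M u A) = (\<Sum>i\<in>A. fv (u i))"
proof
  fix j
  have c: "finsum_vec TYPE('a) M u A \<in> carrier_vec M" by (rule finsum_vec_closed[OF assms(2)])
  have d: "dim_vec (u i) = M" if "i \<in> A" for i using carrier_vecD[OF funcset_mem[OF assms(2) that]] .
  show "fv (finsum_vec TYPE('a) M u A) j = (\<Sum>i\<in>A. fv (u i)) j"
  proof (cases "j < M")
    case True
    then show ?thesis using index_finsum_vec[OF assms(1) True assms(2)] c d
      unfolding fv_def sum_apply by (auto intro!: sum.cong)
  next
    case False
    then show ?thesis using c d unfolding fv_def sum_apply by auto
  qed
qed

lemma lin_VA_sum: "(\<And>i. i \<in> A \<Longrightarrow> F i \<in> VA M) \<Longrightarrow> (\<Sum>i\<in>A. F i) \<in> VA M"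
  unfolding VA_def by (auto simp: sum_apply)

lemma invertible_iff_det:
  assumes A: "A \<in> carrier_mat n n"
  shows "invertible_mat (A :: 'a::field mat) \<longleftrightarrow> det A \<noteq> 0"
proof
  assume "invertible_mat A"
  then obtain B where B: "B \<in> carrier_mat n n" "A * B = 1\<^sub>m n" unfolding invertible_iff_inverse[OF A] by blast
  have "det A * det B = det (A * B)" by (rule det_mult[OF A B(1), symmetric])
  then show "det A \<noteq> 0" unfolding B(2) by auto
qed (rule invertible_of_det[OF A])

lemma inverse_commutes:
  fixes x :: "'a::field mat"
  assumes x: "x \<in> carrier_mat n n" and B: "B \<in> carrier_mat n n" and G: "G \<in> carrier_mat n n"
    and BG: "B * G = 1\<^sub>m n" "G * B = 1\<^sub>m n" and c: "B * x = x * B"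
  shows "G * x = x * G"
proof -
  have xG: "x * G \<in> carrier_mat n n" by (rule mult_carrier_mat[OF x G])
  have "x = x * (B * G)" unfolding BG(1) by (rule right_mult_one_mat[OF x, symmetric])
  also have "\<dots> = x * B * G" by (rule assoc_mult_mat[OF x B G, symmetric])
  also have "\<dots> = B * x * G" unfolding c ..
  also have "\<dots> = B * (x * G)" by (rule assoc_mult_mat[OF B x G])
  finally have "G * x = G * (B * (x * G))" by simp
  also have "\<dots> = G * B * (x * G)" by (rule assoc_mult_mat[OF G B xG, symmetric])
  also have "\<dots> = x * G" unfolding BG(2) by (rule left_mult_one_mat[OF xG])
  finally show ?thesis .
qed

lemma product_commutes:
  fixes x :: "'a::field mat"
  assumes x: "x \<in> carrier_mat n n" and G: "G \<in> carrier_mat n n" and T: "T \<in> carrier_mat n n"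
    and c: "G * x = x * G" "T * x = x * T"
  shows "(G * T) * x = x * (G * T)"
proof -
  have "G * T * x = G * (T * x)" by (rule assoc_mult_mat[OF G T x])
  also have "\<dots> = G * x * T" unfolding c(2) by (rule assoc_mult_mat[OF G x T, symmetric])
  also have "\<dots> = x * (G * T)" unfolding c(1) by (rule assoc_mult_mat[OF x G T])
  finally show ?thesis .
qed

locale exotic_matrix = exotic_coords K M "mop M x" e \<psi> \<rho> \<sigma>
  for K :: "'a::alg_closed_field set" and M x e \<psi> \<rho> \<sigma> +
  assumes x: "x \<in> carrier_mat M M"
begin

lemma x_pow: "x ^\<^sub>m j \<in> carrier_mat M M" using x by simp

lemma W_sum:
  assumes "\<And>i. i \<in> A \<Longrightarrow> F i \<in> W"
  shows "(\<Sum>i\<in>A. F i) \<in> W"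
  using assms
proof (induction A rule: infinite_finite_induct)
  case (insert a A)
  then show ?case unfolding sum.insert[OF insert(1,2)] using W_closed(1) by blast
qed (unfold sum.infinite sum.empty, rule W_closed(3), rule W_closed(3))

lemma kernel_image_in_W:
  assumes w: "w \<in> VA M" and z: "(mop M x ^^ \<pi> i) w = 0"
  shows "(mop M x ^^ \<sigma> i) w \<in> W"
  unfolding W_def
proof (intro CollectI conjI allI impI pow_VA[OF w])
  fix k a assume k: "k < N" and a: "a < \<sigma> (k div 2)"
  have aL: "a < pdouble \<pi> k" using a L_eq[of k] by simp
  show "crd k a ((mop M x ^^ \<sigma> i) w) = 0"
  proof (cases "\<sigma> i \<le> a")
    case True
    have "k div 2 < i"
    proof (rule ccontr)
      assume "\<not> k div 2 < i"
      then have "\<sigma> (k div 2) \<le> \<sigma> i" by (intro partition_antimono[OF \<sigma>]) simp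
      then show False using a True by simp
    qed
    then have "\<rho> i \<le> \<rho> (k div 2)" by (intro partition_antimono[OF \<rho>]) simp
    moreover have "\<pi> i = \<rho> i + \<sigma> i" unfolding padd_def ..
    ultimately have "(a - \<sigma> i) + \<pi> i < pdouble \<pi> k" using a True L_eq[of k] by linarith
    then have "crd k (a - \<sigma> i) w = 0" using z k unfolding kernel_iff[OF w] by blast
    then show ?thesis unfolding crd_pow[OF k aL w] by simp
  next
    case False
    then show ?thesis unfolding crd_pow[OF k aL w] by simp
  qed
qed

lemma ker_sum_iff:
  "v \<in> ker_sum M x \<sigma> \<pi> \<longleftrightarrow> v \<in> carrier_vec M \<and> fv v \<in> W"
proof
  assume "v \<in> ker_sum M x \<sigma> \<pi>"
  then obtain u where u: "v = finsum_vec TYPE('a) M u {..<plen \<pi>}"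
    "\<forall>i<plen \<pi>. u i \<in> (\<lambda>w. (x ^\<^sub>m \<sigma> i) *\<^sub>v w) ` mat_kernel (x ^\<^sub>m \<pi> i)" unfolding ker_sum_def by auto
  have ui: "u i \<in> carrier_vec M \<and> fv (u i) \<in> W" if i: "i < plen \<pi>" for i
  proof -
    obtain w where w: "w \<in> mat_kernel (x ^\<^sub>m \<pi> i)" "u i = (x ^\<^sub>m \<sigma> i) *\<^sub>v w" using u(2) i by blast
    have wc: "w \<in> carrier_vec M" "(x ^\<^sub>m \<pi> i) *\<^sub>v w = 0\<^sub>v M" using mat_kernelD[OF x_pow w(1)] by auto
    have "(mop M x ^^ \<pi> i) (fv w) = 0" using fv_pow[OF x wc(1), of "\<pi> i"] wc(2) fv_zero by metis
    then have "(mop M x ^^ \<sigma> i) (fv w) \<in> W" by (rule kernel_image_in_W[OF fv_VA[OF wc(1)]])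
    moreover have "u i \<in> carrier_vec M" unfolding w(2) by (rule mult_mat_vec_carrier[OF x_pow wc(1)])
    ultimately show ?thesis unfolding w(2) fv_pow[OF x wc(1)] by simp
  qed
  then have uc: "u \<in> {..<plen \<pi>} \<rightarrow> carrier_vec M" by auto
  have "fv v \<in> W" unfolding u(1) fv_finsum[OF finite_lessThan uc] by (rule W_sum) (use ui in auto)
  moreover have "v \<in> carrier_vec M" unfolding u(1) by (rule finsum_vec_closed[OF uc])
  ultimately show "v \<in> carrier_vec M \<and> fv v \<in> W" by simp
next
  assume v: "v \<in> carrier_vec M \<and> fv v \<in> W"
  let ?f = "fv v"
  have fA: "?f \<in> VA M" using fv_VA v by blast
  define F where "F k = (\<Sum>a<pdouble \<pi> k. sc (crd k a ?f) ((mop M x ^^ a) (e k)))" for k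
  define G where "G k = (\<Sum>a\<in>{\<sigma> (k div 2)..<pdouble \<pi> k}. sc (crd k a ?f) ((mop M x ^^ (a - \<sigma> (k div 2))) (e k)))" for k
  define w where "w i = G (2 * i) + G (Suc (2 * i))" for i
  have GA: "G k \<in> VA M" if "k < N" for k
    unfolding G_def by (intro lin_VA_sum VA_closed(2)) (use pow_e_VK[OF that] VK_VA in auto)
  have FG: "F k = (mop M x ^^ \<sigma> (k div 2)) (G k)" if k: "k < N" for k
  proof -
    have "F k = (\<Sum>a\<in>{\<sigma> (k div 2)..<pdouble \<pi> k}. sc (crd k a ?f) ((mop M x ^^ a) (e k)))"
      unfolding F_def
    proof (rule sum.mono_neutral_right)
      show "\<forall>a\<in>{..<pdouble \<pi> k} - {\<sigma> (k div 2)..<pdouble \<pi> k}. sc (crd k a ?f) ((mop M x ^^ a) (e k)) = 0"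
        using v k unfolding W_def by auto
    qed auto
    also have "\<dots> = (\<Sum>a\<in>{\<sigma> (k div 2)..<pdouble \<pi> k}. (mop M x ^^ \<sigma> (k div 2)) (sc (crd k a ?f) ((mop M x ^^ (a - \<sigma> (k div 2))) (e k))))"
    proof (rule sum.cong[OF refl])
      fix a assume "a \<in> {\<sigma> (k div 2)..<pdouble \<pi> k}"
      then have "a = \<sigma> (k div 2) + (a - \<sigma> (k div 2))" by simp
      then have "(mop M x ^^ a) (e k) = (mop M x ^^ \<sigma> (k div 2)) ((mop M x ^^ (a - \<sigma> (k div 2))) (e k))"
        by (metis comp_apply funpow_add)
      then show "sc (crd k a ?f) ((mop M x ^^ a) (e k)) = (mop M x ^^ \<sigma> (k div 2)) (sc (crd k a ?f) ((mop M x ^^ (a - \<sigma> (k div 2))) (e k)))"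
        by (simp add: alinD(2)[OF lin])
    qed
    finally show ?thesis unfolding G_def alin_sum[OF lin] .
  qed
  have Gz: "(mop M x ^^ \<pi> (k div 2)) (G k) = 0" if k: "k < N" for k
  proof -
    have "(mop M x ^^ \<pi> (k div 2)) (sc (crd k a ?f) ((mop M x ^^ (a - \<sigma> (k div 2))) (e k))) = 0" for a
    proof -
      have "(mop M x ^^ \<pi> (k div 2)) ((mop M x ^^ (a - \<sigma> (k div 2))) (e k)) = (mop M x ^^ (\<pi> (k div 2) + (a - \<sigma> (k div 2)))) (e k)"
        by (simp only: funpow_add o_apply)
      also have "\<dots> = 0" by (rule pow_e_zero[OF k]) (simp add: pdouble_def)
      finally show ?thesis by (simp add: alinD(2)[OF lin])
    qed
    then show ?thesis unfolding G_def alin_sum[OF lin] by (intro sum.neutral) blast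
  qed
  have wA: "w i \<in> VA M" if i: "i < plen \<pi>" for i
    unfolding w_def by (intro VA_closed(1) GA) (use i N_eq in simp_all)
  have wz: "(mop M x ^^ \<pi> i) (w i) = 0" if "i < plen \<pi>" for i
    using Gz[of "2 * i"] Gz[of "Suc (2 * i)"] that N_eq unfolding w_def by (simp add: alinD(1)[OF lin])
  define u where "u i = (x ^\<^sub>m \<sigma> i) *\<^sub>v vec M (w i)" for i
  have uc: "u \<in> {..<plen \<pi>} \<rightarrow> carrier_vec M" unfolding u_def using mult_mat_vec_carrier[OF x_pow] by auto
  have fu: "fv (u i) = F (2 * i) + F (Suc (2 * i))" if i: "i < plen \<pi>" for i
  proof -
    have "fv (u i) = (mop M x ^^ \<sigma> i) (w i)" unfolding u_def using fv_pow[OF x, of "vec M (w i)"] fv_vec[OF wA[OF i]] by simp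
    then show ?thesis using FG[of "2 * i"] FG[of "Suc (2 * i)"] i N_eq unfolding w_def by (simp add: alinD(1)[OF lin])
  qed
  have "?f = (\<Sum>k<N. F k)" using expand[OF fA] unfolding comb_def F_def by simp
  also have "\<dots> = (\<Sum>i<plen \<pi>. F (2 * i) + F (Suc (2 * i)))" unfolding N_eq by (rule sum_pairs)
  also have "\<dots> = (\<Sum>i<plen \<pi>. fv (u i))" by (rule sum.cong[OF refl]) (use fu in auto)
  also have "\<dots> = fv (finsum_vec TYPE('a) M u {..<plen \<pi>})" using fv_finsum[OF finite_lessThan uc] by simp
  finally have "v = finsum_vec TYPE('a) M u {..<plen \<pi>}"
    using fv_inj[OF _ finsum_vec_closed[OF uc]] v by blast
  moreover have "u i \<in> (\<lambda>w. (x ^\<^sub>m \<sigma> i) *\<^sub>v w) ` mat_kernel (x ^\<^sub>m \<pi> i)" if i: "i < plen \<pi>" for i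
  proof -
    have "fv ((x ^\<^sub>m \<pi> i) *\<^sub>v vec M (w i)) = 0" using fv_pow[OF x, of "vec M (w i)"] fv_vec[OF wA[OF i]] wz[OF i] by simp
    then have "(x ^\<^sub>m \<pi> i) *\<^sub>v vec M (w i) = 0\<^sub>v M" using fv_eq_zero[OF mult_mat_vec_carrier[OF x_pow], of "vec M (w i)"] by simp
    then have "vec M (w i) \<in> mat_kernel (x ^\<^sub>m \<pi> i)" by (intro mat_kernelI[OF x_pow]) auto
    then show ?thesis unfolding u_def by blast
  qed
  ultimately show "v \<in> ker_sum M x \<sigma> \<pi>" unfolding ker_sum_def by blast
qed

lemma orbit_iff:
  assumes v: "v \<in> carrier_vec M" and w: "w \<in> carrier_vec M"
  shows "w \<in> centralizer_orbit M x v \<longleftrightarrow>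
    (\<exists>g\<in>carrier_mat M M. invertible_mat g \<and> g * x = x * g \<and> mop M g (fv v) = fv w)"
proof -
  have "mop M g (fv v) = fv w \<longleftrightarrow> w = g *\<^sub>v v" if "g \<in> carrier_mat M M" for g
    using fv_mult[OF that v] fv_inj[OF w mult_mat_vec_carrier[OF that v]] by auto
  then show ?thesis unfolding centralizer_orbit_def by blast
qed

lemma orbit_subset:
  assumes v: "v \<in> carrier_vec M" "fv v \<in> W"
  shows "centralizer_orbit M x v \<subseteq> ker_sum M x \<sigma> \<pi>"
proof
  fix w assume w: "w \<in> centralizer_orbit M x v"
  then have wc: "w \<in> carrier_vec M" unfolding centralizer_orbit_def using v(1) by auto
  obtain g where g: "g \<in> carrier_mat M M" "g * x = x * g" "mop M g (fv v) = fv w"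
    using w unfolding orbit_iff[OF v(1) wc] by blast
  have "fv w \<in> W" using W_commuting[OF commuting_mop[OF x g(1,2)] v(2)] g(3) by simp
  then show "w \<in> ker_sum M x \<sigma> \<pi>" using wc unfolding ker_sum_iff by simp
qed

text \<open>An operator commuting with \<open>x\<close> that moves \<open>v\<close> to \<open>w\<close> can be chosen to depend linearly on \<open>w - v\<close> and to be the identity at \<open>w = v\<close>. Its determinant is a polynomial in \<open>w\<close>, so the orbit is a union of nonempty open sets.\<close>

lemma generic_open:
  assumes v: "v \<in> carrier_vec M" "fv v \<in> W" and g: "gen (fv v)"
  shows "zariski_open_in M (ker_sum M x \<sigma> \<pi>) (centralizer_orbit M x v)"
proof -
  let ?f = "fv v" and ?V = "ker_sum M x \<sigma> \<pi>" and ?O = "centralizer_orbit M x v"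
  have fA: "?f \<in> VA M" by (rule fv_VA[OF v(1)])
  have "\<forall>q. \<exists>h. q \<in> I \<longrightarrow> h \<in> commuting M (mop M x) \<and> h ?f = (mop M x ^^ snd q) (e (fst q))"
    using generic_generates[OF fA g] unfolding I_def by fastforce
  from choice[OF this] obtain H where H: "\<And>q. q \<in> I \<Longrightarrow> H q \<in> commuting M (mop M x)"
    "\<And>q. q \<in> I \<Longrightarrow> H q ?f = (mop M x ^^ snd q) (e (fst q))" by blast
  define t where "t B q w = (\<Sum>j<M. crd (fst q) (snd q) (mop M B (uvec j)) * w $ j) + - crd (fst q) (snd q) ?f"
    for B q and w :: "'a vec"
  define Sm where "Sm B w = mat M M (\<lambda>(i, j). (if i = j then 1 else 0) + (\<Sum>q\<in>I. t B q w * H q (uvec j) i))" for B w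
  have poly: "(\<lambda>w. det (Sm B w)) \<in> poly_fun M" for B
    unfolding Sm_def t_def
    by (intro poly_fun_det poly_fun.add poly_fun_sum poly_fun.mult poly_fun.const poly_fun.coord) auto
  have t_eq: "t B q w = crd (fst q) (snd q) (mop M B (fv w) - ?f)" if "q \<in> I" "w \<in> carrier_vec M" for B q w
  proof -
    have k: "fst q < N" using that(1) unfolding I_def by auto
    note C = crd_afun[OF k, of "snd q"]
    have "mop M B (fv w) = (\<Sum>j<M. sc (fv w j) (mop M B (uvec j)))"
      by (subst VA_expand[OF fv_VA[OF that(2)]]) (simp add: alin_sum[OF mop_alin] alinD(2)[OF mop_alin])
    then have "crd (fst q) (snd q) (mop M B (fv w)) = (\<Sum>j<M. fv w j * crd (fst q) (snd q) (mop M B (uvec j)))"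
      by (simp add: afun_sum[OF C] afunD(2)[OF C])
    also have "\<dots> = (\<Sum>j<M. crd (fst q) (snd q) (mop M B (uvec j)) * (w :: 'a vec) $ j)"
      by (rule sum.cong[OF refl]) (use that(2) in \<open>auto simp: fv_def\<close>)
    finally show ?thesis unfolding t_def by (simp add: afunD(5)[OF C])
  qed
  define s where "s B w = (\<lambda>f. f + (\<Sum>q\<in>I. sc (t B q w) (H q f)))" for B w
  have s_com: "s B w \<in> commuting M (mop M x)" for B w
    unfolding s_def by (intro commuting_add[OF X_alin] commuting_id commuting_sum[OF X_alin] commuting_scale[OF X_alin] H(1))
  have Sm_s: "Sm B w = matr M (s B w)" for B w
    unfolding Sm_def matr_def s_def by (rule eq_matI) (auto simp: sum_apply sc_def uvec_def)
  have s_val: "s B w ?f = mop M B (fv w)"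
    if B: "B \<in> carrier_mat M M" "B * x = x * B" and w: "w \<in> carrier_vec M" "fv w \<in> W" for B w
  proof -
    have d: "mop M B (fv w) - ?f \<in> W"
    proof -
      have "mop M B (fv w) + sc (- 1) ?f \<in> W"
        by (intro W_closed(1) W_closed(2)[OF v(2)] W_commuting[OF commuting_mop[OF x B] w(2)])
      then show ?thesis by simp
    qed
    have "s B w ?f = ?f + (\<Sum>q\<in>I. sc (crd (fst q) (snd q) (mop M B (fv w) - ?f)) ((mop M x ^^ snd q) (e (fst q))))"
      unfolding s_def by (intro arg_cong2[where f = plus] sum.cong refl) (simp add: t_eq[OF _ w(1)] H(2))
    then show ?thesis unfolding W_expand[OF d] by simp
  qed
  let ?S = "{(\<lambda>w. det (Sm B w)) | B. B \<in> carrier_mat M M \<and> invertible_mat B \<and> B * x = x * B}"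
  have closed: "zariski_closed_in M ?V (?V - ?O)" unfolding zariski_closed_in_def
  proof (intro exI[of _ ?S] conjI)
    show "?S \<subseteq> poly_fun M" using poly by blast
    show "?V - ?O = {w \<in> ?V. \<forall>f\<in>?S. f w = 0}"
    proof (intro equalityI subsetI)
      fix w assume w: "w \<in> ?V - ?O"
      then have wc: "w \<in> carrier_vec M" "fv w \<in> W" using ker_sum_iff[of w] by simp_all
      have "det (Sm B w) = 0" if B: "B \<in> carrier_mat M M" "invertible_mat B" "B * x = x * B" for B
      proof (rule ccontr)
        assume nz: "det (Sm B w) \<noteq> 0"
        obtain G where G: "G \<in> carrier_mat M M" "B * G = 1\<^sub>m M" "G * B = 1\<^sub>m M"
          using B(2) unfolding invertible_iff_inverse[OF B(1)] by blast
        have Gx: "G * x = x * G" by (rule inverse_commutes[OF x B(1) G(1,2,3) B(3)])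
        let ?T = "matr M (s B w)"
        have T: "?T \<in> carrier_mat M M" "invertible_mat ?T" "?T * x = x * ?T"
          using invertible_of_det[OF matr_carrier] nz matr_commutes[OF x s_com] matr_carrier unfolding Sm_s by blast+
        have GT: "G * ?T \<in> carrier_mat M M" by (rule mult_carrier_mat[OF G(1) T(1)])
        have "det G * det B = det (G * B)" by (rule det_mult[OF G(1) B(1), symmetric])
        then have "det G \<noteq> 0" unfolding G(3) by auto
        then have inv: "invertible_mat (G * ?T)"
          unfolding invertible_iff_det[OF GT] using det_mult[OF G(1) T(1)] nz unfolding Sm_s by simp
        have com: "(G * ?T) * x = x * (G * ?T)" by (rule product_commutes[OF x G(1) T(1) Gx T(3)])
        have "mop M (G * ?T) ?f = mop M G (mop M ?T ?f)" by (rule mop_mult[OF G(1) T(1) fA])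
        also have "mop M ?T ?f = s B w ?f"
          by (rule mop_matr[OF _ _ fA]) (use s_com[of B w] in \<open>auto simp: commuting_def\<close>)
        also have "mop M G (s B w ?f) = mop M (G * B) (fv w)"
          unfolding s_val[OF B(1,3) wc] by (rule mop_mult[OF G(1) B(1) fv_VA[OF wc(1)], symmetric])
        also have "\<dots> = fv w" unfolding G(3) by (rule mop_one[OF fv_VA[OF wc(1)]])
        finally have "w \<in> ?O" unfolding orbit_iff[OF v(1) wc(1)] using GT inv com by blast
        then show False using w by blast
      qed
      then show "w \<in> {w \<in> ?V. \<forall>f\<in>?S. f w = 0}" using w by auto
    next
      fix w assume w: "w \<in> {w \<in> ?V. \<forall>f\<in>?S. f w = 0}"
      then have wc: "w \<in> carrier_vec M" "fv w \<in> W" using ker_sum_iff[of w] by simp_all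
      have "w \<notin> ?O"
      proof
        assume "w \<in> ?O"
        then obtain G where G: "G \<in> carrier_mat M M" "invertible_mat G" "G * x = x * G" "mop M G ?f = fv w"
          unfolding orbit_iff[OF v(1) wc(1)] by blast
        obtain B where B: "B \<in> carrier_mat M M" "G * B = 1\<^sub>m M" "B * G = 1\<^sub>m M"
          using G(2) unfolding invertible_iff_inverse[OF G(1)] by blast
        have Bx: "B * x = x * B" by (rule inverse_commutes[OF x G(1) B(1,2,3) G(3)])
        have Bi: "invertible_mat B" unfolding invertible_iff_inverse[OF B(1)] using B G(1) by blast
        have "mop M B (fv w) = mop M (B * G) ?f" unfolding G(4)[symmetric] by (rule mop_mult[OF B(1) G(1) fA, symmetric])
        then have "mop M B (fv w) - ?f = 0" unfolding B(3) mop_one[OF fA] by simp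
        then have d0: "mop M B (fv w) - ?f = 0" .
        have t0: "t B q w = 0" if "q \<in> I" for q
        proof -
          have "fst q < N" using that unfolding I_def by auto
          from crd_zero[OF this, of "snd q"] show ?thesis unfolding t_eq[OF that wc(1)] d0 .
        qed
        have z0: "(\<Sum>q\<in>I. t B q w * H q (uvec j) i) = 0" for i j by (rule sum.neutral) (simp add: t0)
        have "Sm B w = 1\<^sub>m M" unfolding Sm_def z0 by (rule eq_matI) simp_all
        then have "det (Sm B w) = 1" by simp
        have mem: "(\<lambda>w. det (Sm B w)) \<in> ?S" by (intro CollectI exI[of _ B] conjI refl B(1) Bi Bx)
        have "\<forall>f\<in>?S. f w = 0" using w unfolding mem_Collect_eq[of w] by (rule conjunct2)
        from bspec[OF this mem] have "det (Sm B w) = 0" .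
        then show False using \<open>det (Sm B w) = 1\<close> by simp
      qed
      then show "w \<in> ?V - ?O" using w by blast
    qed
  qed
  then show ?thesis unfolding zariski_open_in_def using orbit_subset[OF v] by simp
qed

text \<open>A vector that misses one of the exact depths stays, together with its orbit, in a proper subspace of \<open>W\<close>. A relatively open set containing the vector contains all but finitely many points of a line through it, and over an infinite field a line towards a point outside the subspace leaves the orbit.\<close>

lemma nongeneric_not_open:
  assumes v: "v \<in> carrier_vec M" "fv v \<in> W" and ng: "\<not> gen (fv v)"
  shows "\<not> zariski_open_in M (ker_sum M x \<sigma> \<pi>) (centralizer_orbit M x v)"
proof
  let ?V = "ker_sum M x \<sigma> \<pi>" and ?O = "centralizer_orbit M x v"
  assume "zariski_open_in M ?V ?O"
  then obtain S where S: "S \<subseteq> poly_fun M" "?V - ?O = {w \<in> ?V. \<forall>f\<in>S. f w = 0}"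
    unfolding zariski_open_in_def zariski_closed_in_def by blast
  have fA: "fv v \<in> VA M" by (rule fv_VA[OF v(1)])
  obtain i where i: "\<rho> i > 0" "(mop M x ^^ (\<rho> i - 1)) (fv v) \<in> (mop M x ^^ \<pi> i) ` VA M" using ng unfolding gen_def by blast
  have ip: "i < plen \<pi>" using i(1) partition_pos_iff[OF \<pi>, of i] unfolding padd_def by simp
  then have kN: "2 * i < N" using N_eq by simp
  define w1 where "w1 = (mop M x ^^ \<sigma> i) (e (2 * i))"
  have w1A: "w1 \<in> VA M" unfolding w1_def using pow_e_VK[OF kN] VK_VA by blast
  have w1W: "w1 \<in> W" unfolding W_def w1_def
    using w1A crd_basis[OF _ kN] L_eq unfolding w1_def by (auto split: if_splits)
  have cnz: "crd (2 * i) (\<sigma> i) w1 = 1" unfolding w1_def using crd_basis[OF kN kN, of "\<sigma> i" "\<sigma> i"] i(1) L_eq[of "2 * i"] by simp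
  have cz: "crd (2 * i) (\<sigma> i) f = 0" if f: "f \<in> VA M" "(mop M x ^^ (\<rho> i - 1)) f \<in> (mop M x ^^ \<pi> i) ` VA M" for f
    using that(2) unfolding reach_iff[OF f(1)] using kN i(1) L_eq[of "2 * i"] by (auto simp: padd_def)
  have O: "(mop M x ^^ (\<rho> i - 1)) (fv w) \<in> (mop M x ^^ \<pi> i) ` VA M" if w: "w \<in> ?O" for w
  proof -
    have wc: "w \<in> carrier_vec M" using w unfolding centralizer_orbit_def using v(1) by auto
    obtain g where g: "g \<in> carrier_mat M M" "g * x = x * g" "mop M g (fv v) = fv w"
      using w unfolding orbit_iff[OF v(1) wc] by blast
    note h = commuting_mop[OF x g(1,2)]
    obtain z where z: "z \<in> VA M" "(mop M x ^^ (\<rho> i - 1)) (fv v) = (mop M x ^^ \<pi> i) z" using i(2) by blast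
    have "(mop M x ^^ (\<rho> i - 1)) (fv w) = mop M g ((mop M x ^^ (\<rho> i - 1)) (fv v))"
      unfolding g(3)[symmetric] by (rule commuting_pow[OF X_alin h fA mop_VA, symmetric])
    also have "\<dots> = (mop M x ^^ \<pi> i) (mop M g z)"
      unfolding z(2) by (rule commuting_pow[OF X_alin h z(1) mop_VA])
    finally show ?thesis using mop_VA by blast
  qed
  have "1\<^sub>m M *\<^sub>v v = v" using v(1) by simp
  moreover have "invertible_mat (1\<^sub>m M :: 'a mat)" by (subst invertible_iff_inverse[of _ M]) (auto intro: bexI[of _ "1\<^sub>m M"])
  ultimately have "v \<in> ?O" unfolding centralizer_orbit_def using x by (intro CollectI exI[of _ "1\<^sub>m M"]) auto
  moreover have vV: "v \<in> ?V" using v unfolding ker_sum_iff by simp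
  ultimately obtain F where F: "F \<in> S" "F v \<noteq> 0" using S(2) by blast
  let ?w = "vec M w1"
  have wc: "?w \<in> carrier_vec M" by simp
  obtain p where p: "\<And>t. F (v + t \<cdot>\<^sub>v ?w) = poly p t" using poly_fun_line[OF subsetD[OF S(1) F(1)] v(1) wc] by blast
  have "v + 0 \<cdot>\<^sub>v ?w = v" using v(1) by (intro eq_vecI) auto
  then have "p \<noteq> 0" using p[of 0] F(2) by auto
  then have "finite {t. poly p t = 0}" by (rule poly_roots_finite)
  then have "infinite (UNIV - insert 0 {t. poly p t = 0})" using infinite_alg_closed by (intro Diff_infinite_finite) auto
  then have "UNIV - insert 0 {t. poly p t = 0} \<noteq> {}" by (metis finite.emptyI)
  then obtain t where t: "t \<noteq> 0" "poly p t \<noteq> 0" by blast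
  have ft: "fv (v + t \<cdot>\<^sub>v ?w) = fv v + sc t w1"
    using fv_add[OF v(1), of "t \<cdot>\<^sub>v ?w"] fv_smult[of t ?w] fv_vec[OF w1A] by simp
  have "fv (v + t \<cdot>\<^sub>v ?w) \<in> W" unfolding ft by (intro W_closed(1) W_closed(2) v(2) w1W)
  then have "v + t \<cdot>\<^sub>v ?w \<in> ?V" unfolding ker_sum_iff using v(1) by simp
  moreover have "F (v + t \<cdot>\<^sub>v ?w) \<noteq> 0" unfolding p by (rule t(2))
  ultimately have wO: "v + t \<cdot>\<^sub>v ?w \<in> ?O" using S(2) F(1) by blast
  from O[OF wO] have "crd (2 * i) (\<sigma> i) (fv v + sc t w1) = 0"
    unfolding ft by (intro cz VA_closed(1,2) fA w1A)
  then show False using cz[OF fA i(2)] cnz t(1) afunD(1,2)[OF crd_afun[OF kN]] by simp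
qed

theorem open_orbit_iff:
  assumes v: "v \<in> carrier_vec M"
  shows "v \<in> ker_sum M x \<sigma> \<pi> \<and> zariski_open_in M (ker_sum M x \<sigma> \<pi>) (centralizer_orbit M x v) \<longleftrightarrow>
    (\<forall>i. depth (VA M) (mop M x) (\<pi> i) (fv v) = \<rho> i)"
  unfolding depth_iff[OF fv_VA[OF v]] ker_sum_iff
  using v generic_open[OF v] nongeneric_not_open[OF v] by blast

end

section \<open>Rational points of exotic orbits\<close>

lemma vec_lin: "vec M (f + g) = vec M f + vec M g" "vec M (sc c f) = c \<cdot>\<^sub>v vec M f" "vec M (uvec i :: nat \<Rightarrow> 'a::field) = unit_vec M i"
  unfolding sc_def uvec_def unit_vec_def by auto

lemma vec_fv: "v \<in> carrier_vec M \<Longrightarrow> vec M (fv v) = v"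
  unfolding fv_def by auto

locale exotic_setting = coord_space K "2 * n" for K :: "'a::alg_closed_field set" and n +
  fixes B :: "'a vec \<Rightarrow> 'a vec \<Rightarrow> 'a"
  assumes sympl: "symplectic_form (2 * n) B" and over: "form_over (2 * n) K B"
begin

abbreviation "M \<equiv> 2 * n"

definition Bf :: "(nat \<Rightarrow> 'a) \<Rightarrow> (nat \<Rightarrow> 'a) \<Rightarrow> 'a" where
  "Bf f g = B (vec M f) (vec M g)"

lemma Bf_afun: "afun (Bf f)" "afun (\<lambda>g. Bf g f)"
  using sympl unfolding symplectic_form_def afun_def Bf_def by (simp_all add: vec_lin)

lemma Bf_self: "Bf f f = 0"
  using sympl unfolding symplectic_form_def Bf_def by simp

lemma Bf_K:
  assumes f: "f \<in> VK" and g: "g \<in> VK"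
  shows "Bf f g \<in> K"
proof -
  have "Bf f g = Bf (\<Sum>i<M. sc (f i) (uvec i)) (\<Sum>j<M. sc (g j) (uvec j))"
    using VA_expand[OF VK_VA[OF f]] VA_expand[OF VK_VA[OF g]] by simp
  also have "\<dots> = (\<Sum>j<M. g j * (\<Sum>i<M. f i * Bf (uvec i) (uvec j)))"
    unfolding afun_sum[OF Bf_afun(2)] afunD(2)[OF Bf_afun(2)] afun_sum[OF Bf_afun(1)] afunD(2)[OF Bf_afun(1)] ..
  also have "\<dots> \<in> K"
    using over f g unfolding form_over_def VK_def Bf_def vec_lin by (intro K_sum K_closed(4)) auto
  finally show ?thesis .
qed

lemma Bf_altform: "altform VK Bf"
  unfolding altform_def kfunctional_def using Bf_K Bf_self by (simp add: afunD[OF Bf_afun(1)] afunD[OF Bf_afun(2)])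

lemma Bf_nondegenerate: "nondegenerate VK Bf"
  unfolding nondegenerate_def
proof (intro ballI impI)
  fix v assume v: "v \<in> VK" "\<forall>w\<in>VK. Bf v w = 0"
  have z: "afun (\<lambda>_ :: nat \<Rightarrow> 'a. 0 :: 'a)" unfolding afun_def by simp
  have "Bf v f = 0" if "f \<in> VA M" for f
    using afun_eqI[OF Bf_afun(1) z that, of v] v(2) uvec_VK by simp
  then have "B (vec M v) w = 0" if "w \<in> carrier_vec M" for w
    using fv_VA[OF that] vec_fv[OF that] unfolding Bf_def by metis
  moreover have "\<forall>v\<in>carrier_vec M. (\<forall>w\<in>carrier_vec M. B v w = 0) \<longrightarrow> v = 0\<^sub>v M"
    using sympl unfolding symplectic_form_def by (elim conjE)
  ultimately have "vec M v = 0\<^sub>v M" by (metis vec_carrier)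
  then show "v = 0" using fv_vec[OF VK_VA[OF v(1)]] fv_zero by metis
qed

lemma jordan_exists:
  assumes x: "x \<in> carrier_mat M M" "elements_mat x \<subseteq> K" "x \<in> nilpotent_mats M"
  shows "\<exists>N e L \<psi>. jordan_coords K M (mop M x) N e L \<psi>"
proof -
  obtain m where m: "x ^\<^sub>m m = 0\<^sub>m M M" using x(3) unfolding nilpotent_mats_def by auto
  have r: "ratop (mop M x)" by (rule mop_ratop[OF x(1,2)])
  obtain N e L \<psi> where c: "chains (mop M x) N e L \<psi>" "\<forall>f\<in>VA M. chain_part (mop M x) N e L \<psi> f = f"
    using rational_jordan_basis[OF r fv_nilpotent[OF x(1) m VK_VA]] by blast
  have "jordan_coords K M (mop M x) N e L \<psi>" by unfold_locales (use r c in auto)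
  then show ?thesis by blast
qed

lemma alternating_rational:
  assumes x: "x \<in> carrier_mat M M" "elements_mat x \<subseteq> K" "x \<in> nilpotent_mats M"
  shows "(\<forall>w\<in>carrier_vec M. B (x *\<^sub>v w) w = 0) \<longleftrightarrow> (\<forall>f\<in>VK. Bf (mop M x f) f = 0)"
proof -
  obtain m where m: "x ^\<^sub>m m = 0\<^sub>m M M" using x(3) unfolding nilpotent_mats_def by auto
  obtain N e L \<psi> where J: "jordan_coords K M (mop M x) N e L \<psi>" using jordan_exists[OF x] by blast
  have a: "alin (mop M x)" by (rule mop_alin)
  have e: "Bf (mop M x (fv w)) (fv w) = B (x *\<^sub>v w) w" if w: "w \<in> carrier_vec M" for w
    unfolding Bf_def fv_mult[OF x(1) w, symmetric] using vec_fv[OF w] vec_fv[OF mult_mat_vec_carrier[OF x(1) w]] by simp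
  have "Bf (mop M x f) f = 0" if h: "\<forall>f\<in>VK. Bf (mop M x f) f = 0" and f: "f \<in> VA M" for f
  proof (rule jordan_coords.quadratic_vanish[OF J, where \<phi> = "\<lambda>f. Bf (mop M x f) f" and j = m
        and \<beta> = "\<lambda>f g. Bf (mop M x f) g + Bf (mop M x g) f"])
    show "Bf (mop M x (f + g)) (f + g) = Bf (mop M x f) f + Bf (mop M x g) g + (Bf (mop M x f) g + Bf (mop M x g) f)" for f g
      by (simp add: alinD(1)[OF a] afunD(1)[OF Bf_afun(1)] afunD(1)[OF Bf_afun(2)])
    show "Bf (mop M x (sc c f)) (sc c f) = c\<^sup>2 * Bf (mop M x f) f" for c f
      by (simp add: alinD(2)[OF a] afunD(2)[OF Bf_afun(1)] afunD(2)[OF Bf_afun(2)] power2_eq_square)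
    have *: "afun (\<lambda>g. Bf (mop M x f) g + Bf (mop M x g) f)" for f
      unfolding afun_def
      by (simp add: alinD(1,2)[OF a] afunD(1,2)[OF Bf_afun(1)] afunD(1,2)[OF Bf_afun(2)] add_ac distrib_left)
    show "afun (\<lambda>g. Bf (mop M x f) g + Bf (mop M x g) f)" for f by (rule *)
    show "afun (\<lambda>g. Bf (mop M x g) f + Bf (mop M x f) g)" for f using *[of f] by (simp add: add.commute)
    show "Bf (mop M x f) f = 0" if "f \<in> VK" for f using h that by blast
    show "f \<in> VA M" by (rule f)
    show "(mop M x ^^ m) f = 0" by (rule fv_nilpotent[OF x(1) m f])
  qed
  moreover have "Bf (mop M x f) f = 0" if h: "\<forall>w\<in>carrier_vec M. B (x *\<^sub>v w) w = 0" and f: "f \<in> VA M" for f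
    using e[of "vec M f"] h fv_vec[OF f] by simp
  ultimately show ?thesis using e fv_VA VK_VA by metis
qed

definition nilp :: "part \<Rightarrow> 'a mat set" where
  "nilp \<pi> = {x \<in> nilpotent_mats M. elements_mat x \<subseteq> K \<and> (\<forall>f\<in>VK. Bf (mop M x f) f = 0) \<and> has_jordan_type x (pdouble \<pi>)}"

lemma nilp_carrier: "x \<in> nilp \<pi> \<Longrightarrow> x \<in> carrier_mat M M" unfolding nilp_def nilpotent_mats_def by auto

lemma nilp_jordan:
  assumes x: "x \<in> nilp \<pi>" and \<pi>: "is_partition \<pi>"
  shows "\<exists>e \<psi>. jordan_coords K M (mop M x) (plen (pdouble \<pi>)) e (pdouble \<pi>) \<psi>"
  using jordan_type_iff(1)[OF nilp_carrier[OF x] _ _ partition_pdouble[OF \<pi>]] x unfolding nilp_def by blast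

text \<open>Both the open orbit and the Jordan type are expressed by depths and ranks, which do not change when passing from the closed field to \<open>K\<close>.\<close>

lemma exotic_orbit_rational:
  assumes b: "(\<rho>, \<sigma>) \<in> bipartitions n"
  shows "exotic_orbit n B \<rho> \<sigma> \<inter> rational_pairs K =
    {(v, x). x \<in> nilp (padd \<rho> \<sigma>) \<and> v \<in> carrier_vec M \<and> vec_set v \<subseteq> K \<and>
       (\<forall>i. depth (VA M) (mop M x) (padd \<rho> \<sigma> i) (fv v) = \<rho> i)}"
proof -
  have p: "is_partition \<rho>" "is_partition \<sigma>" using b unfolding bipartitions_def by auto
  have "(v, x) \<in> exotic_orbit n B \<rho> \<sigma> \<inter> rational_pairs K \<longleftrightarrow>
    x \<in> nilp (padd \<rho> \<sigma>) \<and> v \<in> carrier_vec M \<and> vec_set v \<subseteq> K \<and>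
       (\<forall>i. depth (VA M) (mop M x) (padd \<rho> \<sigma> i) (fv v) = \<rho> i)" for v x
  proof (cases "x \<in> nilp (padd \<rho> \<sigma>) \<and> v \<in> carrier_vec M \<and> vec_set v \<subseteq> K")
    case True
    obtain e \<psi> where J: "jordan_coords K M (mop M x) (plen (pdouble (padd \<rho> \<sigma>))) e (pdouble (padd \<rho> \<sigma>)) \<psi>"
      using nilp_jordan[OF _ partition_padd[OF p]] True by blast
    have xc: "x \<in> carrier_mat M M" using nilp_carrier True by blast
    interpret exotic_matrix K M x e \<psi> \<rho> \<sigma>
      by (intro exotic_matrix.intro exotic_coords.intro exotic_coords_axioms.intro exotic_matrix_axioms.intro J p xc)
    have "(v, x) \<in> exotic_cone n B \<and> has_jordan_type x (pdouble (padd \<rho> \<sigma>)) \<and> (v, x) \<in> rational_pairs K"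
      using True alternating_rational[OF xc] unfolding nilp_def exotic_cone_def rational_pairs_def by auto
    then show ?thesis using open_orbit_iff[of v] True unfolding exotic_orbit_def by auto
  next
    case False
    have "\<not> (v, x) \<in> exotic_orbit n B \<rho> \<sigma> \<inter> rational_pairs K"
    proof
      assume h: "(v, x) \<in> exotic_orbit n B \<rho> \<sigma> \<inter> rational_pairs K"
      then have c: "v \<in> carrier_vec M" "x \<in> nilpotent_mats M" "\<forall>w\<in>carrier_vec M. B (x *\<^sub>v w) w = 0"
        "has_jordan_type x (pdouble (padd \<rho> \<sigma>))" "vec_set v \<subseteq> K" "elements_mat x \<subseteq> K"
        unfolding exotic_orbit_def exotic_cone_def rational_pairs_def by auto
      have "x \<in> carrier_mat M M" using c(2) unfolding nilpotent_mats_def by auto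
      then have "x \<in> nilp (padd \<rho> \<sigma>)" unfolding nilp_def using alternating_rational c by blast
      then show False using False c by blast
    qed
    then show ?thesis using False by blast
  qed
  then show ?thesis by auto
qed

lemma klin_expand:
  assumes g: "klin VK g" and f: "f \<in> VK"
  shows "g f = (\<Sum>i<M. sc (f i) (g (uvec i)))"
proof -
  have "(\<Sum>i<m. sc (f i) (uvec i)) \<in> VK \<and> g (\<Sum>i<m. sc (f i) (uvec i)) = (\<Sum>i<m. sc (f i) (g (uvec i)))" if "m \<le> M" for m
    using that
  proof (induction m)
    case 0
    show ?case unfolding lessThan_0 sum.empty using klinD'(1)[OF g ksub_VK] ksubD(2)[OF ksub_VK] by blast
  next
    case (Suc m)
    then have IH: "(\<Sum>i<m. sc (f i) (uvec i)) \<in> VK" "g (\<Sum>i<m. sc (f i) (uvec i)) = (\<Sum>i<m. sc (f i) (g (uvec i)))" by auto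
    have m: "m < M" using Suc(2) by simp
    have u: "uvec m \<in> VK" "f m \<in> K" "sc (f m) (uvec m) \<in> VK"
      using uvec_VK[OF m] f m ksubD(4)[OF ksub_VK _ uvec_VK[OF m]] unfolding VK_def by blast+
    show ?case unfolding sum.lessThan_Suc
      using ksubD(3)[OF ksub_VK IH(1) u(3)] klinD(2)[OF g IH(1) u(3)] klinD(3)[OF g u(2,1)] IH(2) by metis
  qed
  then have "g (\<Sum>i<M. sc (f i) (uvec i)) = (\<Sum>i<M. sc (f i) (g (uvec i)))" by blast
  then show ?thesis unfolding VA_expand[OF VK_VA[OF f], symmetric] .
qed

lemma card_nilp:
  assumes \<pi>: "is_partition \<pi>"
  shows "card (nilp \<pi>) = card (ranked VK Bf (drank \<pi>))"
proof -
  define R where "R x = (\<lambda>f. if f \<in> VK then mop M x f else 0)" for x :: "'a mat"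
  have Rpow: "(R x ^^ j) f = (mop M x ^^ j) f \<and> (R x ^^ j) f \<in> VK" if x: "ratop (mop M x)" and f: "f \<in> VK" for x f j
    by (induction j) (use x f in \<open>auto simp: R_def ratop_def\<close>)
  have Rim: "(R x ^^ j) ` VK = (mop M x ^^ j) ` VK" if "ratop (mop M x)" for x j
    by (rule image_cong[OF refl]) (use Rpow[OF that] in blast)
  have bb: "boxes_beyond (pdouble \<pi>) j = drank \<pi> j" for j by (rule boxes_beyond_pdouble[OF \<pi>])
  have "bij_betw R (nilp \<pi>) (ranked VK Bf (drank \<pi>))"
  proof (rule bij_betw_byWitness[where f' = "matr M"])
    show "\<forall>x\<in>nilp \<pi>. matr M (R x) = x"
    proof
      fix x assume "x \<in> nilp \<pi>"
      then have x: "x \<in> carrier_mat M M" by (rule nilp_carrier)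
      show "matr M (R x) = x" unfolding matr_def R_def
        by (rule eq_matI) (use x mop_uvec[OF x] uvec_VK in auto)
    qed
    have matr_op: "mop M (matr M g) f = g f" if g: "klin VK g" and f: "f \<in> VK" for g f
    proof
      fix i
      have gi: "g (uvec j) \<in> VK" if "j < M" for j using klinD(1)[OF g uvec_VK[OF that]] .
      show "mop M (matr M g) f i = g f i"
      proof (cases "i < M")
        case True
        have "mop M (matr M g) f i = (\<Sum>j<M. f j * g (uvec j) i)"
          unfolding mop_def matr_def using True by (simp add: mult.commute)
        then show ?thesis unfolding klin_expand[OF g f] sum_apply sc_def .
      next
        case False
        then show ?thesis using klinD(1)[OF g f] unfolding mop_def VK_def by simp
      qed
    qed
    show "\<forall>g\<in>ranked VK Bf (drank \<pi>). R (matr M g) = g"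
      using matr_op unfolding ranked_def alt_endos_def R_def by (auto simp: fun_eq_iff)
    show "R ` nilp \<pi> \<subseteq> ranked VK Bf (drank \<pi>)"
    proof
      fix g assume "g \<in> R ` nilp \<pi>"
      then obtain x where x: "x \<in> nilp \<pi>" "g = R x" by auto
      have xc: "x \<in> carrier_mat M M" "elements_mat x \<subseteq> K" "x \<in> nilpotent_mats M"
        using nilp_carrier[OF x(1)] x(1) unfolding nilp_def by auto
      have r: "ratop (mop M x)" by (rule mop_ratop[OF xc(1,2)])
      have k: "klin VK (R x)"
        unfolding klin_def R_def using ratop_klin[OF r] ksubD(3,4)[OF ksub_VK] unfolding klin_def by simp
      have "\<forall>j. card ((R x ^^ j) ` VK) = card K ^ drank \<pi> j"
        using jordan_type_iff(2)[OF xc partition_pdouble[OF \<pi>]] x(1) unfolding Rim[OF r] bb nilp_def by blast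
      moreover have "\<forall>f\<in>VK. Bf (R x f) f = 0" using x(1) unfolding nilp_def R_def by simp
      ultimately show "g \<in> ranked VK Bf (drank \<pi>)" unfolding x(2) ranked_def alt_endos_def using k by (simp add: R_def)
    qed
    show "matr M ` ranked VK Bf (drank \<pi>) \<subseteq> nilp \<pi>"
    proof
      fix x assume "x \<in> matr M ` ranked VK Bf (drank \<pi>)"
      then obtain g where g: "g \<in> ranked VK Bf (drank \<pi>)" "x = matr M g" by auto
      then have k: "klin VK g" "\<forall>v\<in>VK. Bf (g v) v = 0" unfolding ranked_def alt_endos_def by auto
      have xc: "x \<in> carrier_mat M M" unfolding g(2) by simp
      have xK: "elements_mat x \<subseteq> K"
      proof
        fix c assume "c \<in> elements_mat x"
        then obtain i j where ij: "i < M" "j < M" "c = x $$ (i, j)" using xc by (auto dest!: elements_matD)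
        then show "c \<in> K" unfolding g(2) matr_def using klinD(1)[OF k(1) uvec_VK[OF ij(2)]] unfolding VK_def by simp
      qed
      have r: "ratop (mop M x)" by (rule mop_ratop[OF xc xK])
      have gR: "R x = g"
        using matr_op[OF k(1)] g(1) unfolding ranked_def alt_endos_def R_def g(2) by (auto simp: fun_eq_iff)
      have cards: "card ((mop M x ^^ j) ` VK) = card K ^ drank \<pi> j" for j
      proof -
        have "card ((g ^^ j) ` VK) = card K ^ drank \<pi> j" using g(1) unfolding ranked_def by blast
        then show ?thesis unfolding Rim[OF r, of j, unfolded gR] .
      qed
      have xn: "x \<in> nilpotent_mats M"
      proof -
        let ?m = "\<pi> 0"
        have "boxes_beyond \<pi> ?m = 0" unfolding boxes_beyond_def using partition_antimono[OF \<pi>, of 0] by simp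
        then have "card ((mop M x ^^ ?m) ` VK) = 1" using cards[of ?m] by simp
        then obtain z where z: "(mop M x ^^ ?m) ` VK = {z}" by (rule card_1_singletonE)
        have "(mop M x ^^ ?m) 0 = 0" by (rule alinD(3)[OF alin_pow[OF mop_alin]])
        then have "z = 0" using z ksubD(2)[OF ksub_VK] by (metis imageI singletonD)
        then have zero: "(mop M x ^^ ?m) f = 0" if "f \<in> VK" for f using z that by blast
        have "x ^\<^sub>m ?m = 0\<^sub>m M M"
        proof (rule mop_ext)
          fix r assume r: "r < M"
          have u: "(unit_vec M r :: 'a vec) \<in> carrier_vec M" by simp
          have "mop M (x ^\<^sub>m ?m) (fv (unit_vec M r)) = fv ((x ^\<^sub>m ?m) *\<^sub>v unit_vec M r)"
            by (rule fv_mult[OF pow_carrier_mat[OF xc] u, symmetric])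
          also have "\<dots> = (mop M x ^^ ?m) (fv (unit_vec M r))" by (rule fv_pow[OF xc u])
          also have "\<dots> = 0" unfolding fv_unit[OF r] by (rule zero[OF uvec_VK[OF r]])
          finally have "mop M (x ^\<^sub>m ?m) (uvec r) = 0" unfolding fv_unit[OF r] .
          moreover have "mop M (0\<^sub>m M M) (uvec r) = (0 :: nat \<Rightarrow> 'a)" by (rule ext) (simp add: mop_def)
          ultimately show "mop M (x ^\<^sub>m ?m) (uvec r) = mop M (0\<^sub>m M M) (uvec r)" by simp
        qed (rule pow_carrier_mat[OF xc], rule zero_carrier_mat)
        then show ?thesis unfolding nilpotent_mats_def using xc by blast
      qed
      have "has_jordan_type x (pdouble \<pi>)"
        unfolding jordan_type_iff(2)[OF xc xK xn partition_pdouble[OF \<pi>]] bb using cards by blast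
      moreover have "\<forall>f\<in>VK. Bf (mop M x f) f = 0" using k(2) matr_op[OF k(1)] unfolding g(2) by simp
      ultimately show "x \<in> nilp \<pi>" unfolding nilp_def using xn xK by blast
    qed
  qed
  then show ?thesis by (rule bij_betw_same_card)
qed

lemma finite_nilp: "is_partition \<pi> \<Longrightarrow> finite (nilp \<pi>)"
proof -
  have "finite {x \<in> carrier_mat M M. elements_mat x \<subseteq> K}"
  proof (rule finite_subset)
    show "{x \<in> carrier_mat M M. elements_mat x \<subseteq> K} \<subseteq> (\<lambda>F. mat M M F) ` (({..<M} \<times> {..<M}) \<rightarrow>\<^sub>E K)"
    proof
      fix x assume x: "x \<in> {x \<in> carrier_mat M M. elements_mat x \<subseteq> K}"
      let ?F = "restrict (\<lambda>p. x $$ p) ({..<M} \<times> {..<M})"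
      have "?F \<in> ({..<M} \<times> {..<M}) \<rightarrow>\<^sub>E K" using x by auto
      moreover have "x = mat M M ?F" using x by (intro eq_matI) auto
      ultimately show "x \<in> (\<lambda>F. mat M M F) ` (({..<M} \<times> {..<M}) \<rightarrow>\<^sub>E K)" by blast
    qed
  qed (use finite_K in \<open>intro finite_imageI finite_PiE; simp\<close>)
  then show ?thesis by (rule rev_finite_subset) (auto simp: nilp_def nilpotent_mats_def)
qed

lemma card_vectors: "card {v \<in> carrier_vec M. vec_set v \<subseteq> K \<and> P (fv v)} = card {f \<in> VK. P f}"
proof -
  have "bij_betw fv {v \<in> carrier_vec M. vec_set v \<subseteq> K \<and> P (fv v)} {f \<in> VK. P f}"
  proof (rule bij_betw_imageI)
    show "inj_on fv {v \<in> carrier_vec M. vec_set v \<subseteq> K \<and> P (fv v)}"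
    proof (rule inj_onI)
      fix u v assume "u \<in> {v \<in> carrier_vec M. vec_set v \<subseteq> K \<and> P (fv v)}"
        "v \<in> {v \<in> carrier_vec M. vec_set v \<subseteq> K \<and> P (fv v)}" "fv u = fv v"
      then show "u = v" using fv_inj[of u M v] by blast
    qed
    show "fv ` {v \<in> carrier_vec M. vec_set v \<subseteq> K \<and> P (fv v)} = {f \<in> VK. P f}"
    proof (intro equalityI subsetI)
      fix f assume f: "f \<in> {f \<in> VK. P f}"
      then have e: "fv (vec M f) = f" using fv_vec[OF VK_VA, of f] by simp
      have "vec_set (vec M f) \<subseteq> K" using iffD1[OF fv_VK[OF vec_carrier], of f] f unfolding e by blast
      then have "vec M f \<in> {v \<in> carrier_vec M. vec_set v \<subseteq> K \<and> P (fv v)}" using f e by simp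
      from imageI[OF this, of fv] show "f \<in> fv ` {v \<in> carrier_vec M. vec_set v \<subseteq> K \<and> P (fv v)}" unfolding e .
    next
      fix f assume "f \<in> fv ` {v \<in> carrier_vec M. vec_set v \<subseteq> K \<and> P (fv v)}"
      then obtain v where v: "v \<in> carrier_vec M" "vec_set v \<subseteq> K" "P (fv v)" "f = fv v" by blast
      then show "f \<in> {f \<in> VK. P f}" using fv_VK[OF v(1)] by simp
    qed
  qed
  then show ?thesis by (rule bij_betw_same_card)
qed

text \<open>The number of operators times the number of vectors with the given depths: the second factor depends only on the Jordan type of the operator.\<close>

theorem card_exotic_orbit:
  assumes b: "(\<rho>, \<sigma>) \<in> bipartitions n"
  shows "int (card (exotic_orbit n B \<rho> \<sigma> \<inter> rational_pairs K)) * poly (type_denominator n (padd \<rho> \<sigma>)) (int (card K)) =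
    poly (type_numerator n (padd \<rho> \<sigma>)) (int (card K)) * poly (half_count (padd \<rho> \<sigma>) \<rho>) (int (card K))"
proof -
  let ?\<pi> = "padd \<rho> \<sigma>"
  have p: "is_partition \<rho>" "is_partition \<sigma>" "psize \<rho> + psize \<sigma> = n" using b unfolding bipartitions_def by auto
  have \<pi>: "is_partition ?\<pi>" by (rule partition_padd[OF p(1,2)])
  let ?V = "\<lambda>x. {v \<in> carrier_vec M. vec_set v \<subseteq> K \<and> (\<forall>i. depth (VA M) (mop M x) (?\<pi> i) (fv v) = \<rho> i)}"
  have fin: "finite (?V x)" for x
  proof -
    have "finite (fv -` VK \<inter> carrier_vec M)"
      by (rule finite_vimage_IntI[OF ksubD(1)[OF ksub_VK]]) (use fv_inj in \<open>auto intro!: inj_onI\<close>)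
    then show ?thesis by (rule rev_finite_subset) (auto simp: fv_VK)
  qed
  have cV: "int (card (?V x)) = poly (half_count ?\<pi> \<rho>) (int (card K))" if x: "x \<in> nilp ?\<pi>" for x
  proof -
    obtain e \<psi> where J: "jordan_coords K M (mop M x) (plen (pdouble ?\<pi>)) e (pdouble ?\<pi>) \<psi>"
      using nilp_jordan[OF x \<pi>] by blast
    have "(\<lambda>i. ?\<pi> i - \<rho> i) = \<sigma>" unfolding padd_def by auto
    then show ?thesis
      unfolding card_vectors[of "\<lambda>f. \<forall>i. depth (VA M) (mop M x) (?\<pi> i) f = \<rho> i"]
      by (intro card_depth[OF J \<pi> p(1)]) (use p(2) in \<open>auto simp: padd_def\<close>)
  qed
  have "bij_betw (\<lambda>(x, v). (v, x)) (SIGMA x:nilp ?\<pi>. ?V x) (exotic_orbit n B \<rho> \<sigma> \<inter> rational_pairs K)"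
    unfolding exotic_orbit_rational[OF b]
    by (rule bij_betw_byWitness[where f' = "\<lambda>(v, x). (x, v)"]) auto
  then have "card (exotic_orbit n B \<rho> \<sigma> \<inter> rational_pairs K) = card (SIGMA x:nilp ?\<pi>. ?V x)"
    by (simp add: bij_betw_same_card)
  also have "\<dots> = (\<Sum>x\<in>nilp ?\<pi>. card (?V x))" by (rule card_SigmaI) (use finite_nilp[OF \<pi>] fin in auto)
  finally have "int (card (exotic_orbit n B \<rho> \<sigma> \<inter> rational_pairs K)) = (\<Sum>x\<in>nilp ?\<pi>. int (card (?V x)))" by simp
  also have "\<dots> = (\<Sum>x\<in>nilp ?\<pi>. poly (half_count ?\<pi> \<rho>) (int (card K)))" by (rule sum.cong[OF refl cV])
  finally have "int (card (exotic_orbit n B \<rho> \<sigma> \<inter> rational_pairs K)) =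
    int (card (nilp ?\<pi>)) * poly (half_count ?\<pi> \<rho>) (int (card K))" by simp
  moreover have "int (card (nilp ?\<pi>)) * poly (type_denominator n ?\<pi>) (int (card K)) = poly (type_numerator n ?\<pi>) (int (card K))"
    unfolding card_nilp[OF \<pi>]
    by (rule card_ranked[OF ksub_VK Bf_altform Bf_nondegenerate card_VK \<pi>]) (use psize_padd[OF p(1,2)] p(3) in simp)
  ultimately show ?thesis by (simp add: ac_simps)
qed

end

section \<open>Elements of the orthogonal Lie algebra as pairs\<close>

definition consf :: "'a \<Rightarrow> (nat \<Rightarrow> 'a) \<Rightarrow> nat \<Rightarrow> 'a" where
  "consf a f = (\<lambda>i. case i of 0 \<Rightarrow> a | Suc i \<Rightarrow> f i)"

lemma consf_simps [simp]: "consf a f 0 = a" "consf a f (Suc i) = f i"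
  unfolding consf_def by auto

lemma consf_eq [simp]: "consf a f = consf b g \<longleftrightarrow> a = b \<and> f = g"
proof
  assume h: "consf a f = consf b g"
  have "f i = g i" for i using fun_cong[OF h, of "Suc i"] by simp
  then show "a = b \<and> f = g" using fun_cong[OF h, of 0] by auto
qed auto

lemma consf_zero: "consf a f = 0 \<longleftrightarrow> a = 0 \<and> f = 0"
proof -
  have "(0 :: nat \<Rightarrow> 'a::zero) = consf 0 0" by (auto simp: fun_eq_iff consf_def split: nat.split)
  then show ?thesis by (metis consf_eq)
qed

lemma consf_minus: "consf a f - consf b g = consf (a - b) (f - g)" for a b :: "'a::ab_group_add"
  by (auto simp: fun_eq_iff consf_def split: nat.split)

lemma consf_surj: "\<exists>a f. h = consf a f"
  by (intro exI[of _ "h 0"] exI[of _ "\<lambda>i. h (Suc i)"]) (auto simp: fun_eq_iff consf_def split: nat.split)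

lemma consf_VA: "consf a f \<in> VA (Suc M) \<longleftrightarrow> f \<in> VA M"
proof -
  have "(\<forall>i\<ge>Suc M. consf a f i = 0) \<longleftrightarrow> (\<forall>i\<ge>M. f i = 0)"
    by (metis Suc_le_D Suc_le_mono consf_simps(2))
  then show ?thesis unfolding VA_def by simp
qed

text \<open>In characteristic two the polar form of \<open>quad n\<close> is alternating, and it carries both sides of the comparison.\<close>

locale orth_setting = exotic_setting K n "polar (quad n)" for K :: "'a::alg_closed_field set" and n +
  assumes char2: "CHAR('a) = 2"
begin

lemma two0: "a + a = (0 :: 'a)"
proof -
  have "(2 :: 'a) = 0" using of_nat_CHAR[where ?'a = 'a] unfolding char2 by simp
  then show ?thesis by (metis mult_2 mult_zero_left)
qed

lemma uminus2: "- a = (a :: 'a)" using two0[of a] by (simp add: eq_neg_iff_add_eq_0 minus_equation_iff)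

lemma sq_add: "(a + b)\<^sup>2 = a\<^sup>2 + (b :: 'a)\<^sup>2"
  using two0[of "a * b"] by (simp add: power2_eq_square algebra_simps)

lemma sq_inj: "a\<^sup>2 = (b :: 'a)\<^sup>2 \<longleftrightarrow> a = b"
  using power2_eq_iff[of a b] uminus2 by auto

definition qf :: "(nat \<Rightarrow> 'a) \<Rightarrow> 'a" where "qf f = quad n (vec M f)"

lemma qf_add: "qf (f + g) = qf f + qf g + Bf f g"
  unfolding qf_def Bf_def polar_def by (simp add: vec_lin)

lemma qf_scale: "qf (sc c f) = c\<^sup>2 * qf f"
  unfolding qf_def quad_def vec_lin by (auto simp: sum_distrib_left power2_eq_square intro!: sum.cong)

lemma qf_zero: "qf 0 = 0" using qf_scale[of 0 0] by simp

lemma qf_K: "f \<in> VK \<Longrightarrow> qf f \<in> K"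
  unfolding qf_def quad_def VK_def by (intro K_sum) auto

text \<open>The matrix of \<open>a e0 + f \<mapsto> B(v, f) e0 + x f\<close> with \<open>e0\<close> at position zero.\<close>

definition ymat :: "'a vec \<Rightarrow> 'a mat \<Rightarrow> 'a mat" where
  "ymat v x = mat (Suc M) (Suc M) (\<lambda>(i, j). if j = 0 then 0
     else if i = 0 then Bf (fv v) (uvec (j - 1)) else x $$ (i - 1, j - 1))"

lemma ymat_carrier: "ymat v x \<in> carrier_mat (Suc M) (Suc M)" unfolding ymat_def by simp

lemma ymat_op:
  assumes f: "f \<in> VA M"
  shows "mop (Suc M) (ymat v x) (consf a f) = consf (Bf (fv v) f) (mop M x f)"
proof
  fix i
  have s: "(\<Sum>j<Suc M. F j * consf a f j) = F 0 * a + (\<Sum>j<M. F (Suc j) * f j)" for F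
    unfolding sum.lessThan_Suc_shift by simp
  have B: "Bf (fv v) f = (\<Sum>j<M. Bf (fv v) (uvec j) * f j)"
    by (subst VA_expand[OF f]) (simp add: afun_sum[OF Bf_afun(1)] afunD(2)[OF Bf_afun(1)] mult.commute)
  show "mop (Suc M) (ymat v x) (consf a f) i = consf (Bf (fv v) f) (mop M x f) i"
  proof (cases i)
    case 0
    have "(\<Sum>j<Suc M. ymat v x $$ (0, j) * consf a f j) = Bf (fv v) f"
      unfolding s B by (simp add: ymat_def)
    then show ?thesis unfolding mop_def 0 by (simp del: sum.lessThan_Suc)
  next
    case (Suc k)
    have "(\<Sum>j<Suc M. ymat v x $$ (i, j) * consf a f j) = (\<Sum>j<M. x $$ (k, j) * f j)" if "k < M"
      unfolding s using that Suc by (simp add: ymat_def)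
    then show ?thesis unfolding mop_def using Suc by (simp del: sum.lessThan_Suc)
  qed
qed

lemma ymat_pow:
  assumes f: "f \<in> VA M"
  shows "(mop (Suc M) (ymat v x) ^^ Suc j) (consf a f) = consf (Bf (fv v) ((mop M x ^^ j) f)) ((mop M x ^^ Suc j) f)"
proof (induction j)
  case 0
  then show ?case using ymat_op[OF f] by simp
next
  case (Suc j)
  have "(mop M x ^^ Suc j) f \<in> VA M" unfolding funpow.simps o_apply by (rule mop_VA)
  from ymat_op[OF this] show ?case using Suc by (simp only: funpow.simps(2)[of "Suc j"] o_apply)
qed

lemma quad_ext_fv:
  assumes u: "u \<in> carrier_vec (Suc M)" "fv u = consf a f"
  shows "quad_ext n u = a\<^sup>2 + qf f"
proof -
  have "u $ 0 = a" using fun_cong[OF u(2), of 0] u(1) unfolding fv_def by simp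
  moreover have "vec_last u M = vec M f"
  proof (rule eq_vecI)
    fix i assume "i < dim_vec (vec M f)"
    then have i: "i < M" by simp
    then show "vec_last u M $ i = vec M f $ i"
      using fun_cong[OF u(2), of "Suc i"] u(1) unfolding fv_def vec_last_def by simp
  qed simp
  ultimately show ?thesis unfolding quad_ext_def qf_def by simp
qed

sublocale Y: coord_space K "Suc M" by unfold_locales

lemma Y_VK: "consf a f \<in> Y.VK \<longleftrightarrow> a \<in> K \<and> f \<in> VK"
proof -
  have "(\<forall>i<Suc M. consf a f i \<in> K) \<longleftrightarrow> a \<in> K \<and> (\<forall>i<M. f i \<in> K)" by (auto simp: less_Suc_eq_0_disj)
  moreover have "(\<forall>i\<ge>Suc M. consf a f i = 0) \<longleftrightarrow> (\<forall>i\<ge>M. f i = 0)"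
    by (metis Suc_le_D Suc_le_mono consf_simps(2))
  ultimately show ?thesis unfolding Y.VK_def VK_def by auto
qed

text \<open>Rational points suffice for the condition on the form, by the rational Jordan basis of the matrix.\<close>

definition cone_mats :: "'a mat set" where
  "cone_mats = {x \<in> nilpotent_mats M. elements_mat x \<subseteq> K \<and> (\<forall>f\<in>VK. Bf (mop M x f) f = 0)}"

lemma cone_matsD:
  assumes "x \<in> cone_mats"
  shows "x \<in> carrier_mat M M" "elements_mat x \<subseteq> K" "x \<in> nilpotent_mats M" "\<forall>f\<in>VK. Bf (mop M x f) f = 0"
    "ratop (mop M x)" "klin VK (mop M x)"
  using assms mop_ratop[of x] ratop_klin[of "mop M x"] unfolding cone_mats_def nilpotent_mats_def by auto

lemma nilp_iff: "x \<in> nilp \<pi> \<longleftrightarrow> x \<in> cone_mats \<and> has_jordan_type x (pdouble \<pi>)"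
  unfolding nilp_def cone_mats_def by auto

definition rat_vecs :: "'a vec set" where
  "rat_vecs = {v \<in> carrier_vec M. vec_set v \<subseteq> K}"

lemma rat_vecs_fv: "v \<in> carrier_vec M \<Longrightarrow> v \<in> rat_vecs \<longleftrightarrow> fv v \<in> VK"
  unfolding rat_vecs_def using fv_VK by simp

lemma ymat_rational:
  assumes "v \<in> rat_vecs" "x \<in> cone_mats"
  shows "elements_mat (ymat v x) \<subseteq> K"
proof
  fix c assume "c \<in> elements_mat (ymat v x)"
  then obtain i j where ij: "i < Suc M" "j < Suc M" "c = ymat v x $$ (i, j)"
    using ymat_carrier[of v x] by (auto dest!: elements_matD)
  have v: "fv v \<in> VK" using assms(1) rat_vecs_fv unfolding rat_vecs_def by blast
  have "x $$ (i', j') \<in> K" if "i' < M" "j' < M" for i' j'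
    using cone_matsD(2)[OF assms(2)] elements_matI[OF cone_matsD(1)[OF assms(2)] that refl] by blast
  then show "c \<in> K" unfolding ij(3) ymat_def using ij(1,2) Bf_K[OF v uvec_VK] by auto
qed

lemma polar_ext:
  fixes w w' :: "'a vec"
  assumes "w \<in> carrier_vec M" "w' \<in> carrier_vec M"
  shows "polar (quad_ext n) (vCons a w) (vCons 0 w') = polar (quad n) w w'"
proof -
  have l: "vec_last (vCons a w) M = w" if "w \<in> carrier_vec M" for a :: 'a and w
    using that by (intro eq_vecI) (auto simp: vec_last_def)
  have "vCons a w + vCons 0 w' = vCons a (w + w')" 
    using assms by (intro eq_vecI) (auto simp: vec_index_vCons)
  then show ?thesis unfolding polar_def quad_ext_def
    by (simp add: l[OF assms(1), of a] l[OF assms(2), of 0] l[OF add_carrier_vec[OF assms], of a] power2_eq_square)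
qed

lemma fv_vCons: "w \<in> carrier_vec m \<Longrightarrow> fv (vCons a w) = consf a (fv w)"
  unfolding fv_def consf_def by (auto simp: fun_eq_iff split: nat.split)

lemma mop_nilpotent:
  fixes x :: "'a mat"
  assumes x: "x \<in> carrier_mat m m" and z: "\<And>j. j < m \<Longrightarrow> (mop m x ^^ k) (uvec j) = 0"
  shows "x ^\<^sub>m k = 0\<^sub>m m m"
proof (rule mop_ext[OF pow_carrier_mat[OF x] zero_carrier_mat])
  fix r assume r: "r < m"
  have "mop m (x ^\<^sub>m k) (fv (unit_vec m r :: 'a vec)) = (mop m x ^^ k) (fv (unit_vec m r))"
    using fv_mult[OF pow_carrier_mat[OF x, of k], of "unit_vec m r"] fv_pow[OF x, of "unit_vec m r" k] by simp
  then have "mop m (x ^\<^sub>m k) (uvec r) = 0" unfolding fv_unit[OF r] z[OF r] .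
  also have "0 = mop m (0\<^sub>m m m) (uvec r)" unfolding mop_def by (auto simp: fun_eq_iff)
  finally show "mop m (x ^\<^sub>m k) (uvec r) = mop m (0\<^sub>m m m) (uvec r)" .
qed

text \<open>An element of the Lie algebra kills \<open>e0\<close>, so its block below the first row is an operator \<open>x\<close> on the symplectic space, and the first row is a functional, represented by a unique vector \<open>v\<close> because the form is nondegenerate. The component along \<open>e0\<close> is in the radical and the condition on the form concerns \<open>x\<close> alone.\<close>

lemma ymat_bij:
  "bij_betw (\<lambda>(v, x). ymat v x) (rat_vecs \<times> cone_mats)
     (orthogonal_lie n \<inter> nilpotent_mats (Suc M) \<inter> rational_mats K)"
proof (rule bij_betw_imageI)
  have mv: "ymat v x *\<^sub>v vCons a w = vCons (Bf (fv v) (fv w)) (x *\<^sub>v w)"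
    if x: "x \<in> carrier_mat M M" and w: "w \<in> carrier_vec M" for v x a w
  proof -
    have u: "vCons a w \<in> carrier_vec (Suc M)" using w by simp
    have "fv (ymat v x *\<^sub>v vCons a w) = consf (Bf (fv v) (fv w)) (mop M x (fv w))"
      using fv_mult[OF ymat_carrier u] ymat_op[OF fv_VA[OF w]] fv_vCons[OF w] by simp
    also have "\<dots> = fv (vCons (Bf (fv v) (fv w)) (x *\<^sub>v w))"
      using fv_vCons[OF mult_mat_vec_carrier[OF x w]] fv_mult[OF x w] by simp
    finally show ?thesis
      using fv_inj[OF mult_mat_vec_carrier[OF ymat_carrier u], of "vCons (Bf (fv v) (fv w)) (x *\<^sub>v w)"]
        mult_mat_vec_carrier[OF x w] by simp
  qed
  show "inj_on (\<lambda>(v, x). ymat v x) (rat_vecs \<times> cone_mats)"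
  proof (rule inj_onI, clarify)
    fix v x v' x' assume a: "v \<in> rat_vecs" "x \<in> cone_mats" "v' \<in> rat_vecs" "x' \<in> cone_mats" "ymat v x = ymat v' x'"
    have x: "x \<in> carrier_mat M M" "x' \<in> carrier_mat M M" and v: "v \<in> carrier_vec M" "v' \<in> carrier_vec M"
      using a cone_matsD(1) unfolding rat_vecs_def by auto
    have e: "ymat v x $$ (i, j) = ymat v' x' $$ (i, j)" for i j using a(5) by simp
    have "x = x'"
    proof (rule eq_matI)
      fix i j assume "i < dim_row x'" "j < dim_col x'"
      then show "x $$ (i, j) = x' $$ (i, j)" using e[of "Suc i" "Suc j"] x unfolding ymat_def by simp
    qed (use x in auto)
    moreover have "Bf (fv v) (uvec j) = Bf (fv v') (uvec j)" if "j < M" for j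
      using e[of 0 "Suc j"] that unfolding ymat_def by simp
    then have eq: "Bf (fv v) f = Bf (fv v') f" if "f \<in> VA M" for f
      by (intro afun_eqI[OF Bf_afun(1) Bf_afun(1) that])
    have vk: "fv v \<in> VK" "fv v' \<in> VK" using a(1,3) rat_vecs_fv v by auto
    have d: "fv v - fv v' \<in> VK" by (rule ksubD(6)[OF ksub_VK vk])
    have "Bf (fv v - fv v') w = 0" if "w \<in> VK" for w
      unfolding afunD(5)[OF Bf_afun(2)] using eq[OF VK_VA[OF that]] by simp
    then have "fv v - fv v' = 0" using Bf_nondegenerate d unfolding nondegenerate_def by blast
    then have "fv v = fv v'" by (rule iffD2[OF eq_iff_diff_eq_0])
    then have "v = v'" using fv_inj[OF v] by blast
    ultimately show "v = v' \<and> x = x'" by simp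
  qed
  show "(\<lambda>(v, x). ymat v x) ` (rat_vecs \<times> cone_mats) = orthogonal_lie n \<inter> nilpotent_mats (Suc M) \<inter> rational_mats K"
  proof (intro equalityI subsetI)
    fix y assume "y \<in> (\<lambda>(v, x). ymat v x) ` (rat_vecs \<times> cone_mats)"
    then obtain p where p: "y = (\<lambda>(v, x). ymat v x) p" "p \<in> rat_vecs \<times> cone_mats" by (rule imageE)
    obtain v x where vx0: "p = (v, x)" by (cases p)
    have vx: "v \<in> rat_vecs" "x \<in> cone_mats" "y = ymat v x" using p unfolding vx0 by auto
    note C = cone_matsD[OF vx(2)]
    have "y *\<^sub>v unit_vec (Suc M) 0 = 0\<^sub>v (Suc M)"
      unfolding vx(3) ymat_def by (intro eq_vecI) (auto simp: mult_mat_vec_def)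
    moreover have "polar (quad_ext n) (y *\<^sub>v vCons 0 w) (vCons 0 w) = 0" if w: "w \<in> carrier_vec M" for w
      using mv[OF C(1) w] polar_ext[OF mult_mat_vec_carrier[OF C(1) w] w] alternating_rational[OF C(1-3)] C(4) w
      unfolding vx(3) by simp
    ultimately have o: "y \<in> orthogonal_lie n" unfolding orthogonal_lie_def using ymat_carrier[of v x] vx(3) by simp
    obtain m where m: "x ^\<^sub>m m = 0\<^sub>m M M" using C(3) unfolding nilpotent_mats_def by auto
    have "y ^\<^sub>m Suc m = 0\<^sub>m (Suc M) (Suc M)"
    proof (rule mop_nilpotent)
      show "y \<in> carrier_mat (Suc M) (Suc M)" unfolding vx(3) by (rule ymat_carrier)
      fix j assume j: "j < Suc M"
      obtain a f where af: "(uvec j :: nat \<Rightarrow> 'a) = consf a f" using consf_surj[of "uvec j :: nat \<Rightarrow> 'a"] by blast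
      have "consf a f \<in> VA (Suc M)" unfolding af[symmetric] using uvec_VA[OF j] .
      then have fA: "f \<in> VA M" unfolding consf_VA .
      have z: "(mop M x ^^ m) f = 0" by (rule fv_nilpotent[OF C(1) m fA])
      have z': "(mop M x ^^ Suc m) f = 0" unfolding funpow.simps o_apply z by (rule alinD(3)[OF mop_alin])
      show "(mop (Suc M) y ^^ Suc m) (uvec j) = 0"
        unfolding vx(3) af ymat_pow[OF fA] consf_zero using afunD(3)[OF Bf_afun(1), of "fv v"] z z' by (simp only: simp_thms)
    qed
    then have "\<exists>k. y ^\<^sub>m k = 0\<^sub>m (Suc M) (Suc M)" by (rule exI)
    then have "y \<in> nilpotent_mats (Suc M)"
      using ymat_carrier[of v x] unfolding nilpotent_mats_def vx(3) by (intro CollectI conjI)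
    moreover have "y \<in> rational_mats K" using ymat_rational[OF vx(1,2)] unfolding rational_mats_def vx(3) by (rule CollectI)
    ultimately show "y \<in> orthogonal_lie n \<inter> nilpotent_mats (Suc M) \<inter> rational_mats K"
      using o by (intro IntI)
  next
    fix y assume y: "y \<in> orthogonal_lie n \<inter> nilpotent_mats (Suc M) \<inter> rational_mats K"
    then have yc: "y \<in> carrier_mat (Suc M) (Suc M)" and y0: "y *\<^sub>v unit_vec (Suc M) 0 = 0\<^sub>v (Suc M)"
      and yp: "\<forall>w\<in>carrier_vec M. polar (quad_ext n) (y *\<^sub>v vCons 0 w) (vCons 0 w) = 0" and yK: "elements_mat y \<subseteq> K"
      unfolding orthogonal_lie_def rational_mats_def by auto
    have yK': "y $$ (i, j) \<in> K" if "i < Suc M" "j < Suc M" for i j using yK elements_matI[OF yc that refl] by blast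
    define x where "x = mat M M (\<lambda>(i, j). y $$ (Suc i, Suc j))"
    have xc: "x \<in> carrier_mat M M" unfolding x_def by simp
    have "kfunctional VK (\<lambda>f. \<Sum>j<M. y $$ (0, Suc j) * f j)"
      unfolding kfunctional_def
    proof (intro conjI ballI)
      show "(\<Sum>j<M. y $$ (0, Suc j) * f j) \<in> K" if "f \<in> VK" for f
        using that yK' unfolding VK_def by (intro K_sum K_closed(4)) auto
    next
      show "(\<Sum>j<M. y $$ (0, Suc j) * (f + g) j) = (\<Sum>j<M. y $$ (0, Suc j) * f j) + (\<Sum>j<M. y $$ (0, Suc j) * g j)" for f g
        unfolding sum.distrib[symmetric] by (intro sum.cong) (auto simp: algebra_simps)
      show "(\<Sum>j<M. y $$ (0, Suc j) * sc c f j) = c * (\<Sum>j<M. y $$ (0, Suc j) * f j)" for c f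
        unfolding sum_distrib_left by (intro sum.cong) (auto simp: sc_def)
    qed
    then obtain c where c: "c \<in> VK" "\<forall>f\<in>VK. (\<Sum>j<M. y $$ (0, Suc j) * f j) = Bf c f"
      using extend_functional[OF ksub_VK Bf_altform Bf_nondegenerate ksub_VK order_refl] by blast
    define v where "v = vec M c"
    have fvv: "fv v = c" unfolding v_def by (rule fv_vec[OF VK_VA[OF c(1)]])
    have v: "v \<in> rat_vecs" using rat_vecs_fv[of v] c(1) fvv unfolding v_def by simp
    have y00: "y $$ (i, 0) = 0" if "i < Suc M" for i
    proof -
      have "(y *\<^sub>v unit_vec (Suc M) 0) $ i = 0" unfolding y0 using that by simp
      then show ?thesis using yc that by simp
    qed
    have yx: "y = ymat v x"
    proof (rule eq_matI)
      fix i j assume "i < dim_row (ymat v x)" "j < dim_col (ymat v x)"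
      then have ij: "i < Suc M" "j < Suc M" unfolding ymat_def by auto
      have "y $$ (0, Suc j') = Bf c (uvec j')" if "j' < M" for j'
        using c(2) uvec_VK[OF that] that by (auto simp: uvec_def if_distrib[of "\<lambda>t. _ * t"] cong: if_cong)
      then show "y $$ (i, j) = ymat v x $$ (i, j)"
        using ij y00 by (cases i; cases j) (auto simp: ymat_def x_def fvv)
    qed (use yc in \<open>auto simp: ymat_def\<close>)
    have xK: "elements_mat x \<subseteq> K" unfolding x_def by (auto dest!: elements_matD intro: yK')
    obtain m where m: "y ^\<^sub>m m = 0\<^sub>m (Suc M) (Suc M)" using y unfolding nilpotent_mats_def by auto
    have xn: "x ^\<^sub>m Suc m = 0\<^sub>m M M"
    proof (rule mop_nilpotent[OF xc])
      fix j assume "j < M"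
      then have u: "uvec j \<in> VA M" by (rule uvec_VA)
      have "(mop (Suc M) y ^^ m) (consf 0 (uvec j)) = 0"
        by (rule fv_nilpotent[OF yc m]) (use u in \<open>simp add: consf_VA\<close>)
      then have "(mop (Suc M) y ^^ Suc m) (consf 0 (uvec j)) = 0"
        unfolding funpow.simps o_apply by (simp only: alinD(3)[OF mop_alin])
      then show "(mop M x ^^ Suc m) (uvec j) = 0" unfolding yx ymat_pow[OF u] consf_zero by (rule conjunct2)
    qed
    have "\<exists>k. x ^\<^sub>m k = 0\<^sub>m M M" using xn by (rule exI[of _ "Suc m"])
    then have xnil: "x \<in> nilpotent_mats M" using xc unfolding nilpotent_mats_def by (intro CollectI conjI)
    have "polar (quad n) (x *\<^sub>v w) w = 0" if w: "w \<in> carrier_vec M" for w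
    proof -
      have "polar (quad_ext n) (ymat v x *\<^sub>v vCons 0 w) (vCons 0 w) = 0" using yp w unfolding yx by (rule bspec)
      then show ?thesis unfolding mv[OF xc w] polar_ext[OF mult_mat_vec_carrier[OF xc w] w] .
    qed
    then have "\<forall>f\<in>VK. Bf (mop M x f) f = 0" using alternating_rational[OF xc xK xnil] by simp
    then have "x \<in> cone_mats" unfolding cone_mats_def using xK xnil by (intro CollectI conjI)
    moreover have "y = (\<lambda>(v, x). ymat v x) (v, x)" by (simp only: prod.case yx)
    ultimately show "y \<in> (\<lambda>(v, x). ymat v x) ` (rat_vecs \<times> cone_mats)"
      using v by (intro image_eqI[of _ _ "(v, x)"] SigmaI)
  qed
qed

text \<open>The extra row of the power is the functional \<open>f \<mapsto> B(v, X ^^ j f)\<close>. It raises the rank exactly when it is not a combination of the other rows, that is, when it does not vanish on the kernel of \<open>X ^^ Suc j\<close>.\<close>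

lemma ymat_rank:
  assumes v: "v \<in> rat_vecs" and x: "x \<in> cone_mats"
  shows "card ((mop (Suc M) (ymat v x) ^^ Suc j) ` Y.VK) =
    (if (mop M x ^^ j) (fv v) \<in> (mop M x ^^ Suc j) ` VK then 1 else card K) * card ((mop M x ^^ Suc j) ` VK)"
proof -
  let ?X = "mop M x" and ?v = "fv v"
  note C = cone_matsD[OF x]
  have vK: "?v \<in> VK" using v rat_vecs_fv unfolding rat_vecs_def by blast
  have lin: "alin (?X ^^ j)" for j by (rule alin_pow[OF mop_alin])
  have XK: "(?X ^^ i) f \<in> VK" if "f \<in> VK" for i f using ratop_pow[OF C(5)] that unfolding ratop_def by blast
  define G where "G f = consf (Bf ?v ((?X ^^ j) f)) ((?X ^^ Suc j) f)" for f
  have im: "(mop (Suc M) (ymat v x) ^^ Suc j) ` Y.VK = G ` VK"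
  proof (intro equalityI subsetI)
    fix z assume "z \<in> (mop (Suc M) (ymat v x) ^^ Suc j) ` Y.VK"
    then obtain h where h: "h \<in> Y.VK" "z = (mop (Suc M) (ymat v x) ^^ Suc j) h" by blast
    obtain a f where af: "h = consf a f" using consf_surj[of h] by blast
    have "f \<in> VK" using h(1) unfolding af Y_VK by simp
    then show "z \<in> G ` VK" unfolding h(2) af G_def using ymat_pow[OF VK_VA] by blast
  next
    fix z assume "z \<in> G ` VK"
    then obtain f where f: "f \<in> VK" "z = G f" by blast
    have "consf 0 f \<in> Y.VK" using f(1) unfolding Y_VK by simp
    moreover have "z = (mop (Suc M) (ymat v x) ^^ Suc j) (consf 0 f)" unfolding f(2) G_def ymat_pow[OF VK_VA[OF f(1)]] ..
    ultimately show "z \<in> (mop (Suc M) (ymat v x) ^^ Suc j) ` Y.VK" by blast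
  qed
  let ?k = "{f \<in> VK. (?X ^^ Suc j) f = 0}"
  let ?g = "\<lambda>f. Bf ?v ((?X ^^ j) f)"
  have c1: "card VK = card (G ` VK) * card {f \<in> VK. G f = 0}"
    by (rule card_additive_image_kernel)
      (use ksubD[OF ksub_VK] in \<open>auto simp: G_def consf_minus alinD(5)[OF lin] afunD(5)[OF Bf_afun(1)] simp del: funpow.simps\<close>)
  have c2: "card VK = card ((?X ^^ Suc j) ` VK) * card ?k" by (rule card_klin[OF klin_pow[OF C(6)] ksub_VK])
  have G0: "{f \<in> VK. G f = 0} = {f \<in> ?k. ?g f = 0}" unfolding G_def consf_zero by auto
  have kk: "ksub ?k" by (rule ksub_kernel[OF klin_pow[OF C(6)] ksub_VK])
  have g: "kfunctional ?k ?g" unfolding kfunctional_def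
    using Bf_K[OF vK XK] by (simp add: alinD[OF lin] afunD[OF Bf_afun(1)] del: funpow.simps)
  have sa: "Bf ?v ((?X ^^ i) f) = Bf ((?X ^^ i) ?v) f" if "f \<in> VK" for f i
    by (rule alt_pow(1)[OF ksub_VK Bf_altform C(6,4) vK that, symmetric])
  have pos: "card {f \<in> VK. G f = 0} > 0"
  proof -
    have "0 \<in> {f \<in> VK. G f = 0}" using ksubD(2)[OF ksub_VK] alinD(3)[OF lin] afunD(3)[OF Bf_afun(1)]
      unfolding G_def consf_zero by (simp del: funpow.simps)
    then show ?thesis using ksubD(1)[OF ksub_VK] by (auto simp: card_gt_0_iff)
  qed
  show ?thesis
  proof (cases "(?X ^^ j) ?v \<in> (?X ^^ Suc j) ` VK")
    case True
    then obtain w where w: "w \<in> VK" "(?X ^^ j) ?v = (?X ^^ Suc j) w" by blast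
    have "?g f = 0" if f: "f \<in> ?k" for f
    proof -
      have fV: "f \<in> VK" and fk: "(?X ^^ Suc j) f = 0" using f by (simp_all only: mem_Collect_eq)
      have "?g f = Bf ((?X ^^ Suc j) w) f" unfolding sa[OF fV] w(2) ..
      also have "\<dots> = Bf w 0" unfolding alt_pow(1)[OF ksub_VK Bf_altform C(6,4) w(1) fV, of "Suc j"] fk ..
      finally show ?thesis using afunD(3)[OF Bf_afun(1)] by (rule trans)
    qed
    then have "{f \<in> VK. G f = 0} = ?k" unfolding G0 by blast
    then have "card (G ` VK) * card ?k = card ((?X ^^ Suc j) ` VK) * card ?k" "card ?k \<noteq> 0" using c1 c2 pos by (simp_all only:)
    then have "card (G ` VK) = card ((?X ^^ Suc j) ` VK)" by (simp only: mult_cancel2) simp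
    then show ?thesis unfolding im using True by (simp only: if_True mult_1)
  next
    case False
    have "\<exists>f\<in>?k. ?g f \<noteq> 0"
    proof (rule ccontr)
      assume h: "\<not> (\<exists>f\<in>?k. ?g f \<noteq> 0)"
      have "(?X ^^ j) ?v \<in> (?X ^^ Suc j) ` VK"
      proof (rule image_pow_eq[OF ksub_VK Bf_altform Bf_nondegenerate C(6,4) XK[OF vK]])
        fix w assume w: "w \<in> VK" "(?X ^^ Suc j) w = 0"
        then have "Bf ((?X ^^ j) ?v) w = 0" using h sa[OF w(1), of j] by force
        then show "Bf w ((?X ^^ j) ?v) = 0" using altformD'(7)[OF Bf_altform ksub_VK XK[OF vK] w(1)] by simp
      qed
      then show False using False by blast
    qed
    then have "?g ` ?k = K" using kfunctional_surj[OF g kk] by blast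
    then have "card ?k = card K * card {f \<in> VK. G f = 0}" unfolding G0 using card_kfunctional[OF g kk] by simp
    then have "card (G ` VK) * card {f \<in> VK. G f = 0} = (card K * card ((?X ^^ Suc j) ` VK)) * card {f \<in> VK. G f = 0}"
      using c1 c2 by (simp only: mult_ac)
    then have "card (G ` VK) = card K * card ((?X ^^ Suc j) ` VK)" using pos by (simp only: mult_cancel2) simp
    then show ?thesis unfolding im using False by (simp only: if_False)
  qed
qed

end

section \<open>The quadratic form on kernels of powers\<close>

lemma pow_pow: "(X ^^ i) ((X ^^ j) f) = (X ^^ (i + j)) f"
  by (simp add: funpow_add)

lemma (in kspace) ksub_plus:
  assumes "ksub U" "ksub W"
  shows "ksub {u + w | u w. u \<in> U \<and> w \<in> W}"
proof -
  have e: "{u + w | u w. u \<in> U \<and> w \<in> W} = (\<lambda>(u, w). u + w) ` (U \<times> W)" by auto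
  show ?thesis unfolding ksub_def
  proof (intro conjI ballI)
    show "finite {u + w | u w. u \<in> U \<and> w \<in> W}" unfolding e using ksubD(1)[OF assms(1)] ksubD(1)[OF assms(2)] by simp
    show "0 \<in> {u + w | u w. u \<in> U \<and> w \<in> W}" using ksubD(2)[OF assms(1)] ksubD(2)[OF assms(2)] by force
  next
    fix s t assume "s \<in> {u + w | u w. u \<in> U \<and> w \<in> W}" "t \<in> {u + w | u w. u \<in> U \<and> w \<in> W}"
    then obtain a b c d where h: "a \<in> U" "b \<in> W" "c \<in> U" "d \<in> W" "s = a + b" "t = c + d" by auto
    have "s + t = (a + c) + (b + d)" unfolding h by (simp only: ac_simps)
    then show "s + t \<in> {u + w | u w. u \<in> U \<and> w \<in> W}" using ksubD(3)[OF assms(1) h(1,3)] ksubD(3)[OF assms(2) h(2,4)] by blast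
  next
    fix k s assume k: "k \<in> K" and "s \<in> {u + w | u w. u \<in> U \<and> w \<in> W}"
    then obtain a b where h: "a \<in> U" "b \<in> W" "s = a + b" by auto
    have "k *s s = k *s a + k *s b" unfolding h by (rule scale_right_distrib)
    then show "k *s s \<in> {u + w | u w. u \<in> U \<and> w \<in> W}" using ksubD(4)[OF assms(1) k h(1)] ksubD(4)[OF assms(2) k h(2)] by blast
  qed
qed

context orth_setting
begin

lemma Bf_zero: "Bf f 0 = 0" "Bf 0 f = 0"
  by (rule afunD(3)[OF Bf_afun(1)], rule afunD(3)[OF Bf_afun(2)])

lemma Bf_sym: "Bf f g = Bf g f"
proof -
  have "Bf (f + g) (f + g) = Bf f g + Bf g f"
    unfolding afunD(1)[OF Bf_afun(1)] afunD(1)[OF Bf_afun(2)] by (simp add: Bf_self)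
  then have "Bf f g = - Bf g f" unfolding Bf_self by (simp add: eq_neg_iff_add_eq_0)
  then show ?thesis unfolding uminus2 .
qed

lemma cone_pow:
  assumes x: "x \<in> cone_mats"
  shows "alin (mop M x ^^ j)" "f \<in> VK \<Longrightarrow> (mop M x ^^ j) f \<in> VK"
    "f \<in> VK \<Longrightarrow> g \<in> VK \<Longrightarrow> Bf ((mop M x ^^ j) f) g = Bf f ((mop M x ^^ j) g)"
    "klin VK (mop M x ^^ j)" "mop M x ` VK \<subseteq> VK"
proof -
  note C = cone_matsD[OF x]
  show "alin (mop M x ^^ j)" by (rule alin_pow[OF mop_alin])
  show k: "klin VK (mop M x ^^ j)" by (rule klin_pow[OF C(6)])
  show "f \<in> VK \<Longrightarrow> (mop M x ^^ j) f \<in> VK" by (rule klinD(1)[OF k])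
  show "f \<in> VK \<Longrightarrow> g \<in> VK \<Longrightarrow> Bf ((mop M x ^^ j) f) g = Bf f ((mop M x ^^ j) g)"
    by (rule alt_pow(1)[OF ksub_VK Bf_altform C(6,4)])
  show "mop M x ` VK \<subseteq> VK" using klinD(1)[OF C(6)] by auto
qed

lemma image_pow_detect:
  assumes x: "x \<in> cone_mats" and t: "t \<in> VK"
  shows "t \<in> (mop M x ^^ m) ` VK \<longleftrightarrow> (\<forall>g\<in>VK. (mop M x ^^ m) g = 0 \<longrightarrow> Bf t g = 0)"
proof
  assume "t \<in> (mop M x ^^ m) ` VK"
  then obtain w where w: "w \<in> VK" "t = (mop M x ^^ m) w" by (rule imageE)
  show "\<forall>g\<in>VK. (mop M x ^^ m) g = 0 \<longrightarrow> Bf t g = 0"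
  proof (intro ballI impI)
    fix g assume g: "g \<in> VK" "(mop M x ^^ m) g = 0"
    show "Bf t g = 0" unfolding w(2) cone_pow(3)[OF x w(1) g(1)] g(2) by (rule Bf_zero)
  qed
next
  assume h: "\<forall>g\<in>VK. (mop M x ^^ m) g = 0 \<longrightarrow> Bf t g = 0"
  show "t \<in> (mop M x ^^ m) ` VK"
  proof (rule image_pow_eq[OF ksub_VK Bf_altform Bf_nondegenerate cone_matsD(6,4)[OF x] t])
    fix w assume "w \<in> VK" "(mop M x ^^ m) w = 0"
    then show "Bf w t = 0" unfolding Bf_sym[of w t] using h by blast
  qed
qed

text \<open>For \<open>i \<le> j\<close>, an element of the image of \<open>X ^^ j\<close> is orthogonal to everything that \<open>X ^^ i\<close> kills. So the intersections of image and kernel of the same power are isotropic and orthogonal to each other, and so is their sum.\<close>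

lemma isotropic_span:
  assumes x: "x \<in> cone_mats"
  shows "\<exists>U. ksub U \<and> U \<subseteq> VK \<and> (\<forall>u\<in>U. \<forall>w\<in>U. Bf u w = 0) \<and>
    (\<forall>j. \<forall>z\<in>(mop M x ^^ Suc j) ` VK. (mop M x ^^ Suc j) z = 0 \<longrightarrow> z \<in> U)"
proof -
  define X where "X = mop M x"
  note P = cone_pow[OF x, folded X_def]
  define S where "S j = {z \<in> (X ^^ Suc j) ` VK. (X ^^ Suc j) z = 0}" for j
  have SV: "S j \<subseteq> VK" for j unfolding S_def using P(2)[of _ "Suc j"] by blast
  have S_le: "Bf z w = 0" if z: "z \<in> S i" and w: "w \<in> S j" and ij: "i \<le> j" for z w i j
  proof -
    obtain b where b: "b \<in> VK" "w = (X ^^ Suc j) b" using w unfolding S_def by blast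
    have zi: "(X ^^ Suc i) z = 0" using z unfolding S_def by blast
    have "(X ^^ Suc j) z = (X ^^ (j - i)) ((X ^^ Suc i) z)" unfolding pow_pow using ij by simp
    also have "\<dots> = 0" unfolding zi by (rule alinD(3)[OF P(1)])
    finally have z0: "(X ^^ Suc j) z = 0" .
    have zV: "z \<in> VK" using z SV by blast
    have "Bf z w = Bf ((X ^^ Suc j) z) b" unfolding b(2) by (rule P(3)[OF zV b(1), symmetric])
    then show ?thesis unfolding z0 Bf_zero .
  qed
  have S_orth: "Bf z w = 0" if "z \<in> S i" "w \<in> S j" for z w i j
    using S_le[OF that] S_le[OF that(2,1)] Bf_sym[of z w] by (cases "i \<le> j") auto
  have S_ksub: "ksub (S j)" for j unfolding S_def
  proof (rule ksub_kernel)
    show "ksub ((X ^^ Suc j) ` VK)" by (rule ksub_image[OF P(4) ksub_VK subset_refl ksub_VK])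
    have sub: "(X ^^ Suc j) ` VK \<subseteq> VK" using P(2)[of _ "Suc j"] by blast
    show "klin ((X ^^ Suc j) ` VK) (X ^^ Suc j)" unfolding klin_def
    proof (intro conjI ballI)
      fix u assume "u \<in> (X ^^ Suc j) ` VK"
      then have "u \<in> VK" using sub by blast
      then show "(X ^^ Suc j) u \<in> (X ^^ Suc j) ` VK" by (rule imageI)
    qed (rule alinD(1)[OF P(1)], rule alinD(2)[OF P(1)])
  qed
  have ex: "\<exists>U. ksub U \<and> U \<subseteq> VK \<and> (\<forall>u\<in>U. \<forall>j. \<forall>s\<in>S j. Bf u s = 0) \<and> (\<forall>u\<in>U. \<forall>w\<in>U. Bf u w = 0) \<and> (\<forall>j<D. S j \<subseteq> U)" for D
  proof (induction D)
    case 0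
    have "sc c (0 :: nat \<Rightarrow> 'a) = 0" for c :: 'a by (rule ext) (simp add: sc_def)
    then have "ksub {0}" unfolding ksub_def by simp
    moreover have "{0} \<subseteq> VK" using ksubD(2)[OF ksub_VK] by blast
    moreover have "Bf u s = 0" if "u \<in> {0}" for u s using singletonD[OF that] Bf_zero(2)[of s] by (simp only:)
    ultimately show ?case by (intro exI[of _ "{0}"]) (simp only: less_nat_zero_code simp_thms ball_simps all_simps ball_triv Bf_zero)
  next
    case (Suc D)
    then obtain U where U: "ksub U" "U \<subseteq> VK" "\<forall>u\<in>U. \<forall>j. \<forall>s\<in>S j. Bf u s = 0" "\<forall>u\<in>U. \<forall>w\<in>U. Bf u w = 0" "\<forall>j<D. S j \<subseteq> U"
      by blast
    define U' where "U' = {u + w | u w. u \<in> U \<and> w \<in> S D}"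
    have mem: "\<exists>a b. a \<in> U \<and> b \<in> S D \<and> u = a + b" if "u \<in> U'" for u using that unfolding U'_def by blast
    have inc: "a + b \<in> U'" if "a \<in> U" "b \<in> S D" for a b using that unfolding U'_def by blast
    have us: "Bf u s = 0" if u: "u \<in> U'" and s: "s \<in> S j" for u s j
    proof -
      obtain a b where ab: "a \<in> U" "b \<in> S D" "u = a + b" using mem[OF u] by blast
      show ?thesis unfolding ab(3) afunD(1)[OF Bf_afun(2)] using U(3) ab(1) s S_orth[OF ab(2) s] by auto
    qed
    have "ksub U'" unfolding U'_def by (rule ksub_plus[OF U(1) S_ksub])
    moreover have "U' \<subseteq> VK"
    proof
      fix u assume "u \<in> U'"
      then obtain a b where ab: "a \<in> U" "b \<in> S D" "u = a + b" using mem by blast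
      show "u \<in> VK" unfolding ab(3) using ab(1,2) U(2) SV by (intro ksubD(3)[OF ksub_VK]) auto
    qed
    moreover have "Bf u w = 0" if u: "u \<in> U'" and w: "w \<in> U'" for u w
    proof -
      obtain a b where ab: "a \<in> U" "b \<in> S D" "u = a + b" using mem[OF u] by blast
      obtain c d where cd: "c \<in> U" "d \<in> S D" "w = c + d" using mem[OF w] by blast
      have "Bf u d = 0" by (rule us[OF u cd(2)])
      moreover have "Bf a c = 0" using U(4) ab(1) cd(1) by blast
      moreover have "Bf b c = 0" unfolding Bf_sym[of b c] using U(3) cd(1) ab(2) by blast
      ultimately show ?thesis unfolding cd(3) afunD(1)[OF Bf_afun(1)] unfolding ab(3) afunD(1)[OF Bf_afun(2)] by simp
    qed
    moreover have "S j \<subseteq> U'" if j: "j < Suc D" for j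
    proof
      fix s assume s: "s \<in> S j"
      show "s \<in> U'"
      proof (cases "j = D")
        case True
        then show ?thesis using inc[OF ksubD(2)[OF U(1)], of s] s by simp
      next
        case False
        then have "j < D" using j by simp
        then have "s \<in> U" using s U(5) by blast
        then have "s + 0 \<in> U'" using inc[of s 0] ksubD(2)[OF S_ksub[of D]] by blast
        then show ?thesis unfolding add_0_right .
      qed
    qed
    ultimately show ?case using us by (intro exI[of _ U']) blast
  qed
  obtain D where D: "x ^\<^sub>m D = 0\<^sub>m M M" using cone_matsD(3)[OF x] unfolding nilpotent_mats_def by auto
  obtain U where U: "ksub U" "U \<subseteq> VK" "\<forall>u\<in>U. \<forall>w\<in>U. Bf u w = 0" "\<forall>j<D. S j \<subseteq> U" using ex[of D] by blast
  have "z \<in> U" if z: "z \<in> (X ^^ Suc j) ` VK" "(X ^^ Suc j) z = 0" for j z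
  proof (cases "j < D")
    case True
    have "z \<in> S j" unfolding S_def using z by blast
    then show ?thesis using U(4) True by blast
  next
    case False
    obtain b where b: "b \<in> VK" "z = (X ^^ Suc j) b" using z(1) by (rule imageE)
    have b0: "(X ^^ D) b = 0" unfolding X_def by (rule fv_nilpotent[OF cone_matsD(1)[OF x] D VK_VA[OF b(1)]])
    have e: "Suc j - D + D = Suc j" using False by simp
    have "z = (X ^^ (Suc j - D)) ((X ^^ D) b)" unfolding b(2) pow_pow e ..
    also have "\<dots> = 0" unfolding b0 by (rule alinD(3)[OF P(1)])
    finally show ?thesis using ksubD(2)[OF U(1)] by (simp only:)
  qed
  then show ?thesis using U(1-3) unfolding X_def[symmetric] by (intro exI[of _ U]) blast
qed

text \<open>On a totally isotropic subspace the quadratic form is additive, and squaring is a bijection of a finite field of characteristic two. So the root of the form is a linear functional on the isotropic span, and it extends to one given by a vector.\<close>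

lemma isotropic_root:
  assumes x: "x \<in> cone_mats"
  shows "\<exists>c. c \<in> VK \<and> (\<forall>j. \<forall>z\<in>(mop M x ^^ Suc j) ` VK. (mop M x ^^ Suc j) z = 0 \<longrightarrow> qf z = (Bf c z)\<^sup>2)"
proof -
  obtain U where U: "ksub U" "U \<subseteq> VK" "\<forall>u\<in>U. \<forall>w\<in>U. Bf u w = 0"
    "\<forall>j. \<forall>z\<in>(mop M x ^^ Suc j) ` VK. (mop M x ^^ Suc j) z = 0 \<longrightarrow> z \<in> U"
    using isotropic_span[OF x] by blast
  have surj: "(\<lambda>s. s\<^sup>2) ` K = K"
  proof (rule endo_inj_surj[OF finite_K])
    show "(\<lambda>s. s\<^sup>2) ` K \<subseteq> K" by (auto simp: power2_eq_square intro: K_closed)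
    show "inj_on (\<lambda>s. s\<^sup>2) K" by (rule inj_onI) (simp only: sq_inj)
  qed
  have "\<exists>s\<in>K. s\<^sup>2 = a" if "a \<in> K" for a
  proof -
    have "a \<in> (\<lambda>s. s\<^sup>2) ` K" unfolding surj by (rule that)
    then show ?thesis by blast
  qed
  then obtain r where r: "\<And>a. a \<in> K \<Longrightarrow> r a \<in> K \<and> (r a)\<^sup>2 = a" by metis
  have q: "qf u \<in> K" if "u \<in> U" for u using qf_K that U(2) by blast
  have "kfunctional U (\<lambda>u. r (qf u))" unfolding kfunctional_def
  proof (intro conjI ballI)
    show "r (qf u) \<in> K" if "u \<in> U" for u using r q that by blast
    fix u w assume uw: "u \<in> U" "w \<in> U"
    have "qf (u + w) = qf u + qf w" unfolding qf_add using U(3) uw by simp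
    then have "(r (qf (u + w)))\<^sup>2 = (r (qf u) + r (qf w))\<^sup>2"
      unfolding sq_add using r[OF q[OF uw(1)]] r[OF q[OF uw(2)]] r[OF q[OF ksubD(3)[OF U(1) uw]]] by simp
    then show "r (qf (u + w)) = r (qf u) + r (qf w)" unfolding sq_inj .
  next
    fix c u assume cu: "c \<in> K" "u \<in> U"
    have "(r (qf (sc c u)))\<^sup>2 = (c * r (qf u))\<^sup>2"
      unfolding power_mult_distrib using r[OF q[OF cu(2)]] r[OF q[OF ksubD(4)[OF U(1) cu]]] qf_scale[of c u] by simp
    then show "r (qf (sc c u)) = c * r (qf u)" unfolding sq_inj .
  qed
  then obtain c where c: "c \<in> VK" "\<forall>u\<in>U. r (qf u) = Bf c u"
    using extend_functional[OF ksub_VK Bf_altform Bf_nondegenerate U(1,2)] by blast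
  have "qf z = (Bf c z)\<^sup>2" if "z \<in> U" for z using c(2) r[OF q[OF that]] that by auto
  then show ?thesis using c(1) U(4) by blast
qed

definition isovec :: "'a mat \<Rightarrow> nat \<Rightarrow> 'a" where
  "isovec x = (SOME c. c \<in> VK \<and> (\<forall>j. \<forall>z\<in>(mop M x ^^ Suc j) ` VK. (mop M x ^^ Suc j) z = 0 \<longrightarrow> qf z = (Bf c z)\<^sup>2))"

lemma isovec:
  assumes "x \<in> cone_mats"
  shows "isovec x \<in> VK" "z \<in> (mop M x ^^ Suc j) ` VK \<Longrightarrow> (mop M x ^^ Suc j) z = 0 \<Longrightarrow> qf z = (Bf (isovec x) z)\<^sup>2"
  using someI_ex[OF isotropic_root[OF assms]] unfolding isovec_def[symmetric] by blast+

text \<open>Adding \<open>X c\<close>, where \<open>B c\<close> is the root of the quadratic form on the isotropic span, absorbs the contribution of the quadratic form to the invariants of the orthogonal orbit.\<close>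

definition shift :: "'a mat \<Rightarrow> (nat \<Rightarrow> 'a) \<Rightarrow> nat \<Rightarrow> 'a" where
  "shift x f = f + mop M x (isovec x)"

definition jump :: "'a mat \<Rightarrow> (nat \<Rightarrow> 'a) \<Rightarrow> nat \<Rightarrow> bool" where
  "jump x f j \<longleftrightarrow> (mop M x ^^ j) f \<notin> (mop M x ^^ Suc j) ` VK"

lemma shift_pow:
  assumes x: "x \<in> cone_mats"
  shows "(mop M x ^^ j) (shift x f) = (mop M x ^^ j) f + (mop M x ^^ Suc j) (isovec x)"
  unfolding shift_def alinD(1)[OF cone_pow(1)[OF x]] by (simp only: funpow_Suc_right o_apply)

lemma shift_VK: "x \<in> cone_mats \<Longrightarrow> f \<in> VK \<Longrightarrow> shift x f \<in> VK"
  unfolding shift_def using cone_pow(5)[of x] isovec(1)[of x] by (intro ksubD(3)[OF ksub_VK]) auto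

lemma jump_shift:
  assumes x: "x \<in> cone_mats" and f: "f \<in> VK"
  shows "jump x (shift x f) j \<longleftrightarrow> jump x f j"
proof -
  let ?X = "mop M x" and ?c = "isovec x"
  have k: "ksub ((?X ^^ Suc j) ` VK)" by (rule ksub_image[OF cone_pow(4)[OF x] ksub_VK subset_refl ksub_VK])
  have c: "(?X ^^ Suc j) ?c \<in> (?X ^^ Suc j) ` VK" by (rule imageI[OF isovec(1)[OF x]])
  have "(?X ^^ j) f + (?X ^^ Suc j) ?c \<in> (?X ^^ Suc j) ` VK \<longleftrightarrow> (?X ^^ j) f \<in> (?X ^^ Suc j) ` VK"
    using ksubD(3)[OF k _ c] ksubD(6)[OF k _ c] by (metis add_diff_cancel_right')
  then show ?thesis unfolding jump_def shift_pow[OF x] by (rule arg_cong)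
qed

lemma jump_antimono:
  assumes x: "x \<in> cone_mats" and h: "jump x f j" and ij: "i \<le> j"
  shows "jump x f i"
proof (rule ccontr)
  assume "\<not> jump x f i"
  then obtain w where w: "w \<in> VK" "(mop M x ^^ i) f = (mop M x ^^ Suc i) w" unfolding jump_def by blast
  have "(mop M x ^^ j) f = (mop M x ^^ (j - i)) ((mop M x ^^ i) f)" unfolding pow_pow using ij by simp
  also have "\<dots> = (mop M x ^^ Suc j) w" unfolding w(2) pow_pow using ij by (simp only: add_Suc_right le_add_diff_inverse2)
  finally show False using h w(1) unfolding jump_def by blast
qed

lemma jump_detect:
  assumes x: "x \<in> cone_mats" and f: "f \<in> VK" and h: "jump x f j"
  shows "\<exists>g\<in>VK. (mop M x ^^ Suc j) g = 0 \<and> Bf f ((mop M x ^^ j) g) \<noteq> 0"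
proof -
  obtain g where g: "g \<in> VK" "(mop M x ^^ Suc j) g = 0" "Bf ((mop M x ^^ j) f) g \<noteq> 0"
    using h image_pow_detect[OF x cone_pow(2)[OF x f], of j "Suc j"] unfolding jump_def by blast
  then show ?thesis using cone_pow(3)[OF x f g(1), of j] by metis
qed

text \<open>The condition whose least solution is prescribed by \<open>chi_B2\<close>.\<close>

definition qcond :: "'a vec \<Rightarrow> 'a mat \<Rightarrow> nat \<Rightarrow> nat \<Rightarrow> bool" where
  "qcond v x m j \<longleftrightarrow> (\<forall>w\<in>mat_kernel (ymat v x ^\<^sub>m m). quad_ext n ((ymat v x ^\<^sub>m j) *\<^sub>v w) = 0)"

definition qe :: "(nat \<Rightarrow> 'a) \<Rightarrow> 'a" where "qe h = (h 0)\<^sup>2 + qf (\<lambda>i. h (Suc i))"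

lemma qe_consf: "qe (consf a f) = a\<^sup>2 + qf f" unfolding qe_def by simp

lemma quad_ext_qe: "u \<in> carrier_vec (Suc M) \<Longrightarrow> quad_ext n u = qe (fv u)"
proof -
  assume u: "u \<in> carrier_vec (Suc M)"
  obtain a f where af: "fv u = consf a f" using consf_surj[of "fv u"] by blast
  show ?thesis unfolding af qe_consf by (rule quad_ext_fv[OF u af])
qed

lemma qcond_iff:
  "qcond v x m j \<longleftrightarrow> (\<forall>a. \<forall>f\<in>VA M. (mop (Suc M) (ymat v x) ^^ m) (consf a f) = 0 \<longrightarrow>
     qe ((mop (Suc M) (ymat v x) ^^ j) (consf a f)) = 0)"
proof -
  let ?y = "ymat v x" and ?Y = "mop (Suc M) (ymat v x)"
  have yc: "?y \<in> carrier_mat (Suc M) (Suc M)" by (rule ymat_carrier)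
  have pc: "?y ^\<^sub>m k \<in> carrier_mat (Suc M) (Suc M)" for k by (rule pow_carrier_mat[OF yc])
  have ker: "w \<in> mat_kernel (?y ^\<^sub>m m) \<longleftrightarrow> (?Y ^^ m) (fv w) = 0" if w: "w \<in> carrier_vec (Suc M)" for w
  proof -
    have "(?y ^\<^sub>m m) *\<^sub>v w = 0\<^sub>v (Suc M) \<longleftrightarrow> fv ((?y ^\<^sub>m m) *\<^sub>v w) = 0"
      using fv_inj[OF mult_mat_vec_carrier[OF pc w] zero_carrier_vec, of m] fv_zero[of "Suc M"] by (metis (no_types, lifting))
    then show ?thesis unfolding fv_pow[OF yc w] using mat_kernel[OF pc] w by auto
  qed
  have q: "quad_ext n ((?y ^\<^sub>m j) *\<^sub>v w) = qe ((?Y ^^ j) (fv w))" if w: "w \<in> carrier_vec (Suc M)" for w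
    unfolding quad_ext_qe[OF mult_mat_vec_carrier[OF pc w]] fv_pow[OF yc w] ..
  have kc: "w \<in> carrier_vec (Suc M)" if "w \<in> mat_kernel (?y ^\<^sub>m m)" for w using that mat_kernel[OF pc] by auto
  show ?thesis
  proof
    assume h: "qcond v x m j"
    show "\<forall>a. \<forall>f\<in>VA M. (?Y ^^ m) (consf a f) = 0 \<longrightarrow> qe ((?Y ^^ j) (consf a f)) = 0"
    proof (intro allI ballI impI)
      fix a f assume f: "f \<in> VA M" and z: "(?Y ^^ m) (consf a f) = 0"
      define w where "w = vec (Suc M) (consf a f)"
      have wc: "w \<in> carrier_vec (Suc M)" unfolding w_def by simp
      have fw: "fv w = consf a f" unfolding w_def by (rule fv_vec) (use f consf_VA in blast)
      have "w \<in> mat_kernel (?y ^\<^sub>m m)" unfolding ker[OF wc] fw by (rule z)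
      then have "quad_ext n ((?y ^\<^sub>m j) *\<^sub>v w) = 0" using h unfolding qcond_def by blast
      then show "qe ((?Y ^^ j) (consf a f)) = 0" unfolding q[OF wc] fw .
    qed
  next
    assume h: "\<forall>a. \<forall>f\<in>VA M. (?Y ^^ m) (consf a f) = 0 \<longrightarrow> qe ((?Y ^^ j) (consf a f)) = 0"
    show "qcond v x m j" unfolding qcond_def
    proof
      fix w assume w: "w \<in> mat_kernel (?y ^\<^sub>m m)"
      note wc = kc[OF w]
      obtain a f where af: "fv w = consf a f" using consf_surj[of "fv w"] by blast
      have "consf a f \<in> VA (Suc M)" unfolding af[symmetric] by (rule fv_VA[OF wc])
      then have f: "f \<in> VA M" unfolding consf_VA .
      have "(?Y ^^ m) (consf a f) = 0" using w unfolding ker[OF wc] af .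
      then show "quad_ext n ((?y ^\<^sub>m j) *\<^sub>v w) = 0" unfolding q[OF wc] af using h f by blast
    qed
  qed
qed

lemma qcond_0: "qcond v x 0 j"
  unfolding qcond_iff
proof (intro allI ballI impI)
  fix a f assume "(mop (Suc M) (ymat v x) ^^ 0) (consf a f) = 0"
  then have z: "consf a f = 0" by (simp only: funpow.simps id_apply)
  have "qe (0 :: nat \<Rightarrow> 'a) = 0" using qe_consf[of 0 0] qf_zero consf_zero[of "0::'a" 0] by simp
  then show "qe ((mop (Suc M) (ymat v x) ^^ j) (consf a f)) = 0"
    unfolding z alinD(3)[OF alin_pow[OF mop_alin]] .
qed

lemma mop_pow_zero: "(mop M x ^^ j) (0 :: nat \<Rightarrow> 'a) = 0"
  by (rule alinD(3)[OF alin_pow[OF mop_alin]])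

lemma qcond_Suc_0: "\<not> qcond v x (Suc i) 0"
proof
  assume h: "qcond v x (Suc i) 0"
  have z: "(0 :: nat \<Rightarrow> 'a) \<in> VA M" unfolding VA_def by simp
  have "(mop (Suc M) (ymat v x) ^^ Suc i) (consf 1 0) = 0"
    unfolding ymat_pow[OF z] consf_zero mop_pow_zero Bf_zero by (simp only: simp_thms)
  then have "qe ((mop (Suc M) (ymat v x) ^^ 0) (consf 1 0)) = 0" using h z unfolding qcond_iff by blast
  then show False unfolding funpow.simps id_apply qe_consf qf_zero by simp
qed

lemma qcond_Suc:
  "qcond v x (Suc i) (Suc k) \<longleftrightarrow> (\<forall>f\<in>VA M. Bf (fv v) ((mop M x ^^ i) f) = 0 \<longrightarrow> (mop M x ^^ Suc i) f = 0 \<longrightarrow>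
     (Bf (fv v) ((mop M x ^^ k) f))\<^sup>2 + qf ((mop M x ^^ Suc k) f) = 0)"
proof -
  have "((mop (Suc M) (ymat v x) ^^ Suc i) (consf a f) = 0 \<longrightarrow> qe ((mop (Suc M) (ymat v x) ^^ Suc k) (consf a f)) = 0)
    \<longleftrightarrow> (Bf (fv v) ((mop M x ^^ i) f) = 0 \<longrightarrow> (mop M x ^^ Suc i) f = 0 \<longrightarrow>
     (Bf (fv v) ((mop M x ^^ k) f))\<^sup>2 + qf ((mop M x ^^ Suc k) f) = 0)" if "f \<in> VA M" for a f
    unfolding ymat_pow[OF that] consf_zero qe_consf by blast
  then show ?thesis unfolding qcond_iff by blast
qed

text \<open>A jump at a step below \<open>i\<close> gives a vector of the kernel that \<open>v\<close> detects at this step while the next power kills it, so the quadratic form contributes nothing and the value is nonzero. At \<open>Suc i\<close> both terms vanish on the kernel.\<close>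

lemma least_jump:
  assumes v: "fv v \<in> VK" and x: "x \<in> cone_mats" and j: "\<And>k. i = Suc k \<Longrightarrow> jump x (fv v) k"
  shows "(LEAST j. qcond v x (Suc i) j) = Suc i"
proof (rule Least_equality)
  show "qcond v x (Suc i) (Suc i)" unfolding qcond_Suc
  proof (intro ballI impI)
    fix f assume h: "Bf (fv v) ((mop M x ^^ i) f) = 0" "(mop M x ^^ Suc i) f = 0"
    show "(Bf (fv v) ((mop M x ^^ i) f))\<^sup>2 + qf ((mop M x ^^ Suc i) f) = 0" unfolding h qf_zero by simp
  qed
  fix m assume m: "qcond v x (Suc i) m"
  show "Suc i \<le> m"
  proof (rule ccontr)
    assume lt: "\<not> Suc i \<le> m"
    obtain k where k: "m = Suc k" using m qcond_Suc_0 by (cases m) auto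
    obtain i' where i': "i = Suc i'" using lt unfolding k by (cases i) auto
    have ki: "k \<le> i'" using lt unfolding k i' by simp
    obtain g where g: "g \<in> VK" "(mop M x ^^ Suc k) g = 0" "Bf (fv v) ((mop M x ^^ k) g) \<noteq> 0"
      using jump_detect[OF x v jump_antimono[OF x j[OF i'] ki]] by blast
    have gi: "(mop M x ^^ i) g = 0"
    proof -
      have "(mop M x ^^ i) g = (mop M x ^^ (i' - k)) ((mop M x ^^ Suc k) g)" unfolding pow_pow i' using ki by simp
      then show ?thesis unfolding g(2) mop_pow_zero .
    qed
    have gs: "(mop M x ^^ Suc i) g = 0" unfolding funpow.simps o_apply gi by (rule alinD(3)[OF mop_alin])
    have "Bf (fv v) ((mop M x ^^ i) g) = 0" unfolding gi by (rule Bf_zero)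
    then have "(Bf (fv v) ((mop M x ^^ k) g))\<^sup>2 + qf ((mop M x ^^ Suc k) g) = 0"
      using m gs VK_VA[OF g(1)] unfolding k qcond_Suc by blast
    then show False using g(3) unfolding g(2) qf_zero by simp
  qed
qed

text \<open>Without a jump at \<open>i\<close> the kernel of the power of \<open>y\<close> is the full preimage of the kernel of the power of \<open>x\<close>. If the condition holds at \<open>Suc k\<close>, its polar form vanishes on this kernel; the block of size \<open>Suc i\<close> then forces \<open>Suc i \<le> 2 * Suc k\<close>. Under this inequality the values of the quadratic form are squares of \<open>B(c, -)\<close>, the whole condition is the square of one functional, and it says that the shifted vector has depth at most \<open>k\<close>.\<close>

lemma least_nojump:
  assumes v: "fv v \<in> VK" and x: "x \<in> cone_mats" and nj: "\<not> jump x (fv v) i"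
    and e: "e \<in> VK" "(mop M x ^^ Suc i) e = 0" "(mop M x ^^ i) e \<notin> (mop M x ^^ Suc i) ` VK"
  shows "(LEAST j. qcond v x (Suc i) j) = max ((Suc i + 1) div 2) (Suc (depth VK (mop M x) (Suc i) (shift x (fv v))))"
proof -
  define X where "X = mop M x"
  define u where "u = fv v"
  define u' where "u' = shift x u"
  note P = cone_pow[OF x, folded X_def]
  have uK: "u \<in> VK" unfolding u_def by (rule v)
  have u'K: "u' \<in> VK" unfolding u'_def by (rule shift_VK[OF x uK])
  obtain N e' L \<psi> where J: "jordan_coords K M X N e' L \<psi>" using jordan_exists[OF cone_matsD(1-3)[OF x]] unfolding X_def by blast
  define \<phi> where "\<phi> k f = (Bf u ((X ^^ k) f))\<^sup>2 + qf ((X ^^ Suc k) f)" for k f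
  define \<beta> where "\<beta> k f g = Bf ((X ^^ Suc k) f) ((X ^^ Suc k) g)" for k f g
  have \<phi>_add: "\<phi> k (f + g) = \<phi> k f + \<phi> k g + \<beta> k f g" for k f g
    unfolding \<phi>_def \<beta>_def alinD(1)[OF P(1)] afunD(1)[OF Bf_afun(1)] sq_add qf_add by (simp only: add_ac)
  have \<phi>_sc: "\<phi> k (sc c f) = c\<^sup>2 * \<phi> k f" for k c f
    unfolding \<phi>_def alinD(2)[OF P(1)] afunD(2)[OF Bf_afun(1)] qf_scale power_mult_distrib by (simp only: distrib_left)
  have \<beta>_afun: "afun (\<beta> k f)" "afun (\<lambda>g. \<beta> k g f)" for k f
    unfolding afun_def \<beta>_def alinD(1)[OF P(1)] alinD(2)[OF P(1)] afunD(1)[OF Bf_afun(1)] afunD(2)[OF Bf_afun(1)]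
      afunD(1)[OF Bf_afun(2)] afunD(2)[OF Bf_afun(2)] by (intro conjI allI refl)+
  have kerK: "Bf u ((X ^^ i) f) = 0" if f: "f \<in> VK" "(X ^^ Suc i) f = 0" for f
  proof -
    obtain w where w: "w \<in> VK" "(X ^^ i) u = (X ^^ Suc i) w" using nj unfolding jump_def X_def u_def by blast
    have "Bf u ((X ^^ i) f) = Bf ((X ^^ Suc i) w) f" unfolding P(3)[OF uK f(1), symmetric] w(2) ..
    then show ?thesis unfolding P(3)[OF w(1) f(1)] f(2) Bf_zero .
  qed
  have ker: "Bf u ((X ^^ i) f) = 0" if f: "f \<in> VA M" "(X ^^ Suc i) f = 0" for f
  proof -
    have "(Bf u ((X ^^ i) f))\<^sup>2 = 0"
    proof (rule jordan_coords.quadratic_vanish[OF J, where \<phi> = "\<lambda>f. (Bf u ((X ^^ i) f))\<^sup>2" and \<beta> = "\<lambda>_ _. 0" and j = "Suc i"])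
      show "(Bf u ((X ^^ i) (f + g)))\<^sup>2 = (Bf u ((X ^^ i) f))\<^sup>2 + (Bf u ((X ^^ i) g))\<^sup>2 + 0" for f g
        unfolding alinD(1)[OF P(1)] afunD(1)[OF Bf_afun(1)] sq_add by simp
      show "(Bf u ((X ^^ i) (sc c f)))\<^sup>2 = c\<^sup>2 * (Bf u ((X ^^ i) f))\<^sup>2" for c f
        unfolding alinD(2)[OF P(1)] afunD(2)[OF Bf_afun(1)] power_mult_distrib ..
      show "(Bf u ((X ^^ i) f))\<^sup>2 = 0" if "f \<in> VK" "(X ^^ Suc i) f = 0" for f using kerK[OF that] by simp
    qed (use f in \<open>simp_all add: afun_def del: funpow.simps\<close>)
    then show ?thesis by simp
  qed
  have qK: "qcond v x (Suc i) (Suc k) \<longleftrightarrow> (\<forall>f\<in>VK. (X ^^ Suc i) f = 0 \<longrightarrow> \<phi> k f = 0)" for k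
  proof -
    have "qcond v x (Suc i) (Suc k) \<longleftrightarrow> (\<forall>f\<in>VA M. (X ^^ Suc i) f = 0 \<longrightarrow> \<phi> k f = 0)"
      unfolding qcond_Suc \<phi>_def X_def[symmetric] u_def[symmetric] using ker by blast
    also have "\<dots> \<longleftrightarrow> (\<forall>f\<in>VK. (X ^^ Suc i) f = 0 \<longrightarrow> \<phi> k f = 0)"
    proof
      show "\<forall>f\<in>VK. (X ^^ Suc i) f = 0 \<longrightarrow> \<phi> k f = 0" if "\<forall>f\<in>VA M. (X ^^ Suc i) f = 0 \<longrightarrow> \<phi> k f = 0"
        using that VK_VA by blast
      assume h: "\<forall>f\<in>VK. (X ^^ Suc i) f = 0 \<longrightarrow> \<phi> k f = 0"
      show "\<forall>f\<in>VA M. (X ^^ Suc i) f = 0 \<longrightarrow> \<phi> k f = 0"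
      proof (intro ballI impI)
        fix f assume f: "f \<in> VA M" "(X ^^ Suc i) f = 0"
        show "\<phi> k f = 0"
        proof (rule jordan_coords.quadratic_vanish[OF J, where \<phi> = "\<phi> k" and \<beta> = "\<beta> k" and j = "Suc i"])
          show "\<phi> k (f + g) = \<phi> k f + \<phi> k g + \<beta> k f g" for f g by (rule \<phi>_add)
          show "\<phi> k (sc c f) = c\<^sup>2 * \<phi> k f" for c f by (rule \<phi>_sc)
          show "afun (\<beta> k f)" "afun (\<lambda>g. \<beta> k g f)" for f by (rule \<beta>_afun)+
          show "\<phi> k f = 0" if "f \<in> VK" "(X ^^ Suc i) f = 0" for f using h that by blast
        qed (rule f)+
      qed
    qed
    finally show ?thesis .
  qed
  have \<phi>_low: "\<phi> k f = (Bf ((X ^^ k) u') f)\<^sup>2" if f: "f \<in> VK" "(X ^^ Suc i) f = 0" and le: "Suc i \<le> 2 * Suc k" for k f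
  proof -
    define z where "z = (X ^^ Suc k) f"
    have e: "2 * Suc k - Suc i + Suc i = Suc k + Suc k" using le by simp
    have "(X ^^ Suc k) z = (X ^^ (2 * Suc k - Suc i)) ((X ^^ Suc i) f)" unfolding z_def pow_pow e ..
    then have z0: "(X ^^ Suc k) z = 0" unfolding f(2) alinD(3)[OF P(1)] .
    have zi: "z \<in> (X ^^ Suc k) ` VK" unfolding z_def by (rule imageI[OF f(1)])
    have "qf z = (Bf (isovec x) z)\<^sup>2" using isovec(2)[OF x, folded X_def, OF zi z0] .
    moreover have "Bf (isovec x) z = Bf ((X ^^ Suc k) (isovec x)) f" unfolding z_def by (rule P(3)[OF isovec(1)[OF x] f(1), symmetric])
    moreover have "Bf u ((X ^^ k) f) = Bf ((X ^^ k) u) f" by (rule P(3)[OF uK f(1), symmetric])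
    ultimately show ?thesis
      unfolding \<phi>_def z_def[symmetric] u'_def X_def[symmetric] shift_pow[OF x, folded X_def] afunD(1)[OF Bf_afun(2)] sq_add by (simp only:)
  qed
  have big: "Suc i \<le> 2 * Suc k" if h: "\<forall>f\<in>VK. (X ^^ Suc i) f = 0 \<longrightarrow> \<phi> k f = 0" for k
  proof (rule ccontr)
    assume "\<not> Suc i \<le> 2 * Suc k"
    then have le: "2 * Suc k \<le> i" by simp
    \<comment> \<open>the polar form of the condition on this vector is the top power of \<open>X\<close> at \<open>e\<close>, which a kernel vector detects\<close>
    define f where "f = (X ^^ (i - 2 * Suc k)) e"
    have e2: "Suc k + (Suc k + (i - 2 * Suc k)) = i" and e3: "Suc k + Suc k + (i - 2 * Suc k) = i" using le by simp_all
    have fK: "f \<in> VK" unfolding f_def by (rule P(2)[OF e(1)])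
    have "(X ^^ Suc i) f = (X ^^ (i - 2 * Suc k)) ((X ^^ Suc i) e)" unfolding f_def pow_pow by (simp only: add.commute)
    then have f0: "(X ^^ Suc i) f = 0" using e(2) alinD(3)[OF P(1)] unfolding X_def[symmetric] by (simp only:)
    have "Bf ((X ^^ i) e) g = 0" if g: "g \<in> VK" "(X ^^ Suc i) g = 0" for g
    proof -
      have fg: "f + g \<in> VK" by (rule ksubD(3)[OF ksub_VK fK g(1)])
      have "(X ^^ Suc i) (f + g) = 0" unfolding alinD(1)[OF P(1)] f0 g(2) by (rule add_0_left)
      then have "\<phi> k (f + g) = 0" using h fg by blast
      moreover have "\<phi> k f = 0" "\<phi> k g = 0" using h fK f0 g by blast+
      ultimately have "\<beta> k f g = 0" unfolding \<phi>_add by simp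
      then have "Bf ((X ^^ Suc k) ((X ^^ Suc k) f)) g = 0" unfolding \<beta>_def P(3)[OF P(2)[OF fK] g(1)] .
      moreover have "(X ^^ Suc k) ((X ^^ Suc k) f) = (X ^^ i) e" unfolding f_def pow_pow using e2 e3 by (simp only:)
      ultimately show ?thesis by (simp only:)
    qed
    then have "(X ^^ i) e \<in> (X ^^ Suc i) ` VK"
      using image_pow_detect[OF x, folded X_def, OF P(2)[OF e(1)]] by blast
    then show False using e(3) unfolding X_def by blast
  qed
  have key: "qcond v x (Suc i) (Suc k) \<longleftrightarrow> Suc i \<le> 2 * Suc k \<and> depth VK X (Suc i) u' \<le> k" for k
  proof -
    have d: "depth VK X (Suc i) u' \<le> k \<longleftrightarrow> (\<forall>g\<in>VK. (X ^^ Suc i) g = 0 \<longrightarrow> Bf ((X ^^ k) u') g = 0)"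
      unfolding depth_le_iff[OF P(5) u'K] by (rule image_pow_detect[OF x, folded X_def, OF P(2)[OF u'K]])
    show ?thesis
    proof (cases "Suc i \<le> 2 * Suc k")
      case True
      then show ?thesis unfolding qK d using \<phi>_low[OF _ _ True] by (simp del: funpow.simps)
    next
      case False
      then show ?thesis unfolding qK using big by blast
    qed
  qed
  have "(LEAST j. qcond v x (Suc i) j) = max ((Suc i + 1) div 2) (Suc (depth VK X (Suc i) u'))"
  proof (rule Least_equality)
    obtain k where k: "max ((Suc i + 1) div 2) (Suc (depth VK X (Suc i) u')) = Suc k"
      using Suc_le_D[OF max.cobounded2] by blast
    have "(Suc i + 1) div 2 \<le> Suc k" "Suc (depth VK X (Suc i) u') \<le> Suc k"
      unfolding k[symmetric] by (rule max.cobounded1, rule max.cobounded2)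
    then have "Suc i \<le> 2 * Suc k" "depth VK X (Suc i) u' \<le> k" by (presburger, simp only: Suc_le_mono)
    then show "qcond v x (Suc i) (max ((Suc i + 1) div 2) (Suc (depth VK X (Suc i) u')))" unfolding k key by blast
    fix j assume j: "qcond v x (Suc i) j"
    obtain k' where k': "j = Suc k'" using j qcond_Suc_0 by (cases j) auto
    have "Suc i \<le> 2 * Suc k'" "depth VK X (Suc i) u' \<le> k'" using j unfolding k' key by auto
    then have "(Suc i + 1) div 2 \<le> Suc k'" "Suc (depth VK X (Suc i) u') \<le> Suc k'" by (presburger, simp only: Suc_le_mono)
    then show "max ((Suc i + 1) div 2) (Suc (depth VK X (Suc i) u')) \<le> j" unfolding k' by (rule max.boundedI)
  qed
  then show ?thesis unfolding X_def u'_def u_def .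
qed

lemma nilp_part_vector:
  assumes x: "x \<in> nilp \<pi>" and \<pi>: "is_partition \<pi>" and a: "\<pi> a = Suc i"
  shows "\<exists>e\<in>VK. (mop M x ^^ Suc i) e = 0 \<and> (mop M x ^^ i) e \<notin> (mop M x ^^ Suc i) ` VK"
proof -
  obtain e \<psi> where J: "jordan_coords K M (mop M x) (plen (pdouble \<pi>)) e (pdouble \<pi>) \<psi>" using nilp_jordan[OF x \<pi>] by blast
  interpret J: jordan_coords K M "mop M x" "plen (pdouble \<pi>)" e "pdouble \<pi>" \<psi> by (rule J)
  have L: "pdouble \<pi> (2 * a) = Suc i" unfolding pdouble_def using a by simp
  have k: "2 * a < plen (pdouble \<pi>)" using partition_pos_iff[OF partition_pdouble[OF \<pi>], of "2 * a"] L by simp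
  have "(mop M x ^^ i) (e (2 * a)) \<notin> (mop M x ^^ Suc i) ` VK"
  proof
    assume "(mop M x ^^ i) (e (2 * a)) \<in> (mop M x ^^ Suc i) ` VK"
    then have "J.crd (2 * a) i ((mop M x ^^ i) (e (2 * a))) = 0"
      using J.image_iff_crd(2)[OF VK_VA[OF J.pow_e_VK[OF k]] J.pow_e_VK[OF k], of i "Suc i"] k L by auto
    then show False using J.crd_basis[OF k k, of i i] L by simp
  qed
  moreover have "(mop M x ^^ Suc i) (e (2 * a)) = 0" by (rule J.pow_e_zero[OF k]) (simp add: L)
  ultimately show ?thesis using J.e_VK[OF k] by blast
qed

text \<open>A jump at \<open>j\<close> is a nonzero first coordinate in a block longer than \<open>j\<close>; for the size of this block the depth is maximal.\<close>

lemma jump_top: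
  assumes x: "x \<in> nilp \<pi>" and \<pi>: "is_partition \<pi>" and f: "f \<in> VK" and h: "jump x f j"
  shows "\<exists>i. j < \<pi> i \<and> depth VK (mop M x) (\<pi> i) f = \<pi> i"
proof -
  obtain e \<psi> where J: "jordan_coords K M (mop M x) (plen (pdouble \<pi>)) e (pdouble \<pi>) \<psi>" using nilp_jordan[OF x \<pi>] by blast
  interpret J: jordan_coords K M "mop M x" "plen (pdouble \<pi>)" e "pdouble \<pi>" \<psi> by (rule J)
  have xc: "x \<in> cone_mats" using x nilp_iff by blast
  obtain k a where ka: "k < plen (pdouble \<pi>)" "a < pdouble \<pi> k" "a < Suc j" "J.crd k a ((mop M x ^^ j) f) \<noteq> 0"
    using h J.image_iff_crd(2)[OF VK_VA[OF J.pow_VK[OF f]] J.pow_VK[OF f], of j "Suc j"] unfolding jump_def by blast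
  have aj: "a = j" and c0: "J.crd k 0 f \<noteq> 0" using ka(3,4) J.crd_pow[OF ka(1,2) VK_VA[OF f], of j] by (auto split: if_splits)
  have L: "pdouble \<pi> k = \<pi> (k div 2)" unfolding pdouble_def ..
  let ?i = "k div 2"
  have "\<not> depth VK (mop M x) (\<pi> ?i) f \<le> \<pi> ?i - 1"
  proof
    let ?t = "\<pi> ?i - 1"
    have t: "?t < pdouble \<pi> k" using ka(2) L by simp
    assume "depth VK (mop M x) (\<pi> ?i) f \<le> ?t"
    then have "(mop M x ^^ ?t) f \<in> (mop M x ^^ \<pi> ?i) ` VK" unfolding depth_le_iff[OF cone_pow(5)[OF xc] f] .
    then have "J.crd k ?t ((mop M x ^^ ?t) f) = 0"
      using J.image_iff_crd(2)[OF VK_VA[OF J.pow_VK[OF f]] J.pow_VK[OF f], of ?t "\<pi> ?i"] ka(1) t L by auto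
    then show False using J.crd_pow[OF ka(1) t VK_VA[OF f], of ?t] c0 by simp
  qed
  moreover have "depth VK (mop M x) (\<pi> ?i) f \<le> \<pi> ?i" by (rule depth_le_self[OF f])
  ultimately have "depth VK (mop M x) (\<pi> ?i) f = \<pi> ?i" by linarith
  moreover have "j < \<pi> ?i" using ka(2) aj L by simp
  ultimately show ?thesis by blast
qed

text \<open>The form \<open>B (X ^^ j f) g\<close> is again alternating, and its radical is the kernel of the power.\<close>

lemma image_card_even:
  assumes x: "x \<in> cone_mats"
  shows "\<exists>k. card ((mop M x ^^ j) ` VK) = card K ^ (2 * k)"
proof -
  let ?X = "mop M x"
  have "altform VK (\<lambda>f g. Bf ((?X ^^ j) f) g)"
    unfolding altform_def kfunctional_def
  proof (intro conjI ballI)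
    fix f assume f: "f \<in> VK"
    show "Bf ((?X ^^ j) f) f = 0" by (rule alt_pow(2)[OF ksub_VK Bf_altform cone_matsD(6,4)[OF x] f])
    show "Bf ((?X ^^ j) f) g \<in> K" "Bf ((?X ^^ j) g) f \<in> K" if "g \<in> VK" for g
      using Bf_K[OF cone_pow(2)[OF x f] that] Bf_K[OF cone_pow(2)[OF x that] f] by auto
  qed (simp_all only: alinD(1)[OF cone_pow(1)[OF x]] alinD(2)[OF cone_pow(1)[OF x]] afunD(1)[OF Bf_afun(1)] afunD(2)[OF Bf_afun(1)]
      afunD(1)[OF Bf_afun(2)] afunD(2)[OF Bf_afun(2)])
  then obtain k where k: "card VK = card K ^ (2 * k) * card {f \<in> VK. \<forall>g\<in>VK. Bf ((?X ^^ j) f) g = 0}"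
    using altform_rank_even[OF ksub_VK] by blast
  have "{f \<in> VK. \<forall>g\<in>VK. Bf ((?X ^^ j) f) g = 0} = {f \<in> VK. (?X ^^ j) f = 0}"
    using Bf_nondegenerate cone_pow(2)[OF x] Bf_zero(2) unfolding nondegenerate_def by auto
  then have "card ((?X ^^ j) ` VK) * card {f \<in> VK. (?X ^^ j) f = 0} = card K ^ (2 * k) * card {f \<in> VK. (?X ^^ j) f = 0}"
    using k card_klin[OF cone_pow(4)[OF x] ksub_VK, of j] by simp
  moreover have "card {f \<in> VK. (?X ^^ j) f = 0} \<noteq> 0"
  proof -
    have "0 \<in> {f \<in> VK. (?X ^^ j) f = 0}" using ksubD(2)[OF ksub_VK] mop_pow_zero by blast
    then show ?thesis using ksubD(1)[OF ksub_VK] by (auto simp: card_eq_0_iff)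
  qed
  ultimately show ?thesis by (intro exI[of _ k]) simp
qed

end

section \<open>Combinatorics of the invariants\<close>

lemma second_zero: "is_partition \<nu> \<Longrightarrow> \<nu> i = 0 \<longleftrightarrow> plen \<nu> \<le> i"
  using partition_pos_iff[of \<nu> i] by auto

lemma Phi_eq: "Phi_B2 \<mu> \<nu> = (pdouble (padd \<mu> \<nu>))(2 * plen \<nu> := padd \<mu> \<nu> (plen \<nu>) + 1)"
  unfolding Phi_B2_def Let_def by (simp add: pdouble_def)

text \<open>The second partition vanishes at its length and not before. This gap makes the sequence of parts of \<open>Phi_B2\<close> weakly decreasing and the rules for \<open>chi_B2\<close> consistent.\<close>

lemma part_gap:
  assumes "is_partition \<mu>" "is_partition \<nu>" "i < plen \<nu>"
  shows "padd \<mu> \<nu> (plen \<nu>) < padd \<mu> \<nu> i"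
  using partition_antimono[OF assms(1), of i "plen \<nu>"] second_zero[OF assms(2), of "plen \<nu>"] second_zero[OF assms(2), of i] assms(3)
  unfolding padd_def by simp

lemma Phi_partition:
  assumes p: "is_partition \<mu>" "is_partition \<nu>"
  shows "is_partition (Phi_B2 \<mu> \<nu>)"
proof (rule is_partitionI[of _ "2 * plen (padd \<mu> \<nu>) + 2 * plen \<nu> + 1"])
  let ?l = "padd \<mu> \<nu>"
  have L: "is_partition ?l" by (rule partition_padd[OF p])
  have P: "is_partition (pdouble ?l)" by (rule partition_pdouble[OF L])
  show "Phi_B2 \<mu> \<nu> (Suc i) \<le> Phi_B2 \<mu> \<nu> i" for i
  proof (cases "Suc i = 2 * plen \<nu>")
    case True
    then have "i div 2 < plen \<nu>" "i \<noteq> 2 * plen \<nu>" by auto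
    then have "?l (plen \<nu>) + 1 \<le> pdouble ?l i" using part_gap[OF p, of "i div 2"] unfolding pdouble_def by simp
    then show ?thesis unfolding Phi_eq using True \<open>i \<noteq> 2 * plen \<nu>\<close> by simp
  next
    case False
    have a: "pdouble ?l (Suc i) \<le> pdouble ?l i" by (rule partition_antimono[OF P]) simp
    show ?thesis
    proof (cases "i = 2 * plen \<nu>")
      case True
      have "pdouble ?l i = ?l (plen \<nu>)" unfolding pdouble_def True by simp
      then show ?thesis unfolding Phi_eq using a True by simp
    next
      case F: False
      then show ?thesis unfolding Phi_eq using a False by simp
    qed
  qed
  fix i assume i: "2 * plen ?l + 2 * plen \<nu> + 1 \<le> i"
  then have "plen ?l \<le> i div 2" "i \<noteq> 2 * plen \<nu>" by auto
  then show "Phi_B2 \<mu> \<nu> i = 0" unfolding Phi_eq using second_zero[OF L, of "i div 2"] by (simp add: pdouble_def)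
qed

lemma boxes_beyond_upto:
  assumes "is_partition \<pi>" "plen \<pi> \<le> N"
  shows "boxes_beyond \<pi> j = (\<Sum>i<N. \<pi> i - j)"
  unfolding boxes_beyond_def using sum_beyond_plen[OF assms, of "\<lambda>x. x - j"] by simp

lemma Phi_boxes:
  assumes p: "is_partition \<mu>" "is_partition \<nu>"
  shows "boxes_beyond (Phi_B2 \<mu> \<nu>) j = boxes_beyond (pdouble (padd \<mu> \<nu>)) j + (if j \<le> padd \<mu> \<nu> (plen \<nu>) then 1 else 0)"
proof -
  let ?P = "pdouble (padd \<mu> \<nu>)" and ?b = "if j \<le> padd \<mu> \<nu> (plen \<nu>) then 1 else (0::nat)"
  define N where "N = plen (Phi_B2 \<mu> \<nu>) + plen ?P + 2 * plen \<nu> + 1"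
  have P: "is_partition ?P" by (intro partition_pdouble partition_padd p)
  have "boxes_beyond (Phi_B2 \<mu> \<nu>) j = (\<Sum>i<N. Phi_B2 \<mu> \<nu> i - j)"
    by (rule boxes_beyond_upto[OF Phi_partition[OF p]]) (simp add: N_def)
  also have "\<dots> = (\<Sum>i<N. (?P i - j) + (if i = 2 * plen \<nu> then ?b else 0))"
  proof (rule sum.cong[OF refl])
    fix i
    show "Phi_B2 \<mu> \<nu> i - j = (?P i - j) + (if i = 2 * plen \<nu> then ?b else 0)"
    proof (cases "i = 2 * plen \<nu>")
      case True
      have "?P i = padd \<mu> \<nu> (plen \<nu>)" unfolding pdouble_def True by simp
      then show ?thesis unfolding Phi_eq using True by auto
    qed (simp add: Phi_eq)
  qed
  also have "\<dots> = (\<Sum>i<N. ?P i - j) + ?b" unfolding sum.distrib by (simp add: N_def)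
  also have "(\<Sum>i<N. ?P i - j) = boxes_beyond ?P j" by (rule boxes_beyond_upto[OF P, symmetric]) (simp add: N_def)
  finally show ?thesis .
qed

lemma Phi_range: "range (Phi_B2 \<mu> \<nu>) = insert (padd \<mu> \<nu> (plen \<nu>) + 1) (range (padd \<mu> \<nu>))"
proof
  show "range (Phi_B2 \<mu> \<nu>) \<subseteq> insert (padd \<mu> \<nu> (plen \<nu>) + 1) (range (padd \<mu> \<nu>))"
    unfolding Phi_eq pdouble_def by auto
  have "padd \<mu> \<nu> i = Phi_B2 \<mu> \<nu> (Suc (2 * i))" for i
  proof -
    have "Suc (2 * i) \<noteq> 2 * plen \<nu>" by presburger
    then show ?thesis unfolding Phi_eq pdouble_def by simp
  qed
  moreover have "padd \<mu> \<nu> (plen \<nu>) + 1 = Phi_B2 \<mu> \<nu> (2 * plen \<nu>)" unfolding Phi_eq by simp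
  ultimately show "insert (padd \<mu> \<nu> (plen \<nu>) + 1) (range (padd \<mu> \<nu>)) \<subseteq> range (Phi_B2 \<mu> \<nu>)" by auto
qed

lemma chi_values:
  assumes p: "is_partition \<mu>" "is_partition \<nu>"
  shows "chi_B2 \<mu> \<nu> (padd \<mu> \<nu> (plen \<nu>) + 1) = padd \<mu> \<nu> (plen \<nu>) + 1"
    and "chi_B2 \<mu> \<nu> (padd \<mu> \<nu> i) = (if i < plen \<nu> then \<mu> i + 1 else \<mu> i)"
proof -
  let ?l = "plen \<nu>" and ?val = "\<lambda>i. if i < plen \<nu> then \<mu> i + 1 else \<mu> i"
  have nl: "\<nu> ?l = 0" using second_zero[OF p(2), of ?l] by simp
  have le: "?val i = ?val j" if "\<mu> i + \<nu> i = \<mu> j + \<nu> j" "i \<le> j" for i j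
  proof -
    have "\<mu> i = \<mu> j" "\<nu> i = \<nu> j" using partition_antimono[OF p(1) that(2)] partition_antimono[OF p(2) that(2)] that(1) by auto
    then show ?thesis using second_zero[OF p(2), of i] second_zero[OF p(2), of j] by auto
  qed
  have eq: "?val i = ?val j" if "\<mu> i + \<nu> i = \<mu> j + \<nu> j" for i j
    using le[OF that] le[OF that[symmetric]] by (metis linear)
  have top: "?val i = \<mu> ?l + 1" if h: "\<mu> i + \<nu> i = \<mu> ?l + 1" for i
  proof (cases "i < ?l")
    case True
    then have "\<nu> i \<noteq> 0" "\<mu> ?l \<le> \<mu> i" using second_zero[OF p(2), of i] partition_antimono[OF p(1), of i ?l] by auto
    then show ?thesis using h True by simp
  next
    case False
    then have "\<nu> i = 0" "\<mu> i \<le> \<mu> ?l" using second_zero[OF p(2), of i] partition_antimono[OF p(1), of ?l i] by auto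
    then show ?thesis using h by simp
  qed
  show "chi_B2 \<mu> \<nu> (padd \<mu> \<nu> ?l + 1) = padd \<mu> \<nu> ?l + 1"
    unfolding chi_B2_def padd_def nl by (rule the_equality) (use top in force)+
  show "chi_B2 \<mu> \<nu> (padd \<mu> \<nu> i) = ?val i"
    unfolding chi_B2_def padd_def
  proof (rule the_equality)
    show "\<mu> i + \<nu> i = \<mu> ?l + 1 \<and> ?val i = \<mu> ?l + 1 \<or> (\<exists>j. \<mu> i + \<nu> i = \<mu> j + \<nu> j \<and> ?val i = ?val j)" by blast
    fix c assume "\<mu> i + \<nu> i = \<mu> ?l + 1 \<and> c = \<mu> ?l + 1 \<or> (\<exists>j. \<mu> i + \<nu> i = \<mu> j + \<nu> j \<and> c = ?val j)"
    then show "c = ?val i"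
    proof
      assume "\<mu> i + \<nu> i = \<mu> ?l + 1 \<and> c = \<mu> ?l + 1"
      then show ?thesis using top[of i] by argo
    next
      assume "\<exists>j. \<mu> i + \<nu> i = \<mu> j + \<nu> j \<and> c = ?val j"
      then obtain j where j: "\<mu> i + \<nu> i = \<mu> j + \<nu> j" "c = ?val j" by blast
      show ?thesis unfolding j(2) by (rule eq[OF j(1), symmetric])
    qed
  qed
qed

lemma half_sum: "(m + 1) div 2 + m div 2 = (m :: nat)"
  by presburger

text \<open>Where the replacement takes place, half of the sum exceeds the entry, and elsewhere it does not, so the new first entry is a maximum. This is the form in which the invariants of the orthogonal orbit present it.\<close>

lemma tilde_entry:
  fixes r s a b :: nat
  assumes "r + s = a + b"
  shows "(if r + 2 < s then (r + s + 1) div 2 - 1 else r) = a \<and> (if r + 2 < s then (r + s) div 2 + 1 else s) = b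
    \<longleftrightarrow> max ((a + b + 1) div 2) (Suc r) = Suc a"
proof (cases "r + 2 < s")
  case True
  then have "2 * r + 2 \<le> a + b + 1" using assms by linarith
  then have "Suc r * 2 \<le> a + b + 1" by simp
  then have le: "Suc r \<le> (a + b + 1) div 2" by (simp only: less_eq_div_iff_mult_less_eq zero_less_numeral)
  then have m: "max ((a + b + 1) div 2) (Suc r) = (a + b + 1) div 2" by (rule max_absorb1)
  show ?thesis unfolding m assms using True le half_sum[of "a + b"] by (simp only: if_True) linarith
next
  case False
  then have "a + b + 1 < 2 * r + 4" using assms by linarith
  then have "a + b + 1 < Suc (Suc r) * 2" by simp
  then have "(a + b + 1) div 2 < Suc (Suc r)" by (simp only: div_less_iff_less_mult zero_less_numeral)
  then have m: "max ((a + b + 1) div 2) (Suc r) = Suc r" by (intro max_absorb2) (simp only: less_Suc_eq_le)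
  show ?thesis unfolding m using False assms by (simp only: if_False) linarith
qed

lemma tilde_max:
  assumes r: "\<And>i. r i \<le> padd \<mu> \<nu> i"
  shows "tilde_B2 (r, \<lambda>i. padd \<mu> \<nu> i - r i) = (\<mu>, \<nu>) \<longleftrightarrow> (\<forall>i. max ((padd \<mu> \<nu> i + 1) div 2) (Suc (r i)) = Suc (\<mu> i))"
proof -
  have e: "r i + (padd \<mu> \<nu> i - r i) = \<mu> i + \<nu> i" for i using r[of i] by (simp add: padd_def)
  show ?thesis unfolding tilde_B2_def prod.case prod.inject fun_eq_iff all_conj_distrib[symmetric] tilde_entry[OF e]
    by (simp add: padd_def)
qed

lemma tilde_sum:
  assumes "tilde_B2 (\<rho>, \<sigma>) = (\<mu>, \<nu>)"
  shows "padd \<rho> \<sigma> = padd \<mu> \<nu>"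
proof
  fix i
  have h: "(if \<rho> i + 2 < \<sigma> i then (\<rho> i + \<sigma> i + 1) div 2 - 1 else \<rho> i) = \<mu> i" "(if \<rho> i + 2 < \<sigma> i then (\<rho> i + \<sigma> i) div 2 + 1 else \<sigma> i) = \<nu> i"
    using assms unfolding tilde_B2_def by auto
  have "\<mu> i + \<nu> i = \<rho> i + \<sigma> i"
  proof (cases "\<rho> i + 2 < \<sigma> i")
    case True
    have "1 * 2 \<le> \<rho> i + \<sigma> i + 1" using True by simp
    then have "1 \<le> (\<rho> i + \<sigma> i + 1) div 2" by (simp only: less_eq_div_iff_mult_less_eq zero_less_numeral)
    moreover have "(\<rho> i + \<sigma> i + 1) div 2 - 1 = \<mu> i" "(\<rho> i + \<sigma> i) div 2 + 1 = \<nu> i"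
      using h unfolding if_P[OF True] .
    ultimately show ?thesis using half_sum[of "\<rho> i + \<sigma> i"] by linarith
  next
    case False
    show ?thesis using h unfolding if_not_P[OF False] by simp
  qed
  then show "padd \<rho> \<sigma> i = padd \<mu> \<nu> i" unfolding padd_def by simp
qed

lemma finite_tilde_fibre: "finite {b \<in> bipartitions n. tilde_B2 b = (\<mu>, \<nu>)}" if "is_partition \<mu>" "is_partition \<nu>"
proof (rule finite_subset)
  let ?l = "padd \<mu> \<nu>"
  have L: "is_partition ?l" by (rule partition_padd[OF that])
  let ?F = "{f. \<forall>i. (i \<in> {..<plen ?l} \<longrightarrow> f i \<in> {..?l 0}) \<and> (i \<notin> {..<plen ?l} \<longrightarrow> f i = 0)}"
  show "finite ((\<lambda>\<rho>. (\<rho>, \<lambda>i. ?l i - \<rho> i)) ` ?F)" by (intro finite_imageI finite_set_of_finite_funs) simp_all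
  show "{b \<in> bipartitions n. tilde_B2 b = (\<mu>, \<nu>)} \<subseteq> (\<lambda>\<rho>. (\<rho>, \<lambda>i. ?l i - \<rho> i)) ` ?F"
  proof
    fix b assume b: "b \<in> {b \<in> bipartitions n. tilde_B2 b = (\<mu>, \<nu>)}"
    obtain \<rho> \<sigma> where bb: "b = (\<rho>, \<sigma>)" by (cases b)
    have s: "\<rho> i + \<sigma> i = ?l i" for i using tilde_sum[of \<rho> \<sigma> \<mu> \<nu>] b bb by (auto simp: padd_def dest: fun_cong)
    have le: "\<rho> i \<le> ?l i" for i using s[of i] by simp
    have sg: "\<sigma> = (\<lambda>i. ?l i - \<rho> i)"
    proof
      fix i show "\<sigma> i = ?l i - \<rho> i" using s[of i] by simp
    qed
    have "\<rho> \<in> ?F"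
    proof (intro CollectI allI conjI impI)
      fix i
      show "\<rho> i \<in> {..?l 0}" using le[of i] partition_antimono[OF L, of 0 i] by simp
      show "\<rho> i = 0" if "i \<notin> {..<plen ?l}" using le[of i] second_zero[OF L, of i] that by simp
    qed
    then show "b \<in> (\<lambda>\<rho>. (\<rho>, \<lambda>i. ?l i - \<rho> i)) ` ?F" unfolding bb by (rule rev_image_eqI) (rule prod_eqI, simp, simp only: snd_conv, rule sg)
  qed
qed

section \<open>Comparison of the two counts\<close>

lemma parity_exponents:
  "(if P then 1 else 0) + 2 * k = 2 * b + (if Q then 1 else 0) \<longleftrightarrow> (P \<longleftrightarrow> Q) \<and> 2 * k = 2 * (b :: nat)"
  by (cases P; cases Q; simp only: if_True if_False simp_thms; presburger)

lemma all_nat_Suc: "(\<forall>j::nat. A j) \<longleftrightarrow> A 0 \<and> (\<forall>j. A (Suc j))"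
  by (metis not0_implies_Suc)

context orth_setting
begin

lemma ymat_cone:
  assumes "v \<in> rat_vecs" "x \<in> cone_mats"
  shows "ymat v x \<in> orthogonal_lie n" "ymat v x \<in> nilpotent_mats (Suc M)" "ymat v x \<in> rational_mats K"
proof -
  have "(\<lambda>(v, x). ymat v x) (v, x) \<in> orthogonal_lie n \<inter> nilpotent_mats (Suc M) \<inter> rational_mats K"
    by (rule bij_betw_apply[OF ymat_bij]) (use assms in simp)
  then show "ymat v x \<in> orthogonal_lie n" "ymat v x \<in> nilpotent_mats (Suc M)" "ymat v x \<in> rational_mats K"
    unfolding prod.case by blast+
qed

lemma rat_vecs_VK: "v \<in> rat_vecs \<Longrightarrow> fv v \<in> VK"
  using rat_vecs_fv[of v] unfolding rat_vecs_def by blast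

text \<open>The ranks of the powers of \<open>x\<close> are even, and the ones of \<open>y\<close> exceed them by zero or one. So parity separates the contributions of \<open>x\<close> and of the jumps of \<open>v\<close>.\<close>

lemma type_iff:
  assumes v: "v \<in> rat_vecs" and x: "x \<in> cone_mats" and b: "(\<mu>, \<nu>) \<in> bipartitions n"
  shows "has_jordan_type (ymat v x) (Phi_B2 \<mu> \<nu>) \<longleftrightarrow>
    x \<in> nilp (padd \<mu> \<nu>) \<and> (\<forall>j. jump x (fv v) j \<longleftrightarrow> j < padd \<mu> \<nu> (plen \<nu>))"
proof -
  let ?l = "padd \<mu> \<nu>" and ?q = "card K"
  have p: "is_partition \<mu>" "is_partition \<nu>" and sz: "psize \<mu> + psize \<nu> = n" using b unfolding bipartitions_def by auto
  have L: "is_partition ?l" by (rule partition_padd[OF p])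
  have q1: "1 < ?q" using card_K_ge_2 by simp
  have b0: "boxes_beyond (pdouble ?l) 0 = M"
  proof -
    have "boxes_beyond ?l 0 = psize ?l" unfolding psize_upto[OF L order_refl] boxes_beyond_def by simp
    then show ?thesis unfolding boxes_beyond_pdouble[OF L] psize_padd[OF p] sz by simp
  qed
  have step: "card ((mop (Suc M) (ymat v x) ^^ Suc j) ` Y.VK) = ?q ^ boxes_beyond (Phi_B2 \<mu> \<nu>) (Suc j) \<longleftrightarrow>
     (jump x (fv v) j \<longleftrightarrow> j < ?l (plen \<nu>)) \<and> card ((mop M x ^^ Suc j) ` VK) = ?q ^ boxes_beyond (pdouble ?l) (Suc j)" for j
  proof -
    obtain k where k: "card ((mop M x ^^ Suc j) ` VK) = ?q ^ (2 * k)" using image_card_even[OF x] by blast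
    have "card ((mop (Suc M) (ymat v x) ^^ Suc j) ` Y.VK) = (if jump x (fv v) j then ?q else 1) * ?q ^ (2 * k)"
      unfolding ymat_rank[OF v x] k jump_def by simp
    also have "\<dots> = ?q ^ ((if jump x (fv v) j then 1 else 0) + 2 * k)" by simp
    finally have c: "card ((mop (Suc M) (ymat v x) ^^ Suc j) ` Y.VK) = ?q ^ ((if jump x (fv v) j then 1 else 0) + 2 * k)" .
    show ?thesis unfolding c k Phi_boxes[OF p] boxes_beyond_pdouble[OF L] power_inject_exp[OF q1] Suc_le_eq
      by (rule parity_exponents)
  qed
  have z1: "card ((mop (Suc M) (ymat v x) ^^ 0) ` Y.VK) = ?q ^ boxes_beyond (Phi_B2 \<mu> \<nu>) 0"
    unfolding Phi_boxes[OF p] b0 using Y.card_VK by simp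
  have z2: "card ((mop M x ^^ 0) ` VK) = ?q ^ boxes_beyond (pdouble ?l) 0"
    unfolding b0 using card_VK by simp
  have "has_jordan_type (ymat v x) (Phi_B2 \<mu> \<nu>) \<longleftrightarrow> (\<forall>j. card ((mop (Suc M) (ymat v x) ^^ j) ` Y.VK) = ?q ^ boxes_beyond (Phi_B2 \<mu> \<nu>) j)"
    by (rule Y.jordan_type_iff(2)[OF ymat_carrier ymat_rational[OF v x] ymat_cone(2)[OF v x] Phi_partition[OF p]])
  also have "\<dots> \<longleftrightarrow> (\<forall>j. (jump x (fv v) j \<longleftrightarrow> j < ?l (plen \<nu>)) \<and> card ((mop M x ^^ Suc j) ` VK) = ?q ^ boxes_beyond (pdouble ?l) (Suc j))"
    unfolding all_nat_Suc[of "\<lambda>j. card ((mop (Suc M) (ymat v x) ^^ j) ` Y.VK) = ?q ^ boxes_beyond (Phi_B2 \<mu> \<nu>) j"] step using z1 by (simp only: simp_thms)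
  also have "\<dots> \<longleftrightarrow> (\<forall>j. jump x (fv v) j \<longleftrightarrow> j < ?l (plen \<nu>)) \<and> (\<forall>j. card ((mop M x ^^ j) ` VK) = ?q ^ boxes_beyond (pdouble ?l) j)"
    unfolding all_nat_Suc[of "\<lambda>j. card ((mop M x ^^ j) ` VK) = ?q ^ boxes_beyond (pdouble ?l) j"] using z2 by (simp only: simp_thms all_conj_distrib)
  also have "(\<forall>j. card ((mop M x ^^ j) ` VK) = ?q ^ boxes_beyond (pdouble ?l) j) \<longleftrightarrow> has_jordan_type x (pdouble ?l)"
    by (rule jordan_type_iff(2)[OF cone_matsD(1-3)[OF x] partition_pdouble[OF L], symmetric])
  finally show ?thesis unfolding nilp_iff using x by blast
qed

definition depths :: "part \<Rightarrow> 'a mat \<Rightarrow> (nat \<Rightarrow> 'a) \<Rightarrow> part" where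
  "depths \<pi> x f = (\<lambda>i. depth VK (mop M x) (\<pi> i) f)"

text \<open>Given the type of \<open>y\<close>, the invariants at the parts beyond the length of \<open>\<nu>\<close> hold automatically, because there all steps are jumps, while the other ones compare \<open>\<mu>\<close> with a maximum involving the depth of the shifted vector. Together they say that the depths form a bipartition in the fibre over \<open>(\<mu>, \<nu>)\<close>; conversely such depths determine the jumps.\<close>

lemma orbit_iff:
  assumes v: "v \<in> rat_vecs" and x: "x \<in> cone_mats" and b: "(\<mu>, \<nu>) \<in> bipartitions n"
  defines "l \<equiv> padd \<mu> \<nu>"
  defines "r \<equiv> depths l x (shift x (fv v))"
  shows "ymat v x \<in> orbit_B2 n \<mu> \<nu> \<longleftrightarrow> x \<in> nilp l \<and> tilde_B2 (r, \<lambda>i. l i - r i) = (\<mu>, \<nu>)"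
proof -
  have p: "is_partition \<mu>" "is_partition \<nu>" using b unfolding bipartitions_def by auto
  have L: "is_partition l" unfolding l_def by (rule partition_padd[OF p])
  let ?N = "plen \<nu>"
  have vK: "fv v \<in> VK" by (rule rat_vecs_VK[OF v])
  have uK: "shift x (fv v) \<in> VK" by (rule shift_VK[OF x vK])
  have rle: "r i \<le> l i" for i unfolding r_def depths_def by (rule depth_le_self[OF uK])
  have l_beyond: "l i = \<mu> i" if "?N \<le> i" for i using second_zero[OF p(2), of i] that unfolding l_def padd_def by simp
  have gap: "l ?N < l i" if "i < ?N" for i unfolding l_def by (rule part_gap[OF p that])
  have ant: "l i \<le> l ?N" if "?N \<le> i" for i by (rule partition_antimono[OF L that])
  let ?J = "\<forall>j. jump x (fv v) j \<longleftrightarrow> j < l ?N"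
  let ?R = "\<forall>i. max ((l i + 1) div 2) (Suc (r i)) = Suc (\<mu> i)"
  have "ymat v x \<in> orbit_B2 n \<mu> \<nu> \<longleftrightarrow> has_jordan_type (ymat v x) (Phi_B2 \<mu> \<nu>) \<and>
      (\<forall>m\<in>range (Phi_B2 \<mu> \<nu>). (LEAST j. qcond v x m j) = chi_B2 \<mu> \<nu> m)"
    unfolding orbit_B2_def qcond_def using ymat_cone[OF v x] by simp
  also have "\<dots> \<longleftrightarrow> x \<in> nilp l \<and> ?J \<and> (\<forall>m\<in>range (Phi_B2 \<mu> \<nu>). (LEAST j. qcond v x m j) = chi_B2 \<mu> \<nu> m)"
    unfolding type_iff[OF v x b] l_def by (simp only: conj_assoc)
  also have "\<dots> \<longleftrightarrow> x \<in> nilp l \<and> ?J \<and> ?R"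
  proof (intro conj_cong refl)
    assume xn: "x \<in> nilp l" and J: ?J
    have top: "(LEAST j. qcond v x (l ?N + 1) j) = chi_B2 \<mu> \<nu> (l ?N + 1)"
    proof -
      have "(LEAST j. qcond v x (Suc (l ?N)) j) = Suc (l ?N)" by (rule least_jump[OF vK x]) (use J in simp)
      then show ?thesis using chi_values(1)[OF p] unfolding l_def by simp
    qed
    have each: "(LEAST j. qcond v x (l i) j) = chi_B2 \<mu> \<nu> (l i) \<longleftrightarrow> max ((l i + 1) div 2) (Suc (r i)) = Suc (\<mu> i)" for i
    proof (cases "i < ?N")
      case True
      obtain m where m: "l i = Suc m" using gap[OF True] by (cases "l i") auto
      have "\<not> jump x (fv v) m" using J gap[OF True] m by simp
      moreover obtain e where "e \<in> VK" "(mop M x ^^ Suc m) e = 0" "(mop M x ^^ m) e \<notin> (mop M x ^^ Suc m) ` VK"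
        using nilp_part_vector[OF xn L m] by blast
      ultimately have "(LEAST j. qcond v x (l i) j) = max ((l i + 1) div 2) (Suc (r i))"
        unfolding r_def depths_def m by (rule least_nojump[OF vK x])
      moreover have "chi_B2 \<mu> \<nu> (l i) = Suc (\<mu> i)" using chi_values(2)[OF p, of i] True unfolding l_def by simp
      ultimately show ?thesis by simp
    next
      case False
      then have i: "?N \<le> i" by simp
      have c: "chi_B2 \<mu> \<nu> (l i) = l i" using chi_values(2)[OF p, of i] False l_beyond[OF i] unfolding l_def by simp
      have "(LEAST j. qcond v x (l i) j) = l i"
      proof (cases "l i")
        case 0
        then show ?thesis using qcond_0 by (simp add: Least_eq_0)
      next
        case (Suc m)
        have "jump x (fv v) k" if "m = Suc k" for k using J ant[OF i] Suc that by simp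
        then show ?thesis unfolding Suc by (rule least_jump[OF vK x])
      qed
      moreover have "r i = l i"
      proof (rule ccontr)
        assume "r i \<noteq> l i"
        then have lt: "r i < l i" using rle[of i] by simp
        have "(mop M x ^^ r i) (shift x (fv v)) \<in> (mop M x ^^ l i) ` VK"
          using depth_le_iff[OF cone_pow(5)[OF x] uK, of "l i" "r i"] unfolding r_def depths_def by simp
        moreover have "(mop M x ^^ l i) ` VK \<subseteq> (mop M x ^^ Suc (r i)) ` VK"
          by (rule image_pow_mono[OF cone_matsD(6)[OF x]]) (use lt in simp)
        ultimately have "\<not> jump x (shift x (fv v)) (r i)" unfolding jump_def by blast
        then show False using J lt ant[OF i] unfolding jump_shift[OF x vK] by simp
      qed
      ultimately show ?thesis using c l_beyond[OF i] by simp
    qed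
    have "(\<forall>m\<in>range (Phi_B2 \<mu> \<nu>). (LEAST j. qcond v x m j) = chi_B2 \<mu> \<nu> m) \<longleftrightarrow> (\<forall>i. (LEAST j. qcond v x (l i) j) = chi_B2 \<mu> \<nu> (l i))"
      unfolding Phi_range using top unfolding l_def by simp
    then show "(\<forall>m\<in>range (Phi_B2 \<mu> \<nu>). (LEAST j. qcond v x m j) = chi_B2 \<mu> \<nu> m) \<longleftrightarrow> ?R" unfolding each .
  qed
  also have "\<dots> \<longleftrightarrow> x \<in> nilp l \<and> ?R"
  proof (intro conj_cong refl iffI conjI; (elim conjE)?)
    assume xn: "x \<in> nilp l" and R: ?R
    \<comment> \<open>beyond the length of \<open>\<nu>\<close> the maximum can only be attained by the depth\<close>
    have rN: "r ?N = l ?N" using R[rule_format, of ?N] l_beyond[of ?N] by (simp add: max_def split: if_splits)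
    show ?J
    proof (intro allI iffI)
      fix j assume "jump x (fv v) j"
      then have "jump x (shift x (fv v)) j" unfolding jump_shift[OF x vK] .
      from jump_top[OF xn L uK this] obtain i where i: "j < l i" "r i = l i" unfolding r_def depths_def by blast
      show "j < l ?N"
      proof (cases "i < ?N")
        case True
        have "\<mu> i = l i" using R[rule_format, of i] i(2) by (simp add: max_def split: if_splits)
        then have "\<nu> i = 0" unfolding l_def padd_def by simp
        then show ?thesis using second_zero[OF p(2), of i] True by simp
      next
        case False
        then show ?thesis using i(1) ant[of i] by simp
      qed
    next
      fix j assume j: "j < l ?N"
      have "\<not> r ?N \<le> l ?N - 1" using rN j by simp
      then have "(mop M x ^^ (l ?N - 1)) (shift x (fv v)) \<notin> (mop M x ^^ l ?N) ` VK"
        unfolding r_def depths_def depth_le_iff[OF cone_pow(5)[OF x] uK] .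
      moreover have "l ?N = Suc (l ?N - 1)" using j by simp
      ultimately have "jump x (shift x (fv v)) (l ?N - 1)" unfolding jump_def by metis
      then have "jump x (shift x (fv v)) j" by (rule jump_antimono[OF x]) (use j in simp)
      then show "jump x (fv v) j" unfolding jump_shift[OF x vK] .
    qed
  qed
  also have "?R \<longleftrightarrow> tilde_B2 (r, \<lambda>i. l i - r i) = (\<mu>, \<nu>)"
    unfolding l_def by (rule tilde_max[symmetric]) (use rle in \<open>simp add: l_def\<close>)
  finally show ?thesis .
qed

text \<open>Both sides of the comparison are brought to this set of pairs, the orthogonal orbit only after the shift.\<close>

definition piece_points :: "part \<Rightarrow> part \<Rightarrow> ('a vec \<times> 'a mat) set" where
  "piece_points \<mu> \<nu> = {(v, x) \<in> rat_vecs \<times> cone_mats. x \<in> nilp (padd \<mu> \<nu>) \<and>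
     tilde_B2 (depths (padd \<mu> \<nu>) x (fv v), \<lambda>i. padd \<mu> \<nu> i - depths (padd \<mu> \<nu>) x (fv v) i) = (\<mu>, \<nu>)}"

text \<open>The shift depends on the operator only, so in characteristic two it is an involution.\<close>

lemma shift_bij:
  "bij_betw (\<lambda>(v, x). (v + vec M (mop M x (isovec x)), x)) (rat_vecs \<times> cone_mats) (rat_vecs \<times> cone_mats)"
proof (rule bij_betw_byWitness[where f' = "\<lambda>(v, x). (v + vec M (mop M x (isovec x)), x)"])
  have inv: "v + w + w = v" if "v \<in> carrier_vec M" "w \<in> carrier_vec M" for v w :: "'a vec"
  proof (rule eq_vecI)
    fix i assume "i < dim_vec v"
    then show "(v + w + w) $ i = v $ i" using that two0[of "w $ i"] by (simp add: add.assoc)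
  qed (use that in auto)
  have w: "vec M (mop M x (isovec x)) \<in> carrier_vec M" for x by simp
  show "\<forall>a\<in>rat_vecs \<times> cone_mats. (\<lambda>(v, x). (v + vec M (mop M x (isovec x)), x)) ((\<lambda>(v, x). (v + vec M (mop M x (isovec x)), x)) a) = a"
    using inv w unfolding rat_vecs_def by auto
  then show "\<forall>a\<in>rat_vecs \<times> cone_mats. (\<lambda>(v, x). (v + vec M (mop M x (isovec x)), x)) ((\<lambda>(v, x). (v + vec M (mop M x (isovec x)), x)) a) = a" .
  have "v + vec M (mop M x (isovec x)) \<in> rat_vecs" if v: "v \<in> rat_vecs" and x: "x \<in> cone_mats" for v x
  proof -
    have c: "v \<in> carrier_vec M" "v + vec M (mop M x (isovec x)) \<in> carrier_vec M" using v unfolding rat_vecs_def by auto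
    have f: "fv (v + vec M (mop M x (isovec x))) = shift x (fv v)"
      unfolding fv_add[OF c(1) w] shift_def fv_vec[OF mop_VA] ..
    show ?thesis unfolding rat_vecs_fv[OF c(2)] f by (rule shift_VK[OF x rat_vecs_VK[OF v]])
  qed
  then show "(\<lambda>(v, x). (v + vec M (mop M x (isovec x)), x)) ` (rat_vecs \<times> cone_mats) \<subseteq> rat_vecs \<times> cone_mats" 
    "(\<lambda>(v, x). (v + vec M (mop M x (isovec x)), x)) ` (rat_vecs \<times> cone_mats) \<subseteq> rat_vecs \<times> cone_mats" by auto
qed

lemma card_orbit:
  assumes b: "(\<mu>, \<nu>) \<in> bipartitions n"
  shows "card (orbit_B2 n \<mu> \<nu> \<inter> rational_mats K) = card (piece_points \<mu> \<nu>)"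
proof -
  define S where "S = rat_vecs \<times> cone_mats"
  define T where "T = (\<lambda>(v, x). (v + vec M (mop M x (isovec x)), x))"
  define F where "F = (\<lambda>(v, x). ymat v x)"
  have Tb: "bij_betw T S S" unfolding T_def S_def by (rule shift_bij)
  have Fb: "bij_betw F S (orthogonal_lie n \<inter> nilpotent_mats (Suc M) \<inter> rational_mats K)" unfolding F_def S_def by (rule ymat_bij)
  have key: "F a \<in> orbit_B2 n \<mu> \<nu> \<longleftrightarrow> T a \<in> piece_points \<mu> \<nu>" if a: "a \<in> S" for a
  proof -
    obtain v x where vx: "a = (v, x)" by (cases a)
    have v: "v \<in> rat_vecs" and x: "x \<in> cone_mats" using a unfolding vx S_def by auto
    have c: "v \<in> carrier_vec M" using v unfolding rat_vecs_def by auto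
    have f: "fv (v + vec M (mop M x (isovec x))) = shift x (fv v)"
      unfolding fv_add[OF c vec_carrier] shift_def fv_vec[OF mop_VA] ..
    have "T a \<in> S" using bij_betw_apply[OF Tb a] .
    then have m: "T a \<in> piece_points \<mu> \<nu> \<longleftrightarrow> x \<in> nilp (padd \<mu> \<nu>) \<and>
       tilde_B2 (depths (padd \<mu> \<nu>) x (shift x (fv v)), \<lambda>i. padd \<mu> \<nu> i - depths (padd \<mu> \<nu>) x (shift x (fv v)) i) = (\<mu>, \<nu>)"
      unfolding piece_points_def S_def T_def vx prod.case mem_Collect_eq f by blast
    show ?thesis unfolding m unfolding F_def vx prod.case by (rule orbit_iff[OF v x b])
  qed
  have "orbit_B2 n \<mu> \<nu> \<inter> rational_mats K = F ` {a \<in> S. F a \<in> orbit_B2 n \<mu> \<nu>}"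
  proof
    have "orbit_B2 n \<mu> \<nu> \<inter> rational_mats K \<subseteq> F ` S"
      unfolding bij_betw_imp_surj_on[OF Fb] unfolding orbit_B2_def by auto
    then show "orbit_B2 n \<mu> \<nu> \<inter> rational_mats K \<subseteq> F ` {a \<in> S. F a \<in> orbit_B2 n \<mu> \<nu>}" by blast
    show "F ` {a \<in> S. F a \<in> orbit_B2 n \<mu> \<nu>} \<subseteq> orbit_B2 n \<mu> \<nu> \<inter> rational_mats K" using bij_betw_apply[OF Fb] by blast
  qed
  then have "card (orbit_B2 n \<mu> \<nu> \<inter> rational_mats K) = card {a \<in> S. F a \<in> orbit_B2 n \<mu> \<nu>}"
    by (simp only:) (rule card_image, rule inj_on_subset[OF bij_betw_imp_inj_on[OF Fb]], blast)
  also have "{a \<in> S. F a \<in> orbit_B2 n \<mu> \<nu>} = {a \<in> S. T a \<in> piece_points \<mu> \<nu>}" using key by blast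
  also have "card \<dots> = card (T ` {a \<in> S. T a \<in> piece_points \<mu> \<nu>})"
    by (rule card_image[symmetric], rule inj_on_subset[OF bij_betw_imp_inj_on[OF Tb]], blast)
  also have "T ` {a \<in> S. T a \<in> piece_points \<mu> \<nu>} = piece_points \<mu> \<nu>"
  proof
    have "piece_points \<mu> \<nu> \<subseteq> T ` S" unfolding bij_betw_imp_surj_on[OF Tb] unfolding S_def piece_points_def by auto
    then show "piece_points \<mu> \<nu> \<subseteq> T ` {a \<in> S. T a \<in> piece_points \<mu> \<nu>}" by blast
  qed blast
  finally show ?thesis .
qed

lemma depth_rat:
  assumes x: "x \<in> cone_mats" and f: "f \<in> VK"
  shows "depth (VA M) (mop M x) m f = depth VK (mop M x) m f"
proof -
  obtain N e L \<psi> where J: "jordan_coords K M (mop M x) N e L \<psi>" using jordan_exists[OF cone_matsD(1-3)[OF x]] by blast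
  show ?thesis unfolding depth_def jordan_coords.reach_rational[OF J f] ..
qed

lemma piece_rational:
  assumes b: "(\<mu>, \<nu>) \<in> bipartitions n"
  shows "exotic_piece_B2 n (polar (quad n)) \<mu> \<nu> \<inter> rational_pairs K = piece_points \<mu> \<nu>"
proof -
  let ?l = "padd \<mu> \<nu>"
  have p: "is_partition \<mu>" "is_partition \<nu>" and sz: "psize \<mu> + psize \<nu> = n" using b unfolding bipartitions_def by auto
  have L: "is_partition ?l" by (rule partition_padd[OF p])
  show ?thesis
  proof (rule Set.set_eqI)
    fix a :: "'a vec \<times> 'a mat"
    obtain v x where a: "a = (v, x)" by (cases a)
    show "a \<in> exotic_piece_B2 n (polar (quad n)) \<mu> \<nu> \<inter> rational_pairs K \<longleftrightarrow> a \<in> piece_points \<mu> \<nu>"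
    proof
      assume "a \<in> exotic_piece_B2 n (polar (quad n)) \<mu> \<nu> \<inter> rational_pairs K"
      then obtain \<rho> \<sigma> where rs: "(\<rho>, \<sigma>) \<in> bipartitions n" "tilde_B2 (\<rho>, \<sigma>) = (\<mu>, \<nu>)"
        "a \<in> exotic_orbit n (polar (quad n)) \<rho> \<sigma> \<inter> rational_pairs K" unfolding exotic_piece_B2_def by auto
      note l = tilde_sum[OF rs(2)]
      have h: "x \<in> nilp ?l" "v \<in> carrier_vec M" "vec_set v \<subseteq> K" "\<forall>i. depth (VA M) (mop M x) (?l i) (fv v) = \<rho> i"
        using rs(3) unfolding exotic_orbit_rational[OF rs(1)] a l by auto
      have x: "x \<in> cone_mats" using h(1) nilp_iff by blast
      have v: "v \<in> rat_vecs" using h(2,3) unfolding rat_vecs_def by blast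
      have d: "depths ?l x (fv v) = \<rho>" unfolding depths_def depth_rat[OF x rat_vecs_VK[OF v], symmetric] using h(4) by (intro ext) simp
      have "(\<lambda>i. ?l i - \<rho> i) = \<sigma>"
      proof
        fix i
        have "\<rho> i + \<sigma> i = ?l i" using fun_cong[OF l, of i] by (simp only: padd_def)
        then show "?l i - \<rho> i = \<sigma> i" by simp
      qed
      then show "a \<in> piece_points \<mu> \<nu>" unfolding piece_points_def a mem_Collect_eq prod.case d using v x h(1) rs(2) by simp
    next
      assume "a \<in> piece_points \<mu> \<nu>"
      then have v: "v \<in> rat_vecs" and x: "x \<in> cone_mats" and xn: "x \<in> nilp ?l"
        and t: "tilde_B2 (depths ?l x (fv v), \<lambda>i. ?l i - depths ?l x (fv v) i) = (\<mu>, \<nu>)" unfolding piece_points_def a by auto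
      define \<rho> where "\<rho> = depths ?l x (fv v)"
      define \<sigma> where "\<sigma> = (\<lambda>i. ?l i - depths ?l x (fv v) i)"
      have vK: "fv v \<in> VK" by (rule rat_vecs_VK[OF v])
      have le: "\<rho> i \<le> ?l i" for i unfolding \<rho>_def depths_def by (rule depth_le_self[OF vK])
      have l: "padd \<rho> \<sigma> = ?l"
      proof
        fix i show "padd \<rho> \<sigma> i = ?l i" unfolding padd_def[of \<rho>] using le[of i] unfolding \<sigma>_def \<rho>_def by simp
      qed
      have P: "is_partition \<rho>" "is_partition \<sigma>"
        unfolding \<rho>_def \<sigma>_def depths_def by (rule depth_bipartition[OF cone_pow(5)[OF x] vK L])+
      have "psize \<rho> + psize \<sigma> = n" using psize_padd[OF P] psize_padd[OF p] sz unfolding l by simp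
      then have bip: "(\<rho>, \<sigma>) \<in> bipartitions n" unfolding bipartitions_def using P by simp
      have "depth (VA M) (mop M x) (?l i) (fv v) = \<rho> i" for i unfolding depth_rat[OF x vK] \<rho>_def depths_def ..
      then have "a \<in> exotic_orbit n (polar (quad n)) \<rho> \<sigma> \<inter> rational_pairs K"
        unfolding exotic_orbit_rational[OF bip] a l using xn v unfolding rat_vecs_def by simp
      moreover have "tilde_B2 (\<rho>, \<sigma>) = (\<mu>, \<nu>)" unfolding \<rho>_def \<sigma>_def by (rule t)
      ultimately show "a \<in> exotic_piece_B2 n (polar (quad n)) \<mu> \<nu> \<inter> rational_pairs K"
        unfolding exotic_piece_B2_def using bip by blast
    qed
  qed
qed

end

context exotic_setting
begin

lemma card_piece:
  assumes p: "is_partition \<mu>" "is_partition \<nu>"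
  shows "card (exotic_piece_B2 n B \<mu> \<nu> \<inter> rational_pairs K) =
    (\<Sum>(\<rho>, \<sigma>)\<in>{b \<in> bipartitions n. tilde_B2 b = (\<mu>, \<nu>)}. card (exotic_orbit n B \<rho> \<sigma> \<inter> rational_pairs K))"
proof -
  let ?I = "{b \<in> bipartitions n. tilde_B2 b = (\<mu>, \<nu>)}" and ?l = "padd \<mu> \<nu>"
  define A where "A b = exotic_orbit n B (fst b) (snd b) \<inter> rational_pairs K" for b
  have L: "is_partition ?l" by (rule partition_padd[OF p])
  have A_eq: "A b = {(v, x). x \<in> nilp ?l \<and> v \<in> carrier_vec M \<and> vec_set v \<subseteq> K \<and>
      (\<forall>i. depth (VA M) (mop M x) (?l i) (fv v) = fst b i)}" if "b \<in> ?I" for b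
  proof -
    have bb: "(fst b, snd b) \<in> bipartitions n" "tilde_B2 (fst b, snd b) = (\<mu>, \<nu>)" using that by auto
    show ?thesis unfolding A_def exotic_orbit_rational[OF bb(1)] tilde_sum[OF bb(2)] ..
  qed
  have fin_vecs: "finite {v \<in> carrier_vec M. vec_set v \<subseteq> K}"
  proof (rule finite_imageD)
    show "finite (fv ` {v \<in> carrier_vec M. vec_set v \<subseteq> K})"
      by (rule finite_subset[OF _ ksubD(1)[OF ksub_VK]]) (use fv_VK in auto)
    show "inj_on fv {v \<in> carrier_vec M. vec_set v \<subseteq> K}" by (rule inj_onI) (use fv_inj in blast)
  qed
  have finA: "finite (A b)" if "b \<in> ?I" for b
    by (rule finite_subset[OF _ finite_cartesian_product[OF fin_vecs finite_nilp[OF L]]]) (auto simp: A_eq[OF that])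
  have disj: "A b \<inter> A b' = {}" if b: "b \<in> ?I" "b' \<in> ?I" "b \<noteq> b'" for b b'
  proof (rule ccontr)
    assume "A b \<inter> A b' \<noteq> {}"
    then have f: "fst b = fst b'" unfolding A_eq[OF b(1)] A_eq[OF b(2)] by (auto simp: fun_eq_iff)
    have "padd (fst b) (snd b) = padd (fst b') (snd b')"
      using tilde_sum[of "fst b" "snd b" \<mu> \<nu>] tilde_sum[of "fst b'" "snd b'" \<mu> \<nu>] b by simp
    then have "snd b = snd b'" unfolding f padd_def by (simp add: fun_eq_iff)
    then show False using f b(3) by (simp add: prod_eq_iff)
  qed
  have e: "exotic_piece_B2 n B \<mu> \<nu> \<inter> rational_pairs K = (\<Union>b\<in>?I. A b)"
    unfolding exotic_piece_B2_def A_def by auto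
  have f: "\<forall>b\<in>?I. finite (A b)" by (intro ballI finA)
  have d: "\<forall>b\<in>?I. \<forall>b'\<in>?I. b \<noteq> b' \<longrightarrow> A b \<inter> A b' = {}" by (intro ballI impI disj)
  have "card (exotic_piece_B2 n B \<mu> \<nu> \<inter> rational_pairs K) = (\<Sum>b\<in>?I. card (A b))"
    unfolding e by (rule card_UN_disjoint[OF finite_tilde_fibre[OF p] f d])
  also have "\<dots> = (\<Sum>(\<rho>, \<sigma>)\<in>?I. card (exotic_orbit n B \<rho> \<sigma> \<inter> rational_pairs K))"
    unfolding A_def by (rule sum.cong[OF refl]) (simp add: case_prod_beta)
  finally show ?thesis .
qed

end

section \<open>Interpolation from odd characteristic\<close>

text \<open>The split symplectic form exists in all characteristics and is defined over the prime field; in characteristic two it is the polar form of \<open>quad n\<close>.\<close>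

definition std_form :: "nat \<Rightarrow> 'a::field vec \<Rightarrow> 'a vec \<Rightarrow> 'a" where
  "std_form n v w = (\<Sum>i<n. v $ i * w $ (2 * n - 1 - i) - v $ (2 * n - 1 - i) * w $ i)"

lemma std_form_unit:
  assumes k: "k < 2 * n"
  shows "std_form n v (unit_vec (2 * n) k) = (if k < n then - (v $ (2 * n - 1 - k)) else v $ (2 * n - 1 - k))"
proof -
  have "v $ i * unit_vec (2 * n) k $ (2 * n - 1 - i) - v $ (2 * n - 1 - i) * unit_vec (2 * n) k $ i
    = (if i = (if k < n then k else 2 * n - 1 - k) then (if k < n then - (v $ (2 * n - 1 - k)) else v $ (2 * n - 1 - k)) else 0)"
    if i: "i < n" for i
  proof -
    have "2 * n - 1 - i < 2 * n" "i < 2 * n" using i by auto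
    then have "unit_vec (2 * n) k $ (2 * n - 1 - i) = (if 2 * n - 1 - i = k then 1 else 0 :: 'a)" "unit_vec (2 * n) k $ i = (if i = k then 1 else 0 :: 'a)"
      by (simp_all add: unit_vec_def)
    then show ?thesis using i k by auto
  qed
  then have "std_form n v (unit_vec (2 * n) k) = (\<Sum>i<n. if i = (if k < n then k else 2 * n - 1 - k) then (if k < n then - (v $ (2 * n - 1 - k)) else v $ (2 * n - 1 - k)) else 0)"
    unfolding std_form_def by (intro sum.cong) auto
  also have "\<dots> = (if k < n then - (v $ (2 * n - 1 - k)) else v $ (2 * n - 1 - k))"
    using k by (subst sum.delta) auto
  finally show ?thesis .
qed

lemma std_form_symplectic: "symplectic_form (2 * n) (std_form n :: 'a::field vec \<Rightarrow> _)"
  unfolding symplectic_form_def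
proof (intro conjI ballI allI impI)
  have i: "2 * n - 1 - i < 2 * n" "i < 2 * n" if "i < n" for i using that by auto
  fix u v w :: "'a vec" assume c: "u \<in> carrier_vec (2 * n)" "v \<in> carrier_vec (2 * n)" "w \<in> carrier_vec (2 * n)"
  show "std_form n (u + v) w = std_form n u w + std_form n v w" "std_form n w (u + v) = std_form n w u + std_form n w v"
    unfolding std_form_def sum.distrib[symmetric] by (intro sum.cong refl; use c i in \<open>auto simp: algebra_simps\<close>)+
next
  have i: "2 * n - 1 - i < 2 * n" "i < 2 * n" if "i < n" for i using that by auto
  fix a and v w :: "'a vec" assume c: "v \<in> carrier_vec (2 * n)" "w \<in> carrier_vec (2 * n)"
  show "std_form n (a \<cdot>\<^sub>v v) w = a * std_form n v w" "std_form n v (a \<cdot>\<^sub>v w) = a * std_form n v w"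
    unfolding std_form_def sum_distrib_left by (intro sum.cong refl; use c i in \<open>auto simp: algebra_simps\<close>)+
next
  fix v :: "'a vec"
  show "std_form n v v = 0" unfolding std_form_def by (simp add: mult.commute)
next
  fix v :: "'a vec" assume v: "v \<in> carrier_vec (2 * n)" and h: "\<forall>w\<in>carrier_vec (2 * n). std_form n v w = 0"
  show "v = 0\<^sub>v (2 * n)"
  proof (rule eq_vecI)
    fix k assume "k < dim_vec (0\<^sub>v (2 * n) :: 'a vec)"
    then have k: "k < 2 * n" by simp
    then have k': "2 * n - 1 - k < 2 * n" and kk: "2 * n - 1 - (2 * n - 1 - k) = k" by auto
    have "std_form n v (unit_vec (2 * n) (2 * n - 1 - k)) = 0" using h by simp
    then show "v $ k = 0\<^sub>v (2 * n) $ k" unfolding std_form_unit[OF k'] kk using k by (auto split: if_splits)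
  qed (use v in simp)
qed

lemma std_form_over: "is_subfield K \<Longrightarrow> form_over (2 * n) K (std_form n)"
  unfolding form_over_def
proof (intro allI impI)
  fix i j assume K: "is_subfield K" and ij: "i < 2 * n" "j < 2 * n"
  have "(0::'a) \<in> K" "1 \<in> K" "- 1 \<in> K" using K unfolding is_subfield_def by auto
  then show "std_form n (unit_vec (2 * n) i) (unit_vec (2 * n) j) \<in> K" unfolding std_form_unit[OF ij(2)] using ij by (auto simp: unit_vec_def)
qed

lemma std_form_prime: "form_over (2 * n) prime_subfield (std_form n)"
  using std_form_over[of _ n] unfolding form_over_def prime_subfield_def by auto

lemma polar_quad_std:
  fixes v w :: "'a::field vec"
  assumes "CHAR('a) = 2" "v \<in> carrier_vec (2 * n)" "w \<in> carrier_vec (2 * n)"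
  shows "polar (quad n) v w = std_form n v w"
proof -
  have "(2 :: 'a) = 0" using of_nat_CHAR[where ?'a = 'a] assms(1) by simp
  then have t: "a + a = 0" for a :: 'a by (metis mult_2 mult_zero_left)
  then have m: "- a = a" for a :: 'a by (metis add_eq_0_iff)
  have "polar (quad n) v w = (\<Sum>i<n. (v + w) $ i * (v + w) $ (2 * n - 1 - i) - v $ i * v $ (2 * n - 1 - i) - w $ i * w $ (2 * n - 1 - i))"
    unfolding polar_def quad_def sum_subtractf ..
  also have "\<dots> = std_form n v w" unfolding std_form_def
  proof (rule sum.cong[OF refl])
    fix i assume "i \<in> {..<n}"
    then have i: "2 * n - 1 - i < 2 * n" "i < 2 * n" by auto
    have s: "v $ i * w $ (2 * n - 1 - i) - v $ (2 * n - 1 - i) * w $ i = v $ i * w $ (2 * n - 1 - i) + v $ (2 * n - 1 - i) * w $ i"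
      by (simp only: diff_conv_add_uminus m)
    show "(v + w) $ i * (v + w) $ (2 * n - 1 - i) - v $ i * v $ (2 * n - 1 - i) - w $ i * w $ (2 * n - 1 - i)
      = v $ i * w $ (2 * n - 1 - i) - v $ (2 * n - 1 - i) * w $ i"
      unfolding s using i assms(2,3) by (simp add: algebra_simps)
  qed
  finally show ?thesis .
qed

lemma polar_quad_symplectic:
  assumes "CHAR('a::field) = 2"
  shows "symplectic_form (2 * n) (polar (quad n) :: 'a vec \<Rightarrow> _)"
  using std_form_symplectic[of n, where ?'a = 'a] unfolding symplectic_form_def by (simp add: polar_quad_std[OF assms])

lemma polar_quad_over:
  assumes "CHAR('a::field) = 2" "is_subfield (K :: 'a set)"
  shows "form_over (2 * n) K (polar (quad n))"
  using std_form_over[OF assms(2), of n] unfolding form_over_def by (simp add: polar_quad_std[OF assms(1)])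

text \<open>The roots of \<open>X ^ q - X\<close> for a power \<open>q\<close> of the characteristic form a subfield. The derivative is minus one, so there are no multiple roots and the subfield has \<open>q\<close> elements.\<close>

lemma large_finite_subfield:
  assumes c: "CHAR('k::alg_closed_field) > 0"
  shows "\<exists>K :: 'k set. is_subfield K \<and> finite K \<and> N \<le> card K"
proof -
  define p where "p = CHAR('k)"
  have pp: "prime p" unfolding p_def by (rule prime_CHAR_semidom[OF c])
  define q where "q = p ^ Suc N"
  have p2: "2 \<le> p" using pp by (rule prime_ge_2_nat)
  have "Suc N < 2 ^ Suc N" by (rule less_exp)
  also have "2 ^ Suc N \<le> q" unfolding q_def by (rule power_mono[OF p2]) simp
  finally have qN: "Suc N < q" .
  have q0: "of_nat q = (0 :: 'k)" unfolding q_def p_def by simp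
  define K where "K = {a :: 'k. a ^ q = a}"
  have fd: "(a + b) ^ q = a ^ q + b ^ q" for a b :: 'k
    unfolding q_def p_def by (rule freshmans_dream'[OF _ refl]) (use pp p_def in simp)
  have sub: "is_subfield K" unfolding is_subfield_def
  proof (intro conjI ballI)
    show "0 \<in> K" "1 \<in> K" unfolding K_def using qN by auto
    fix a b assume "a \<in> K" "b \<in> K"
    then show "a + b \<in> K" "a * b \<in> K" unfolding K_def by (auto simp: fd power_mult_distrib)
  next
    fix a assume a: "a \<in> K"
    have "(- a) ^ q + a ^ q = 0" unfolding fd[symmetric] using qN by (simp add: power_0_left)
    then have "(- a) ^ q = - a" using a unfolding K_def by (simp add: add_eq_0_iff2)
    then show "- a \<in> K" unfolding K_def by simp
    show "inverse a \<in> K" using a unfolding K_def by (simp add: power_inverse)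
  qed
  define f where "f = monom (1 :: 'k) q - [:0, 1:]"
  have f_root: "poly f a = 0 \<longleftrightarrow> a \<in> K" for a unfolding f_def K_def by (simp add: poly_monom)
  have df: "pderiv f = - 1"
  proof -
    have "pderiv [:0, 1 :: 'k:] = 1" by (simp add: pderiv_pCons one_pCons)
    then show ?thesis unfolding f_def pderiv_diff pderiv_monom q0 by simp
  qed
  have deg: "degree f = q"
  proof -
    have "degree f = degree (monom (1 :: 'k) q)" unfolding f_def diff_conv_add_uminus
      by (rule degree_add_eq_left) (use qN in \<open>simp add: degree_monom_eq\<close>)
    then show ?thesis by (simp add: degree_monom_eq)
  qed
  then have f0: "f \<noteq> 0" using qN by auto
  obtain A where A: "size A = degree f" "f = Polynomial.smult (lead_coeff f) (\<Prod>x\<in>#A. [:-x, 1:])" using alg_closed_imp_factorization[OF f0] by blast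
  have one: "count A a \<le> 1" for a
  proof (rule ccontr)
    assume "\<not> count A a \<le> 1"
    then have "replicate_mset 2 a \<subseteq># A" by (simp add: count_le_replicate_mset_subset_eq[symmetric])
    then obtain C where C: "A = replicate_mset 2 a + C" by (metis subset_mset.less_eqE)
    have "f = [:-a, 1:] * ([:-a, 1:] * Polynomial.smult (lead_coeff f) (\<Prod>x\<in>#C. [:-x, 1:]))"
      by (subst A(2)) (simp add: C numeral_2_eq_2 mult.assoc mult_smult_right)
    then obtain g where g: "f = [:-a, 1:] * ([:-a, 1:] * g)" by blast
    have "poly (pderiv f) a = 0" unfolding g pderiv_mult by simp
    then show False unfolding df by simp
  qed
  have "set_mset A = K"
  proof -
    have "poly f a = 0 \<longleftrightarrow> a \<in># A" for a
      by (subst A(2)) (use f0 in \<open>auto simp: poly_prod_mset prod_mset_zero_iff\<close>)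
    then show ?thesis using f_root by blast
  qed
  moreover have "size A = card (set_mset A)"
  proof -
    have "count A a = 1" if "a \<in># A" for a using one[of a] that by (simp add: le_Suc_eq count_eq_zero_iff)
    then show ?thesis unfolding size_multiset_overloaded_eq by simp
  qed
  ultimately have "card K = q" "finite K" using A(1) deg by auto
  then show ?thesis using sub qN by (intro exI[of _ K]) simp
qed

text \<open>The two sides agree at the sizes of all finite subfields, which are unbounded.\<close>

lemma count_polynomial_identity:
  assumes c: "CHAR('k::alg_closed_field) > 0" and P: "exotic_count_polys TYPE('k) n P" and b: "(\<rho>, \<sigma>) \<in> bipartitions n"
  shows "P \<rho> \<sigma> * type_denominator n (padd \<rho> \<sigma>) = type_numerator n (padd \<rho> \<sigma>) * half_count (padd \<rho> \<sigma>) \<rho>" (is "?L = ?R")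
proof (rule ccontr)
  assume "?L \<noteq> ?R"
  then have fin: "finite {t. poly (?L - ?R) t = 0}" by (intro poly_roots_finite) simp
  obtain m where m: "\<forall>t\<in>{t. poly (?L - ?R) t = 0}. t \<le> m" using finite_has_maximal2 fin by (metis Max_ge)
  obtain K :: "'k set" where K: "is_subfield K" "finite K" "nat (m + 1) \<le> card K" using large_finite_subfield[OF c] by blast
  interpret E: exotic_setting K n "std_form n"
    by unfold_locales (rule K(1), rule K(2), rule std_form_symplectic, rule std_form_over[OF K(1)])
  have "int (card (exotic_orbit n (std_form n) \<rho> \<sigma> \<inter> rational_pairs K)) = poly (P \<rho> \<sigma>) (int (card K))"
    using P b K(1,2) std_form_symplectic[of n] std_form_prime[of n] unfolding exotic_count_polys_def by blast
  then have "poly ?L (int (card K)) = poly ?R (int (card K))" using E.card_exotic_orbit[OF b] by simp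
  then have "int (card K) \<le> m" using m by simp
  then show False using K(3) by linarith
qed

theorem theorem4p14:
  fixes n s :: nat and \<mu> \<nu> :: part and K :: "'a::alg_closed_field set"
  assumes "CHAR('a) = 2"
    and "CHAR('k::alg_closed_field) > 0" and "CHAR('k) \<noteq> 2"
    and "(\<mu>, \<nu>) \<in> bipartitions_B2 n"
    and "is_subfield K" and "card K = 2 ^ s"
  shows "card (orbit_B2 n \<mu> \<nu> \<inter> rational_mats K)
           = card (exotic_piece_B2 n (polar (quad n)) \<mu> \<nu> \<inter> rational_pairs K) \<and>
         (\<forall>P. exotic_count_polys TYPE('k) n P \<longrightarrow>
           int (card (exotic_piece_B2 n (polar (quad n)) \<mu> \<nu> \<inter> rational_pairs K))
             = (\<Sum>(\<rho>, \<sigma>) \<in> {b \<in> bipartitions n. tilde_B2 b = (\<mu>, \<nu>)}. poly (P \<rho> \<sigma>) (2 ^ s)))"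
proof -
  have fin: "finite K" by (rule card_ge_0_finite) (simp add: assms(6))
  interpret O: orth_setting K n
    by unfold_locales (rule assms(5), rule fin, rule polar_quad_symplectic[OF assms(1)], rule polar_quad_over[OF assms(1,5)], rule assms(1))
  have b: "(\<mu>, \<nu>) \<in> bipartitions n" using assms(4) unfolding bipartitions_B2_def by blast
  then have p: "is_partition \<mu>" "is_partition \<nu>" unfolding bipartitions_def by auto
  let ?I = "{b \<in> bipartitions n. tilde_B2 b = (\<mu>, \<nu>)}"
  have q: "int (card K) = 2 ^ s" using assms(6) by simp
  have "int (card (exotic_piece_B2 n (polar (quad n)) \<mu> \<nu> \<inter> rational_pairs K)) = (\<Sum>(\<rho>, \<sigma>) \<in> ?I. poly (P \<rho> \<sigma>) (2 ^ s))"
    if P: "exotic_count_polys TYPE('k) n P" for P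
  proof -
    have "int (card (exotic_orbit n (polar (quad n)) \<rho> \<sigma> \<inter> rational_pairs K)) = poly (P \<rho> \<sigma>) (2 ^ s)"
      if rs: "(\<rho>, \<sigma>) \<in> bipartitions n" for \<rho> \<sigma>
    proof -
      have P': "is_partition \<rho>" "is_partition \<sigma>" "psize \<rho> + psize \<sigma> = n" using rs unfolding bipartitions_def by auto
      have "poly (type_denominator n (padd \<rho> \<sigma>)) (int (card K)) > 0"
        by (rule type_denominator_pos[OF partition_padd[OF P'(1,2)] _ O.card_K_ge_2]) (simp add: psize_padd[OF P'(1,2)] P'(3))
      moreover have "poly (P \<rho> \<sigma> * type_denominator n (padd \<rho> \<sigma>)) (int (card K)) =
          poly (type_numerator n (padd \<rho> \<sigma>) * half_count (padd \<rho> \<sigma>) \<rho>) (int (card K))"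
        unfolding count_polynomial_identity[OF assms(2) P rs] ..
      moreover have "int (card (exotic_orbit n (polar (quad n)) \<rho> \<sigma> \<inter> rational_pairs K)) * poly (type_denominator n (padd \<rho> \<sigma>)) (int (card K)) =
          poly (P \<rho> \<sigma>) (int (card K)) * poly (type_denominator n (padd \<rho> \<sigma>)) (int (card K))"
        using calculation(2) O.card_exotic_orbit[OF rs] by (simp only: poly_mult)
      ultimately show ?thesis unfolding q[symmetric] by (simp only: mult_cancel_right) simp
    qed
    then show ?thesis unfolding O.card_piece[OF p] of_nat_sum by (intro sum.cong) auto
  qed
  then show ?thesis using O.card_orbit[OF b] O.piece_rational[OF b] by simp
qed

end
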